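(* Let $\Gamma$ be a positive-definite even lattice of finite rank and let $\pi^0_\Gamma$ be the associated Heisenberg vertex algebra of level $0$. For a principally polarized abelian variety $(X,\Theta)$, one has a canonical isomorphism \[ \mathbb{V}\left(X,\Theta,\pi^0_\Gamma\right)\cong\mathrm{Sym}\left(\mathfrak{h}_\Gamma\otimes_{\mathbb{C}}H^0(X,\Omega^1_X)^*\right). \] Equivalently, $\mathbb{V}(X,\Theta,\pi^0_\Gamma)\cong\mathrm{Fun}\left(\mathfrak{h}_\Gamma\otimes_{\mathbb{C}}H^0(X,\Omega^1_X)\right)$, the ring of polynomial functions on $\mathfrak{h}_\Gamma\otimes_{\mathbb{C}}H^0(X,\Omega^1_X)$.
   Context: Everything is over $\mathbb{C}$. **Extended PPAVs.** Let $H=\mathbb{C}((t))$ with the $t$-adic topology and Lie bracket $\langle f,g\rangle=-\mathrm{Res}_{t=0}f\,dg$, $b_i=t^i$, $H'=H/\mathbb{C}b_0$ with the induced nondegenerate symplectic form, $H'_+=t\mathbb{C}[[t]]$. An extended principally polarized abelian variety (PPAV) of dimension $g$ is a triple $a=(Z,F,L)$ with $Z\subset H'$ Lagrangian, $F\subset Z$ of codimension $g$, and $L$ a rank $2g$ lattice in $F^\perp/F$, such that: (1) $Z\cap H'_+=0$ (so $F^\perp/F=Z/F\oplus F^\perp_+$ with $F^\perp_+=F^\perp\cap H'_+$); (2) $L_{\mathbb{R}}\cap F^\perp_+=0$ in $F^\perp/F$, where $L_{\mathbb{R}}=L\otimes_{\mathbb{Z}}\mathbb{R}$ (so the real structure on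 $F^\perp/F$ given by $L_{\mathbb{R}}$ identifies $F^\perp_+$ with the conjugate of $Z/F$, and $B(u,v)=\frac1\pi\langle\bar u,v\rangle$ is Hermitian on $Z/F$); (3) $\frac{1}{2\pi i}\langle\,,\rangle$ is unimodular on $L$; (4) $B$ is positive definite. It determines a PPAV $(X,\Theta)$: $X$ is the quotient of $Z/F$ by the image of $L$ under $F^\perp/F\to Z/F$, and $\Theta$ is induced by $B$; in particular $Z/F\cong H^0(X,\Omega^1_X)^*$. For a PPAV $(X,\Theta)$, $\mathrm{Sp}(X,\Theta)$ is the infinite-dimensional complex manifold of all extended PPAVs with underlying PPAV $(X,\Theta)$ (the fiber over $(X,\Theta)$ of the forgetful map $\widehat{\mathcal{A}}_g\to\mathcal{A}_g$ from the Arbarello–De Concini moduli space of extended PPAVs). $\mathbb{F}\to\mathrm{Sp}(X,\Theta)$ is the tautological sheaf with fiber $F$ at $(Z,F,L)$. **The vertex algebra.** $\mathfrak{h}_\Gamma=\Gamma\otimes_{\mathbb{Z}}\mathbb{C}$, $d=\mathrm{rank}(\Gamma)$. The Heisenberg algebra $\widehat{\mathfrak h}_\Gamma$ is the central extension of $\mathfrak{h}_\Gamma((t))$ by $\mathbb{C}\mathbf 1$ with $[A\otimes f,B\otimes g]=-(A,B)(\mathrm{Res}_{t=0}f\,dg)\mathbf{1}$; write $A_n=A\otimes t^n$. $V=\pi^0_\Gamma$ is the Fock module of level $0$ (generated by a vector $\mathbf{1}$ killed by $\mathfrak{h}_\Gamma\otimes\mathbb{C}[[t]]$, with the central element acting by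 $0$), i.e. the commutative vertex algebra $\mathrm{Sym}(\mathfrak{h}_\Gamma\otimes t^{-1}\mathbb{C}[t^{-1}])$. Elements $A\otimes f$ with $f\in H'$ act on $V$. **Spaces of coinvariants.** For $a=(Z,F,L)$, $\widehat{\mathbb{V}}(a,V)=V/(\mathfrak{h}_\Gamma\otimes F)(V)$. Globally, with $\mathfrak{h}^{\mathrm{out}}_\Gamma(X,\Theta)=\mathfrak{h}_\Gamma\otimes\mathbb{F}$, \[\widehat{\mathbb{V}}(X,\Theta,V)=V\otimes\mathscr{O}_{\mathrm{Sp}(X,\Theta)}\,/\,\mathfrak{h}^{\mathrm{out}}_\Gamma(X,\Theta)\left(V\otimes\mathscr{O}_{\mathrm{Sp}(X,\Theta)}\right),\] a quasi-coherent sheaf on $\mathrm{Sp}(X,\Theta)$ with fibers $\widehat{\mathbb{V}}(a,V)$. Let $\mathbb{S}\mathrm{p}^+(H')$ be the identity component of the group of continuous symplectic automorphisms of $H'$ preserving $H'_+$; it acts transitively on $\mathrm{Sp}(X,\Theta)$, with Lie algebra $\mathfrak{sp}^+(H')=\{X\in\mathfrak{sp}(H'):X(H'_+)\subseteq H'_+\}$, topologically generated by $b_ib_j$ with $i,j$ not both negative. The Lie algebra $\mathfrak{sp}^+(H')$ acts on $V$ as a subalgebra of the metaplectic algebra $\mathfrak{mp}(H')$ (the universal central extension of $\mathfrak{sp}(H')$ realized by quadratic elements in the Weyl algebra of $H$, which splits over $\mathfrak{sp}^+(H')$ by normal ordering), where $\mathfrak{mp}(H')$ acts on $V$ by $\mathbf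 1\mapsto d\,\mathrm{id}_V$, $b_mb_n\mapsto\sum_{i=1}^dH^i_mH^i_n$ for an orthonormal basis $\{H^i\}$ of $\mathfrak{h}_\Gamma$; combined with its action on $\mathrm{Sp}(X,\Theta)$ it acts on $\widehat{\mathbb{V}}(X,\Theta,V)$, and this action exponentiates to an $\mathbb{S}\mathrm{p}^+(H')$-equivariant structure, for which the stabilizer of each point $a$ acts trivially on the fiber at $a$. The space of coinvariants $\mathbb{V}(X,\Theta,V)$ is the vector space obtained by descending $\widehat{\mathbb{V}}(X,\Theta,V)$ first to $[\mathrm{Sp}(X,\Theta)/\mathbb{S}\mathrm{p}^+(H')]$ and then to $\mathrm{Spec}(\mathbb{C})$.
   Formalization: Sp⁺(H') acts on V by fixing the vacuum and sending A⊗f to A⊗gf, since the stated quadratic formula vanishes at level 0; that L_R identifies F⊥_+ with the conjugate of Z/F is put into the definition; points of Sp(X,Θ) carry an isomorphism of their PPAV with (X,Θ). *)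

theory Defs
  imports
    "HOL-Analysis.Analysis"
    "HOL-Complex_Analysis.Complex_Analysis"
    "HOL-Computational_Algebra.Formal_Laurent_Series"
    "HOL-Library.Poly_Mapping"
    "HOL-Library.Set_Algebras"
    "HOL-Library.Function_Algebras"
begin

section \<open>The symplectic space \<open>H' = \<complex>((t)) / \<complex>\<close>\<close>

definition lie :: "complex fls \<Rightarrow> complex fls \<Rightarrow> complex" where
  "lie f g = - fls_residue (f * fls_deriv g)"

lemma lie_left_diff: "lie (f - f') g = lie f g - lie f' g"
  by (simp add: lie_def left_diff_distrib)

lemma lie_right_diff: "lie f (g - g') = lie f g - lie f g'"
  by (simp add: lie_def right_diff_distrib)

lemma lie_const_left: "lie (fls_const c) g = 0"
  using fls_residue_fls_const_times(1)[of c "fls_deriv g"] fls_residue_deriv[of g]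
  by (simp add: lie_def)

lemma lie_const_right: "lie f (fls_const c) = 0"
  by (simp add: lie_def)

quotient_type hprime = "complex fls" / "\<lambda>f g. \<exists>c. f - g = fls_const c"
proof (rule equivpI)
  show "reflp (\<lambda>f g::complex fls. \<exists>c. f - g = fls_const c)"
    by (rule reflpI) (rule exI[of _ 0], simp)
  show "symp (\<lambda>f g::complex fls. \<exists>c. f - g = fls_const c)"
  proof (rule sympI)
    fix f g :: "complex fls" assume "\<exists>c. f - g = fls_const c"
    then obtain c where "f - g = fls_const c" by blast
    then have "g - f = fls_const (- c)" by (metis fls_const_uminus minus_diff_eq)
    then show "\<exists>c. g - f = fls_const c" by blast
  qed
  show "transp (\<lambda>f g::complex fls. \<exists>c. f - g = fls_const c)"
  proof (rule transpI)
    fix f g h :: "complex fls"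
    assume "\<exists>c. f - g = fls_const c" "\<exists>c. g - h = fls_const c"
    then obtain c d where "f - g = fls_const c" "g - h = fls_const d" by blast
    then have "f - h = fls_const (c + d)"
      by (metis (no_types, lifting) fls_plus_const diff_add_cancel diff_diff_eq2 add_diff_eq)
    then show "\<exists>c. f - h = fls_const c" by blast
  qed
qed

instantiation hprime :: ab_group_add
begin

lift_definition zero_hprime :: hprime is 0 .

lift_definition plus_hprime :: "hprime \<Rightarrow> hprime \<Rightarrow> hprime" is "(+)"
proof -
  fix f f' g g' :: "complex fls"
  assume "\<exists>c. f - f' = fls_const c" "\<exists>c. g - g' = fls_const c"
  then obtain c d where "f - f' = fls_const c" "g - g' = fls_const d" by blast
  then have "(f + g) - (f' + g') = fls_const (c + d)"
    by (simp add: add_diff_add flip: fls_plus_const)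
  then show "\<exists>c. (f + g) - (f' + g') = fls_const c" by blast
qed

lift_definition uminus_hprime :: "hprime \<Rightarrow> hprime" is uminus
proof -
  fix f f' :: "complex fls"
  assume "\<exists>c. f - f' = fls_const c"
  then obtain c where "f - f' = fls_const c" by blast
  then have "(- f) - (- f') = fls_const (- c)"
    by (metis fls_const_uminus minus_diff_commute minus_diff_eq diff_minus_eq_add add.commute uminus_add_conv_diff)
  then show "\<exists>c. (- f) - (- f') = fls_const c" by blast
qed

definition minus_hprime :: "hprime \<Rightarrow> hprime \<Rightarrow> hprime" where
  "minus_hprime x y = x + (- y)"

instance
proof
  fix a b c :: hprime
  show "a + b + c = a + (b + c)" by transfer (rule exI[of _ 0], simp add: add.assoc)
  show "a + b = b + a" by transfer (rule exI[of _ 0], simp add: add.commute)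
  show "0 + a = a" by transfer (rule exI[of _ 0], simp)
  show "- a + a = 0" by transfer (rule exI[of _ 0], simp)
  show "a - b = a + - b" by (rule minus_hprime_def)
qed

end

lift_definition hscale :: "complex \<Rightarrow> hprime \<Rightarrow> hprime" is "\<lambda>c f. fls_const c * f"
proof -
  fix c and f f' :: "complex fls"
  assume "\<exists>d. f - f' = fls_const d"
  then obtain d where "f - f' = fls_const d" by blast
  then have "fls_const c * f - fls_const c * f' = fls_const (c * d)"
    by (simp flip: right_diff_distrib fls_const_mult_const)
  then show "\<exists>d. fls_const c * f - fls_const c * f' = fls_const d" by blast
qed

global_interpretation hp: vector_space hscale
proof
  fix a b :: complex and x y :: hprime
  show "hscale a (x + y) = hscale a x + hscale a y"
    by transfer (rule exI[of _ 0], simp add: distrib_left)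
  show "hscale (a + b) x = hscale a x + hscale b x"
    by transfer (rule exI[of _ 0], simp add: distrib_right flip: fls_plus_const)
  show "hscale a (hscale b x) = hscale (a * b) x"
    by transfer (rule exI[of _ 0], simp add: mult.assoc flip: fls_const_mult_const)
  show "hscale 1 x = x"
    by transfer (rule exI[of _ 0], simp)
qed

instantiation hprime :: real_vector
begin

definition scaleR_hprime :: "real \<Rightarrow> hprime \<Rightarrow> hprime" where
  "scaleR_hprime r x = hscale (complex_of_real r) x"

instance
  by standard
    (simp_all add: scaleR_hprime_def hp.scale_right_distrib hp.scale_left_distrib)

end

text \<open>The quotient of the \<open>t\<close>-adic topology.\<close>

instantiation hprime :: topological_space
begin

definition open_hprime :: "hprime set \<Rightarrow> bool" where
  "open_hprime U \<longleftrightarrow> open (abs_hprime -` U)"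

instance
proof
  show "open (UNIV :: hprime set)" by (simp add: open_hprime_def)
  show "open (S \<inter> T)" if "open S" "open T" for S T :: "hprime set"
    using that by (simp add: open_hprime_def open_Int)
  show "open (\<Union>K)" if "\<forall>S\<in>K. open S" for K :: "hprime set set"
    using that by (auto simp: open_hprime_def vimage_Union)
qed

end

lift_definition hform :: "hprime \<Rightarrow> hprime \<Rightarrow> complex" is lie
proof -
  fix f f' g g' :: "complex fls"
  assume "\<exists>c. f - f' = fls_const c" "\<exists>c. g - g' = fls_const c"
  then obtain c d where c: "f - f' = fls_const c" and d: "g - g' = fls_const d" by blast
  have "lie f g - lie f' g = 0" using c lie_const_left by (metis lie_left_diff)
  moreover have "lie f' g - lie f' g' = 0" using d lie_const_right by (metis lie_right_diff)
  ultimately show "lie f g = lie f' g'" by simp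
qed

text \<open>The coefficient at \<open>t^n\<close> is well defined on \<open>H'\<close> only for \<open>n \<noteq> 0\<close>.\<close>

lift_definition hcoeff :: "hprime \<Rightarrow> int \<Rightarrow> complex" is "\<lambda>f n. if n = 0 then 0 else fls_nth f n"
proof -
  fix f g :: "complex fls"
  assume "\<exists>c. f - g = fls_const c"
  then obtain c where c: "f - g = fls_const c" by blast
  have "fls_nth f n = fls_nth g n" if "n \<noteq> 0" for n
  proof -
    have "fls_nth (f - g) n = 0" using c that by simp
    then show ?thesis by simp
  qed
  then show "(\<lambda>n. if n = 0 then 0 else fls_nth f n) = (\<lambda>n. if n = 0 then 0 else fls_nth g n)" by auto
qed

definition hb :: "int \<Rightarrow> hprime" where
  "hb i = abs_hprime (fls_X_intpow i)"

definition Hplus :: "hprime set" where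
  "Hplus = abs_hprime ` {f. \<forall>n\<le>0. fls_nth f n = 0}"

definition perp :: "hprime set \<Rightarrow> hprime set" where
  "perp S = {x. \<forall>y\<in>S. hform x y = 0}"

definition lagrangian :: "hprime set \<Rightarrow> bool" where
  "lagrangian Z \<longleftrightarrow> hp.subspace Z \<and> perp Z = Z"

definition has_codim :: "hprime set \<Rightarrow> hprime set \<Rightarrow> nat \<Rightarrow> bool" where
  "has_codim F Z n \<longleftrightarrow> hp.subspace F \<and> F \<subseteq> Z \<and>
     (\<exists>S. finite S \<and> card S = n \<and> hp.independent S \<and> hp.span S \<inter> F = {0} \<and> hp.span S + F = Z)"


section \<open>Principally polarized abelian varieties\<close>

text \<open>\<open>E\<close> is a unimodular form on the lattice \<open>L / F\<close>, where the lattice is given by its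
  preimage \<open>L\<close> and \<open>F \<subseteq> L\<close> is divided out.\<close>

definition unimodular_mod :: "'a::ab_group_add set \<Rightarrow> 'a set \<Rightarrow> ('a \<Rightarrow> 'a \<Rightarrow> complex) \<Rightarrow> bool" where
  "unimodular_mod L F E \<longleftrightarrow>
     (\<forall>x\<in>L. \<forall>y\<in>L. E x y \<in> \<int>) \<and>
     (\<forall>x\<in>L. (\<forall>y\<in>L. E x y = 0) \<longleftrightarrow> x \<in> F) \<and>
     (\<forall>\<phi>::'a \<Rightarrow> int. (\<forall>x\<in>L. \<forall>y\<in>L. \<phi> (x + y) = \<phi> x + \<phi> y) \<and> (\<forall>x\<in>F. \<phi> x = 0) \<longrightarrow>
        (\<exists>x\<in>L. \<forall>y\<in>L. E x y = of_int (\<phi> y)))"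

text \<open>A PPAV of dimension \<open>g\<close> is a complex torus \<open>X = \<complex>\<^sup>g / \<Lambda>\<close> with a positive definite Hermitian
  form \<open>B\<close>, conjugate linear in the first argument, whose imaginary part is unimodular
  on \<open>\<Lambda>\<close>. This form is the polarization \<open>\<Theta>\<close>.\<close>

definition ppav :: "(complex^'g) set \<Rightarrow> (complex^'g \<Rightarrow> complex^'g \<Rightarrow> complex) \<Rightarrow> bool" where
  "ppav \<Lambda> B \<longleftrightarrow>
     (\<exists>S. finite S \<and> card S = 2 * CARD('g) \<and> independent S \<and>
          \<Lambda> = {\<Sum>s\<in>S. of_int (m s) *\<^sub>R s |m :: complex^'g \<Rightarrow> int. True}) \<and>
     (\<forall>x y z. B x (y + z) = B x y + B x z) \<and>
     (\<forall>c x y. B x (c *s y) = c * B x y) \<and>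
     (\<forall>x y. B y x = cnj (B x y)) \<and>
     (\<forall>x. x \<noteq> 0 \<longrightarrow> Re (B x x) > 0) \<and>
     unimodular_mod \<Lambda> {0} (\<lambda>x y. of_real (Im (B x y)))"

text \<open>Holomorphic 1-forms on \<open>X = \<complex>\<^sup>g / \<Lambda>\<close>, as \<open>\<Lambda>\<close>-periodic holomorphic 1-forms on \<open>\<complex>\<^sup>g\<close>:
  \<open>\<omega> x v\<close> is the value of \<open>\<omega>\<close> at the point \<open>x\<close> on the tangent vector \<open>v\<close>.\<close>

definition H0_Omega :: "(complex^'g) set \<Rightarrow> (complex^'g \<Rightarrow> complex^'g \<Rightarrow> complex) set" where
  "H0_Omega \<Lambda> = {\<omega>.
     (\<forall>x u v. \<omega> x (u + v) = \<omega> x u + \<omega> x v) \<and> (\<forall>x c v. \<omega> x (c *s v) = c * \<omega> x v) \<and>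
     (\<forall>v x. \<exists>D. ((\<lambda>y. \<omega> y v) has_derivative D) (at x) \<and> (\<forall>c u. D (c *s u) = c * D u)) \<and>
     (\<forall>x. \<forall>l\<in>\<Lambda>. \<omega> (x + l) = \<omega> x)}"

text \<open>Linear functionals on the complex vector space \<open>U\<close> (with scalar multiplication \<open>sc\<close>),
  normalized to be \<open>0\<close> off \<open>U\<close>.\<close>

definition dual_space :: "(complex \<Rightarrow> 'u \<Rightarrow> 'u) \<Rightarrow> 'u::plus set \<Rightarrow> ('u \<Rightarrow> complex) set" where
  "dual_space sc U = {l. (\<forall>u\<in>U. \<forall>v\<in>U. l (u + v) = l u + l v) \<and>
     (\<forall>c. \<forall>u\<in>U. l (sc c u) = c * l u) \<and> (\<forall>u. u \<notin> U \<longrightarrow> l u = 0)}"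

abbreviation H0_dual :: "(complex^'g) set \<Rightarrow> ((complex^'g \<Rightarrow> complex^'g \<Rightarrow> complex) \<Rightarrow> complex) set" where
  "H0_dual \<Lambda> \<equiv> dual_space (\<lambda>c \<omega> x v. c * \<omega> x v) (H0_Omega \<Lambda>)"

abbreviation dual_scale :: "complex \<Rightarrow> ('u \<Rightarrow> complex) \<Rightarrow> ('u \<Rightarrow> complex)" where
  "dual_scale c l \<equiv> (\<lambda>u. c * l u)"

text \<open>The canonical isomorphism from \<open>\<complex>\<^sup>g\<close>, the tangent space of \<open>X\<close> at \<open>0\<close>, to
  \<open>H\<^sup>0(X, \<Omega>\<^sup>1)\<^sup>*\<close>.\<close>

definition tangent_functional ::
  "(complex^'g) set \<Rightarrow> complex^'g \<Rightarrow> (complex^'g \<Rightarrow> complex^'g \<Rightarrow> complex) \<Rightarrow> complex" where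
  "tangent_functional \<Lambda> v = (\<lambda>\<omega>. if \<omega> \<in> H0_Omega \<Lambda> then \<omega> 0 v else 0)"


section \<open>Extended PPAVs\<close>

text \<open>A point consists of \<open>Z\<close>, \<open>F\<close>, the preimage in \<open>F\<^sup>\<bottom>\<close> of the lattice \<open>L \<subset> F\<^sup>\<bottom> / F\<close>, and an
  identification of \<open>Z / F\<close> with \<open>\<complex>\<^sup>g\<close>, given as a linear map on \<open>Z\<close> with kernel \<open>F\<close>.\<close>

record ('g::finite) extpt =
  Zof :: "hprime set"
  Fof :: "hprime set"
  Lof :: "hprime set"
  frame :: "hprime \<Rightarrow> complex^'g"

definition lattice_mod :: "hprime set \<Rightarrow> hprime set \<Rightarrow> nat \<Rightarrow> bool" where
  "lattice_mod F L n \<longleftrightarrow> (\<exists>l::nat \<Rightarrow> hprime.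
     (\<forall>j<n. l j \<in> perp F) \<and>
     (\<forall>c::nat \<Rightarrow> real. (\<Sum>j<n. c j *\<^sub>R l j) \<in> F \<longrightarrow> (\<forall>j<n. c j = 0)) \<and>
     L = {(\<Sum>j<n. of_int (m j) *\<^sub>R l j) + f |(m::nat \<Rightarrow> int) f. f \<in> F})"

text \<open>Modulo \<open>F\<close>, \<open>w\<close> is the conjugate of \<open>u\<close> for the real structure \<open>L\<^sub>\<real>\<close>.
  The real span of \<open>L\<close> is the preimage of \<open>L\<^sub>\<real>\<close>.\<close>

definition conj_mod :: "hprime set \<Rightarrow> hprime set \<Rightarrow> hprime \<Rightarrow> hprime \<Rightarrow> bool" where
  "conj_mod F L u w \<longleftrightarrow> (\<exists>x\<in>span L. \<exists>y\<in>span L.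
     u - (x + hscale \<i> y) \<in> F \<and> w - (x - hscale \<i> y) \<in> F)"

text \<open>Independent of the choice of the representative of the conjugate, since
  \<open>F\<close> is orthogonal to \<open>Z\<close>.\<close>

definition hermB :: "hprime set \<Rightarrow> hprime set \<Rightarrow> hprime \<Rightarrow> hprime \<Rightarrow> complex" where
  "hermB F L u v = hform (SOME w. conj_mod F L u w) v / of_real pi"

text \<open>The condition on \<open>conj_mod\<close> says that the real structure given by \<open>L\<^sub>\<real>\<close> identifies \<open>F\<^sup>\<bottom>\<^sub>+\<close> with
  the conjugate of \<open>Z / F\<close>. It does not follow from \<open>L\<^sub>\<real> \<inter> F\<^sup>\<bottom>\<^sub>+ = 0\<close>. Without it, the position of
  \<open>L\<^sub>\<real>\<close> relative to \<open>Z / F\<close> is an invariant of the action of \<open>Sp\<^sup>+(H')\<close> below, which would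
  then not be transitive on the extended PPAVs with a given underlying PPAV.\<close>

definition extended_ppav :: "nat \<Rightarrow> hprime set \<Rightarrow> hprime set \<Rightarrow> hprime set \<Rightarrow> bool" where
  "extended_ppav g Z F L \<longleftrightarrow>
     lagrangian Z \<and> has_codim F Z g \<and> lattice_mod F L (2 * g) \<and>
     Z \<inter> Hplus = {0} \<and>
     span L \<inter> (perp F \<inter> Hplus) = {0} \<and>
     {w. \<exists>u\<in>Z. conj_mod F L u w} = (perp F \<inter> Hplus) + F \<and>
     unimodular_mod L F (\<lambda>x y. hform x y / (2 * of_real pi * \<i>)) \<and>
     (\<forall>u\<in>Z. \<forall>v\<in>Z. hermB F L v u = cnj (hermB F L u v)) \<and>
     (\<forall>u\<in>Z - F. Re (hermB F L u u) > 0)"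

text \<open>\<open>Sp(X,\<Theta>)\<close> is the fibre of the map of moduli stacks over the point \<open>(X,\<Theta>)\<close>: its points are
  extended PPAVs together with an isomorphism of their underlying PPAV with \<open>(X,\<Theta>)\<close>.\<close>

definition Sp :: "(complex^'g) set \<Rightarrow> (complex^'g \<Rightarrow> complex^'g \<Rightarrow> complex) \<Rightarrow> ('g::finite) extpt set" where
  "Sp \<Lambda> B = {a.
     extended_ppav CARD('g) (Zof a) (Fof a) (Lof a) \<and>
     (\<forall>x\<in>Zof a. \<forall>y\<in>Zof a. frame a (x + y) = frame a x + frame a y) \<and>
     (\<forall>c. \<forall>x\<in>Zof a. frame a (hscale c x) = c *s frame a x) \<and>
     (\<forall>x. x \<notin> Zof a \<longrightarrow> frame a x = 0) \<and>
     frame a ` Zof a = UNIV \<and>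
     {x\<in>Zof a. frame a x = 0} = Fof a \<and>
     {frame a z |z. z \<in> Zof a \<and> (\<exists>h\<in>perp (Fof a) \<inter> Hplus. z + h \<in> Lof a)} = \<Lambda> \<and>
     (\<forall>u\<in>Zof a. \<forall>v\<in>Zof a. hermB (Fof a) (Lof a) u v = B (frame a u) (frame a v))}"


section \<open>The group \<open>Sp\<^sup>+(H')\<close>\<close>

definition SpPlus_full :: "(hprime \<Rightarrow> hprime) set" where
  "SpPlus_full = {g. Vector_Spaces.linear hscale hscale g \<and> bij g \<and>
     continuous_on UNIV g \<and> continuous_on UNIV (inv g) \<and>
     (\<forall>x y. hform (g x) (g y) = hform x y) \<and> g ` Hplus = Hplus}"

text \<open>The coarsest topology for which all matrix coefficients \<open>g \<mapsto> \<langle>x, g y\<rangle>\<close> are continuous (for the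
  usual topology of \<open>\<complex>\<close>).\<close>

definition SpPlus_topology :: "(hprime \<Rightarrow> hprime) topology" where
  "SpPlus_topology =
     pullback_topology SpPlus_full (\<lambda>g (p::hprime \<times> hprime). hform (fst p) (g (snd p))) euclidean"

definition SpPlus :: "(hprime \<Rightarrow> hprime) set" where
  "SpPlus = {g. connected_component_of SpPlus_topology id g}"

definition sp_move :: "(hprime \<Rightarrow> hprime) \<Rightarrow> ('g::finite) extpt \<Rightarrow> ('g::finite) extpt" where
  "sp_move g a = \<lparr> Zof = g ` Zof a, Fof = g ` Fof a, Lof = g ` Lof a,
                   frame = (\<lambda>x. frame a (inv g x)) \<rparr>"


section \<open>The complex manifold structure on \<open>Sp(X,\<Theta>)\<close>\<close>

text \<open>\<open>Z\<close> is the graph of a linear map \<open>H'\<^sub>- \<rightarrow> H'\<^sub>+\<close>, and \<open>zel a k\<close> is its point over \<open>t^{-k-1}\<close>.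
  A point of \<open>Sp(X,\<Theta>)\<close> is determined by this map and by the values of the frame on the \<open>zel a k\<close>.
  Together these are global coordinates, with values in an open subset of a closed linear subspace
  of a countable power of \<open>\<complex>\<close>.\<close>

definition zel :: "('g::finite) extpt \<Rightarrow> nat \<Rightarrow> hprime" where
  "zel a k = (THE z. z \<in> Zof a \<and> z - hb (- int k - 1) \<in> Hplus)"

definition coords :: "('g::finite) extpt \<Rightarrow> (nat \<times> nat \<Rightarrow> complex) \<times> (nat \<Rightarrow> complex^'g)" where
  "coords a = ((\<lambda>(k, m). hcoeff (zel a k) (int m + 1)), (\<lambda>k. frame a (zel a k)))"

definition sp_topology :: "('g::finite) extpt set \<Rightarrow> ('g::finite) extpt topology" where
  "sp_topology M = pullback_topology M coords euclidean"

text \<open>Holomorphic functions in infinitely many variables: continuous, and holomorphic along every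
  complex line of the coordinate space.\<close>

definition hol :: "('g::finite) extpt set \<Rightarrow> ('g::finite) extpt set \<Rightarrow> (('g::finite) extpt \<Rightarrow> complex) \<Rightarrow> bool" where
  "hol M U f \<longleftrightarrow> openin (sp_topology M) U \<and>
     continuous_map (subtopology (sp_topology M) U) euclidean f \<and>
     (\<forall>\<gamma> r a y. r > 0 \<and>
        (\<forall>z\<in>ball 0 r. \<gamma> z \<in> U \<and>
           coords (\<gamma> z) = ((\<lambda>i. fst a i + z * fst y i), (\<lambda>k. snd a k + z *s snd y k))) \<longrightarrow>
        (\<lambda>z. f (\<gamma> z)) holomorphic_on ball 0 r)"


section \<open>Polynomial algebras\<close>

type_synonym 'x cpoly = "('x \<Rightarrow>\<^sub>0 nat) \<Rightarrow>\<^sub>0 complex"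

definition PVar :: "'x \<Rightarrow> 'x cpoly" where
  "PVar x = Poly_Mapping.single (Poly_Mapping.single x 1) 1"

definition PConst :: "complex \<Rightarrow> 'x cpoly" where
  "PConst c = Poly_Mapping.single 0 c"

text \<open>The homomorphism that sends \<open>PVar x\<close> to \<open>\<theta> x\<close> and is \<open>\<kappa>\<close> on constants.\<close>

definition psubst :: "(complex \<Rightarrow> 'r) \<Rightarrow> ('x \<Rightarrow> 'r) \<Rightarrow> 'x cpoly \<Rightarrow> 'r::comm_ring_1" where
  "psubst \<kappa> \<theta> P = (\<Sum>m\<in>Poly_Mapping.keys P. \<kappa> (Poly_Mapping.lookup P m) *
     (\<Prod>x\<in>Poly_Mapping.keys m. \<theta> x ^ Poly_Mapping.lookup m x))"

text \<open>The symmetric algebra of \<open>\<complex>\<^sup>d \<otimes> W\<close>, for a complex vector space \<open>W\<close> with scalar multiplication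
  \<open>sc\<close>: the commutative algebra on generators \<open>A \<otimes> w = PVar (A, w)\<close> modulo the ideal of
  bilinearity relations, with cosets as elements.\<close>

definition bilin_relations ::
  "(complex \<Rightarrow> 'w \<Rightarrow> 'w) \<Rightarrow> 'w::plus set \<Rightarrow> ((complex^'d) \<times> 'w) cpoly set" where
  "bilin_relations sc W =
     {PVar (A + A', w) - PVar (A, w) - PVar (A', w) |A A' w. w \<in> W} \<union>
     {PVar (A, w + w') - PVar (A, w) - PVar (A, w') |A w w'. w \<in> W \<and> w' \<in> W} \<union>
     {PVar (c *s A, w) - PConst c * PVar (A, w) |c A w. w \<in> W} \<union>
     {PVar (A, sc c w) - PConst c * PVar (A, w) |c A w. w \<in> W}"

definition sym_ideal ::
  "(complex \<Rightarrow> 'w \<Rightarrow> 'w) \<Rightarrow> 'w::plus set \<Rightarrow> ((complex^'d) \<times> 'w) cpoly set" where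
  "sym_ideal sc W = module.span (*) (bilin_relations sc W)"

definition Sym_tensor ::
  "(complex \<Rightarrow> 'w \<Rightarrow> 'w) \<Rightarrow> 'w::plus set \<Rightarrow> ((complex^'d) \<times> 'w) cpoly set set" where
  "Sym_tensor sc W =
     {P +o sym_ideal sc W |P. \<forall>m\<in>Poly_Mapping.keys P. Poly_Mapping.keys m \<subseteq> UNIV \<times> W}"

definition sym_scale :: "'x cpoly set \<Rightarrow> complex \<Rightarrow> 'x cpoly set \<Rightarrow> 'x cpoly set" where
  "sym_scale J c X = (\<lambda>P. PConst c * P) ` X + J"

text \<open>The ring of polynomial functions on a vector space \<open>U\<close> (normalized to be \<open>0\<close> off \<open>U\<close>).\<close>

inductive_set polynomial_functions ::
  "(complex \<Rightarrow> 'u \<Rightarrow> 'u) \<Rightarrow> 'u::plus set \<Rightarrow> ('u \<Rightarrow> complex) set"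
  for sc :: "complex \<Rightarrow> 'u \<Rightarrow> 'u" and U :: "'u set" where
  const: "(\<lambda>u. if u \<in> U then c else 0) \<in> polynomial_functions sc U"
| linear: "l \<in> dual_space sc U \<Longrightarrow> l \<in> polynomial_functions sc U"
| add: "p \<in> polynomial_functions sc U \<Longrightarrow> q \<in> polynomial_functions sc U \<Longrightarrow>
    p + q \<in> polynomial_functions sc U"
| mult: "p \<in> polynomial_functions sc U \<Longrightarrow> q \<in> polynomial_functions sc U \<Longrightarrow>
    p * q \<in> polynomial_functions sc U"


section \<open>The level 0 Heisenberg vertex algebra\<close>

text \<open>The lattice is \<open>\<Gamma> = \<int>\<^sup>d\<close> (a choice of \<open>\<int>\<close>-basis) with an arbitrary form, so that
  \<open>\<hh>\<^sub>\<Gamma> = \<Gamma> \<otimes> \<complex> = \<complex>\<^sup>d\<close>.\<close>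

definition even_pd_lattice :: "(int^'d \<Rightarrow> int^'d \<Rightarrow> int) \<Rightarrow> bool" where
  "even_pd_lattice \<beta> \<longleftrightarrow>
     (\<forall>x y z. \<beta> (x + y) z = \<beta> x z + \<beta> y z) \<and> (\<forall>x y. \<beta> x y = \<beta> y x) \<and>
     (\<forall>x. even (\<beta> x x)) \<and> (\<forall>x. x \<noteq> 0 \<longrightarrow> \<beta> x x > 0)"

text \<open>\<open>Sym(\<hh>\<^sub>\<Gamma> \<otimes> t\<^sup>-\<^sup>1\<complex>[t\<^sup>-\<^sup>1])\<close> in the basis \<open>e\<^sub>i \<otimes> t^{-k-1}\<close>, written \<open>PVar (i, k)\<close>.\<close>

type_synonym 'd fock = "('d \<times> nat) cpoly"

text \<open>At level 0, \<open>A \<otimes> f\<close> acts on the Fock module as multiplication by the following element: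
  the operators commute, and non-negative powers of \<open>t\<close> act by \<open>0\<close>.\<close>

definition heis :: "complex^'d \<Rightarrow> hprime \<Rightarrow> ('d::finite) fock" where
  "heis A f = (\<Sum>i\<in>UNIV. \<Sum>k | hcoeff f (- int k - 1) \<noteq> 0.
     PConst (A $ i * hcoeff f (- int k - 1)) * PVar (i, k))"

text \<open>The action of \<open>Sp\<^sup>+(H')\<close> on \<open>V\<close> is the one that fixes the vacuum and satisfies
  \<open>g (A \<otimes> f) g\<^sup>-\<^sup>1 = A \<otimes> g f\<close>. On Lie algebras, \<open>X \<in> sp\<^sup>+(H')\<close> kills the vacuum and
  \<open>[X, A \<otimes> f] = A \<otimes> X f\<close>.\<close>

definition sp_act :: "(hprime \<Rightarrow> hprime) \<Rightarrow> ('d::finite) fock \<Rightarrow> ('d::finite) fock" where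
  "sp_act g = psubst PConst (\<lambda>(i, k). heis (axis i 1) (g (hb (- int k - 1))))"


section \<open>Spaces of coinvariants\<close>

text \<open>Sections of \<open>V \<otimes> \<O>\<close> over an open set \<open>U\<close>; only their values on \<open>U\<close> matter.\<close>

definition V_section :: "('g::finite) extpt set \<Rightarrow> ('g::finite) extpt set \<Rightarrow> (('g::finite) extpt \<Rightarrow> ('d::finite) fock) \<Rightarrow> bool" where
  "V_section M U v \<longleftrightarrow> openin (sp_topology M) U \<and>
     (\<forall>a\<in>U. \<exists>W\<subseteq>U. a \<in> W \<and> openin (sp_topology M) W \<and>
        (\<exists>(n::nat) \<phi> P. (\<forall>k<n. hol M W (\<phi> k)) \<and>
           (\<forall>b\<in>W. v b = (\<Sum>k<n. PConst (\<phi> k b) * P k))))"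

text \<open>Sections over \<open>U\<close> of the tautological sheaf with fibre \<open>F\<close>.\<close>

definition F_section :: "('g::finite) extpt set \<Rightarrow> ('g::finite) extpt set \<Rightarrow> (('g::finite) extpt \<Rightarrow> hprime) \<Rightarrow> bool" where
  "F_section M U f \<longleftrightarrow> openin (sp_topology M) U \<and>
     (\<forall>b\<in>U. f b \<in> Fof b) \<and> (\<forall>n. hol M U (\<lambda>b. hcoeff (f b) n)) \<and>
     (\<forall>a\<in>U. \<exists>W\<subseteq>U. a \<in> W \<and> openin (sp_topology M) W \<and>
        (\<exists>N. \<forall>b\<in>W. \<forall>n<N. hcoeff (f b) n = 0))"

text \<open>The stalk at \<open>a\<close> of \<open>\<hh>\<^sup>o\<^sup>u\<^sup>t(V \<otimes> \<O>)\<close>, as the set of all functions whose germ at \<open>a\<close>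
  belongs to it.\<close>

definition out_stalk :: "('g::finite) extpt set \<Rightarrow> ('g::finite) extpt \<Rightarrow> (('g::finite) extpt \<Rightarrow> ('d::finite) fock) set" where
  "out_stalk M a = {w. \<exists>U. a \<in> U \<and> openin (sp_topology M) U \<and>
     (\<exists>(n::nat) A f v. (\<forall>k<n. F_section M U (f k) \<and> V_section M U (v k)) \<and>
        (\<forall>b\<in>U. w b = (\<Sum>k<n. heis (A k) (f k b) * v k b)))}"

text \<open>Global sections of the quotient sheaf \<open>V \<otimes> \<O> / \<hh>\<^sup>o\<^sup>u\<^sup>t(V \<otimes> \<O>)\<close>: families of elements of its stalks,
  locally induced by sections of \<open>V \<otimes> \<O>\<close>.\<close>

definition coinv_sections :: "('g::finite) extpt set \<Rightarrow> (('g::finite) extpt \<Rightarrow> (('g::finite) extpt \<Rightarrow> ('d::finite) fock) set) set" where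
  "coinv_sections M = {s.
     (\<forall>a\<in>M. \<exists>U v. a \<in> U \<and> V_section M U v \<and> (\<forall>b\<in>U. s b = v +o out_stalk M b)) \<and>
     (\<forall>a. a \<notin> M \<longrightarrow> s a = {})}"

definition sec_move ::
  "(hprime \<Rightarrow> hprime) \<Rightarrow> (('g::finite) extpt \<Rightarrow> ('d::finite) fock) \<Rightarrow> (('g::finite) extpt \<Rightarrow> ('d::finite) fock)" where
  "sec_move g v = (\<lambda>b. sp_act g (v (sp_move (inv g) b)))"

text \<open>An equivariant sheaf on the homogeneous space \<open>Sp(X,\<Theta>)\<close> descends to the vector space of its
  invariant global sections when stabilizers act trivially on the fibres.\<close>

definition coinvariants ::
  "(complex^'g) set \<Rightarrow> (complex^'g \<Rightarrow> complex^'g \<Rightarrow> complex) \<Rightarrow>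
   (('g::finite) extpt \<Rightarrow> (('g::finite) extpt \<Rightarrow> ('d::finite) fock) set) set" where
  "coinvariants \<Lambda> B = {s \<in> coinv_sections (Sp \<Lambda> B).
     \<forall>g\<in>SpPlus. \<forall>a\<in>Sp \<Lambda> B. sec_move g ` s a = s (sp_move g a)}"

definition coinv_scale ::
  "('g::finite) extpt set \<Rightarrow> complex \<Rightarrow> (('g::finite) extpt \<Rightarrow> (('g::finite) extpt \<Rightarrow> ('d::finite) fock) set) \<Rightarrow>
   (('g::finite) extpt \<Rightarrow> (('g::finite) extpt \<Rightarrow> ('d::finite) fock) set)" where
  "coinv_scale M c s = (\<lambda>a. (\<lambda>v b. PConst c * v b) ` s a + out_stalk M a)"

definition linear_iso ::
  "(complex \<Rightarrow> 'a \<Rightarrow> 'a) \<Rightarrow> 'a::plus set \<Rightarrow> (complex \<Rightarrow> 'b \<Rightarrow> 'b) \<Rightarrow> 'b::plus set \<Rightarrow> ('a \<Rightarrow> 'b) \<Rightarrow> bool" where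
  "linear_iso sc V sc' W \<Phi> \<longleftrightarrow> bij_betw \<Phi> V W \<and>
     (\<forall>s\<in>V. \<forall>s'\<in>V. s + s' \<in> V \<and> \<Phi> (s + s') = \<Phi> s + \<Phi> s') \<and>
     (\<forall>c. \<forall>s\<in>V. sc c s \<in> V \<and> \<Phi> (sc c s) = sc' c (\<Phi> s))"

text \<open>\<open>\<hh>\<^sub>\<Gamma> \<otimes> H\<^sup>0(X, \<Omega>\<^sup>1)\<close>, with \<open>u\<close> standing for the sum over \<open>i\<close> of \<open>e\<^sub>i \<otimes> u i\<close>.\<close>

definition h_tensor_H0 ::
  "(complex^'g) set \<Rightarrow> ('d \<Rightarrow> complex^'g \<Rightarrow> complex^'g \<Rightarrow> complex) set" where
  "h_tensor_H0 \<Lambda> = {u. \<forall>i. u i \<in> H0_Omega \<Lambda>}"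

abbreviation h_tensor_scale :: "complex \<Rightarrow> ('d \<Rightarrow> complex^'g \<Rightarrow> complex^'g \<Rightarrow> complex) \<Rightarrow>
    ('d \<Rightarrow> complex^'g \<Rightarrow> complex^'g \<Rightarrow> complex)" where
  "h_tensor_scale c u \<equiv> (\<lambda>i x v. c * u i x v)"

text \<open>The polynomial function of \<open>u\<close> attached to a vector of \<open>V\<close> at the point \<open>a\<close>: through
  the form of \<open>\<Gamma>\<close>, \<open>e\<^sub>i \<otimes> \<tau>\<close> is the function sending \<open>e\<^sub>j \<otimes> \<omega>\<close> to \<open>(e\<^sub>i, e\<^sub>j) \<tau>(\<omega>)\<close>.\<close>

definition fun_value ::
  "(int^'d \<Rightarrow> int^'d \<Rightarrow> int) \<Rightarrow> (complex^'g) set \<Rightarrow> ('g::finite) extpt \<Rightarrow> ('d::finite) fock \<Rightarrow>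
   ('d \<Rightarrow> complex^'g \<Rightarrow> complex^'g \<Rightarrow> complex) \<Rightarrow> complex" where
  "fun_value \<beta> \<Lambda> a P u = (if u \<in> h_tensor_H0 \<Lambda> then
     psubst (\<lambda>c. c) (\<lambda>(i, k). \<Sum>j\<in>UNIV. of_int (\<beta> (axis i 1) (axis j 1)) *
       tangent_functional \<Lambda> (frame a (zel a k)) (u j)) P else 0)"

text \<open>The class of \<open>(A\<^sub>1 \<otimes> z\<^sub>1) \<dots> (A\<^sub>r \<otimes> z\<^sub>r) 1\<close>, for \<open>z\<^sub>i\<close> in \<open>Z\<close>, goes to the product of the
  \<open>A\<^sub>i \<otimes> [z\<^sub>i]\<close> with \<open>[z\<^sub>i]\<close> in \<open>Z / F = H\<^sup>0(X, \<Omega>\<^sup>1)\<^sup>*\<close>.\<close>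

definition sym_value ::
  "(complex^'g) set \<Rightarrow> ('g::finite) extpt \<Rightarrow> ('d::finite) fock \<Rightarrow>
   ((complex^'d) \<times> ((complex^'g \<Rightarrow> complex^'g \<Rightarrow> complex) \<Rightarrow> complex)) cpoly" where
  "sym_value \<Lambda> a = psubst PConst
     (\<lambda>(i, k). PVar (axis i 1, tangent_functional \<Lambda> (frame a (zel a k))))"

end

theory Submission
  imports Defs
begin

text \<open>At level \<open>0\<close> the operators \<open>A \<otimes> f\<close> are multiplications, and \<open>A \<otimes> f\<close> depends only on the class of
  \<open>f\<close> modulo \<open>H'\<^sub>+\<close>. At a point \<open>a = (Z, F, L)\<close> the projection along \<open>H'\<^sub>+\<close> identifies \<open>H' / H'\<^sub>+\<close> with \<open>Z\<close>,
  so that \<open>V = Sym(\<hh>\<^sub>\<Gamma> \<otimes> Z)\<close>, and dividing by the ideal generated by \<open>\<hh>\<^sub>\<Gamma> \<otimes> F\<close> leaves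
  \<open>Sym(\<hh>\<^sub>\<Gamma> \<otimes> Z / F)\<close>. The frame identifies \<open>Z / F\<close> with \<open>\<complex>\<^sup>g\<close>, so that every fibre becomes the same
  polynomial ring in the variables \<open>e\<^sub>i \<otimes> e\<^sub>j\<close>. The map from \<open>V\<close> to this ring is called
  \<open>fibre_value a\<close>. The theorem says that invariant sections correspond to constants of this ring.

  The argument has four ingredients. The first is a description of \<open>Sp(X,\<Theta>)\<close>: the lattice is determined by
  the rest of the data, because the conjugate of \<open>z \<in> Z\<close> must be the element of \<open>H'\<^sub>+\<close> that represents the
  functional \<open>\<pi> B (\<phi> z) \<circ> \<phi>\<close>, where \<open>\<phi>\<close> is the frame. Hence points are the same as pairs of a Lagrangian
  complement \<open>Z\<close> of \<open>H'\<^sub>+\<close> and a surjective linear map \<open>\<phi>\<close> from \<open>Z\<close> to \<open>\<complex>\<^sup>g\<close>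
  (\<open>standard_point_in_Sp\<close>, \<open>Sp_eq_standard_point\<close>).

  The second is the transitivity of \<open>Sp\<^sup>+(H')\<close>. All group elements that are needed have the form \<open>1 + X\<close> with
  \<open>X\<^sup>2 = 0\<close>; the path \<open>1 + sX\<close> shows that they lie in the identity component. One such element
  moves \<open>Z\<close> to any other complement, and two of them move one frame of \<open>Z\<close> to another. Since
  \<open>fibre_value (g a) (g P) = fibre_value a P\<close>, the value of an invariant section is the same at all points
  (\<open>SpPlus_invariant_constant\<close>).

  The third is that a section of \<open>V \<otimes> \<O>\<close> with values \<open>0\<close> in all fibres near a point belongs to the image of
  \<open>\<hh>\<^sup>o\<^sup>u\<^sup>t\<close> there (\<open>fibre_value_zero_imp_out_stalk\<close>). Near a point, finitely many of the generators \<open>t^{-k-1}\<close> of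
  \<open>H' / H'\<^sub>+\<close> give a basis of \<open>Z / F\<close>, and Cramer's rule expresses every other generator through them,
  with holomorphic coefficients, up to a section of the tautological sheaf with fibre \<open>F\<close>. Together with the
  second ingredient this shows that the coinvariants are exactly the families with a constant value in the
  polynomial ring, and that every constant occurs (\<open>coinvariants_eq_range\<close>).

  Finally, by Liouville's theorem the holomorphic 1-forms on \<open>X\<close> are the constant ones, so that
  \<open>H\<^sup>0(X, \<Omega>\<^sup>1)\<^sup>*\<close> is \<open>\<complex>\<^sup>g\<close> and the symmetric algebra is the polynomial ring above. The form of \<open>\<Gamma>\<close>
  is positive definite, hence has an invertible Gram matrix, and therefore identifies the same ring with the
  polynomial functions on \<open>\<hh>\<^sub>\<Gamma> \<otimes> H\<^sup>0(X, \<Omega>\<^sup>1)\<close>; no element is lost, since a polynomial that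
  vanishes at all points is zero.\<close>

section \<open>Polynomial algebras and their homomorphisms\<close>

definition scalar_hom :: "(complex \<Rightarrow> 'r::comm_ring_1) \<Rightarrow> bool" where
  "scalar_hom \<kappa> \<longleftrightarrow> \<kappa> 0 = 0 \<and> \<kappa> 1 = 1 \<and> (\<forall>a b. \<kappa> (a + b) = \<kappa> a + \<kappa> b) \<and> (\<forall>a b. \<kappa> (a * b) = \<kappa> a * \<kappa> b)"

lemma PConst_0 [simp]: "PConst 0 = 0"
  and PConst_1 [simp]: "PConst 1 = 1"
  and PConst_add: "PConst (a + b) = PConst a + PConst b"
  and PConst_diff: "PConst (a - b) = PConst a - PConst b"
  and PConst_uminus: "PConst (- a) = - PConst a"
  and PConst_mult: "PConst (a * b) = PConst a * PConst b"
  by (simp_all add: PConst_def single_add single_diff single_uminus mult_single)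

lemma PConst_sum: "PConst (sum f A) = (\<Sum>x\<in>A. PConst (f x))"
  by (induction A rule: infinite_finite_induct) (auto simp: PConst_add)

lemma scalar_hom_PConst [simp]: "scalar_hom PConst"
  by (simp add: scalar_hom_def PConst_add PConst_mult)

lemma scalar_hom_id [simp]: "scalar_hom (\<lambda>c. c)"
  by (simp add: scalar_hom_def)

definition mon_value :: "('x \<Rightarrow> 'r::comm_ring_1) \<Rightarrow> ('x \<Rightarrow>\<^sub>0 nat) \<Rightarrow> 'r" where
  "mon_value \<theta> m = (\<Prod>x\<in>Poly_Mapping.keys m. \<theta> x ^ Poly_Mapping.lookup m x)"

lemma mon_value_superset:
  assumes "finite A" "Poly_Mapping.keys m \<subseteq> A"
  shows "mon_value \<theta> m = (\<Prod>x\<in>A. \<theta> x ^ Poly_Mapping.lookup m x)"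
  unfolding mon_value_def using assms
  by (intro prod.mono_neutral_left) (auto simp: in_keys_iff)

lemma mon_value_add: "mon_value \<theta> (m + n) = mon_value \<theta> m * mon_value \<theta> n"
proof -
  let ?A = "Poly_Mapping.keys m \<union> Poly_Mapping.keys n"
  have "Poly_Mapping.keys (m + n) \<subseteq> ?A"
    by (rule keys_add)
  then show ?thesis
    by (simp add: mon_value_superset[of ?A] lookup_add power_add prod.distrib)
qed

lemma mon_value_0 [simp]: "mon_value \<theta> 0 = 1"
  by (simp add: mon_value_def)

lemma mon_value_single: "mon_value \<theta> (Poly_Mapping.single x n) = \<theta> x ^ n"
  by (simp add: mon_value_def)

lemma poly_mapping_sum_singles:
  "P = (\<Sum>m\<in>Poly_Mapping.keys P. Poly_Mapping.single m (Poly_Mapping.lookup P m))"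
  by (rule poly_mapping_eqI)
     (auto simp: lookup_sum lookup_single when_def sum.delta in_keys_iff)

lemma psubst_superset:
  assumes "scalar_hom \<kappa>" "finite A" "Poly_Mapping.keys P \<subseteq> A"
  shows "psubst \<kappa> \<theta> P = (\<Sum>m\<in>A. \<kappa> (Poly_Mapping.lookup P m) * mon_value \<theta> m)"
  unfolding psubst_def mon_value_def[symmetric] using assms
  by (intro sum.mono_neutral_left) (auto simp: in_keys_iff scalar_hom_def)

lemma psubst_0 [simp]: "psubst \<kappa> \<theta> 0 = 0"
  by (simp add: psubst_def)

lemma psubst_add:
  assumes "scalar_hom \<kappa>"
  shows "psubst \<kappa> \<theta> (P + Q) = psubst \<kappa> \<theta> P + psubst \<kappa> \<theta> Q"
proof -
  let ?A = "Poly_Mapping.keys P \<union> Poly_Mapping.keys Q"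
  have "Poly_Mapping.keys (P + Q) \<subseteq> ?A"
    by (rule keys_add)
  then show ?thesis using assms
    by (simp add: psubst_superset[of _ ?A] lookup_add scalar_hom_def distrib_right sum.distrib)
qed

lemma psubst_sum:
  assumes "scalar_hom \<kappa>"
  shows "psubst \<kappa> \<theta> (sum f A) = (\<Sum>x\<in>A. psubst \<kappa> \<theta> (f x))"
  by (induction A rule: infinite_finite_induct) (auto simp: psubst_add[OF assms])

lemma psubst_single:
  assumes "scalar_hom \<kappa>"
  shows "psubst \<kappa> \<theta> (Poly_Mapping.single m c) = \<kappa> c * mon_value \<theta> m"
  by (subst psubst_superset[of _ "{m}"]) (use assms in auto)

lemma psubst_mult:
  assumes "scalar_hom \<kappa>"
  shows "psubst \<kappa> \<theta> (P * Q) = psubst \<kappa> \<theta> P * psubst \<kappa> \<theta> Q"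
proof -
  let ?s = "\<lambda>P m. Poly_Mapping.single m (Poly_Mapping.lookup P m)"
  have "P * Q = (\<Sum>m\<in>Poly_Mapping.keys P. ?s P m) * (\<Sum>n\<in>Poly_Mapping.keys Q. ?s Q n)"
    using poly_mapping_sum_singles[of P] poly_mapping_sum_singles[of Q] by metis
  also have "\<dots> = (\<Sum>m\<in>Poly_Mapping.keys P. \<Sum>n\<in>Poly_Mapping.keys Q. ?s P m * ?s Q n)"
    by (rule sum_product)
  finally have "psubst \<kappa> \<theta> (P * Q) = (\<Sum>m\<in>Poly_Mapping.keys P. \<Sum>n\<in>Poly_Mapping.keys Q.
      (\<kappa> (Poly_Mapping.lookup P m) * mon_value \<theta> m) * (\<kappa> (Poly_Mapping.lookup Q n) * mon_value \<theta> n))"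
    using assms
    by (simp add: psubst_sum mult_single psubst_single mon_value_add scalar_hom_def algebra_simps)
  also have "\<dots> = psubst \<kappa> \<theta> P * psubst \<kappa> \<theta> Q"
    unfolding psubst_def mon_value_def[symmetric] by (rule sum_product[symmetric])
  finally show ?thesis .
qed

lemma psubst_PConst: "scalar_hom \<kappa> \<Longrightarrow> psubst \<kappa> \<theta> (PConst c) = \<kappa> c"
  by (simp add: PConst_def psubst_single)

lemma psubst_PVar: "scalar_hom \<kappa> \<Longrightarrow> psubst \<kappa> \<theta> (PVar x) = \<theta> x"
  by (simp add: PVar_def psubst_single mon_value_single) (simp add: scalar_hom_def)

lemma psubst_uminus: "scalar_hom \<kappa> \<Longrightarrow> psubst \<kappa> \<theta> (- P) = - psubst \<kappa> \<theta> P"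
  by (metis add.right_inverse add_eq_0_iff psubst_0 psubst_add)

lemma psubst_diff: "scalar_hom \<kappa> \<Longrightarrow> psubst \<kappa> \<theta> (P - Q) = psubst \<kappa> \<theta> P - psubst \<kappa> \<theta> Q"
  using psubst_add[of \<kappa> \<theta> P "- Q"] by (simp add: psubst_uminus)

lemmas psubst_simps = psubst_add psubst_mult psubst_sum psubst_diff psubst_PConst psubst_PVar

lemma PVar_power: "PVar x ^ n = Poly_Mapping.single (Poly_Mapping.single x n) 1"
  by (induction n) (auto simp: PVar_def mult_single simp flip: single_add)

lemma mon_value_PVar: "mon_value PVar m = Poly_Mapping.single m 1"
proof -
  have "(\<Prod>x\<in>A. PVar x ^ e x) = Poly_Mapping.single (\<Sum>x\<in>A. Poly_Mapping.single x (e x)) 1"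
    for A and e :: "'a \<Rightarrow> nat"
    by (induction A rule: infinite_finite_induct) (auto simp: PVar_power mult_single)
  then show ?thesis
    unfolding mon_value_def using poly_mapping_sum_singles[of m] by metis
qed

lemma psubst_PVar_id: "psubst PConst PVar P = P"
proof -
  have "psubst PConst PVar P
      = (\<Sum>m\<in>Poly_Mapping.keys P. Poly_Mapping.single m (Poly_Mapping.lookup P m))"
    unfolding psubst_def mon_value_def[symmetric] mon_value_PVar
    by (simp add: PConst_def mult_single)
  then show ?thesis using poly_mapping_sum_singles[of P] by simp
qed

definition vars_in :: "'x set \<Rightarrow> 'x cpoly \<Rightarrow> bool" where
  "vars_in A P \<longleftrightarrow> (\<forall>m\<in>Poly_Mapping.keys P. Poly_Mapping.keys m \<subseteq> A)"

lemma cpoly_induct_vars [consumes 1, case_names const var add mult]: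
  assumes "vars_in A P"
    and const: "\<And>c. R (PConst c)" and var: "\<And>x. x \<in> A \<Longrightarrow> R (PVar x)"
    and add: "\<And>P Q. R P \<Longrightarrow> R Q \<Longrightarrow> R (P + Q)" and mult: "\<And>P Q. R P \<Longrightarrow> R Q \<Longrightarrow> R (P * Q)"
  shows "R P"
proof -
  have R0: "R 0" and R1: "R 1"
    using const[of 0] const[of 1] by auto
  have sum: "R (sum f I)" if "\<And>x. x \<in> I \<Longrightarrow> R (f x)" for f and I :: "('a \<Rightarrow>\<^sub>0 nat) set"
    using that by (induction I rule: infinite_finite_induct) (auto intro: R0 add)
  have prod: "R (prod f I)" if "\<And>x. x \<in> I \<Longrightarrow> R (f x)" for f and I :: "'a set"
    using that by (induction I rule: infinite_finite_induct) (auto intro: R1 mult)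
  have pow: "R (Q ^ n)" if "R Q" for Q n
    by (induction n) (auto intro: R1 mult that)
  have "R (psubst PConst PVar P)"
    unfolding psubst_def using assms(1)
    by (intro sum mult const prod pow var) (auto simp: vars_in_def)
  then show ?thesis by (simp add: psubst_PVar_id)
qed

lemma cpoly_induct [case_names const var add mult]:
  assumes "\<And>c. R (PConst c)" and "\<And>x. R (PVar x)"
    and "\<And>P Q. R P \<Longrightarrow> R Q \<Longrightarrow> R (P + Q)" and "\<And>P Q. R P \<Longrightarrow> R Q \<Longrightarrow> R (P * Q)"
  shows "R P"
  by (rule cpoly_induct_vars[of UNIV]) (auto simp: vars_in_def assms)

lemma vars_in_PConst [simp]: "vars_in A (PConst c)"
  by (simp add: vars_in_def PConst_def)

lemma vars_in_PVar: "x \<in> A \<Longrightarrow> vars_in A (PVar x)"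
  by (simp add: vars_in_def PVar_def)

lemma vars_in_add: "vars_in A P \<Longrightarrow> vars_in A Q \<Longrightarrow> vars_in A (P + Q)"
  using keys_add[of P Q] by (auto simp: vars_in_def)

lemma vars_in_mult: "vars_in A P \<Longrightarrow> vars_in A Q \<Longrightarrow> vars_in A (P * Q)"
proof -
  assume "vars_in A P" "vars_in A Q"
  then have "Poly_Mapping.keys (a + b) \<subseteq> A"
    if "a \<in> Poly_Mapping.keys P" "b \<in> Poly_Mapping.keys Q" for a b
    using that keys_add[of a b] unfolding vars_in_def by blast
  then show ?thesis
    using keys_mult[of P Q] by (force simp: vars_in_def)
qed

lemma psubst_psubst:
  assumes "scalar_hom \<kappa>"
  shows "psubst \<kappa> \<theta> (psubst PConst \<theta>' P) = psubst \<kappa> (\<lambda>x. psubst \<kappa> \<theta> (\<theta>' x)) P"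
  by (induction P rule: cpoly_induct) (auto simp: psubst_simps assms)

lemma vars_in_finite: "\<exists>A. finite A \<and> vars_in A P"
  by (rule exI[of _ "\<Union>(Poly_Mapping.keys ` Poly_Mapping.keys P)"]) (auto simp: vars_in_def)

text \<open>The terms are grouped by the exponent of one variable. Each group is the coefficient of a polynomial in
  that variable with infinitely many roots, hence vanishes at all values of the remaining variables.\<close>

lemma monomials_independent:
  fixes K :: "('x \<Rightarrow> nat) set" and c :: "('x \<Rightarrow> nat) \<Rightarrow> complex"
  assumes "finite A" "finite K" "\<And>m x. m \<in> K \<Longrightarrow> x \<notin> A \<Longrightarrow> m x = 0"
    and "\<And>\<theta>. (\<Sum>m\<in>K. c m * (\<Prod>x\<in>A. \<theta> x ^ m x)) = 0"
    and "m \<in> K"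
  shows "c m = 0"
  using assms
proof (induction A arbitrary: K c m rule: finite_induct)
  case empty
  have "m = (\<lambda>_. 0)" if "m \<in> K" for m
    using empty(2) that by auto
  then have "K = {m}" using empty by blast
  then show ?case using empty by auto
next
  case (insert y A)
  have split: "m \<in> K \<Longrightarrow> (\<Prod>x\<in>insert y A. \<theta> x ^ m x) = \<theta> y ^ m y * (\<Prod>x\<in>A. \<theta> x ^ m x)" for \<theta> :: "'x \<Rightarrow> complex" and m
    using insert.hyps by simp
  obtain N where N: "\<And>m. m \<in> K \<Longrightarrow> m y \<le> N"
    using finite_imageI[OF \<open>finite K\<close>, of "\<lambda>m. m y"] by (metis finite_nat_set_iff_bounded_le imageI)
  have coeff0: "(\<Sum>m | m \<in> K \<and> m y = n. c m * (\<Prod>x\<in>A. \<theta> x ^ m x)) = 0" for \<theta> n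
  proof (cases "n \<le> N")
    case True
    define q where "q n = (\<Sum>m | m \<in> K \<and> m y = n. c m * (\<Prod>x\<in>A. \<theta> x ^ m x))" for n
    have "(\<Sum>n\<le>N. q n * z ^ n) = 0" for z
    proof -
      have "0 = (\<Sum>m\<in>K. c m * (\<Prod>x\<in>insert y A. (\<theta>(y := z)) x ^ m x))"
        using insert.prems by simp
      also have "\<dots> = (\<Sum>m\<in>K. c m * (\<Prod>x\<in>A. \<theta> x ^ m x) * z ^ m y)"
      proof (intro sum.cong refl)
        fix m assume "m \<in> K"
        have "(\<Prod>x\<in>A. (\<theta>(y := z)) x ^ m x) = (\<Prod>x\<in>A. \<theta> x ^ m x)"
          using insert.hyps by (intro prod.cong) auto
        then show "c m * (\<Prod>x\<in>insert y A. (\<theta>(y := z)) x ^ m x) = c m * (\<Prod>x\<in>A. \<theta> x ^ m x) * z ^ m y"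
          using insert.hyps by (simp add: mult_ac)
      qed
      also have "\<dots> = (\<Sum>n\<le>N. \<Sum>m | m \<in> K \<and> m y = n. c m * (\<Prod>x\<in>A. \<theta> x ^ m x) * z ^ m y)"
        using N \<open>finite K\<close> by (intro sum.group[symmetric]) auto
      also have "\<dots> = (\<Sum>n\<le>N. q n * z ^ n)"
        by (auto simp: q_def sum_distrib_right intro!: sum.cong)
      finally show ?thesis by simp
    qed
    then show ?thesis using polyfun_eq_0[of q N] True by (auto simp: q_def)
  next
    case False
    then have "{m. m \<in> K \<and> m y = n} = {}" using N by auto
    then show ?thesis by (simp only: sum.empty)
  qed
  define n where "n = m y"
  \<comment> \<open>The group of terms of degree \<open>n\<close> in \<open>y\<close>, with \<open>y\<close> removed from the exponents.\<close>
  define K' where "K' = (\<lambda>m. m(y := 0)) ` {m. m \<in> K \<and> m y = n}"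
  have inj: "inj_on (\<lambda>m. m(y := 0)) {m. m \<in> K \<and> m y = n}"
    by (rule inj_onI) (metis (mono_tags, lifting) fun_upd_triv fun_upd_upd mem_Collect_eq)
  have "(\<Sum>m'\<in>K'. c (m'(y := n)) * (\<Prod>x\<in>A. \<theta> x ^ m' x)) = 0" for \<theta>
  proof -
    have "(\<Sum>m'\<in>K'. c (m'(y := n)) * (\<Prod>x\<in>A. \<theta> x ^ m' x))
        = (\<Sum>m | m \<in> K \<and> m y = n. c m * (\<Prod>x\<in>A. \<theta> x ^ m x))"
      unfolding K'_def sum.reindex[OF inj] o_def
    proof (intro sum.cong refl)
      fix m assume m: "m \<in> {m \<in> K. m y = n}"
      have "(\<Prod>x\<in>A. \<theta> x ^ (m(y := 0)) x) = (\<Prod>x\<in>A. \<theta> x ^ m x)"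
        using insert.hyps by (intro prod.cong) auto
      moreover have "m(y := n) = m" using m by auto
      ultimately show "c ((m(y := 0))(y := n)) * (\<Prod>x\<in>A. \<theta> x ^ (m(y := 0)) x) = c m * (\<Prod>x\<in>A. \<theta> x ^ m x)"
        by simp
    qed
    then show ?thesis using coeff0 by simp
  qed
  moreover have "finite K'" "\<And>m x. m \<in> K' \<Longrightarrow> x \<notin> A \<Longrightarrow> m x = 0"
    using insert.prems by (auto simp: K'_def)
  moreover have "m(y := 0) \<in> K'" using insert.prems by (auto simp: K'_def n_def)
  ultimately have "c ((m(y := 0))(y := n)) = 0"
    using insert.IH[where K = K' and c = "\<lambda>m. c (m(y := n))" and m = "m(y := 0)"] by blast
  then show ?case by (simp add: n_def)
qed

lemma psubst_all_zero_imp_zero: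
  fixes P :: "'x cpoly"
  assumes "\<And>\<theta>. psubst (\<lambda>c. c) \<theta> P = 0"
  shows "P = 0"
proof (rule poly_mapping_eqI)
  fix m
  obtain A where A: "finite A" "vars_in A P" using vars_in_finite by blast
  let ?K = "Poly_Mapping.lookup ` Poly_Mapping.keys P"
  let ?c = "\<lambda>f. Poly_Mapping.lookup P (SOME m. Poly_Mapping.lookup m = f)"
  have some: "(SOME m'. Poly_Mapping.lookup m' = Poly_Mapping.lookup m) = m" for m :: "'x \<Rightarrow>\<^sub>0 nat"
    by (rule some_equality) (auto simp: lookup_inject)
  show "Poly_Mapping.lookup P m = Poly_Mapping.lookup 0 m"
  proof (cases "m \<in> Poly_Mapping.keys P")
    case True
    have "?c (Poly_Mapping.lookup m) = 0"
    proof (rule monomials_independent[of A ?K])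
      fix \<theta>
      have "(\<Sum>f\<in>?K. ?c f * (\<Prod>x\<in>A. \<theta> x ^ f x))
          = (\<Sum>m\<in>Poly_Mapping.keys P. Poly_Mapping.lookup P m * (\<Prod>x\<in>A. \<theta> x ^ Poly_Mapping.lookup m x))"
        by (subst sum.reindex) (auto simp: inj_on_def lookup_inject some)
      also have "\<dots> = psubst (\<lambda>c. c) \<theta> P"
        unfolding psubst_def mon_value_def[symmetric] using A
        by (intro sum.cong refl arg_cong2[of _ _ _ _ "(*)"] mon_value_superset[symmetric]) (auto simp: vars_in_def)
      finally show "(\<Sum>f\<in>?K. ?c f * (\<Prod>x\<in>A. \<theta> x ^ f x)) = 0" using assms by simp
    next
      fix f x assume "f \<in> ?K" "x \<notin> A"
      then show "f x = 0" using A(2) unfolding vars_in_def by (metis imageE in_keys_iff subsetD)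
    qed (use A True in auto)
    then show ?thesis by (simp add: some)
  next
    case False
    then show ?thesis by (simp add: in_keys_iff)
  qed
qed

section \<open>Coordinates and the symplectic form on \<open>H'\<close>\<close>

lemma hcoeff_0 [simp]: "hcoeff 0 n = 0"
  and hcoeff_add [simp]: "hcoeff (x + y) n = hcoeff x n + hcoeff y n"
  and hcoeff_uminus [simp]: "hcoeff (- x) n = - hcoeff x n"
  and hcoeff_scale [simp]: "hcoeff (hscale c x) n = c * hcoeff x n"
  and hcoeff_at_0 [simp]: "hcoeff x 0 = 0"
  by (transfer; simp)+

lemma hcoeff_diff [simp]: "hcoeff (x - y) n = hcoeff x n - hcoeff y n"
  unfolding minus_hprime_def hcoeff_add hcoeff_uminus by simp

lemma hcoeff_sum [simp]: "hcoeff (sum f A) n = (\<Sum>a\<in>A. hcoeff (f a) n)"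
  by (induction A rule: infinite_finite_induct) auto

lemma hprime_eqI: "(\<And>n. hcoeff x n = hcoeff y n) \<Longrightarrow> x = y"
proof (transfer)
  fix f g :: "complex fls"
  assume eq: "\<And>n. (if n = 0 then 0 else fls_nth f n) = (if n = 0 then 0 else fls_nth g n)"
  have "f - g = fls_const (fls_nth f 0 - fls_nth g 0)"
  proof (rule fls_eqI)
    fix n show "fls_nth (f - g) n = fls_nth (fls_const (fls_nth f 0 - fls_nth g 0)) n"
      using eq[of n] by (cases "n = 0") auto
  qed
  then show "\<exists>c. f - g = fls_const c" by blast
qed

lemma hcoeff_abs: "hcoeff (abs_hprime f) n = (if n = 0 then 0 else fls_nth f n)"
  by (simp add: hcoeff.abs_eq)

lemma hcoeff_hb [simp]: "hcoeff (hb i) n = (if n = i \<and> n \<noteq> 0 then 1 else 0)"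
  by (simp add: hb_def hcoeff_abs)

lemma hcoeff_bounded_below: "\<exists>N::nat. \<forall>k\<ge>N. hcoeff x (- int k - 1) = 0"
proof transfer
  fix f :: "complex fls"
  have "fls_nth f (- int k - 1) = 0" if "k \<ge> nat (- fls_subdegree f)" for k
    using that by (intro fls_eq0_below_subdegree) auto
  then show "\<exists>N::nat. \<forall>k\<ge>N. (if - int k - 1 = 0 then 0 else fls_nth f (- int k - 1)) = 0"
    by (intro exI[of _ "nat (- fls_subdegree f)"]) auto
qed

lemma finite_polar_support: "finite {k::nat. hcoeff x (- int k - 1) \<noteq> 0}"
proof -
  obtain N where "\<forall>k\<ge>N. hcoeff x (- int k - 1) = 0"
    using hcoeff_bounded_below by blast
  then have "{k::nat. hcoeff x (- int k - 1) \<noteq> 0} \<subseteq> {..<N}"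
    by (auto simp: not_le[symmetric])
  then show ?thesis by (rule finite_subset) simp
qed

text \<open>The coefficient at \<open>t^{k+1}\<close> is \<open>c k\<close>.\<close>

definition hplus_of :: "(nat \<Rightarrow> complex) \<Rightarrow> hprime" where
  "hplus_of c = abs_hprime (Abs_fls (\<lambda>n. if n \<le> 0 then 0 else c (nat (n - 1))))"

lemma nth_Abs_fls_pos:
  "fls_nth (Abs_fls (\<lambda>n. if n \<le> 0 then 0 else c (nat (n - 1)))) n = (if n \<le> 0 then 0 else c (nat (n - 1)))"
  by (rule nth_Abs_fls_lower_bound[of 0]) auto

lemma hcoeff_hplus_of: "hcoeff (hplus_of c) n = (if n \<le> 0 then 0 else c (nat (n - 1)))"
  by (simp add: hplus_of_def hcoeff_abs nth_Abs_fls_pos)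

lemma hplus_of_in_Hplus: "hplus_of c \<in> Hplus"
  unfolding hplus_of_def Hplus_def by (rule imageI) (simp add: nth_Abs_fls_pos)

lemma Hplus_iff: "x \<in> Hplus \<longleftrightarrow> (\<forall>n<0. hcoeff x n = 0)"
proof
  assume "x \<in> Hplus"
  then show "\<forall>n<0. hcoeff x n = 0"
    by (auto simp: Hplus_def hcoeff_abs)
next
  assume *: "\<forall>n<0. hcoeff x n = 0"
  have "x = hplus_of (\<lambda>k. hcoeff x (int k + 1))"
  proof (rule hprime_eqI)
    fix n show "hcoeff x n = hcoeff (hplus_of (\<lambda>k. hcoeff x (int k + 1))) n"
      using * by (cases "n = 0") (auto simp: hcoeff_hplus_of)
  qed
  then show "x \<in> Hplus" using hplus_of_in_Hplus by metis
qed

lemma Hplus_iff_nat: "x \<in> Hplus \<longleftrightarrow> (\<forall>k::nat. hcoeff x (- int k - 1) = 0)"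
proof -
  have "(\<forall>n<0. hcoeff x n = 0) \<longleftrightarrow> (\<forall>k::nat. hcoeff x (- int k - 1) = 0)" (is "?L = ?R")
  proof
    assume ?R
    show ?L
    proof (intro allI impI)
      fix n :: int assume "n < 0"
      then have "n = - int (nat (- n - 1)) - 1" by auto
      then show "hcoeff x n = 0" using \<open>?R\<close> by metis
    qed
  qed auto
  then show ?thesis by (simp add: Hplus_iff)
qed

lemma Hplus_subspace: "hp.subspace Hplus"
  by (auto simp: hp.subspace_def Hplus_iff)

lemma hform_add_left: "hform (x + y) z = hform x z + hform y z"
  by transfer (simp only: lie_def distrib_right fls_residue_add minus_add_distrib)

lemma hform_add_right: "hform z (x + y) = hform z x + hform z y"
  by transfer (simp only: lie_def fls_deriv_add distrib_left fls_residue_add minus_add_distrib)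

lemma hform_scale_left: "hform (hscale c x) z = c * hform x z"
  by transfer (simp only: lie_def mult.assoc fls_residue_fls_const_times mult_minus_right)

lemma hform_antisym: "hform x y = - hform y x"
proof transfer
  fix x y :: "complex fls"
  show "lie x y = - lie y x"
    by (simp only: lie_def mult.commute[of x "fls_deriv y"] fls_residue_times_deriv)
qed

lemma hform_scale_right: "hform x (hscale c z) = c * hform x z"
  using hform_antisym[of x "hscale c z"] hform_antisym[of x z] by (simp add: hform_scale_left)

lemma hform_0_left [simp]: "hform 0 x = 0" and hform_0_right [simp]: "hform x 0 = 0"
  using hform_scale_left[of 0 0 x] hform_scale_right[of x 0 0] by simp_all

lemma hform_uminus_left: "hform (- x) y = - hform x y"
  and hform_uminus_right: "hform x (- y) = - hform x y"
  using hform_scale_left[of "- 1" x y] hform_scale_right[of x "- 1" y] by simp_all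

lemma hform_diff_left: "hform (x - y) z = hform x z - hform y z"
  and hform_diff_right: "hform z (x - y) = hform z x - hform z y"
  unfolding minus_hprime_def hform_add_left hform_add_right hform_uminus_left hform_uminus_right by simp_all

lemma hform_sum_left: "hform (sum f A) y = (\<Sum>a\<in>A. hform (f a) y)"
  by (induction A rule: infinite_finite_induct) (auto simp: hform_add_left)

lemma hform_sum_right: "hform y (sum f A) = (\<Sum>a\<in>A. hform y (f a))"
  by (induction A rule: infinite_finite_induct) (auto simp: hform_add_right)

lemmas hform_simps = hform_add_left hform_add_right hform_diff_left hform_diff_right
  hform_scale_left hform_scale_right hform_sum_left hform_sum_right hform_uminus_left hform_uminus_right

lemma hform_hb_left: "hform (hb i) y = of_int i * hcoeff y (- i)"
proof (induction y rule: hprime.abs_induct)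
  fix g :: "complex fls"
  have "lie (fls_X_intpow i) g = of_int i * fls_nth g (- i)"
    unfolding lie_def fls_X_intpow_times_conv_shift fls_residue_def fls_shift_nth fls_deriv_nth by simp
  moreover have "hform (hb i) (abs_hprime g) = lie (fls_X_intpow i) g"
    unfolding hb_def by (rule hform.abs_eq)
  moreover have "of_int i * hcoeff (abs_hprime g) (- i) = of_int i * fls_nth g (- i)"
    unfolding hcoeff_abs by (cases "i = 0") auto
  ultimately show "hform (hb i) (abs_hprime g) = of_int i * hcoeff (abs_hprime g) (- i)" by metis
qed

lemma hform_hb_right: "hform y (hb i) = - of_int i * hcoeff y (- i)"
  by (subst hform_antisym) (simp add: hform_hb_left)

lemma hform_Hplus: "x \<in> Hplus \<Longrightarrow> y \<in> Hplus \<Longrightarrow> hform x y = 0"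
proof -
  assume "x \<in> Hplus" "y \<in> Hplus"
  then obtain f g where f: "x = abs_hprime f" "\<forall>n\<le>0. fls_nth f n = 0" and g: "y = abs_hprime g" "\<forall>n\<le>0. fls_nth g n = 0"
    by (auto simp: Hplus_def)
  obtain F where F: "F = fls_regpart f" by blast
  obtain G where G: "G = fls_regpart g" by blast
  have FG: "f = fps_to_fls F" "g = fps_to_fls G"
    using f(2) g(2) unfolding F G by (auto intro!: fls_eqI)
  have "f * fls_deriv g = fps_to_fls (F * fps_deriv G)"
    unfolding FG by (simp add: fls_deriv_fps_to_fls fls_times_fps_to_fls)
  then have "fls_residue (f * fls_deriv g) = 0" by simp
  then show ?thesis using f(1) g(1) by (simp add: hform.abs_eq lie_def del: fls_residue_def)
qed

text \<open>Modulo \<open>H'\<^sub>+\<close>, a Laurent series is the finite sum of its polar terms.\<close>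

lemma polar_decomposition:
  assumes "finite K" "{k::nat. hcoeff x (- int k - 1) \<noteq> 0} \<subseteq> K"
  shows "x - (\<Sum>k\<in>K. hscale (hcoeff x (- int k - 1)) (hb (- int k - 1))) \<in> Hplus"
  unfolding Hplus_iff_nat
proof
  fix j :: nat
  have "(\<Sum>k\<in>K. hcoeff x (- int k - 1) * hcoeff (hb (- int k - 1)) (- int j - 1))
      = (\<Sum>k\<in>K. if k = j then hcoeff x (- int k - 1) else 0)"
    by (intro sum.cong) auto
  also have "\<dots> = hcoeff x (- int j - 1)" using assms by auto
  finally show "hcoeff (x - (\<Sum>k\<in>K. hscale (hcoeff x (- int k - 1)) (hb (- int k - 1)))) (- int j - 1) = 0"
    by simp
qed

lemma hform_Hplus_left:
  assumes "h \<in> Hplus" "finite K" "{k::nat. hcoeff x (- int k - 1) \<noteq> 0} \<subseteq> K"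
  shows "hform h x = (\<Sum>k\<in>K. of_nat (k + 1) * hcoeff h (int k + 1) * hcoeff x (- int k - 1))"
proof -
  have "hform h (x - (\<Sum>k\<in>K. hscale (hcoeff x (- int k - 1)) (hb (- int k - 1)))) = 0"
    using assms by (intro hform_Hplus polar_decomposition)
  then have "hform h x = (\<Sum>k\<in>K. hcoeff x (- int k - 1) * hform h (hb (- int k - 1)))"
    by (simp add: hform_simps)
  also have "\<dots> = (\<Sum>k\<in>K. of_nat (k + 1) * hcoeff h (int k + 1) * hcoeff x (- int k - 1))"
    by (intro sum.cong refl) (simp add: hform_hb_right add.commute)
  finally show ?thesis .
qed

text \<open>\<open>H'\<^sub>+\<close> is the full dual of \<open>H' / H'\<^sub>+\<close>: every sequence of values on the \<open>t^{-k-1}\<close> is realized.\<close>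

lemma Hplus_represents:
  fixes c :: "nat \<Rightarrow> complex"
  obtains h where "h \<in> Hplus"
    "\<And>x K. finite K \<Longrightarrow> {k::nat. hcoeff x (- int k - 1) \<noteq> 0} \<subseteq> K \<Longrightarrow>
       hform h x = (\<Sum>k\<in>K. c k * hcoeff x (- int k - 1))"
proof
  let ?h = "hplus_of (\<lambda>k. c k / of_nat (k + 1))"
  show "?h \<in> Hplus" by (rule hplus_of_in_Hplus)
  fix x and K :: "nat set" assume "finite K" "{k::nat. hcoeff x (- int k - 1) \<noteq> 0} \<subseteq> K"
  then have "hform ?h x = (\<Sum>k\<in>K. of_nat (k + 1) * hcoeff ?h (int k + 1) * hcoeff x (- int k - 1))"
    by (intro hform_Hplus_left hplus_of_in_Hplus)
  also have "\<dots> = (\<Sum>k\<in>K. c k * hcoeff x (- int k - 1))"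
    by (intro sum.cong refl) (simp add: hcoeff_hplus_of del: of_nat_Suc)
  finally show "hform ?h x = (\<Sum>k\<in>K. c k * hcoeff x (- int k - 1))" .
qed

section \<open>Lagrangian complements of \<open>H'\<^sub>+\<close>\<close>

definition lagrangian_complement :: "hprime set \<Rightarrow> bool" where
  "lagrangian_complement Z \<longleftrightarrow> lagrangian Z \<and> Z \<inter> Hplus = {0}"

lemma lagrangian_complement_subspace: "lagrangian_complement Z \<Longrightarrow> hp.subspace Z"
  and lagrangian_complement_perp: "lagrangian_complement Z \<Longrightarrow> perp Z = Z"
  and lagrangian_complement_Int: "lagrangian_complement Z \<Longrightarrow> z \<in> Z \<Longrightarrow> z \<in> Hplus \<Longrightarrow> z = 0"
  unfolding lagrangian_complement_def lagrangian_def by blast+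

lemma lagrangian_complement_isotropic:
  "lagrangian_complement Z \<Longrightarrow> x \<in> Z \<Longrightarrow> y \<in> Z \<Longrightarrow> hform x y = 0"
  using lagrangian_complement_perp unfolding perp_def by blast

text \<open>A basis of \<open>W\<close> together with \<open>x\<close> is independent, and functionals can be prescribed on it.\<close>

lemma exists_functional_vanishing_on:
  assumes W: "hp.subspace W" and x: "x \<notin> W"
  obtains f :: "hprime \<Rightarrow> complex" where "Vector_Spaces.linear hscale (*) f" "\<And>w. w \<in> W \<Longrightarrow> f w = 0" "f x = 1"
proof -
  interpret vp: vector_space_pair hscale "(*) :: complex \<Rightarrow> complex \<Rightarrow> complex"
    by unfold_locales (auto simp: algebra_simps)
  obtain B where B: "B \<subseteq> W" "hp.independent B" "W \<subseteq> hp.span B"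
    using hp.maximal_independent_subset[of W] by blast
  have span: "hp.span B = W"
    using B W hp.span_minimal by blast
  then have "hp.independent (insert x B)"
    using B x by (intro hp.independent_insertI) auto
  then obtain f where f: "Vector_Spaces.linear hscale (*) f" "\<forall>b\<in>insert x B. f b = (if b = x then 1 else 0)"
    using vp.linear_independent_extend[of "insert x B" "\<lambda>b. if b = x then 1 else 0"] by blast
  show ?thesis
  proof
    show "Vector_Spaces.linear hscale (*) f" "f x = 1" using f by auto
    fix w assume "w \<in> W"
    moreover have "f b = 0" if "b \<in> B" for b using f(2) that B(1) x by auto
    ultimately show "f w = 0" using vp.linear_eq_0_on_span[OF f(1), of B w] span by auto
  qed
qed

text \<open>A functional that vanishes on \<open>Z + H'\<^sub>+\<close> is represented by an element of \<open>H'\<^sub>+\<close>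
  orthogonal to \<open>Z\<close>, hence by an element of \<open>Z \<inter> H'\<^sub>+ = 0\<close>.\<close>

lemma lagrangian_complement_spans:
  assumes Z: "lagrangian_complement Z"
  shows "\<exists>z\<in>Z. x - z \<in> Hplus"
proof (rule ccontr)
  let ?W = "{z + h |z h. z \<in> Z \<and> h \<in> Hplus}"
  assume neg: "\<not> ?thesis"
  have "hp.subspace ?W"
    using hp.subspace_sums[OF lagrangian_complement_subspace[OF Z] Hplus_subspace] .
  moreover have "x \<notin> ?W" using neg by auto
  ultimately obtain f where f: "Vector_Spaces.linear hscale (*) f" "\<And>w. w \<in> ?W \<Longrightarrow> f w = 0" "f x = 1"
    using exists_functional_vanishing_on by blast
  interpret f: Vector_Spaces.linear hscale "(*)" f by (rule f(1))
  have Z0: "0 \<in> Z" and H0: "0 \<in> Hplus"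
    using hp.subspace_0 lagrangian_complement_subspace[OF Z] Hplus_subspace by blast+
  have fZ: "f z = 0" if "z \<in> Z" for z using f(2)[of z] that H0 by force
  have fH: "f h = 0" if "h \<in> Hplus" for h using f(2)[of h] that Z0 by force
  obtain h where h: "h \<in> Hplus" "\<And>x K. finite K \<Longrightarrow> {k::nat. hcoeff x (- int k - 1) \<noteq> 0} \<subseteq> K \<Longrightarrow>
       hform h x = (\<Sum>k\<in>K. f (hb (- int k - 1)) * hcoeff x (- int k - 1))"
    using Hplus_represents[of "\<lambda>k. f (hb (- int k - 1))"] by blast
  have hf: "hform h y = f y" for y
  proof -
    let ?K = "{k::nat. hcoeff y (- int k - 1) \<noteq> 0}"
    have "f (y - (\<Sum>k\<in>?K. hscale (hcoeff y (- int k - 1)) (hb (- int k - 1)))) = 0"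
      by (intro fH polar_decomposition finite_polar_support order_refl)
    then show ?thesis
      using h(2)[OF finite_polar_support order_refl, of y] by (simp add: f.diff f.sum f.scale mult.commute)
  qed
  have "h \<in> perp Z" using hf fZ by (simp add: perp_def)
  then have "h = 0"
    using lagrangian_complement_Int[OF Z] lagrangian_complement_perp[OF Z] h(1) by blast
  then show False using hf[of x] f(3) by simp
qed

lemma lagrangian_complement_unique:
  assumes Z: "lagrangian_complement Z" and "z \<in> Z" "x - z \<in> Hplus" "z' \<in> Z" "x - z' \<in> Hplus"
  shows "z = z'"
proof -
  have "z - z' \<in> Z" using assms lagrangian_complement_subspace hp.subspace_diff by blast
  moreover have "(x - z') - (x - z) \<in> Hplus"
    using assms Hplus_subspace hp.subspace_diff by blast
  then have "z - z' \<in> Hplus" by simp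
  ultimately have "z - z' = 0" by (rule lagrangian_complement_Int[OF Z])
  then show ?thesis by simp
qed

definition proj_along_Hplus :: "hprime set \<Rightarrow> hprime \<Rightarrow> hprime" where
  "proj_along_Hplus Z x = (THE z. z \<in> Z \<and> x - z \<in> Hplus)"

context
  fixes Z assumes Z: "lagrangian_complement Z"
begin

lemma proj_unique: "z \<in> Z \<Longrightarrow> x - z \<in> Hplus \<Longrightarrow> proj_along_Hplus Z x = z"
  unfolding proj_along_Hplus_def by (rule the_equality) (auto intro: lagrangian_complement_unique[OF Z])

lemma proj_mem: "proj_along_Hplus Z x \<in> Z" and proj_diff: "x - proj_along_Hplus Z x \<in> Hplus"
  using lagrangian_complement_spans[OF Z, of x] proj_unique by auto

lemma proj_diff': "proj_along_Hplus Z x - x \<in> Hplus"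
  using hp.subspace_neg[OF Hplus_subspace proj_diff[of x]] by simp

lemma proj_on: "z \<in> Z \<Longrightarrow> proj_along_Hplus Z z = z"
  by (rule proj_unique) (auto simp: hp.subspace_0[OF Hplus_subspace])

lemma proj_Hplus: "h \<in> Hplus \<Longrightarrow> proj_along_Hplus Z h = 0"
  by (rule proj_unique) (auto simp: hp.subspace_0[OF lagrangian_complement_subspace[OF Z]])

lemma proj_add: "proj_along_Hplus Z (x + y) = proj_along_Hplus Z x + proj_along_Hplus Z y"
proof (rule proj_unique)
  show "proj_along_Hplus Z x + proj_along_Hplus Z y \<in> Z"
    by (intro hp.subspace_add lagrangian_complement_subspace Z proj_mem)
  have "(x - proj_along_Hplus Z x) + (y - proj_along_Hplus Z y) \<in> Hplus"
    by (intro hp.subspace_add Hplus_subspace proj_diff)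
  then show "x + y - (proj_along_Hplus Z x + proj_along_Hplus Z y) \<in> Hplus"
    by (simp add: algebra_simps)
qed

lemma proj_scale: "proj_along_Hplus Z (hscale c x) = hscale c (proj_along_Hplus Z x)"
proof (rule proj_unique)
  show "hscale c (proj_along_Hplus Z x) \<in> Z"
    by (intro hp.subspace_scale lagrangian_complement_subspace Z proj_mem)
  have "hscale c (x - proj_along_Hplus Z x) \<in> Hplus"
    by (intro hp.subspace_scale Hplus_subspace proj_diff)
  then show "hscale c x - hscale c (proj_along_Hplus Z x) \<in> Hplus"
    by (simp add: hp.scale_right_diff_distrib)
qed

lemma proj_linear: "Vector_Spaces.linear hscale hscale (proj_along_Hplus Z)"
  by unfold_locales (rule proj_add, rule proj_scale)

lemma proj_basis_expansion:
  assumes "finite K" "{k::nat. hcoeff x (- int k - 1) \<noteq> 0} \<subseteq> K"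
  shows "proj_along_Hplus Z x
    = (\<Sum>k\<in>K. hscale (hcoeff x (- int k - 1)) (proj_along_Hplus Z (hb (- int k - 1))))"
proof -
  interpret p: Vector_Spaces.linear hscale hscale "proj_along_Hplus Z" by (rule proj_linear)
  have "proj_along_Hplus Z (x - (\<Sum>k\<in>K. hscale (hcoeff x (- int k - 1)) (hb (- int k - 1)))) = 0"
    by (intro proj_Hplus polar_decomposition assms)
  then show ?thesis by (simp add: p.diff p.sum p.scale)
qed

end

lemma zel_eq_proj:
  assumes "lagrangian_complement (Zof a)"
  shows "zel a k = proj_along_Hplus (Zof a) (hb (- int k - 1))"
proof -
  have "z - x \<in> Hplus \<longleftrightarrow> x - z \<in> Hplus" for x z
    using hp.subspace_neg[OF Hplus_subspace, of "x - z"] hp.subspace_neg[OF Hplus_subspace, of "z - x"] by auto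
  then show ?thesis by (simp add: zel_def proj_along_Hplus_def)
qed

text \<open>A linear functional on \<open>Z\<close> is pairing with an element of \<open>H'\<^sub>+\<close>, since \<open>Z \<cong> H' / H'\<^sub>+\<close>.\<close>

lemma functional_represented:
  fixes f :: "hprime \<Rightarrow> complex"
  assumes Z: "lagrangian_complement Z"
    and add: "\<And>x y. x \<in> Z \<Longrightarrow> y \<in> Z \<Longrightarrow> f (x + y) = f x + f y"
    and scale: "\<And>c x. x \<in> Z \<Longrightarrow> f (hscale c x) = c * f x"
  obtains h where "h \<in> Hplus" "\<And>z. z \<in> Z \<Longrightarrow> hform h z = f z"
proof -
  let ?z = "\<lambda>k::nat. proj_along_Hplus Z (hb (- int k - 1))"
  obtain h where h: "h \<in> Hplus" "\<And>x K. finite K \<Longrightarrow> {k::nat. hcoeff x (- int k - 1) \<noteq> 0} \<subseteq> K \<Longrightarrow>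
       hform h x = (\<Sum>k\<in>K. f (?z k) * hcoeff x (- int k - 1))"
    using Hplus_represents[of "\<lambda>k. f (?z k)"] by blast
  note sub = lagrangian_complement_subspace[OF Z]
  have f0: "f 0 = 0" using scale[of 0 0] hp.subspace_0[OF sub] by simp
  have fsum: "f (\<Sum>k\<in>K. hscale (c k) (?z k)) = (\<Sum>k\<in>K. c k * f (?z k))" for K c
  proof (induction K rule: infinite_finite_induct)
    case (insert k K)
    have "(\<Sum>k\<in>K. hscale (c k) (?z k)) \<in> Z"
      by (intro hp.subspace_sum hp.subspace_scale sub proj_mem Z)
    moreover have "hscale (c k) (?z k) \<in> Z" by (intro hp.subspace_scale sub proj_mem Z)
    ultimately show ?case
      using insert by (simp add: add scale proj_mem[OF Z])
  qed (auto simp: f0)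
  have "hform h z = f z" if "z \<in> Z" for z
  proof -
    let ?K = "{k::nat. hcoeff z (- int k - 1) \<noteq> 0}"
    have "f z = f (\<Sum>k\<in>?K. hscale (hcoeff z (- int k - 1)) (?z k))"
      using proj_basis_expansion[OF Z finite_polar_support order_refl, of z] proj_on[OF Z that] by simp
    also have "\<dots> = hform h z"
      unfolding fsum using h(2)[OF finite_polar_support order_refl, of z] by (simp add: mult.commute)
    finally show ?thesis by simp
  qed
  then show ?thesis using that h(1) by blast
qed

text \<open>The difference is orthogonal to \<open>Z = Z\<^sup>\<bottom>\<close>, hence lies in \<open>Z \<inter> H'\<^sub>+ = 0\<close>.\<close>

lemma Hplus_eq_by_pairing:
  assumes Z: "lagrangian_complement Z" and "h \<in> Hplus" "h' \<in> Hplus"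
    and "\<And>z. z \<in> Z \<Longrightarrow> hform h z = hform h' z"
  shows "h = h'"
proof -
  have "h - h' \<in> perp Z" using assms by (auto simp: perp_def hform_simps)
  then have "h - h' = 0"
    using lagrangian_complement_Int[OF Z] lagrangian_complement_perp[OF Z]
      hp.subspace_diff[OF Hplus_subspace] assms(2,3) by blast
  then show ?thesis by simp
qed

section \<open>Extended PPAVs as framed Lagrangian complements\<close>

lemma scaleR_hprime_conv: "r *\<^sub>R (x::hprime) = hscale (complex_of_real r) x"
  by (rule scaleR_hprime_def)

lemma scaleR_vec_conv: "r *\<^sub>R (x::complex^'n) = complex_of_real r *s x"
  unfolding vec_eq_iff vector_scaleR_component vector_smult_component by (simp add: scaleR_conv_of_real)

text \<open>A frame of \<open>Z\<close> is an identification of \<open>Z / ker \<phi>\<close> with \<open>\<complex>\<^sup>g\<close>. Outside \<open>Z\<close> its values are fixed to \<open>0\<close>, so that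
  equality of frames is equality of functions.\<close>

definition framed :: "hprime set \<Rightarrow> (hprime \<Rightarrow> complex^'g) \<Rightarrow> bool" where
  "framed Z \<phi> \<longleftrightarrow> lagrangian_complement Z \<and>
     (\<forall>x\<in>Z. \<forall>y\<in>Z. \<phi> (x + y) = \<phi> x + \<phi> y) \<and>
     (\<forall>c. \<forall>x\<in>Z. \<phi> (hscale c x) = c *s \<phi> x) \<and>
     (\<forall>x. x \<notin> Z \<longrightarrow> \<phi> x = 0) \<and> \<phi> ` Z = UNIV"

lemma framed_complement: "framed Z \<phi> \<Longrightarrow> lagrangian_complement Z"
  by (simp add: framed_def)

lemma framed_add: "framed Z \<phi> \<Longrightarrow> x \<in> Z \<Longrightarrow> y \<in> Z \<Longrightarrow> \<phi> (x + y) = \<phi> x + \<phi> y"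
  by (simp add: framed_def)

lemma framed_scale: "framed Z \<phi> \<Longrightarrow> x \<in> Z \<Longrightarrow> \<phi> (hscale c x) = c *s \<phi> x"
  by (simp add: framed_def)

lemma framed_subspace: "framed Z \<phi> \<Longrightarrow> hp.subspace Z"
  by (blast intro: framed_complement lagrangian_complement_subspace)

lemma framed_0: "framed Z \<phi> \<Longrightarrow> \<phi> 0 = 0"
  using framed_scale[of Z \<phi> 0 0] hp.subspace_0[of Z] framed_subspace[of Z \<phi>] by simp

lemma framed_diff: "framed Z \<phi> \<Longrightarrow> x \<in> Z \<Longrightarrow> y \<in> Z \<Longrightarrow> \<phi> (x - y) = \<phi> x - \<phi> y"
  using framed_add[of Z \<phi> "x - y" y] hp.subspace_diff[of Z x y] framed_subspace[of Z \<phi>] by simp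

lemma framed_sum: "framed Z \<phi> \<Longrightarrow> (\<And>i. i \<in> I \<Longrightarrow> f i \<in> Z) \<Longrightarrow> \<phi> (sum f I) = (\<Sum>i\<in>I. \<phi> (f i))"
proof (induction I rule: infinite_finite_induct)
  case (insert i I)
  have "sum f I \<in> Z" using insert by (intro hp.subspace_sum[OF framed_subspace]) auto
  then show ?case using insert by (simp add: framed_add)
qed (auto simp: framed_0)

lemma framed_onto: "framed Z \<phi> \<Longrightarrow> \<exists>z\<in>Z. \<phi> z = v"
  unfolding framed_def by (metis UNIV_I imageE)

lemma framed_section:
  assumes "framed Z \<phi>"
  shows "\<exists>s. \<forall>v. s v \<in> Z \<and> \<phi> (s v) = v"
  using framed_onto[OF assms] by (intro choice) blast

definition frame_kernel :: "hprime set \<Rightarrow> (hprime \<Rightarrow> complex^'g) \<Rightarrow> hprime set" where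
  "frame_kernel Z \<phi> = {x\<in>Z. \<phi> x = 0}"

lemma frame_kernel_subspace: "framed Z \<phi> \<Longrightarrow> hp.subspace (frame_kernel Z \<phi>)"
  using framed_subspace[of Z \<phi>]
  by (auto simp: hp.subspace_def frame_kernel_def framed_0 framed_add framed_scale)

text \<open>Preimages of the unit vectors span a complement of the kernel.\<close>

lemma frame_kernel_codim:
  fixes \<phi> :: "hprime \<Rightarrow> complex^'g::finite"
  assumes "framed Z \<phi>"
  shows "has_codim (frame_kernel Z \<phi>) Z CARD('g)"
proof -
  note sub = framed_subspace[OF assms]
  obtain s' where s': "\<forall>v. s' v \<in> Z \<and> \<phi> (s' v) = v"
    using framed_section[OF assms] by (rule exE)
  define s where "s j = s' (axis j 1)" for j
  have s: "s j \<in> Z" "\<phi> (s j) = axis j (1::complex)" for j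
    using s' by (simp_all add: s_def)
  have \<phi>sum: "\<phi> (\<Sum>j\<in>UNIV. hscale (c j) (s j)) = (\<chi> j. c j)" for c :: "'g \<Rightarrow> complex"
  proof -
    have "\<phi> (\<Sum>j\<in>UNIV. hscale (c j) (s j)) = (\<Sum>j\<in>UNIV. c j *s axis j 1)"
      using s sub by (subst framed_sum[OF assms]) (auto simp: framed_scale[OF assms] hp.subspace_scale)
    also have "\<dots> = (\<chi> j. c j)"
      using basis_expansion[of "\<chi> j. c j"] by simp
    finally show ?thesis .
  qed
  have inj: "inj s"
  proof (rule injI)
    fix i j assume "s i = s j"
    then have "axis i (1::complex) = axis j 1" using s(2) by metis
    then show "i = j" by (simp add: axis_eq_axis)
  qed
  have span_iff: "x \<in> hp.span (range s) \<longleftrightarrow> (\<exists>c. x = (\<Sum>j\<in>UNIV. hscale (c j) (s j)))" for x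
  proof
    assume "x \<in> hp.span (range s)"
    then obtain u where "x = (\<Sum>v\<in>range s. hscale (u v) v)"
      by (auto simp: hp.span_finite)
    then have "x = (\<Sum>j\<in>UNIV. hscale ((u \<circ> s) j) (s j))"
      by (simp add: sum.reindex[OF inj] o_def)
    then show "\<exists>c. x = (\<Sum>j\<in>UNIV. hscale (c j) (s j))" by blast
  next
    assume "\<exists>c. x = (\<Sum>j\<in>UNIV. hscale (c j) (s j))"
    then show "x \<in> hp.span (range s)"
      by (auto intro!: hp.span_sum hp.span_scale intro: hp.span_base)
  qed
  have "hp.independent (range s)"
  proof (rule hp.independent_if_scalars_zero)
    fix u v assume "(\<Sum>v\<in>range s. hscale (u v) v) = 0" "v \<in> range s"
    then have "(\<Sum>j\<in>UNIV. hscale ((u \<circ> s) j) (s j)) = 0"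
      by (simp add: sum.reindex[OF inj] o_def)
    then have "(\<chi> j. (u \<circ> s) j) = 0" using \<phi>sum[of "u \<circ> s"] framed_0[OF assms] by simp
    then have "u (s j) = 0" for j by (metis o_apply vec_lambda_beta zero_index)
    then show "u v = 0" using \<open>v \<in> range s\<close> by blast
  qed simp
  moreover have "hp.span (range s) \<inter> frame_kernel Z \<phi> = {0}"
  proof -
    have "x = 0" if x: "x \<in> hp.span (range s)" "\<phi> x = 0" for x
    proof -
      obtain c where c: "x = (\<Sum>j\<in>UNIV. hscale (c j) (s j))" using span_iff[THEN iffD1, OF x(1)] by (rule exE)
      then have "(\<chi> j. c j) = 0" using x(2) \<phi>sum[of c] by simp
      then have "c j = 0" for j by (metis vec_lambda_beta zero_index)
      then show ?thesis unfolding c by simp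
    qed
    then show ?thesis
      using hp.span_zero hp.subspace_0[OF frame_kernel_subspace[OF assms]]
      by (auto simp: frame_kernel_def)
  qed
  moreover have "hp.span (range s) + frame_kernel Z \<phi> = Z"
  proof (intro equalityI subsetI)
    fix x assume "x \<in> hp.span (range s) + frame_kernel Z \<phi>"
    then obtain p q where pq: "x = p + q" "p \<in> hp.span (range s)" "q \<in> frame_kernel Z \<phi>"
      by (rule set_plus_elim)
    have "p \<in> Z" using pq(2) hp.span_minimal[of "range s" Z] sub s(1) by blast
    then show "x \<in> Z" using pq hp.subspace_add[OF sub] by (auto simp: frame_kernel_def)
  next
    fix x assume x: "x \<in> Z"
    let ?p = "\<Sum>j\<in>UNIV. hscale (\<phi> x $ j) (s j)"
    have p: "?p \<in> Z" "\<phi> ?p = \<phi> x"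
      using s sub by (auto simp: \<phi>sum intro!: hp.subspace_sum hp.subspace_scale)
    have "x - ?p \<in> frame_kernel Z \<phi>"
      using x p hp.subspace_diff[OF sub] by (simp add: frame_kernel_def framed_diff[OF assms])
    moreover have "?p \<in> hp.span (range s)"
      by (subst span_iff) (rule exI[of _ "\<lambda>j. \<phi> x $ j"], rule refl)
    ultimately have "?p + (x - ?p) \<in> hp.span (range s) + frame_kernel Z \<phi>"
      by (intro set_plus_intro)
    then show "x \<in> hp.span (range s) + frame_kernel Z \<phi>" by simp
  qed
  moreover have "card (range s) = CARD('g)" by (rule card_image[OF inj])
  ultimately show ?thesis
    unfolding has_codim_def using frame_kernel_subspace[OF assms]
    by (auto simp: frame_kernel_def intro!: exI[of _ "range s"])
qed

locale polarized_torus =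
  fixes \<Lambda> :: "(complex^'g::finite) set" and B :: "complex^'g \<Rightarrow> complex^'g \<Rightarrow> complex"
  assumes ppav: "ppav \<Lambda> B"
begin

lemma B_add_right: "B x (y + z) = B x y + B x z"
  and B_scale_right: "B x (c *s y) = c * B x y"
  and B_herm: "B y x = cnj (B x y)"
  and B_pos: "x \<noteq> 0 \<Longrightarrow> Re (B x x) > 0"
  and B_unimodular: "unimodular_mod \<Lambda> {0} (\<lambda>x y. of_real (Im (B x y)))"
  using ppav unfolding ppav_def by blast+

lemma B_add_left: "B (x + y) z = B x z + B y z"
  by (metis B_add_right B_herm complex_cnj_add)

lemma B_scale_left: "B (c *s x) z = cnj c * B x z"
  by (metis B_herm B_scale_right complex_cnj_mult)

lemma B_0_left [simp]: "B 0 z = 0" and B_0_right [simp]: "B z 0 = 0"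
  using B_scale_left[of 0 0 z] B_scale_right[of z 0 0] by simp_all

lemma B_nondegenerate: "(\<And>v. B w v = 0) \<Longrightarrow> w = 0"
  using B_pos[of w] by fastforce

lemma lattice_basis:
  obtains S where "finite S" "card S = 2 * CARD('g)" "independent S" "span S = UNIV"
    "\<Lambda> = {\<Sum>s\<in>S. of_int (m s) *\<^sub>R s |m :: complex^'g \<Rightarrow> int. True}"
proof -
  obtain S where S: "finite S" "card S = 2 * CARD('g)" "independent S"
    "\<Lambda> = {\<Sum>s\<in>S. of_int (m s) *\<^sub>R s |m :: complex^'g \<Rightarrow> int. True}"
    using ppav unfolding ppav_def by blast
  have "DIM(complex^'g) = 2 * CARD('g)" by simp
  then have "UNIV \<subseteq> span S"
    using S by (intro card_ge_dim_independent) (auto simp: dim_UNIV)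
  then show ?thesis using that S by blast
qed

text \<open>The map \<open>w \<mapsto> B w\<close> to functionals is injective, as \<open>B\<close> is positive definite, and conjugate linear. So it is
  surjective by counting real dimensions.\<close>

lemma riesz:
  fixes f :: "complex^'g \<Rightarrow> complex"
  assumes "\<And>x y. f (x + y) = f x + f y" "\<And>c x. f (c *s x) = c * f x"
  shows "\<exists>w. \<forall>v. f v = B w v"
proof -
  let ?T = "\<lambda>w. (\<chi> j. B w (axis j 1))"
  have expand: "g v = (\<Sum>j\<in>UNIV. v $ j * g (axis j 1))"
    if "\<And>x y. g (x + y) = g x + g y" "\<And>c x. g (c *s x) = c * g x" for g :: "complex^'g \<Rightarrow> complex" and v
  proof -
    have g0: "g 0 = 0" using that(2)[of 0 0] by simp
    have gs: "g (sum h I) = (\<Sum>i\<in>I. g (h i))" for h and I :: "'g set"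
      by (induction I rule: infinite_finite_induct) (auto simp: g0 that(1))
    have "g v = g (\<Sum>j\<in>UNIV. v $ j *s axis j 1)" by (simp only: basis_expansion)
    then show ?thesis by (simp add: gs that(2))
  qed
  have lin: "linear ?T"
  proof (rule linearI)
    show "?T (x + y) = ?T x + ?T y" for x y by (simp add: vec_eq_iff B_add_left)
    show "?T (r *\<^sub>R x) = r *\<^sub>R ?T x" for r x
    proof (rule vec_eq_iff[THEN iffD2], rule allI)
      fix j
      have "?T (r *\<^sub>R x) $ j = B (complex_of_real r *s x) (axis j 1)"
        by (simp only: scaleR_vec_conv vec_lambda_beta)
      also have "\<dots> = r *\<^sub>R B x (axis j 1)"
        by (simp only: B_scale_left complex_cnj_complex_of_real scaleR_conv_of_real)
      finally show "?T (r *\<^sub>R x) $ j = (r *\<^sub>R ?T x) $ j"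
        by (simp only: vector_scaleR_component vec_lambda_beta)
    qed
  qed
  have "inj ?T"
  proof (rule linear_injective_0[OF lin, THEN iffD2], intro allI impI)
    fix w assume "?T w = 0"
    then have "B w (axis j 1) = 0" for j by (auto simp: vec_eq_iff)
    then have "B w v = 0" for v
      using expand[of "B w" v] by (simp add: B_add_right B_scale_right)
    then show "w = 0" by (rule B_nondegenerate)
  qed
  then have "surj ?T" by (rule linear_inj_imp_surj[OF lin])
  obtain w where w: "(\<chi> j. f (axis j 1)) = ?T w"
    using surjD[OF \<open>surj ?T\<close>, of "\<chi> j. f (axis j 1)"] by (rule exE)
  have "f v = B w v" for v
  proof -
    have "B w (axis j 1) = f (axis j 1)" for j
      using arg_cong[OF w, of "\<lambda>u. u $ j"] by simp
    then show ?thesis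
      using expand[of f v] expand[of "B w" v] assms by (simp add: B_add_right B_scale_right)
  qed
  then show ?thesis by blast
qed

text \<open>The element of \<open>H'\<^sub>+\<close> that represents the functional \<open>\<pi> B w \<circ> \<phi>\<close> on \<open>Z\<close>. For \<open>w = \<phi> z\<close> this has to be the
  conjugate of \<open>z\<close> modulo \<open>F\<close>, because the Hermitian form \<open>B\<close> is \<open>1 / \<pi>\<close> times the pairing with the
  conjugate.\<close>

definition conj_plus :: "hprime set \<Rightarrow> (hprime \<Rightarrow> complex^'g) \<Rightarrow> complex^'g \<Rightarrow> hprime" where
  "conj_plus Z \<phi> w = (SOME h. h \<in> Hplus \<and> (\<forall>z\<in>Z. hform h z = of_real pi * B w (\<phi> z)))"

context
  fixes Z \<phi> assumes fr: "framed Z (\<phi> :: hprime \<Rightarrow> complex^'g)"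
begin

lemma conj_plus: "conj_plus Z \<phi> w \<in> Hplus \<and> (\<forall>z\<in>Z. hform (conj_plus Z \<phi> w) z = of_real pi * B w (\<phi> z))"
  unfolding conj_plus_def
proof (rule someI_ex)
  show "\<exists>h. h \<in> Hplus \<and> (\<forall>z\<in>Z. hform h z = of_real pi * B w (\<phi> z))"
  proof (rule functional_represented[OF framed_complement[OF fr], where f = "\<lambda>z. of_real pi * B w (\<phi> z)"])
    show "of_real pi * B w (\<phi> (x + y)) = of_real pi * B w (\<phi> x) + of_real pi * B w (\<phi> y)"
      if "x \<in> Z" "y \<in> Z" for x y
      by (simp only: framed_add[OF fr that] B_add_right distrib_left)
    show "of_real pi * B w (\<phi> (hscale c x)) = c * (of_real pi * B w (\<phi> x))" if "x \<in> Z" for c x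
      by (simp only: framed_scale[OF fr that] B_scale_right mult.left_commute)
  qed blast
qed

lemma conj_plus_Hplus: "conj_plus Z \<phi> w \<in> Hplus"
  and conj_plus_pairing: "z \<in> Z \<Longrightarrow> hform (conj_plus Z \<phi> w) z = of_real pi * B w (\<phi> z)"
  using conj_plus by blast+

lemma conj_plus_unique:
  "h \<in> Hplus \<Longrightarrow> (\<And>z. z \<in> Z \<Longrightarrow> hform h z = of_real pi * B w (\<phi> z)) \<Longrightarrow> h = conj_plus Z \<phi> w"
  by (rule Hplus_eq_by_pairing[OF framed_complement[OF fr]]) (auto simp: conj_plus_Hplus conj_plus_pairing)

lemma conj_plus_add: "conj_plus Z \<phi> (v + w) = conj_plus Z \<phi> v + conj_plus Z \<phi> w"
  by (rule conj_plus_unique[symmetric])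
     (auto simp: hform_simps conj_plus_pairing B_add_left algebra_simps
           intro: hp.subspace_add[OF Hplus_subspace] conj_plus_Hplus)

lemma conj_plus_scale: "conj_plus Z \<phi> (c *s w) = hscale (cnj c) (conj_plus Z \<phi> w)"
  by (rule conj_plus_unique[symmetric])
     (auto simp: hform_simps conj_plus_pairing B_scale_left
           intro: hp.subspace_scale[OF Hplus_subspace] conj_plus_Hplus)

lemma conj_plus_0: "conj_plus Z \<phi> 0 = 0"
  using conj_plus_scale[of 0 0] by simp

lemma conj_plus_eq_0: "conj_plus Z \<phi> w = 0 \<Longrightarrow> w = 0"
proof (rule B_nondegenerate)
  fix v assume "conj_plus Z \<phi> w = 0"
  moreover obtain z where "z \<in> Z" "\<phi> z = v" using framed_onto[OF fr] by blast
  ultimately show "B w v = 0" using conj_plus_pairing[of z w] by simp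
qed

lemma Z_subset_perp: "z \<in> Z \<Longrightarrow> z \<in> perp (frame_kernel Z \<phi>)"
  using lagrangian_complement_isotropic[OF framed_complement[OF fr]]
  by (auto simp: perp_def frame_kernel_def)

text \<open>An element of \<open>H'\<^sub>+\<close> orthogonal to \<open>F\<close> induces a functional on \<open>Z / F = \<complex>\<^sup>g\<close>, which \<open>B\<close> represents.\<close>

lemma perp_kernel_Hplus: "perp (frame_kernel Z \<phi>) \<inter> Hplus = range (conj_plus Z \<phi>)"
proof (intro equalityI subsetI)
  fix h assume "h \<in> range (conj_plus Z \<phi>)"
  then obtain w where w: "h = conj_plus Z \<phi> w" by blast
  have "hform h x = 0" if "x \<in> frame_kernel Z \<phi>" for x
    using that conj_plus_pairing[of x w] by (simp add: w frame_kernel_def)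
  moreover have "h \<in> Hplus" unfolding w by (rule conj_plus_Hplus)
  ultimately show "h \<in> perp (frame_kernel Z \<phi>) \<inter> Hplus"
    unfolding perp_def by blast
next
  fix h assume h: "h \<in> perp (frame_kernel Z \<phi>) \<inter> Hplus"
  obtain s where "\<forall>v. s v \<in> Z \<and> \<phi> (s v) = v"
    using framed_section[OF fr] by (rule exE)
  then have s: "s v \<in> Z" "\<phi> (s v) = v" for v by simp_all
  have eq: "hform h z = hform h z'" if "z \<in> Z" "z' \<in> Z" "\<phi> z = \<phi> z'" for z z'
  proof -
    have "z - z' \<in> frame_kernel Z \<phi>"
      using that hp.subspace_diff[OF framed_subspace[OF fr]] by (simp add: frame_kernel_def framed_diff[OF fr])
    then have "hform h (z - z') = 0" using h unfolding perp_def by blast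
    then show ?thesis by (simp only: hform_diff_right right_minus_eq)
  qed
  note sub = framed_subspace[OF fr]
  have "\<exists>w. \<forall>v. hform h (s v) / of_real pi = B w v"
  proof (rule riesz[where f = "\<lambda>v. hform h (s v) / of_real pi"])
    fix x y
    have "hform h (s (x + y)) = hform h (s x + s y)"
      using s(1) by (intro eq hp.subspace_add[OF sub]) (simp_all only: framed_add[OF fr] s(2))
    then show "hform h (s (x + y)) / of_real pi = hform h (s x) / of_real pi + hform h (s y) / of_real pi"
      by (simp only: hform_add_right add_divide_distrib)
  next
    fix c x
    have "hform h (s (c *s x)) = hform h (hscale c (s x))"
      using s(1) by (intro eq hp.subspace_scale[OF sub]) (simp_all only: framed_scale[OF fr] s(2))
    then show "hform h (s (c *s x)) / of_real pi = c * (hform h (s x) / of_real pi)"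
      by (simp only: hform_scale_right times_divide_eq_right)
  qed
  then obtain w where w: "\<And>v. hform h (s v) / of_real pi = B w v" by blast
  have "h = conj_plus Z \<phi> w"
  proof (rule conj_plus_unique)
    fix z assume "z \<in> Z"
    then have "hform h z = hform h (s (\<phi> z))" using s by (intro eq) simp_all
    also have "\<dots> = of_real pi * B w (\<phi> z)" unfolding w[symmetric] by simp
    finally show "hform h z = of_real pi * B w (\<phi> z)" .
  qed (use h in blast)
  then show "h \<in> range (conj_plus Z \<phi>)" by blast
qed

end

end

context polarized_torus
begin

text \<open>A real point is \<open>z\<close> plus its conjugate, so the lattice consists of the sums \<open>z + conj z\<close> with \<open>\<phi> z\<close> a
  period; adding an element of \<open>F\<close> to \<open>z\<close> leaves \<open>\<phi> z\<close> unchanged, hence this is a full preimage.\<close>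

definition standard_point :: "hprime set \<Rightarrow> (hprime \<Rightarrow> complex^'g) \<Rightarrow> 'g extpt" where
  "standard_point Z \<phi> = \<lparr> Zof = Z, Fof = frame_kernel Z \<phi>,
     Lof = {z + conj_plus Z \<phi> (\<phi> z) |z. z \<in> Z \<and> \<phi> z \<in> \<Lambda>}, frame = \<phi> \<rparr>"

context
  fixes Z \<phi> assumes fr: "framed Z (\<phi> :: hprime \<Rightarrow> complex^'g)"
begin

abbreviation (input) "real_point z \<equiv> z + conj_plus Z \<phi> (\<phi> z)"
abbreviation (input) "lattice_preimage \<equiv> {real_point z |z. z \<in> Z \<and> \<phi> z \<in> \<Lambda>}"

lemma sub_Z: "hp.subspace Z" and sub_F: "hp.subspace (frame_kernel Z \<phi>)"
  by (rule framed_subspace[OF fr], rule frame_kernel_subspace[OF fr])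

lemma real_point_add: "x \<in> Z \<Longrightarrow> y \<in> Z \<Longrightarrow> real_point (x + y) = real_point x + real_point y"
  by (simp add: framed_add[OF fr] conj_plus_add[OF fr])

lemma real_point_scale: "x \<in> Z \<Longrightarrow> real_point (r *\<^sub>R x) = r *\<^sub>R real_point x"
  by (simp add: scaleR_hprime_conv framed_scale[OF fr] conj_plus_scale[OF fr] hp.scale_right_distrib)

lemma real_point_kernel: "x \<in> frame_kernel Z \<phi> \<Longrightarrow> real_point x = x"
  by (simp add: frame_kernel_def conj_plus_0[OF fr])

lemma scaleR_Z: "x \<in> Z \<Longrightarrow> r *\<^sub>R x \<in> Z"
  unfolding scaleR_hprime_conv by (rule hp.subspace_scale[OF sub_Z])

lemma real_point_sum:
  "(\<And>i. i \<in> I \<Longrightarrow> f i \<in> Z) \<Longrightarrow> real_point (\<Sum>i\<in>I. c i *\<^sub>R f i) = (\<Sum>i\<in>I. c i *\<^sub>R real_point (f i))"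
proof (induction I rule: infinite_finite_induct)
  case (insert i I)
  have "(\<Sum>i\<in>I. c i *\<^sub>R f i) \<in> Z"
    using insert.prems by (intro hp.subspace_sum[OF sub_Z] scaleR_Z) simp
  moreover have "c i *\<^sub>R f i \<in> Z" using insert.prems by (intro scaleR_Z) simp
  ultimately have "real_point (c i *\<^sub>R f i + (\<Sum>i\<in>I. c i *\<^sub>R f i))
      = real_point (c i *\<^sub>R f i) + real_point (\<Sum>i\<in>I. c i *\<^sub>R f i)"
    by (intro real_point_add)
  moreover have "real_point (c i *\<^sub>R f i) = c i *\<^sub>R real_point (f i)"
    using insert.prems by (intro real_point_scale) simp
  moreover have "real_point (\<Sum>i\<in>I. c i *\<^sub>R f i) = (\<Sum>i\<in>I. c i *\<^sub>R real_point (f i))"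
    using insert.prems by (intro insert.IH) simp
  ultimately show ?case using insert.hyps by simp
qed (simp_all add: framed_0[OF fr] conj_plus_0[OF fr])

lemma complement_decomposition_unique:
  assumes "z \<in> Z" "z' \<in> Z" "h \<in> Hplus" "h' \<in> Hplus" "z + h = z' + h'"
  shows "z = z' \<and> h = h'"
proof -
  have "z - z' \<in> Z" using assms by (intro hp.subspace_diff[OF sub_Z])
  moreover have "h' - h \<in> Hplus" using assms by (intro hp.subspace_diff[OF Hplus_subspace])
  moreover have "z - z' = h' - h" using assms(5) by (simp add: algebra_simps)
  ultimately have "z - z' = 0"
    using lagrangian_complement_Int[OF framed_complement[OF fr], of "z - z'"] by metis
  then show ?thesis using assms(5) by simp
qed

lemma real_point_eq_0: "z \<in> Z \<Longrightarrow> real_point z \<in> Z \<Longrightarrow> \<phi> z = 0"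
proof -
  assume z: "z \<in> Z" "real_point z \<in> Z"
  then have "real_point z - z \<in> Z" by (intro hp.subspace_diff[OF sub_Z])
  then have "conj_plus Z \<phi> (\<phi> z) \<in> Z" by simp
  then have "conj_plus Z \<phi> (\<phi> z) = 0"
    using lagrangian_complement_Int[OF framed_complement[OF fr]] conj_plus_Hplus[OF fr] by blast
  then show ?thesis by (rule conj_plus_eq_0[OF fr])
qed

lemma real_point_perp: "z \<in> Z \<Longrightarrow> real_point z \<in> perp (frame_kernel Z \<phi>)"
proof -
  assume "z \<in> Z"
  then have "z \<in> perp (frame_kernel Z \<phi>)" by (rule Z_subset_perp[OF fr])
  moreover have "conj_plus Z \<phi> (\<phi> z) \<in> perp (frame_kernel Z \<phi>)" using perp_kernel_Hplus[OF fr] by blast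
  ultimately show ?thesis by (simp add: perp_def hform_add_left)
qed

text \<open>A section of \<open>\<phi>\<close> lifts a basis of \<open>\<Lambda>\<close> to a basis of the lattice modulo \<open>F\<close>. As the basis of \<open>\<Lambda>\<close> is also a real
  basis of \<open>\<complex>\<^sup>g\<close>, real combinations of the lifts reach all real points.\<close>

lemma lifted_lattice_basis:
  obtains S s where "finite S" "card S = 2 * CARD('g)" "independent S"
    "\<forall>v. s v \<in> Z" "\<forall>v. \<phi> (s v) = v"
    "lattice_preimage = {(\<Sum>v\<in>S. of_int (m v) *\<^sub>R real_point (s v)) + f |m f. f \<in> frame_kernel Z \<phi>}"
    "\<forall>z\<in>Z. \<exists>c. \<exists>f\<in>frame_kernel Z \<phi>. real_point z = (\<Sum>v\<in>S. c v *\<^sub>R real_point (s v)) + f"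
proof -
  obtain S where S: "finite S" "card S = 2 * CARD('g)" "independent S" "span S = UNIV"
    "\<Lambda> = {\<Sum>s\<in>S. of_int (m s) *\<^sub>R s |m :: complex^'g \<Rightarrow> int. True}"
    using lattice_basis by blast
  obtain s where "\<forall>v. s v \<in> Z \<and> \<phi> (s v) = v"
    using framed_section[OF fr] by (rule exE)
  then have s: "s v \<in> Z" "\<phi> (s v) = v" for v by simp_all
  have sumZ: "(\<Sum>v\<in>S. c v *\<^sub>R s v) \<in> Z" for c :: "complex^'g \<Rightarrow> real"
    by (intro hp.subspace_sum[OF sub_Z] scaleR_Z s)
  have \<phi>sum: "\<phi> (\<Sum>v\<in>S. c v *\<^sub>R s v) = (\<Sum>v\<in>S. c v *\<^sub>R v)" for c :: "complex^'g \<Rightarrow> real"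
  proof -
    have "\<phi> (\<Sum>v\<in>S. c v *\<^sub>R s v) = (\<Sum>v\<in>S. \<phi> (c v *\<^sub>R s v))"
      by (rule framed_sum[OF fr scaleR_Z[OF s(1)]])
    also have "\<dots> = (\<Sum>v\<in>S. c v *\<^sub>R v)"
      by (intro sum.cong refl) (simp only: scaleR_hprime_conv framed_scale[OF fr s(1)] s(2) scaleR_vec_conv)
    finally show ?thesis .
  qed
  have lift: "\<exists>f\<in>frame_kernel Z \<phi>. real_point z = (\<Sum>v\<in>S. c v *\<^sub>R real_point (s v)) + f"
    if z: "z \<in> Z" "\<phi> z = (\<Sum>v\<in>S. c v *\<^sub>R v)" for z and c :: "complex^'g \<Rightarrow> real"
  proof
    let ?f = "z - (\<Sum>v\<in>S. c v *\<^sub>R s v)"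
    show f: "?f \<in> frame_kernel Z \<phi>"
      unfolding frame_kernel_def using z sumZ[of c] \<phi>sum[of c]
      by (simp add: hp.subspace_diff[OF sub_Z] framed_diff[OF fr])
    have "real_point ((\<Sum>v\<in>S. c v *\<^sub>R s v) + ?f) = real_point (\<Sum>v\<in>S. c v *\<^sub>R s v) + real_point ?f"
      using f by (intro real_point_add sumZ) (simp add: frame_kernel_def)
    moreover have "real_point (\<Sum>v\<in>S. c v *\<^sub>R s v) = (\<Sum>v\<in>S. c v *\<^sub>R real_point (s v))"
      by (rule real_point_sum) (rule s)
    moreover have "real_point ?f = ?f" by (rule real_point_kernel[OF f])
    ultimately show "real_point z = (\<Sum>v\<in>S. c v *\<^sub>R real_point (s v)) + ?f"
      by simp
  qed
  have Leq: "lattice_preimage = {(\<Sum>v\<in>S. of_int (m v) *\<^sub>R real_point (s v)) + f |m f. f \<in> frame_kernel Z \<phi>}" (is "_ = ?R")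
  proof (intro equalityI subsetI)
    fix x assume "x \<in> lattice_preimage"
    then obtain z where z: "x = real_point z" "z \<in> Z" "\<phi> z \<in> \<Lambda>" by blast
    then obtain m :: "complex^'g \<Rightarrow> int" where m: "\<phi> z = (\<Sum>v\<in>S. of_int (m v) *\<^sub>R v)"
      unfolding S(5) by blast
    show "x \<in> ?R" using lift[OF z(2) m] z(1) by blast
  next
    fix x assume "x \<in> ?R"
    then obtain m f where mf: "x = (\<Sum>v\<in>S. of_int (m v) *\<^sub>R real_point (s v)) + f" "f \<in> frame_kernel Z \<phi>" by blast
    let ?p = "\<Sum>v\<in>S. real_of_int (m v) *\<^sub>R s v"
    have fZ: "f \<in> Z" "\<phi> f = 0" using mf(2) by (auto simp: frame_kernel_def)
    have "real_point (?p + f) = real_point ?p + real_point f"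
      by (intro real_point_add sumZ fZ)
    moreover have "real_point ?p = (\<Sum>v\<in>S. real_of_int (m v) *\<^sub>R real_point (s v))"
      by (rule real_point_sum) (rule s)
    ultimately have "x = real_point (?p + f)"
      unfolding mf(1) real_point_kernel[OF mf(2)] by simp
    moreover have "?p + f \<in> Z" by (intro hp.subspace_add[OF sub_Z] sumZ fZ)
    moreover have "\<phi> (?p + f) = (\<Sum>v\<in>S. real_of_int (m v) *\<^sub>R v)"
      using framed_add[OF fr sumZ fZ(1)] fZ(2) \<phi>sum by simp
    then have "\<phi> (?p + f) \<in> \<Lambda>" unfolding S(5) by blast
    ultimately show "x \<in> lattice_preimage" by blast
  qed
  have Rall: "\<forall>z\<in>Z. \<exists>c. \<exists>f\<in>frame_kernel Z \<phi>. real_point z = (\<Sum>v\<in>S. c v *\<^sub>R real_point (s v)) + f"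
  proof
    fix z assume "z \<in> Z"
    have "\<phi> z \<in> span S" using S(4) by simp
    then have "\<exists>u. \<phi> z = (\<Sum>v\<in>S. u v *\<^sub>R v)"
      unfolding span_finite[OF S(1)] by blast
    then obtain u where u: "\<phi> z = (\<Sum>v\<in>S. u v *\<^sub>R v)" by (rule exE)
    show "\<exists>c. \<exists>f\<in>frame_kernel Z \<phi>. real_point z = (\<Sum>v\<in>S. c v *\<^sub>R real_point (s v)) + f" using lift[OF \<open>z \<in> Z\<close> u] by (intro exI[of _ u])
  qed
  have sZ: "\<forall>v. s v \<in> Z" "\<forall>v. \<phi> (s v) = v" using s by simp_all
  show ?thesis by (rule that[OF S(1-3) sZ Leq Rall])
qed

text \<open>Independence over \<open>\<real>\<close> modulo \<open>F\<close>: a real combination in \<open>F\<close> has its component in \<open>H'\<^sub>+\<close> equal to \<open>0\<close>, so the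
  corresponding combination of periods vanishes.\<close>

lemma lattice_mod_L: "lattice_mod (frame_kernel Z \<phi>) lattice_preimage (2 * CARD('g))"
proof -
  obtain S s where S: "finite S" "card S = 2 * CARD('g)" "independent S"
    and s0: "\<forall>v. s v \<in> Z" "\<forall>v. \<phi> (s v) = v"
    and L: "lattice_preimage = {(\<Sum>v\<in>S. of_int (m v) *\<^sub>R real_point (s v)) + f |m f. f \<in> frame_kernel Z \<phi>}"
    and "\<forall>z\<in>Z. \<exists>c. \<exists>f\<in>frame_kernel Z \<phi>. real_point z = (\<Sum>v\<in>S. c v *\<^sub>R real_point (s v)) + f"
    by (rule lifted_lattice_basis)
  have s: "s v \<in> Z" "\<phi> (s v) = v" for v using s0 by simp_all
  obtain e where e: "bij_betw e {..<2 * CARD('g)} S"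
    using S(1,2) ex_bij_betw_nat_finite[of S] by (auto simp: atLeast0LessThan)
  let ?N = "{..<2 * CARD('g)}"
  have reindex: "(\<Sum>j\<in>?N. k (e j)) = (\<Sum>v\<in>S. k v)" for k :: "complex^'g \<Rightarrow> hprime"
    by (rule sum.reindex_bij_betw[OF e])
  let ?l = "\<lambda>j. real_point (s (e j))"
  show ?thesis
    unfolding lattice_mod_def
  proof (intro exI[of _ ?l] conjI allI impI)
    show "?l j \<in> perp (frame_kernel Z \<phi>)" for j by (rule real_point_perp[OF s(1)])
  next
    fix c :: "nat \<Rightarrow> real" and j
    assume c: "(\<Sum>j<2 * CARD('g). c j *\<^sub>R ?l j) \<in> frame_kernel Z \<phi>" and j: "j < 2 * CARD('g)"
    let ?z = "\<Sum>j<2 * CARD('g). c j *\<^sub>R s (e j)"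
    have zZ: "?z \<in> Z" by (intro hp.subspace_sum[OF sub_Z] scaleR_Z s)
    have "real_point ?z = (\<Sum>j<2 * CARD('g). c j *\<^sub>R ?l j)"
      by (rule real_point_sum) (rule s)
    then have "real_point ?z \<in> Z" using c by (simp add: frame_kernel_def)
    then have "\<phi> ?z = 0" by (rule real_point_eq_0[OF zZ])
    moreover have "\<phi> ?z = (\<Sum>j<2 * CARD('g). c j *\<^sub>R e j)"
    proof -
      have "\<phi> ?z = (\<Sum>j<2 * CARD('g). \<phi> (c j *\<^sub>R s (e j)))"
        by (rule framed_sum[OF fr scaleR_Z[OF s(1)]])
      also have "\<dots> = (\<Sum>j<2 * CARD('g). c j *\<^sub>R e j)"
        by (intro sum.cong refl) (simp only: scaleR_hprime_conv framed_scale[OF fr s(1)] s(2) scaleR_vec_conv)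
      finally show ?thesis .
    qed
    moreover have "(\<Sum>j\<in>?N. c j *\<^sub>R e j) = (\<Sum>v\<in>S. c (inv_into ?N e v) *\<^sub>R v)"
      unfolding sum.reindex_bij_betw[OF e, symmetric]
      by (intro sum.cong refl) (simp add: inv_into_f_f[OF bij_betw_imp_inj_on[OF e]])
    ultimately have "(\<Sum>v\<in>S. c (inv_into ?N e v) *\<^sub>R v) = 0" by simp
    moreover have "e j \<in> S" using bij_betwE[OF e] j by simp
    ultimately have "c (inv_into ?N e (e j)) = 0"
      by (rule independentD[OF S(3,1) order_refl, where u = "\<lambda>v. c (inv_into {..<2 * CARD('g)} e v)"])
    then show "c j = 0" using inv_into_f_f[OF bij_betw_imp_inj_on[OF e]] j by simp
  next
    show "lattice_preimage = {(\<Sum>j<2 * CARD('g). of_int (m j) *\<^sub>R ?l j) + f |(m::nat \<Rightarrow> int) f. f \<in> frame_kernel Z \<phi>}" (is "_ = ?R")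
    proof (intro equalityI subsetI)
      fix x assume "x \<in> lattice_preimage"
      then obtain m f where mf: "x = (\<Sum>v\<in>S. of_int (m v) *\<^sub>R real_point (s v)) + f" "f \<in> frame_kernel Z \<phi>"
        unfolding L by blast
      have "x = (\<Sum>j<2 * CARD('g). of_int (m (e j)) *\<^sub>R ?l j) + f"
        unfolding mf(1) using reindex[of "\<lambda>v. of_int (m v) *\<^sub>R real_point (s v)"] by simp
      then show "x \<in> ?R" using mf(2) by (intro CollectI exI[of _ "\<lambda>j. m (e j)"] exI[of _ f]) simp
    next
      fix x assume "x \<in> ?R"
      then obtain m f where mf: "x = (\<Sum>j<2 * CARD('g). of_int (m j) *\<^sub>R ?l j) + f" "f \<in> frame_kernel Z \<phi>" by blast
      let ?m = "\<lambda>v. m (inv_into ?N e v)"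
      have "(\<Sum>v\<in>S. of_int (?m v) *\<^sub>R real_point (s v)) = (\<Sum>j\<in>?N. of_int (m j) *\<^sub>R ?l j)"
        unfolding reindex[symmetric]
        by (intro sum.cong refl) (simp add: inv_into_f_f[OF bij_betw_imp_inj_on[OF e]])
      then have "x = (\<Sum>v\<in>S. of_int (?m v) *\<^sub>R real_point (s v)) + f" using mf(1) by simp
      then show "x \<in> lattice_preimage" unfolding L using mf(2) by (intro CollectI exI[of _ ?m] exI[of _ f] conjI)
    qed
  qed
qed

lemma span_L: "span lattice_preimage = {real_point z |z. z \<in> Z}"
proof (intro equalityI)
  have "subspace {real_point z |z. z \<in> Z}"
    unfolding subspace_def
  proof (intro conjI ballI allI)
    show "0 \<in> {real_point z |z. z \<in> Z}"
      by (intro CollectI exI[of _ 0]) (simp add: framed_0[OF fr] conj_plus_0[OF fr] hp.subspace_0[OF sub_Z])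
  next
    fix x y assume "x \<in> {real_point z |z. z \<in> Z}" "y \<in> {real_point z |z. z \<in> Z}"
    then obtain p q where "x = real_point p" "y = real_point q" "p \<in> Z" "q \<in> Z" by blast
    then show "x + y \<in> {real_point z |z. z \<in> Z}"
      using real_point_add[of p q] hp.subspace_add[OF sub_Z, of p q] by (intro CollectI exI[of _ "p + q"]) simp
  next
    fix c x assume "x \<in> {real_point z |z. z \<in> Z}"
    then obtain p where "x = real_point p" "p \<in> Z" by blast
    then show "c *\<^sub>R x \<in> {real_point z |z. z \<in> Z}"
      using real_point_scale[of p c] scaleR_Z[of p c] by (intro CollectI exI[of _ "c *\<^sub>R p"]) simp
  qed
  then show "span lattice_preimage \<subseteq> {real_point z |z. z \<in> Z}"
    by (intro span_minimal) blast+
next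
  obtain S s where S: "finite S" "card S = 2 * CARD('g)" "independent S"
    and s0: "\<forall>v. s v \<in> Z" "\<forall>v. \<phi> (s v) = v"
    and L: "lattice_preimage = {(\<Sum>v\<in>S. of_int (m v) *\<^sub>R real_point (s v)) + f |m f. f \<in> frame_kernel Z \<phi>}"
    and R: "\<forall>z\<in>Z. \<exists>c. \<exists>f\<in>frame_kernel Z \<phi>. real_point z = (\<Sum>v\<in>S. c v *\<^sub>R real_point (s v)) + f"
    by (rule lifted_lattice_basis)
  have s: "s v \<in> Z" "\<phi> (s v) = v" for v using s0 by simp_all
  have F_span: "f \<in> span lattice_preimage" if "f \<in> frame_kernel Z \<phi>" for f
  proof -
    have "f = (\<Sum>v\<in>S. of_int 0 *\<^sub>R real_point (s v)) + f" by simp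
    then have "f \<in> lattice_preimage" unfolding L using that by (intro CollectI exI[of _ "\<lambda>_. 0"] exI[of _ f]) simp
    then show ?thesis by (rule span_base)
  qed
  have v: "real_point (s v) \<in> span lattice_preimage" if "v \<in> S" for v
  proof (rule span_base, unfold L, intro CollectI exI[of _ "\<lambda>w. if w = v then 1 else 0"] exI[of _ 0] conjI)
    have "(\<Sum>w\<in>S. of_int (if w = v then 1 else 0) *\<^sub>R real_point (s w))
        = (\<Sum>w\<in>S. if w = v then real_point (s w) else 0)"
      by (intro sum.cong) auto
    then show "real_point (s v) = (\<Sum>w\<in>S. of_int (if w = v then 1 else 0) *\<^sub>R real_point (s w)) + 0"
      using S(1) that by simp
    show "0 \<in> frame_kernel Z \<phi>" by (rule hp.subspace_0[OF sub_F])
  qed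
  show "{real_point z |z. z \<in> Z} \<subseteq> span lattice_preimage"
  proof
    fix x assume "x \<in> {real_point z |z. z \<in> Z}"
    then obtain z where z: "x = real_point z" "z \<in> Z" by blast
    obtain c f where cf: "f \<in> frame_kernel Z \<phi>" "real_point z = (\<Sum>v\<in>S. c v *\<^sub>R real_point (s v)) + f"
      using bspec[OF R z(2)] by blast
    show "x \<in> span lattice_preimage" unfolding z(1) cf(2) by (intro span_add span_sum span_scale v F_span cf(1))
  qed
qed

end

end

context polarized_torus
begin

context
  fixes Z \<phi> assumes fr: "framed Z (\<phi> :: hprime \<Rightarrow> complex^'g)"
begin

text \<open>Since \<open>conj_plus\<close> is conjugate linear, \<open>x + \<i> y = u\<close> has the real solution given by \<open>u / 2\<close> and \<open>- \<i> u / 2\<close> in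
  \<open>Z\<close>, and then \<open>x - \<i> y\<close> is \<open>conj_plus\<close> of \<open>\<phi> u\<close>. Conversely, the component in \<open>H'\<^sub>+\<close> of \<open>x + \<i> y\<close>
  vanishes, which forces \<open>\<phi> p = \<i> \<phi> q\<close> for the components \<open>p\<close>, \<open>q\<close> of \<open>x\<close>, \<open>y\<close> in \<open>Z\<close>.\<close>

lemma conj_mod_standard:
  assumes u: "u \<in> Z"
  shows "conj_mod (frame_kernel Z \<phi>) (lattice_preimage Z \<phi>) u w
    \<longleftrightarrow> w - conj_plus Z \<phi> (\<phi> u) \<in> frame_kernel Z \<phi>"
proof
  note sub = sub_Z[OF fr] sub_F[OF fr]
  assume "conj_mod (frame_kernel Z \<phi>) (lattice_preimage Z \<phi>) u w"
  then obtain p q where pq: "p \<in> Z" "q \<in> Z"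
    and u': "u - (real_point Z \<phi> p + hscale \<i> (real_point Z \<phi> q)) \<in> frame_kernel Z \<phi>"
    and w': "w - (real_point Z \<phi> p - hscale \<i> (real_point Z \<phi> q)) \<in> frame_kernel Z \<phi>"
    unfolding conj_mod_def span_L[OF fr] by blast
  let ?h = "conj_plus Z \<phi>"
  have iq: "hscale \<i> q \<in> Z" using pq by (intro hp.subspace_scale[OF sub(1)])
  have hH: "?h (\<phi> p - \<i> *s \<phi> q) = ?h (\<phi> p) + hscale \<i> (?h (\<phi> q))"
  proof -
    have "\<phi> p - \<i> *s \<phi> q = \<phi> p + (- \<i>) *s \<phi> q" by (simp add: vec_eq_iff)
    then show ?thesis by (simp only: conj_plus_add[OF fr] conj_plus_scale[OF fr]) simp
  qed
  have hH': "?h (\<phi> p + \<i> *s \<phi> q) = ?h (\<phi> p) - hscale \<i> (?h (\<phi> q))"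
    by (simp add: conj_plus_add[OF fr] conj_plus_scale[OF fr])
  have u2: "(u - (p + hscale \<i> q)) - ?h (\<phi> p - \<i> *s \<phi> q) \<in> frame_kernel Z \<phi>"
    using u' unfolding hH by (simp add: hp.scale_right_distrib algebra_simps)
  have "(u - (p + hscale \<i> q)) \<in> Z" using u pq iq by (intro hp.subspace_diff hp.subspace_add sub)
  moreover have "(u - (p + hscale \<i> q)) - ?h (\<phi> p - \<i> *s \<phi> q) \<in> Z" using u2 by (simp add: frame_kernel_def)
  ultimately have "(u - (p + hscale \<i> q)) - ((u - (p + hscale \<i> q)) - ?h (\<phi> p - \<i> *s \<phi> q)) \<in> Z"
    by (rule hp.subspace_diff[OF sub(1)])
  then have "?h (\<phi> p - \<i> *s \<phi> q) \<in> Z" by simp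
  then have h0: "?h (\<phi> p - \<i> *s \<phi> q) = 0"
    using lagrangian_complement_Int[OF framed_complement[OF fr]] conj_plus_Hplus[OF fr] by blast
  then have \<phi>p: "\<phi> p = \<i> *s \<phi> q" using conj_plus_eq_0[OF fr] by fastforce
  have uF: "u - (p + hscale \<i> q) \<in> frame_kernel Z \<phi>" using u2 h0 by simp
  then have "\<phi> (u - (p + hscale \<i> q)) = 0" by (simp add: frame_kernel_def)
  then have \<phi>u: "\<phi> u = \<phi> p + \<i> *s \<phi> q"
    using u pq iq hp.subspace_add[OF sub(1) pq(1) iq]
    by (simp add: framed_diff[OF fr] framed_add[OF fr] framed_scale[OF fr])
  have "p - hscale \<i> q \<in> frame_kernel Z \<phi>"
    using pq iq \<phi>p hp.subspace_diff[OF sub(1) pq(1) iq]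
    by (simp add: frame_kernel_def framed_diff[OF fr] framed_scale[OF fr])
  moreover have "(w - ?h (\<phi> u)) - (p - hscale \<i> q) \<in> frame_kernel Z \<phi>"
    using w' unfolding \<phi>u hH' by (simp add: hp.scale_right_distrib algebra_simps)
  ultimately have "(p - hscale \<i> q) + ((w - ?h (\<phi> u)) - (p - hscale \<i> q)) \<in> frame_kernel Z \<phi>"
    by (rule hp.subspace_add[OF sub(2)])
  then show "w - ?h (\<phi> u) \<in> frame_kernel Z \<phi>" by simp
next
  note sub = sub_Z[OF fr] sub_F[OF fr]
  let ?h = "conj_plus Z \<phi>"
  assume w: "w - ?h (\<phi> u) \<in> frame_kernel Z \<phi>"
  let ?p = "hscale (1/2) u" and ?q = "hscale (- \<i> / 2) u"
  have pq: "?p \<in> Z" "?q \<in> Z" using hp.subspace_scale[OF sub(1) u] by blast+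
  have rp: "real_point Z \<phi> ?p = hscale (1/2) u + hscale (1/2) (?h (\<phi> u))"
    using u by (simp add: framed_scale[OF fr] conj_plus_scale[OF fr])
  have rq: "hscale \<i> (real_point Z \<phi> ?q) = hscale (1/2) u - hscale (1/2) (?h (\<phi> u))"
  proof -
    have "\<phi> ?q = (- \<i> / 2) *s \<phi> u" by (rule framed_scale[OF fr u])
    then have "hscale \<i> (real_point Z \<phi> ?q) = hscale (\<i> * (- \<i> / 2)) u + hscale (\<i> * cnj (- \<i> / 2)) (?h (\<phi> u))"
      by (simp only: conj_plus_scale[OF fr] hp.scale_right_distrib hp.scale_scale)
    moreover have "\<i> * (- \<i> / 2) = 1 / 2" "\<i> * cnj (- \<i> / 2) = - (1 / 2)" by simp_all
    ultimately show ?thesis by (simp only: hp.scale_minus_left) simp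
  qed
  have half: "hscale (1/2) x + hscale (1/2) x = x" for x
    by (simp flip: hp.scale_left_distrib)
  have "real_point Z \<phi> ?p + hscale \<i> (real_point Z \<phi> ?q) = u"
    unfolding rp rq using half[of u] by (simp add: algebra_simps)
  moreover have "real_point Z \<phi> ?p - hscale \<i> (real_point Z \<phi> ?q) = ?h (\<phi> u)"
    unfolding rp rq using half[of "?h (\<phi> u)"] by (simp add: algebra_simps)
  ultimately have "u - (real_point Z \<phi> ?p + hscale \<i> (real_point Z \<phi> ?q)) \<in> frame_kernel Z \<phi>"
    "w - (real_point Z \<phi> ?p - hscale \<i> (real_point Z \<phi> ?q)) \<in> frame_kernel Z \<phi>"
    using w hp.subspace_0[OF sub(2)] by simp_all
  then show "conj_mod (frame_kernel Z \<phi>) (lattice_preimage Z \<phi>) u w"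
    unfolding conj_mod_def span_L[OF fr] using pq by blast
qed

lemma hermB_standard:
  assumes "u \<in> Z" "v \<in> Z"
  shows "hermB (frame_kernel Z \<phi>) (lattice_preimage Z \<phi>) u v = B (\<phi> u) (\<phi> v)"
proof -
  let ?w = "SOME w. conj_mod (frame_kernel Z \<phi>) (lattice_preimage Z \<phi>) u w"
  have "conj_mod (frame_kernel Z \<phi>) (lattice_preimage Z \<phi>) u (conj_plus Z \<phi> (\<phi> u))"
    unfolding conj_mod_standard[OF assms(1)] using hp.subspace_0[OF sub_F[OF fr]] by simp
  then have "conj_mod (frame_kernel Z \<phi>) (lattice_preimage Z \<phi>) u ?w" by (rule someI)
  then have "?w - conj_plus Z \<phi> (\<phi> u) \<in> frame_kernel Z \<phi>"
    by (rule conj_mod_standard[OF assms(1), THEN iffD1])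
  then have "?w - conj_plus Z \<phi> (\<phi> u) \<in> Z" unfolding frame_kernel_def by blast
  then have "hform (?w - conj_plus Z \<phi> (\<phi> u)) v = 0"
    using assms(2) by (rule lagrangian_complement_isotropic[OF framed_complement[OF fr]])
  then have "hform ?w v = hform (conj_plus Z \<phi> (\<phi> u)) v"
    unfolding hform_diff_left by simp
  then have "hform ?w v = of_real pi * B (\<phi> u) (\<phi> v)"
    unfolding conj_plus_pairing[OF fr assms(2)] .
  then show ?thesis unfolding hermB_def by simp
qed

text \<open>Both \<open>Z\<close> and \<open>H'\<^sub>+\<close> are isotropic, so only the mixed terms \<open>\<pi> B (\<phi> x) (\<phi> y)\<close> and
  \<open>- \<pi> B (\<phi> y) (\<phi> x)\<close> remain.\<close>

lemma hform_real_points: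
  assumes "x \<in> Z" "y \<in> Z"
  shows "hform (real_point Z \<phi> x) (real_point Z \<phi> y) / (2 * of_real pi * \<i>)
    = of_real (Im (B (\<phi> x) (\<phi> y)))"
proof -
  have "hform (real_point Z \<phi> x) (real_point Z \<phi> y)
      = hform (conj_plus Z \<phi> (\<phi> x)) y + hform x (conj_plus Z \<phi> (\<phi> y))"
    using assms conj_plus_Hplus[OF fr] lagrangian_complement_isotropic[OF framed_complement[OF fr]]
    by (simp add: hform_add_left hform_add_right hform_Hplus)
  also have "\<dots> = of_real pi * (B (\<phi> x) (\<phi> y) - B (\<phi> y) (\<phi> x))"
    unfolding hform_antisym[of x "conj_plus Z \<phi> (\<phi> y)"] conj_plus_pairing[OF fr assms(1)] conj_plus_pairing[OF fr assms(2)]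
    by (simp add: algebra_simps)
  also have "B (\<phi> y) (\<phi> x) = cnj (B (\<phi> x) (\<phi> y))" by (rule B_herm)
  also have "of_real pi * (B (\<phi> x) (\<phi> y) - cnj (B (\<phi> x) (\<phi> y)))
      = (2 * of_real pi * \<i>) * of_real (Im (B (\<phi> x) (\<phi> y)))"
    by (simp add: complex_eq_iff)
  finally show ?thesis by simp
qed

text \<open>The map \<open>\<phi>\<close> identifies the lattice modulo \<open>F\<close> with \<open>\<Lambda>\<close> and the symplectic form with the imaginary part of \<open>B\<close>,
  so unimodularity is inherited from the polarization.\<close>

lemma unimodular_standard:
  "unimodular_mod (lattice_preimage Z \<phi>) (frame_kernel Z \<phi>) (\<lambda>x y. hform x y / (2 * of_real pi * \<i>))"
  unfolding unimodular_mod_def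
proof (intro conjI ballI allI impI)
  fix x y assume "x \<in> lattice_preimage Z \<phi>" "y \<in> lattice_preimage Z \<phi>"
  then obtain p q where "x = real_point Z \<phi> p" "y = real_point Z \<phi> q" "p \<in> Z" "q \<in> Z" "\<phi> p \<in> \<Lambda>" "\<phi> q \<in> \<Lambda>"
    by blast
  then show "hform x y / (2 * of_real pi * \<i>) \<in> \<int>"
    using B_unimodular unfolding unimodular_mod_def by (simp only: hform_real_points)
next
  fix x assume "x \<in> lattice_preimage Z \<phi>"
  then obtain p where p: "x = real_point Z \<phi> p" "p \<in> Z" "\<phi> p \<in> \<Lambda>" by blast
  have "(\<forall>y\<in>lattice_preimage Z \<phi>. hform x y / (2 * of_real pi * \<i>) = 0)
      \<longleftrightarrow> (\<forall>l\<in>\<Lambda>. of_real (Im (B (\<phi> p) l)) = (0::complex))"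
  proof
    assume *: "\<forall>y\<in>lattice_preimage Z \<phi>. hform x y / (2 * of_real pi * \<i>) = 0"
    show "\<forall>l\<in>\<Lambda>. of_real (Im (B (\<phi> p) l)) = (0::complex)"
    proof
      fix l assume l: "l \<in> \<Lambda>"
      obtain q where q: "q \<in> Z" "\<phi> q = l" using framed_onto[OF fr, of l] by blast
      then have "real_point Z \<phi> q \<in> lattice_preimage Z \<phi>" using l by blast
      then have "hform x (real_point Z \<phi> q) / (2 * of_real pi * \<i>) = 0" by (rule bspec[OF *])
      then have "of_real (Im (B (\<phi> p) (\<phi> q))) = (0::complex)"
        unfolding p(1) hform_real_points[OF p(2) q(1)] .
      then show "of_real (Im (B (\<phi> p) l)) = (0::complex)" unfolding q(2) .
    qed
  next
    assume *: "\<forall>l\<in>\<Lambda>. of_real (Im (B (\<phi> p) l)) = (0::complex)"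
    show "\<forall>y\<in>lattice_preimage Z \<phi>. hform x y / (2 * of_real pi * \<i>) = 0"
    proof
      fix y assume "y \<in> lattice_preimage Z \<phi>"
      then obtain q where q: "y = real_point Z \<phi> q" "q \<in> Z" "\<phi> q \<in> \<Lambda>" by blast
      show "hform x y / (2 * of_real pi * \<i>) = 0"
        unfolding p(1) q(1) hform_real_points[OF p(2) q(2)] by (rule bspec[OF * q(3)])
    qed
  qed
  also have "\<dots> \<longleftrightarrow> \<phi> p = 0"
    using B_unimodular p(3) unfolding unimodular_mod_def by blast
  also have "\<dots> \<longleftrightarrow> x \<in> frame_kernel Z \<phi>"
  proof
    assume "\<phi> p = 0"
    then show "x \<in> frame_kernel Z \<phi>"
      using p by (simp add: frame_kernel_def conj_plus_0[OF fr])
  next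
    assume "x \<in> frame_kernel Z \<phi>"
    then show "\<phi> p = 0" using real_point_eq_0[OF fr p(2)] p(1) by (simp add: frame_kernel_def)
  qed
  finally show "(\<forall>y\<in>lattice_preimage Z \<phi>. hform x y / (2 * of_real pi * \<i>) = 0) \<longleftrightarrow> x \<in> frame_kernel Z \<phi>" .
next
  fix \<psi> :: "hprime \<Rightarrow> int"
  assume \<psi>: "(\<forall>x\<in>lattice_preimage Z \<phi>. \<forall>y\<in>lattice_preimage Z \<phi>. \<psi> (x + y) = \<psi> x + \<psi> y) \<and> (\<forall>x\<in>frame_kernel Z \<phi>. \<psi> x = 0)"
  obtain s where "\<forall>v. s v \<in> Z \<and> \<phi> (s v) = v"
    using framed_section[OF fr] by (rule exE)
  then have s: "s v \<in> Z" "\<phi> (s v) = v" for v by simp_all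
  note sub = sub_Z[OF fr] sub_F[OF fr]
  have \<Lambda>add: "k + l \<in> \<Lambda>" if "k \<in> \<Lambda>" "l \<in> \<Lambda>" for k l
  proof -
    obtain S where S: "\<Lambda> = {\<Sum>s\<in>S. of_int (m s) *\<^sub>R s |m :: complex^'g \<Rightarrow> int. True}"
      using lattice_basis by blast
    obtain m n where "k = (\<Sum>s\<in>S. of_int (m s) *\<^sub>R s)" "l = (\<Sum>s\<in>S. of_int (n s) *\<^sub>R s)"
      using \<open>k \<in> \<Lambda>\<close> \<open>l \<in> \<Lambda>\<close> unfolding S by blast
    then have "k + l = (\<Sum>s\<in>S. of_int (m s + n s) *\<^sub>R s)"
      by (simp add: scaleR_left_distrib sum.distrib)
    then show ?thesis unfolding S by (intro CollectI exI[of _ "\<lambda>s. m s + n s"]) simp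
  qed
  have dep: "\<psi> (real_point Z \<phi> x) = \<psi> (real_point Z \<phi> y)" if xy: "x \<in> Z" "y \<in> Z" "\<phi> x = \<phi> y" "\<phi> y \<in> \<Lambda>" for x y
  proof -
    have f: "x - y \<in> frame_kernel Z \<phi>"
      using xy hp.subspace_diff[OF sub(1)] by (simp add: frame_kernel_def framed_diff[OF fr])
    have "0 \<in> \<Lambda>"
    proof -
      obtain S where S: "\<Lambda> = {\<Sum>s\<in>S. of_int (m s) *\<^sub>R s |m :: complex^'g \<Rightarrow> int. True}"
        using lattice_basis by blast
      show ?thesis unfolding S by (intro CollectI exI[of _ "\<lambda>_. 0"]) simp
    qed
    then have "x - y \<in> lattice_preimage Z \<phi>"
      using f by (intro CollectI exI[of _ "x - y"]) (simp add: frame_kernel_def conj_plus_0[OF fr])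
    moreover have "real_point Z \<phi> y \<in> lattice_preimage Z \<phi>" using xy by blast
    ultimately have "\<psi> ((x - y) + real_point Z \<phi> y) = \<psi> (x - y) + \<psi> (real_point Z \<phi> y)"
      using \<psi> by blast
    moreover have "(x - y) + real_point Z \<phi> y = real_point Z \<phi> x" using xy(3) by simp
    moreover have "\<psi> (x - y) = 0" using \<psi> f by blast
    ultimately show ?thesis by simp
  qed
  let ?\<psi> = "\<lambda>l. if l \<in> \<Lambda> then \<psi> (real_point Z \<phi> (s l)) else 0"
  have "\<forall>k\<in>\<Lambda>. \<forall>l\<in>\<Lambda>. ?\<psi> (k + l) = ?\<psi> k + ?\<psi> l"
  proof (intro ballI)
    fix k l assume kl: "k \<in> \<Lambda>" "l \<in> \<Lambda>"
    have "\<psi> (real_point Z \<phi> (s (k + l))) = \<psi> (real_point Z \<phi> (s k + s l))"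
      using \<Lambda>add[OF kl] by (intro dep s hp.subspace_add[OF sub(1)]) (simp_all add: framed_add[OF fr] s)
    also have "real_point Z \<phi> (s k + s l) = real_point Z \<phi> (s k) + real_point Z \<phi> (s l)"
      by (intro real_point_add[OF fr] s)
    also have "\<psi> \<dots> = \<psi> (real_point Z \<phi> (s k)) + \<psi> (real_point Z \<phi> (s l))"
    proof -
      have "real_point Z \<phi> (s j) \<in> lattice_preimage Z \<phi>" if "j \<in> \<Lambda>" for j
        using that s by (intro CollectI exI[of _ "s j"]) simp
      then have "real_point Z \<phi> (s k) \<in> lattice_preimage Z \<phi>" "real_point Z \<phi> (s l) \<in> lattice_preimage Z \<phi>"
        using kl by blast+
      then show ?thesis using \<psi> by blast
    qed
    finally show "?\<psi> (k + l) = ?\<psi> k + ?\<psi> l" using kl \<Lambda>add by simp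
  qed
  moreover have "?\<psi> 0 = 0"
  proof (cases "0 \<in> \<Lambda>")
    case True
    have "s 0 \<in> frame_kernel Z \<phi>" using s by (simp add: frame_kernel_def)
    then have "\<psi> (real_point Z \<phi> (s 0)) = 0"
      using \<psi> real_point_kernel[OF fr] by simp
    then show ?thesis by simp
  qed simp
  ultimately have "\<exists>x\<in>\<Lambda>. \<forall>y\<in>\<Lambda>. of_real (Im (B x y)) = (of_int (?\<psi> y) :: complex)"
    by (intro spec[OF conjunct2[OF conjunct2[OF B_unimodular[unfolded unimodular_mod_def]]], THEN mp, of ?\<psi>] conjI)
       simp_all
  then obtain k where k: "k \<in> \<Lambda>" "\<forall>l\<in>\<Lambda>. of_real (Im (B k l)) = (of_int (?\<psi> l) :: complex)" by blast
  show "\<exists>x\<in>lattice_preimage Z \<phi>. \<forall>y\<in>lattice_preimage Z \<phi>. hform x y / (2 * of_real pi * \<i>) = of_int (\<psi> y)"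
  proof (intro bexI ballI)
    show "real_point Z \<phi> (s k) \<in> lattice_preimage Z \<phi>"
      using k(1) s by (intro CollectI exI[of _ "s k"]) simp
    fix y assume "y \<in> lattice_preimage Z \<phi>"
    then obtain q where q: "y = real_point Z \<phi> q" "q \<in> Z" "\<phi> q \<in> \<Lambda>" by blast
    have "hform (real_point Z \<phi> (s k)) y / (2 * of_real pi * \<i>) = of_real (Im (B k (\<phi> q)))"
      using hform_real_points[OF s(1)[of k] q(2)] unfolding q(1) s(2) .
    also have "\<dots> = of_int (?\<psi> (\<phi> q))" using k(2) q(3) by blast
    also have "?\<psi> (\<phi> q) = \<psi> (real_point Z \<phi> (s (\<phi> q)))" using q(3) by simp
    also have "\<dots> = \<psi> y" unfolding q(1) using q by (intro dep s) (simp_all add: s)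
    finally show "hform (real_point Z \<phi> (s k)) y / (2 * of_real pi * \<i>) = of_int (\<psi> y)" .
  qed
qed

lemma standard_point_in_Sp: "standard_point Z \<phi> \<in> Sp \<Lambda> B"
proof -
  note sub = sub_Z[OF fr] sub_F[OF fr]
  have Z0: "Z \<inter> Hplus = {0}"
    using lagrangian_complement_Int[OF framed_complement[OF fr]] hp.subspace_0[OF sub(1)] hp.subspace_0[OF Hplus_subspace] by blast
  have lag: "lagrangian Z" using framed_complement[OF fr] by (simp add: lagrangian_complement_def)
  have span0: "span (lattice_preimage Z \<phi>) \<inter> (perp (frame_kernel Z \<phi>) \<inter> Hplus) = {0}"
  proof (intro equalityI subsetI)
    fix x assume "x \<in> span (lattice_preimage Z \<phi>) \<inter> (perp (frame_kernel Z \<phi>) \<inter> Hplus)"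
    then obtain z where z: "x = real_point Z \<phi> z" "z \<in> Z" "x \<in> Hplus"
      unfolding span_L[OF fr] by blast
    have "z = 0 \<and> conj_plus Z \<phi> (\<phi> z) = x"
      using z(1) by (intro complement_decomposition_unique[OF fr] z(2,3) conj_plus_Hplus[OF fr] hp.subspace_0[OF sub(1)]) simp
    then have "conj_plus Z \<phi> (\<phi> 0) = x" by blast
    then show "x \<in> {0}" unfolding framed_0[OF fr] conj_plus_0[OF fr] by simp
  next
    fix x :: hprime assume "x \<in> {0}"
    then show "x \<in> span (lattice_preimage Z \<phi>) \<inter> (perp (frame_kernel Z \<phi>) \<inter> Hplus)"
      by (simp add: span_zero perp_def hp.subspace_0[OF Hplus_subspace])
  qed
  have conj_eq: "{w. \<exists>u\<in>Z. conj_mod (frame_kernel Z \<phi>) (lattice_preimage Z \<phi>) u w}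
      = perp (frame_kernel Z \<phi>) \<inter> Hplus + frame_kernel Z \<phi>"
  proof (intro equalityI subsetI)
    fix w assume "w \<in> {w. \<exists>u\<in>Z. conj_mod (frame_kernel Z \<phi>) (lattice_preimage Z \<phi>) u w}"
    then obtain u where u: "u \<in> Z" "conj_mod (frame_kernel Z \<phi>) (lattice_preimage Z \<phi>) u w"
      by blast
    have "w - conj_plus Z \<phi> (\<phi> u) \<in> frame_kernel Z \<phi>"
      by (rule conj_mod_standard[OF u(1), THEN iffD1, OF u(2)])
    then have "conj_plus Z \<phi> (\<phi> u) + (w - conj_plus Z \<phi> (\<phi> u)) \<in> perp (frame_kernel Z \<phi>) \<inter> Hplus + frame_kernel Z \<phi>"
      unfolding perp_kernel_Hplus[OF fr] by (intro set_plus_intro) simp_all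
    then show "w \<in> perp (frame_kernel Z \<phi>) \<inter> Hplus + frame_kernel Z \<phi>" by simp
  next
    fix w assume "w \<in> perp (frame_kernel Z \<phi>) \<inter> Hplus + frame_kernel Z \<phi>"
    then obtain h f where hf: "w = h + f" "h \<in> range (conj_plus Z \<phi>)" "f \<in> frame_kernel Z \<phi>"
      unfolding perp_kernel_Hplus[OF fr] by (rule set_plus_elim)
    then obtain v where v: "h = conj_plus Z \<phi> v" by blast
    obtain u where u: "u \<in> Z" "\<phi> u = v" using framed_onto[OF fr, of v] by blast
    have "w - conj_plus Z \<phi> (\<phi> u) = f" unfolding hf(1) v u(2) by simp
    then have "w - conj_plus Z \<phi> (\<phi> u) \<in> frame_kernel Z \<phi>" using hf(3) by simp
    then have "conj_mod (frame_kernel Z \<phi>) (lattice_preimage Z \<phi>) u w"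
      by (rule conj_mod_standard[OF u(1), THEN iffD2])
    then show "w \<in> {w. \<exists>u\<in>Z. conj_mod (frame_kernel Z \<phi>) (lattice_preimage Z \<phi>) u w}" using u(1) by blast
  qed
  have herm: "hermB (frame_kernel Z \<phi>) (lattice_preimage Z \<phi>) v u
      = cnj (hermB (frame_kernel Z \<phi>) (lattice_preimage Z \<phi>) u v)" if uv: "u \<in> Z" "v \<in> Z" for u v
    unfolding hermB_standard[OF uv] hermB_standard[OF uv(2,1)] by (rule B_herm)
  have pos: "Re (hermB (frame_kernel Z \<phi>) (lattice_preimage Z \<phi>) u u) > 0" if u: "u \<in> Z - frame_kernel Z \<phi>" for u
  proof -
    have "u \<in> Z" "\<phi> u \<noteq> 0" using u by (auto simp: frame_kernel_def)
    then show ?thesis unfolding hermB_standard[OF \<open>u \<in> Z\<close> \<open>u \<in> Z\<close>] by (intro B_pos)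
  qed
  have ext: "extended_ppav CARD('g) Z (frame_kernel Z \<phi>) (lattice_preimage Z \<phi>)"
    unfolding extended_ppav_def
    by (intro conjI ballI lag frame_kernel_codim[OF fr] lattice_mod_L[OF fr] Z0 span0 conj_eq
        unimodular_standard herm pos)
  have periods: "{\<phi> z |z. z \<in> Z \<and> (\<exists>h\<in>perp (frame_kernel Z \<phi>) \<inter> Hplus. z + h \<in> lattice_preimage Z \<phi>)} = \<Lambda>"
  proof (intro equalityI subsetI)
    fix l assume "l \<in> {\<phi> z |z. z \<in> Z \<and> (\<exists>h\<in>perp (frame_kernel Z \<phi>) \<inter> Hplus. z + h \<in> lattice_preimage Z \<phi>)}"
    then obtain z h z' where "l = \<phi> z" and z: "z \<in> Z" "h \<in> Hplus" "z + h = real_point Z \<phi> z'" "z' \<in> Z" "\<phi> z' \<in> \<Lambda>"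
      by blast
    moreover have "z = z' \<and> h = conj_plus Z \<phi> (\<phi> z')"
      by (intro complement_decomposition_unique[OF fr] z conj_plus_Hplus[OF fr])
    ultimately show "l \<in> \<Lambda>" by simp
  next
    fix l assume l: "l \<in> \<Lambda>"
    obtain z where z: "z \<in> Z" "\<phi> z = l" using framed_onto[OF fr, of l] by blast
    have "conj_plus Z \<phi> (\<phi> z) \<in> perp (frame_kernel Z \<phi>) \<inter> Hplus"
      unfolding perp_kernel_Hplus[OF fr] by blast
    moreover have "real_point Z \<phi> z \<in> lattice_preimage Z \<phi>" using z l by blast
    ultimately show "l \<in> {\<phi> z |z. z \<in> Z \<and> (\<exists>h\<in>perp (frame_kernel Z \<phi>) \<inter> Hplus. z + h \<in> lattice_preimage Z \<phi>)}"
      using z by blast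
  qed
  have kernel: "{x \<in> Z. \<phi> x = 0} = frame_kernel Z \<phi>" by (simp add: frame_kernel_def)
  have "\<phi> ` Z = UNIV" "\<forall>x. x \<notin> Z \<longrightarrow> \<phi> x = 0" using fr unfolding framed_def by blast+
  then show ?thesis
    unfolding Sp_def standard_point_def
    by (intro CollectI, unfold extpt.select_convs)
       (intro conjI ballI allI ext framed_add[OF fr] framed_scale[OF fr] kernel periods hermB_standard; blast)
qed

end

end

lemma perp_subspace: "hp.subspace (perp S)"
  unfolding hp.subspace_def perp_def by (auto simp: hform_add_left hform_scale_left)

lemma hsubspace_scaleR: "hp.subspace S \<Longrightarrow> x \<in> S \<Longrightarrow> r *\<^sub>R x \<in> S"
  unfolding scaleR_hprime_conv by (rule hp.subspace_scale)

context polarized_torus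
begin

lemma Sp_framed: "a \<in> Sp \<Lambda> B \<Longrightarrow> framed (Zof a) (frame a)"
  unfolding Sp_def mem_Collect_eq extended_ppav_def framed_def lagrangian_complement_def
  by (elim conjE, intro conjI; assumption)

context
  fixes a assumes a: "a \<in> Sp \<Lambda> B"
begin

lemma Sp_kernel: "Fof a = frame_kernel (Zof a) (frame a)"
  using a unfolding Sp_def mem_Collect_eq frame_kernel_def by (elim conjE) (rule sym)

lemma Sp_F_subspace: "hp.subspace (Fof a)"
  unfolding Sp_kernel by (rule frame_kernel_subspace[OF Sp_framed[OF a]])

lemma Sp_F_subset: "f \<in> Fof a \<Longrightarrow> f \<in> Zof a"
  unfolding Sp_kernel frame_kernel_def by blast

lemma Sp_lattice_mod: "lattice_mod (Fof a) (Lof a) (2 * CARD('g))"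
  and Sp_span_L: "span (Lof a) \<inter> (perp (Fof a) \<inter> Hplus) = {0}"
  and Sp_conj: "{w. \<exists>u\<in>Zof a. conj_mod (Fof a) (Lof a) u w} = (perp (Fof a) \<inter> Hplus) + Fof a"
  by (insert a, unfold Sp_def mem_Collect_eq extended_ppav_def, (elim conjE, assumption)+)

lemma Sp_periods: "{frame a z |z. z \<in> Zof a \<and> (\<exists>h\<in>perp (Fof a) \<inter> Hplus. z + h \<in> Lof a)} = \<Lambda>"
  and Sp_hermB: "u \<in> Zof a \<Longrightarrow> v \<in> Zof a \<Longrightarrow> hermB (Fof a) (Lof a) u v = B (frame a u) (frame a v)"
  by (insert a, unfold Sp_def mem_Collect_eq, (elim conjE, assumption)+) (elim conjE, blast)

lemma Sp_lattice_facts: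
  shows "f \<in> Fof a \<Longrightarrow> f \<in> Lof a"
    and "x \<in> Lof a \<Longrightarrow> f \<in> Fof a \<Longrightarrow> x + f \<in> Lof a"
    and "x \<in> Lof a \<Longrightarrow> x \<in> perp (Fof a)"
proof -
  obtain l where l: "\<forall>j<2 * CARD('g). l j \<in> perp (Fof a)"
    and L: "Lof a = {(\<Sum>j<2 * CARD('g). of_int (m j) *\<^sub>R l j) + f |(m::nat \<Rightarrow> int) f. f \<in> Fof a}"
    using Sp_lattice_mod unfolding lattice_mod_def by blast
  show "f \<in> Lof a" if "f \<in> Fof a"
    unfolding L using that by (intro CollectI exI[of _ "\<lambda>_. 0"] exI[of _ f]) simp
  show "x + f \<in> Lof a" if x: "x \<in> Lof a" and f: "f \<in> Fof a"
  proof -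
    obtain m f' where "x = (\<Sum>j<2 * CARD('g). of_int (m j) *\<^sub>R l j) + f'" "f' \<in> Fof a"
      using x unfolding L by blast
    then show ?thesis
      unfolding L using f hp.subspace_add[OF Sp_F_subspace]
      by (intro CollectI exI[of _ m] exI[of _ "f' + f"]) (simp add: add.assoc)
  qed
  show "x \<in> perp (Fof a)" if x: "x \<in> Lof a"
  proof -
    obtain m f where x: "x = (\<Sum>j<2 * CARD('g). of_int (m j) *\<^sub>R l j) + f" "f \<in> Fof a"
      using x unfolding L by blast
    have "f \<in> perp (Fof a)"
      using Z_subset_perp[OF Sp_framed[OF a] Sp_F_subset[OF x(2)]] unfolding Sp_kernel .
    then show ?thesis
      unfolding x(1) using l
      by (intro hp.subspace_add[OF perp_subspace] hp.subspace_sum[OF perp_subspace] hsubspace_scaleR[OF perp_subspace]) auto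
  qed
qed

lemma Sp_F_subset_span: "f \<in> Fof a \<Longrightarrow> f \<in> span (Lof a)"
  by (intro span_base Sp_lattice_facts)

text \<open>If \<open>w\<close> is conjugate to \<open>u\<close>, then \<open>u + w\<close> is real modulo \<open>F\<close>. So the difference of two conjugates of \<open>u\<close> is real; modulo
  \<open>F\<close> it also lies in \<open>F\<^sup>\<bottom>\<^sub>+\<close>, hence it vanishes there.\<close>

lemma Sp_conj_unique:
  assumes u: "u \<in> Zof a" and w: "conj_mod (Fof a) (Lof a) u w" and w': "conj_mod (Fof a) (Lof a) u w'"
  shows "w - w' \<in> Fof a"
proof -
  note sub = Sp_F_subspace
  have split: "\<exists>h f. w = h + f \<and> h \<in> perp (Fof a) \<inter> Hplus \<and> f \<in> Fof a"
    if "conj_mod (Fof a) (Lof a) u w" for w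
  proof -
    have "w \<in> (perp (Fof a) \<inter> Hplus) + Fof a"
      unfolding Sp_conj[symmetric] using that u by blast
    then show ?thesis by (rule set_plus_elim) blast
  qed
  obtain h f where hf: "w = h + f" "h \<in> perp (Fof a)" "h \<in> Hplus" "f \<in> Fof a" using split[OF w] by blast
  obtain h' f' where hf': "w' = h' + f'" "h' \<in> perp (Fof a)" "h' \<in> Hplus" "f' \<in> Fof a" using split[OF w'] by blast
  obtain x y where xy: "x \<in> span (Lof a)" "u - (x + hscale \<i> y) \<in> Fof a" "w - (x - hscale \<i> y) \<in> Fof a"
    using w unfolding conj_mod_def by blast
  obtain x' y' where xy': "x' \<in> span (Lof a)" "u - (x' + hscale \<i> y') \<in> Fof a" "w' - (x' - hscale \<i> y') \<in> Fof a"
    using w' unfolding conj_mod_def by blast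
  have "(u - (x + hscale \<i> y)) + (w - (x - hscale \<i> y)) - ((u - (x' + hscale \<i> y')) + (w' - (x' - hscale \<i> y'))) - (f - f') \<in> Fof a"
    by (intro hp.subspace_diff[OF sub] hp.subspace_add[OF sub] xy xy' hf hf')
  moreover have "(u - (x + hscale \<i> y)) + (w - (x - hscale \<i> y)) - ((u - (x' + hscale \<i> y')) + (w' - (x' - hscale \<i> y'))) - (f - f')
      = (h - h') - ((x + x) - (x' + x'))"
    unfolding hf(1) hf'(1) by (simp add: algebra_simps)
  ultimately have "(h - h') - ((x + x) - (x' + x')) \<in> Fof a" by (simp only:)
  then have "((h - h') - ((x + x) - (x' + x'))) + ((x + x) - (x' + x')) \<in> span (Lof a)"
    by (rule span_add[OF Sp_F_subset_span span_diff[OF span_add[OF xy(1) xy(1)] span_add[OF xy'(1) xy'(1)]]])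
  then have "h - h' \<in> span (Lof a)" by simp
  moreover have "h - h' \<in> perp (Fof a)" by (rule hp.subspace_diff[OF perp_subspace hf(2) hf'(2)])
  moreover have "h - h' \<in> Hplus" by (rule hp.subspace_diff[OF Hplus_subspace hf(3) hf'(3)])
  ultimately have "h - h' = 0" using Sp_span_L by blast
  then have "w - w' = f - f'" using hf(1) hf'(1) by simp
  then show ?thesis using hp.subspace_diff[OF sub hf(4) hf'(4)] by simp
qed

lemma Sp_conj_pairing:
  assumes u: "u \<in> Zof a" and w: "conj_mod (Fof a) (Lof a) u w" and v: "v \<in> Zof a"
  shows "hform w v = of_real pi * B (frame a u) (frame a v)"
proof -
  let ?w = "SOME w. conj_mod (Fof a) (Lof a) u w"
  have "conj_mod (Fof a) (Lof a) u ?w" using w by (rule someI)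
  then have "w - ?w \<in> Zof a" by (intro Sp_F_subset Sp_conj_unique[OF u w])
  then have "hform (w - ?w) v = 0"
    using v by (rule lagrangian_complement_isotropic[OF framed_complement[OF Sp_framed[OF a]]])
  then have "hform w v = hform ?w v" unfolding hform_diff_left by simp
  moreover have "hform ?w v = of_real pi * hermB (Fof a) (Lof a) u v" unfolding hermB_def by simp
  ultimately show ?thesis unfolding Sp_hermB[OF u v] by simp
qed

lemma Sp_conj_Hplus:
  assumes "u \<in> Zof a" "conj_mod (Fof a) (Lof a) u h" "h \<in> Hplus"
  shows "h = conj_plus (Zof a) (frame a) (frame a u)"
  by (rule conj_plus_unique[OF Sp_framed[OF a] assms(3)]) (rule Sp_conj_pairing[OF assms(1,2)])

text \<open>As \<open>h\<close> lies in \<open>F\<^sup>\<bottom>\<^sub>+\<close>, it is the conjugate of some \<open>u \<in> Z\<close>. Since \<open>z + h\<close> is real, the conjugate of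
  \<open>z\<close> is \<open>z + h\<close> minus the conjugate of \<open>h\<close>, that is \<open>z + h - u\<close>. On the other hand the conjugate of \<open>z\<close>
  is some \<open>h' \<in> H'\<^sub>+\<close> modulo \<open>F\<close>. Comparing components in \<open>Z \<oplus> H'\<^sub>+\<close> gives \<open>h = h'\<close>.\<close>

lemma Sp_lattice_point:
  assumes x: "z + h \<in> Lof a" and z: "z \<in> Zof a" and h: "h \<in> Hplus"
  shows "h = conj_plus (Zof a) (frame a) (frame a z)"
proof -
  note sub = Sp_F_subspace
  have "z \<in> perp (Fof a)" using Z_subset_perp[OF Sp_framed[OF a] z] unfolding Sp_kernel .
  then have "(z + h) - z \<in> perp (Fof a)" by (intro hp.subspace_diff[OF perp_subspace] Sp_lattice_facts(3)[OF x])
  then have hp: "h \<in> perp (Fof a) \<inter> Hplus" using h by simp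
  have "h + 0 \<in> (perp (Fof a) \<inter> Hplus) + Fof a"
    by (rule set_plus_intro[OF hp hp.subspace_0[OF sub]])
  then have "h \<in> {w. \<exists>u\<in>Zof a. conj_mod (Fof a) (Lof a) u w}" unfolding Sp_conj by simp
  then obtain u where u: "u \<in> Zof a" "conj_mod (Fof a) (Lof a) u h" by blast
  obtain p q where pq: "p \<in> span (Lof a)" "q \<in> span (Lof a)"
    "u - (p + hscale \<i> q) \<in> Fof a" "h - (p - hscale \<i> q) \<in> Fof a"
    using u(2) unfolding conj_mod_def by blast
  have conj1: "conj_mod (Fof a) (Lof a) z (z + h - u)"
    unfolding conj_mod_def
  proof (rule bexI[of _ "z + h - p"], rule bexI[of _ q], intro conjI)
    show "z + h - p \<in> span (Lof a)" by (intro span_diff[OF span_base[OF x] pq(1)])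
    show "q \<in> span (Lof a)" by (rule pq(2))
    have eq: "z - (z + h - p + hscale \<i> q) = - (h - (p - hscale \<i> q))"
      "z + h - u - (z + h - p - hscale \<i> q) = - (u - (p + hscale \<i> q))" by simp_all
    show "z - (z + h - p + hscale \<i> q) \<in> Fof a" unfolding eq by (rule hp.subspace_neg[OF sub pq(4)])
    show "z + h - u - (z + h - p - hscale \<i> q) \<in> Fof a" unfolding eq by (rule hp.subspace_neg[OF sub pq(3)])
  qed
  then have "z + h - u \<in> (perp (Fof a) \<inter> Hplus) + Fof a" unfolding Sp_conj[symmetric] using z by blast
  then obtain h' f where hf: "z + h - u = h' + f" "h' \<in> perp (Fof a) \<inter> Hplus" "f \<in> Fof a"
    by (rule set_plus_elim)
  have h': "h' \<in> Hplus" using hf(2) by blast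
  obtain p' q' where pq': "p' \<in> span (Lof a)" "q' \<in> span (Lof a)"
    "z - (p' + hscale \<i> q') \<in> Fof a" "z + h - u - (p' - hscale \<i> q') \<in> Fof a"
    using conj1 unfolding conj_mod_def by blast
  have "h' - (p' - hscale \<i> q') = (z + h - u - (p' - hscale \<i> q')) - f" unfolding hf(1) by simp
  then have "h' - (p' - hscale \<i> q') \<in> Fof a" using hp.subspace_diff[OF sub pq'(4) hf(3)] by (simp only:)
  then have "conj_mod (Fof a) (Lof a) z h'" unfolding conj_mod_def using pq' by blast
  then have h'eq: "h' = conj_plus (Zof a) (frame a) (frame a z)" by (rule Sp_conj_Hplus[OF z _ h'])
  have "z - u \<in> Zof a" using z u by (intro hp.subspace_diff[OF framed_subspace[OF Sp_framed[OF a]]])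
  moreover have "z - u + h = f + h'" using hf(1) by (simp add: algebra_simps)
  ultimately have "z - u = f \<and> h = h'"
    using h h' Sp_F_subset[OF hf(3)] by (intro complement_decomposition_unique[OF Sp_framed[OF a]])
  then show ?thesis using h'eq by blast
qed

lemma Sp_eq_standard_point: "a = standard_point (Zof a) (frame a)"
proof -
  note fr = Sp_framed[OF a]
  have "Lof a = lattice_preimage (Zof a) (frame a)"
  proof (intro equalityI subsetI)
    fix x assume x: "x \<in> Lof a"
    let ?z = "proj_along_Hplus (Zof a) x"
    have z: "?z \<in> Zof a" and h: "x - ?z \<in> Hplus"
      by (rule proj_mem[OF framed_complement[OF fr]], rule proj_diff[OF framed_complement[OF fr]])
    have zh: "?z + (x - ?z) \<in> Lof a" using x by simp
    have heq: "x - ?z = conj_plus (Zof a) (frame a) (frame a ?z)" by (rule Sp_lattice_point[OF zh z h])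
    have "x - ?z \<in> perp (Fof a) \<inter> Hplus"
      unfolding heq Sp_kernel perp_kernel_Hplus[OF fr] by blast
    then have "frame a ?z \<in> \<Lambda>" using z zh Sp_periods by blast
    moreover have "x = real_point (Zof a) (frame a) ?z" unfolding heq[symmetric] by simp
    ultimately show "x \<in> lattice_preimage (Zof a) (frame a)" using z by blast
  next
    fix x assume "x \<in> lattice_preimage (Zof a) (frame a)"
    then obtain z where z: "x = real_point (Zof a) (frame a) z" "z \<in> Zof a" "frame a z \<in> \<Lambda>" by blast
    have "frame a z \<in> {frame a z |z. z \<in> Zof a \<and> (\<exists>h\<in>perp (Fof a) \<inter> Hplus. z + h \<in> Lof a)}"
      using z(3) unfolding Sp_periods .
    then obtain z' h where z': "frame a z = frame a z'" "z' \<in> Zof a" "h \<in> Hplus" "z' + h \<in> Lof a"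
      by blast
    have "h = conj_plus (Zof a) (frame a) (frame a z)"
      unfolding z'(1) by (rule Sp_lattice_point[OF z'(4,2,3)])
    then have xeq: "x = (z' + h) + (z - z')" using z(1) by simp
    have "z - z' \<in> Fof a"
      using z(2) z'(1,2) hp.subspace_diff[OF framed_subspace[OF fr]]
      unfolding Sp_kernel frame_kernel_def by (simp add: framed_diff[OF fr])
    then show "x \<in> Lof a" unfolding xeq by (rule Sp_lattice_facts(2)[OF z'(4)])
  qed
  then show ?thesis
    using Sp_kernel unfolding standard_point_def by (cases a) simp
qed

end

lemma Sp_eqI:
  assumes "a \<in> Sp \<Lambda> B" "b \<in> Sp \<Lambda> B" "Zof a = Zof b" "frame a = frame b"
  shows "a = b"
  using Sp_eq_standard_point[OF assms(1)] Sp_eq_standard_point[OF assms(2)] assms(3,4) by simp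

text \<open>The point with \<open>Z = t\<^sup>-\<^sup>1\<complex>[t\<^sup>-\<^sup>1]\<close> and with some \<open>g\<close> of the coefficients as frame.\<close>

lemma Sp_nonempty: "Sp \<Lambda> B \<noteq> {}"
proof -
  let ?Z = "{x. \<forall>n>0. hcoeff x n = 0}"
  have sub: "hp.subspace ?Z" by (auto simp: hp.subspace_def)
  have iso: "hform x y = 0" if x: "x \<in> ?Z" and y: "y \<in> ?Z" for x y
  proof -
    let ?K = "{k::nat. hcoeff y (- int k - 1) \<noteq> 0}"
    let ?s = "\<Sum>k\<in>?K. hscale (hcoeff y (- int k - 1)) (hb (- int k - 1))"
    have K: "finite ?K" by (rule finite_polar_support)
    have neg: "y - ?s \<in> Hplus" by (rule polar_decomposition[OF K order_refl])
    have "hcoeff ?s n = 0" if "n > 0" for n using that by simp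
    then have pos: "hcoeff (y - ?s) n = 0" if "n > 0" for n
      unfolding hcoeff_diff using y that by simp
    have "y - ?s = 0"
    proof (rule hprime_eqI)
      fix n show "hcoeff (y - ?s) n = hcoeff 0 n"
      proof (cases n "0::int" rule: linorder_cases)
        case less
        then show ?thesis unfolding hcoeff_0 using neg[unfolded Hplus_iff] by blast
      next
        case equal
        then show ?thesis by (simp only: hcoeff_at_0)
      next
        case greater
        then show ?thesis unfolding hcoeff_0 by (rule pos)
      qed
    qed
    have "hform x y = hform x (y - ?s) + hform x ?s" unfolding hform_diff_right by simp
    also have "\<dots> = hform x ?s" unfolding \<open>y - ?s = 0\<close> by simp
    also have "\<dots> = 0"
      using x by (simp add: hform_sum_right hform_scale_right hform_hb_right)
    finally show ?thesis .
  qed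
  have lag: "lagrangian_complement ?Z"
    unfolding lagrangian_complement_def lagrangian_def
  proof (intro conjI sub equalityI subsetI)
    fix x assume "x \<in> perp ?Z"
    have "hcoeff x n = 0" if "n > 0" for n
    proof -
      have "hb (- n) \<in> ?Z" using that by simp
      then have "hform x (hb (- n)) = 0" using \<open>x \<in> perp ?Z\<close> unfolding perp_def by blast
      then show ?thesis using that by (simp add: hform_hb_right)
    qed
    then show "x \<in> ?Z" by blast
  next
    fix x assume "x \<in> ?Z"
    then show "x \<in> perp ?Z" unfolding perp_def using iso by blast
  next
    fix x assume "x \<in> ?Z \<inter> Hplus"
    then have x: "\<forall>n>0. hcoeff x n = 0" "\<forall>n<0. hcoeff x n = 0" using Hplus_iff by blast+
    have "hcoeff x n = hcoeff 0 n" for n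
      using x by (cases n "0::int" rule: linorder_cases) simp_all
    then have "x = 0" by (rule hprime_eqI)
    then show "x \<in> {0}" by simp
  next
    fix x :: hprime assume "x \<in> {0}"
    then show "x \<in> ?Z \<inter> Hplus" by (simp add: Hplus_iff)
  qed
  obtain e :: "'g \<Rightarrow> nat" where e: "inj e" using finite_imp_inj_to_nat_seg[of "UNIV :: 'g set"] by auto
  let ?\<phi> = "\<lambda>x. if x \<in> ?Z then (\<chi> j. hcoeff x (- int (e j) - 1)) else 0"
  have "framed ?Z ?\<phi>"
    unfolding framed_def
  proof (intro conjI ballI allI lag)
    show "?\<phi> (x + y) = ?\<phi> x + ?\<phi> y" if "x \<in> ?Z" "y \<in> ?Z" for x y
      using that hp.subspace_add[OF sub that] by (simp add: vec_eq_iff)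
    show "?\<phi> (hscale c x) = c *s ?\<phi> x" if "x \<in> ?Z" for c x
      using that hp.subspace_scale[OF sub that] by (simp add: vec_eq_iff)
    show "x \<notin> ?Z \<longrightarrow> ?\<phi> x = 0" for x by (rule impI) (rule if_not_P)
    show "?\<phi> ` ?Z = UNIV"
    proof (intro equalityI subset_UNIV subsetI)
      fix v :: "complex^'g"
      let ?z = "\<Sum>j\<in>UNIV. hscale (v $ j) (hb (- int (e j) - 1))"
      have z: "?z \<in> ?Z" by simp
      have "(\<Sum>j\<in>UNIV. v $ j * hcoeff (hb (- int (e j) - 1)) (- int (e i) - 1)) = v $ i" for i
      proof -
        have "(\<Sum>j\<in>UNIV. v $ j * hcoeff (hb (- int (e j) - 1)) (- int (e i) - 1)) = (\<Sum>j\<in>UNIV. if j = i then v $ j else 0)"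
          by (intro sum.cong) (auto simp: inj_eq[OF e])
        then show ?thesis by simp
      qed
      then have \<phi>z: "?\<phi> ?z = v" using z by (simp add: vec_eq_iff)
      show "v \<in> ?\<phi> ` ?Z" using \<phi>z[symmetric] z by (rule image_eqI[of v ?\<phi> ?z ?Z])
    qed
  qed
  then show ?thesis using standard_point_in_Sp by blast
qed

end

section \<open>The group \<open>Sp\<^sup>+(H')\<close>\<close>

lemma dist_fls_less_imp_nth_eq:
  fixes a b :: "complex fls"
  assumes "dist a b < inverse (2 ^ N)" "n \<le> int N"
  shows "fls_nth (a - b) n = 0"
proof (cases "a = b")
  case False
  have "fls_subdegree (a - b) > int N"
  proof (cases "fls_subdegree (a - b) \<ge> 0")
    case True
    then have "inverse (2 ^ nat (fls_subdegree (a - b))) < (inverse (2 ^ N) :: real)"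
      using assms(1) False by (simp add: dist_fls_def)
    then have "(2::real) ^ N < 2 ^ nat (fls_subdegree (a - b))"
      by (simp add: inverse_less_iff_less)
    then show ?thesis by (simp add: zless_nat_eq_int_zless)
  next
    case neg: False
    then have "2 ^ nat (- fls_subdegree (a - b)) < (inverse (2 ^ N) :: real)"
      using assms(1) False by (simp add: dist_fls_def)
    moreover have "(inverse (2 ^ N) :: real) \<le> 1" by (simp add: inverse_le_1_iff)
    moreover have "(1::real) \<le> 2 ^ nat (- fls_subdegree (a - b))" by simp
    ultimately show ?thesis by linarith
  qed
  then show ?thesis using assms(2) by (intro fls_eq0_below_subdegree) simp
qed simp

lemma nth_eq_imp_dist_fls_less:
  fixes a b :: "complex fls"
  assumes "\<And>n. n \<le> int M \<Longrightarrow> fls_nth (a - b) n = 0"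
  shows "dist a b < inverse (2 ^ M)"
proof (cases "a = b")
  case False
  then have "fls_nth (a - b) (fls_subdegree (a - b)) \<noteq> 0" by (intro nth_fls_subdegree_nonzero) simp
  then have sd: "fls_subdegree (a - b) > int M" using assms[of "fls_subdegree (a - b)"] by linarith
  then have "(2::real) ^ M < 2 ^ nat (fls_subdegree (a - b))"
    by (intro power_strict_increasing) auto
  then have "inverse (2 ^ nat (fls_subdegree (a - b))) < (inverse (2 ^ M) :: real)"
    by (simp add: inverse_less_iff_less)
  then show ?thesis using False sd by (simp add: dist_fls_def)
qed simp

lemma abs_hprime_add: "abs_hprime (f + g) = abs_hprime f + abs_hprime g"
  by (simp add: plus_hprime.abs_eq)

text \<open>A map with an adjoint is \<open>t\<close>-adically continuous: a coefficient of its value at \<open>x\<close> is the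
  pairing of \<open>x\<close> with a fixed Laurent series, which involves finitely many coefficients of \<open>x\<close>.\<close>

lemma adjoint_imp_continuous:
  assumes add: "\<And>x y. g (x + y) = g x + g y"
    and adj: "\<And>x y. hform (g x) y = hform x (g' y)"
    and plus: "\<And>h. h \<in> Hplus \<Longrightarrow> g h \<in> Hplus"
  shows "continuous_on UNIV g"
proof -
  have "open (g -` U)" if U: "open U" for U
    unfolding open_hprime_def open_dist
  proof (intro ballI)
    fix f assume "f \<in> abs_hprime -` (g -` U)"
    then have fU: "g (abs_hprime f) \<in> U" by simp
    have "\<exists>f0. x = abs_hprime f0" for x
      by (induction x rule: hprime.abs_induct) blast
    then obtain f0 where f0: "g (abs_hprime f) = abs_hprime f0" by blast
    have "open (abs_hprime -` U)" using U by (simp add: open_hprime_def)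
    moreover have "f0 \<in> abs_hprime -` U" using fU f0 by simp
    ultimately obtain e where e: "e > 0" "\<And>y. dist y f0 < e \<Longrightarrow> abs_hprime y \<in> U"
      unfolding open_dist by blast
    obtain M where M: "(1/2 :: real) ^ M < e"
      using real_arch_pow_inv[of e "1/2"] e(1) by auto
    \<comment> \<open>Up to order \<open>M\<close> the value of \<open>g\<close> depends only on the coefficients up to order \<open>N\<close> of its argument.\<close>
    let ?K = "\<Union>n\<in>{1..M}. {k::nat. hcoeff (g' (hb (- int n))) (- int k - 1) \<noteq> 0}"
    have "finite ?K" by (intro finite_UN_I finite_polar_support) simp
    then obtain N where "?K \<subseteq> {..<N}" using finite_nat_bounded[of ?K] by blast
    then have N: "k < N" if "k \<in> ?K" for k using that by blast
    show "\<exists>e>0. \<forall>y. dist y f < e \<longrightarrow> y \<in> abs_hprime -` (g -` U)"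
    proof (intro exI[of _ "inverse (2 ^ N) :: real"] conjI allI impI)
      show "(0::real) < inverse (2 ^ N)" by simp
      fix y assume y: "dist y f < inverse (2 ^ N)"
      let ?x = "abs_hprime (y - f)"
      have xN: "hcoeff ?x n = 0" if "n \<le> int N" for n
        using dist_fls_less_imp_nth_eq[OF y that] by (simp only: hcoeff_abs if_cancel)
      then have xH: "?x \<in> Hplus" unfolding Hplus_iff by auto
      then obtain r where r: "g ?x = abs_hprime r" "\<forall>n\<le>0. fls_nth r n = 0"
        using plus[OF xH] unfolding Hplus_def by blast
      have "fls_nth r n = 0" if n: "n \<le> int M" for n
      proof (cases "n \<le> 0")
        case True
        then show ?thesis using r(2) by blast
      next
        case False
        let ?n = "nat n"
        have nM: "?n \<in> {1..M}" "int ?n = n" using False n by auto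
        have "hform (g ?x) (hb (- n)) = hform ?x (g' (hb (- n)))" by (rule adj)
        also have "\<dots> = (\<Sum>k | hcoeff (g' (hb (- n))) (- int k - 1) \<noteq> 0.
            of_nat (k + 1) * hcoeff ?x (int k + 1) * hcoeff (g' (hb (- n))) (- int k - 1))"
          by (rule hform_Hplus_left[OF xH finite_polar_support order_refl])
        also have "\<dots> = 0"
        proof (intro sum.neutral ballI)
          fix k assume "k \<in> {k. hcoeff (g' (hb (- n))) (- int k - 1) \<noteq> 0}"
          then have "k \<in> ?K" using nM by (intro UN_I[of ?n]) simp_all
          then have "hcoeff ?x (int k + 1) = 0" using N[of k] by (intro xN) simp
          then show "of_nat (k + 1) * hcoeff ?x (int k + 1) * hcoeff (g' (hb (- n))) (- int k - 1) = 0"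
            by simp
        qed
        finally have "of_int n * hcoeff (g ?x) n = 0" by (simp add: hform_hb_right)
        then have "hcoeff (g ?x) n = 0" using False by simp
        then show ?thesis unfolding r(1) hcoeff_abs using False by simp
      qed
      then have "dist (f0 + r) f0 < inverse (2 ^ M)"
        by (intro nth_eq_imp_dist_fls_less) simp
      also have "\<dots> < e" using M by (simp add: power_one_over inverse_eq_divide)
      finally have "abs_hprime (f0 + r) \<in> U" by (rule e(2))
      moreover have "abs_hprime (f0 + r) = g (abs_hprime y)"
      proof -
        have "abs_hprime (f0 + r) = g (abs_hprime f + ?x)"
          unfolding abs_hprime_add add f0 r(1) ..
        also have "abs_hprime f + ?x = abs_hprime y"
          unfolding abs_hprime_add[symmetric] by simp
        finally show ?thesis .
      qed
      ultimately show "y \<in> abs_hprime -` (g -` U)" by simp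
    qed
  qed
  then show ?thesis by (simp add: continuous_on_open_vimage)
qed

text \<open>Continuity is automatic, because the inverse of a symplectic map is its adjoint.\<close>

lemma SpPlus_fullI:
  assumes lin: "Vector_Spaces.linear hscale hscale g"
    and inv: "\<And>x. g (g' x) = x" "\<And>x. g' (g x) = x"
    and form: "\<And>x y. hform (g x) (g y) = hform x y"
    and plus: "\<And>h. h \<in> Hplus \<Longrightarrow> g h \<in> Hplus" "\<And>h. h \<in> Hplus \<Longrightarrow> g' h \<in> Hplus"
  shows "g \<in> SpPlus_full" "inv g = g'"
proof -
  interpret g: Vector_Spaces.linear hscale hscale g by (rule lin)
  have adj: "hform (g x) y = hform x (g' y)" for x y
    using form[of x "g' y"] by (simp add: inv)
  have adj': "hform (g' x) y = hform x (g y)" for x y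
    using form[of "g' x" y] by (simp add: inv)
  have add': "g' (x + y) = g' x + g' y" for x y
  proof -
    have "g (g' x + g' y) = x + y" by (simp only: g.add inv)
    then have "g' (g (g' x + g' y)) = g' (x + y)" by (rule arg_cong)
    then show ?thesis by (simp only: inv(2))
  qed
  have bij: "bij g" by (rule o_bij[of g']) (auto simp: inv)
  show ig: "inv g = g'" by (rule inv_equality) (auto simp: inv)
  have gH: "g ` Hplus = Hplus"
  proof (intro equalityI subsetI)
    show "x \<in> Hplus" if "x \<in> g ` Hplus" for x using that plus(1) by blast
    show "x \<in> g ` Hplus" if "x \<in> Hplus" for x
      using image_eqI[of x g "g' x" Hplus, OF inv(1)[symmetric] plus(2)[OF that]] .
  qed
  have "continuous_on UNIV g" by (rule adjoint_imp_continuous[of g g', OF g.add adj plus(1)])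
  moreover have "continuous_on UNIV (inv g)"
    unfolding ig by (rule adjoint_imp_continuous[of g' g, OF add' adj' plus(2)])
  ultimately show "g \<in> SpPlus_full"
    unfolding SpPlus_full_def by (intro CollectI conjI allI lin bij form gH)
qed

context
  fixes g assumes g: "g \<in> SpPlus_full"
begin

lemma SpPlus_linear: "Vector_Spaces.linear hscale hscale g"
  and SpPlus_bij: "bij g"
  and SpPlus_form: "hform (g x) (g y) = hform x y"
  and SpPlus_Hplus_image: "g ` Hplus = Hplus"
  by (insert g, unfold SpPlus_full_def mem_Collect_eq, (elim conjE, assumption)+) (elim conjE, blast, elim conjE)

lemma SpPlus_inv [simp]: "g (inv g x) = x" "inv g (g x) = x"
  using SpPlus_bij by (auto simp: bij_is_surj surj_f_inv_f bij_is_inj)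

lemma SpPlus_Hplus: "g h \<in> Hplus \<longleftrightarrow> h \<in> Hplus"
proof
  assume "g h \<in> Hplus"
  then obtain h' where "h' \<in> Hplus" "g h = g h'" using SpPlus_Hplus_image by blast
  then have "inv g (g h) = inv g (g h')" by simp
  then show "h \<in> Hplus" using \<open>h' \<in> Hplus\<close> by simp
qed (use SpPlus_Hplus_image in blast)

lemma SpPlus_inv_Hplus: "inv g h \<in> Hplus \<longleftrightarrow> h \<in> Hplus"
  using SpPlus_Hplus[of "inv g h"] by simp

lemma SpPlus_add: "g (x + y) = g x + g y" and SpPlus_scale: "g (hscale c x) = hscale c (g x)"
proof -
  interpret g: Vector_Spaces.linear hscale hscale g by (rule SpPlus_linear)
  show "g (x + y) = g x + g y" "g (hscale c x) = hscale c (g x)" by (rule g.add, rule g.scale)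
qed

lemma SpPlus_inv_add: "inv g (x + y) = inv g x + inv g y"
  by (metis SpPlus_add SpPlus_inv)

lemma SpPlus_inv_scale: "inv g (hscale c x) = hscale c (inv g x)"
  by (metis SpPlus_scale SpPlus_inv)

lemma SpPlus_adjoint: "hform (g x) y = hform x (inv g y)"
  using SpPlus_form[of x "inv g y"] by simp

lemma SpPlus_inv_adjoint: "hform (inv g x) y = hform x (g y)"
  using SpPlus_form[of "inv g x" y] by simp

lemma SpPlus_full_inv: "inv g \<in> SpPlus_full" and inv_inv_SpPlus: "inv (inv g) = g"
proof -
  have lin: "Vector_Spaces.linear hscale hscale (inv g)"
    by unfold_locales (rule SpPlus_inv_add, rule SpPlus_inv_scale)
  have form: "hform (inv g x) (inv g y) = hform x y" for x y
    using SpPlus_form[of "inv g x" "inv g y"] by simp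
  show "inv g \<in> SpPlus_full" "inv (inv g) = g"
    by (rule SpPlus_fullI[OF lin, of g]; simp add: form SpPlus_Hplus SpPlus_inv_Hplus)+
qed

end

lemma SpPlus_subset_full: "g \<in> SpPlus \<Longrightarrow> g \<in> SpPlus_full"
proof -
  assume "g \<in> SpPlus"
  then have "g \<in> topspace SpPlus_topology"
    unfolding SpPlus_def using connected_component_in_topspace by fastforce
  then show ?thesis by (simp add: SpPlus_topology_def topspace_pullback_topology)
qed

text \<open>If \<open>X\<^sup>2 = 0\<close>, then \<open>1 + X\<close> is joined to the identity by the path \<open>1 + sX\<close>.\<close>

lemma unipotent_in_SpPlus:
  assumes lin: "Vector_Spaces.linear hscale hscale X"
    and skew: "\<And>x y. hform (X x) y = - hform x (X y)"
    and square: "\<And>x. X (X x) = 0"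
    and plus: "\<And>h. h \<in> Hplus \<Longrightarrow> X h \<in> Hplus"
  shows "(\<lambda>x. x + X x) \<in> SpPlus" "inv (\<lambda>x. x + X x) = (\<lambda>x. x - X x)"
proof -
  interpret X: Vector_Spaces.linear hscale hscale X by (rule lin)
  let ?g = "\<lambda>c x. x + hscale c (X x)"
  have full: "?g c \<in> SpPlus_full \<and> inv (?g c) = (\<lambda>x. x - hscale c (X x))" for c
  proof -
    have "Vector_Spaces.linear hscale hscale (?g c)"
      by unfold_locales (simp_all add: X.add X.scale hp.scale_right_distrib algebra_simps)
    moreover have "hform (?g c x) (?g c y) = hform x y" for x y
      using skew[of x "X y"] skew[of x y] square by (simp add: hform_simps)
    ultimately show ?thesis
      by (intro conjI SpPlus_fullI[of "?g c" "\<lambda>x. x - hscale c (X x)"])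
         (simp_all add: X.add X.diff X.scale square plus hp.subspace_add[OF Hplus_subspace]
            hp.subspace_diff[OF Hplus_subspace] hp.subspace_scale[OF Hplus_subspace])
  qed
  have path: "continuous_map euclideanreal SpPlus_topology (\<lambda>s. ?g (complex_of_real s))"
    unfolding SpPlus_topology_def
  proof (rule continuous_map_pullback')
    have "continuous_on UNIV (\<lambda>s p. hform (fst p) (?g (complex_of_real s) (snd p)))"
    proof (rule continuous_on_coordinatewise_then_product)
      fix p :: "hprime \<times> hprime"
      show "continuous_on UNIV (\<lambda>s. hform (fst p) (?g (complex_of_real s) (snd p)))"
        unfolding hform_add_right hform_scale_right by (intro continuous_intros)
    qed
    then show "continuous_map euclideanreal euclidean
        ((\<lambda>g p. hform (fst p) (g (snd p))) \<circ> (\<lambda>s. ?g (complex_of_real s)))"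
      by (simp add: o_def)
    show "topspace euclideanreal \<subseteq> (\<lambda>s. ?g (complex_of_real s)) -` SpPlus_full"
      using full by blast
  qed
  have "connectedin SpPlus_topology ((\<lambda>s. ?g (complex_of_real s)) ` UNIV)"
    by (rule connectedin_continuous_map_image[OF path]) simp
  moreover have "id \<in> range (\<lambda>s. ?g (complex_of_real s))"
    by (rule image_eqI[of _ _ 0]) (auto simp: id_def)
  moreover have "(\<lambda>x. x + X x) \<in> range (\<lambda>s. ?g (complex_of_real s))"
    by (rule image_eqI[of _ _ 1]) auto
  ultimately show "(\<lambda>x. x + X x) \<in> SpPlus"
    unfolding SpPlus_def connected_component_of_def by blast
  show "inv (\<lambda>x. x + X x) = (\<lambda>x. x - X x)" using full[of 1] by simp
qed

lemma sp_move_simps [simp]: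
  "Zof (sp_move g a) = g ` Zof a" "Fof (sp_move g a) = g ` Fof a" "Lof (sp_move g a) = g ` Lof a"
  "frame (sp_move g a) = (\<lambda>x. frame a (inv g x))"
  by (simp_all add: sp_move_def)

lemma sp_move_inv:
  assumes "g \<in> SpPlus_full"
  shows "sp_move g (sp_move (inv g) a) = a" "sp_move (inv g) (sp_move g a) = a"
  by (cases a, simp add: sp_move_def image_comp o_def assms inv_inv_SpPlus)+

lemma perp_image:
  assumes "g \<in> SpPlus_full"
  shows "perp (g ` S) = g ` perp S"
proof (intro equalityI subsetI)
  fix x assume "x \<in> perp (g ` S)"
  then have "inv g x \<in> perp S" by (simp add: perp_def SpPlus_inv_adjoint[OF assms])
  then have "g (inv g x) \<in> g ` perp S" by (rule imageI)
  then show "x \<in> g ` perp S" by (simp add: assms)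
next
  fix x assume "x \<in> g ` perp S"
  then show "x \<in> perp (g ` S)" by (auto simp: perp_def SpPlus_form[OF assms])
qed

text \<open>Both conditions on \<open>Z\<close>, to be Lagrangian and to meet \<open>H'\<^sub>+\<close> in \<open>0\<close>, are expressed by the form and by \<open>H'\<^sub>+\<close>.\<close>

lemma framed_move:
  assumes g: "g \<in> SpPlus_full" and fr: "framed Z \<phi>"
  shows "framed (g ` Z) (\<lambda>x. \<phi> (inv g x))"
proof -
  interpret g: Vector_Spaces.linear hscale hscale g by (rule SpPlus_linear[OF g])
  note lc = framed_complement[OF fr]
  have "hp.subspace (g ` Z)"
    using lagrangian_complement_subspace[OF lc] by (rule g.subspace_image)
  moreover have "perp (g ` Z) = g ` Z" unfolding perp_image[OF g] lagrangian_complement_perp[OF lc] ..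
  moreover have "g ` Z \<inter> Hplus = {0}"
  proof (intro equalityI subsetI)
    fix x assume "x \<in> g ` Z \<inter> Hplus"
    then obtain z where z: "x = g z" "z \<in> Z" "z \<in> Hplus" using SpPlus_Hplus[OF g] by blast
    then show "x \<in> {0}" using lagrangian_complement_Int[OF lc z(2,3)] by (simp add: g.zero)
  next
    fix x :: hprime assume "x \<in> {0}"
    then show "x \<in> g ` Z \<inter> Hplus"
      using hp.subspace_0[OF \<open>hp.subspace (g ` Z)\<close>] hp.subspace_0[OF Hplus_subspace] by simp
  qed
  ultimately have "lagrangian_complement (g ` Z)"
    unfolding lagrangian_complement_def lagrangian_def by blast
  then show ?thesis
    unfolding framed_def
  proof (intro conjI ballI allI)
    fix x y assume "x \<in> g ` Z" "y \<in> g ` Z"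
    then show "\<phi> (inv g (x + y)) = \<phi> (inv g x) + \<phi> (inv g y)"
      by (auto simp: SpPlus_inv_add g framed_add[OF fr])
  next
    fix c x assume "x \<in> g ` Z"
    then show "\<phi> (inv g (hscale c x)) = c *s \<phi> (inv g x)"
      by (auto simp: SpPlus_inv_scale g framed_scale[OF fr])
  next
    fix x show "x \<notin> g ` Z \<longrightarrow> \<phi> (inv g x) = 0"
    proof
      assume "x \<notin> g ` Z"
      then have "inv g x \<notin> Z" using SpPlus_inv(1)[OF g, of x] by (metis imageI)
      then show "\<phi> (inv g x) = 0" using fr unfolding framed_def by blast
    qed
  next
    have "(\<lambda>x. \<phi> (inv g x)) ` g ` Z = \<phi> ` Z" by (simp add: image_comp o_def g)
    then show "(\<lambda>x. \<phi> (inv g x)) ` g ` Z = UNIV" using fr unfolding framed_def by simp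
  qed
qed

context polarized_torus
begin

text \<open>The conjugation used for standard points is defined by pairings with elements of \<open>H'\<^sub>+\<close>, hence commutes with \<open>g\<close>.\<close>

lemma sp_move_standard_point:
  assumes g: "g \<in> SpPlus_full" and fr: "framed Z \<phi>"
  shows "sp_move g (standard_point Z \<phi>) = standard_point (g ` Z) (\<lambda>x. \<phi> (inv g x))"
proof -
  have conj: "conj_plus (g ` Z) (\<lambda>x. \<phi> (inv g x)) w = g (conj_plus Z \<phi> w)" for w
  proof (rule conj_plus_unique[OF framed_move[OF g fr], symmetric])
    show "g (conj_plus Z \<phi> w) \<in> Hplus" using conj_plus_Hplus[OF fr] by (simp add: SpPlus_Hplus g)
    fix z assume "z \<in> g ` Z"
    then obtain z' where "z = g z'" "z' \<in> Z" by blast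
    then show "hform (g (conj_plus Z \<phi> w)) z = of_real pi * B w (\<phi> (inv g z))"
      by (simp add: SpPlus_form g conj_plus_pairing[OF fr])
  qed
  have kernel: "g ` frame_kernel Z \<phi> = frame_kernel (g ` Z) (\<lambda>x. \<phi> (inv g x))"
    unfolding frame_kernel_def by (auto simp: g)
  have real: "g (real_point Z \<phi> z) = real_point (g ` Z) (\<lambda>x. \<phi> (inv g x)) (g z)" for z
    unfolding conj SpPlus_add[OF g] by (simp add: g)
  have lattice: "g ` lattice_preimage Z \<phi> = lattice_preimage (g ` Z) (\<lambda>x. \<phi> (inv g x))"
  proof (intro equalityI subsetI)
    fix x assume "x \<in> g ` lattice_preimage Z \<phi>"
    then obtain z where z: "x = g (real_point Z \<phi> z)" "z \<in> Z" "\<phi> z \<in> \<Lambda>" by blast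
    have "\<phi> (inv g (g z)) \<in> \<Lambda>" using z(3) by (simp add: g)
    then show "x \<in> lattice_preimage (g ` Z) (\<lambda>x. \<phi> (inv g x))"
      using z(2) unfolding z(1) real by blast
  next
    fix x assume "x \<in> lattice_preimage (g ` Z) (\<lambda>x. \<phi> (inv g x))"
    then obtain z where z: "x = real_point (g ` Z) (\<lambda>x. \<phi> (inv g x)) (g z)" "z \<in> Z" "\<phi> (inv g (g z)) \<in> \<Lambda>"
      by blast
    have "\<phi> z \<in> \<Lambda>" using z(3) by (simp add: g)
    then have "real_point Z \<phi> z \<in> lattice_preimage Z \<phi>" using z(2) by blast
    then show "x \<in> g ` lattice_preimage Z \<phi>" unfolding z(1) real[symmetric] by (rule imageI)
  qed
  show ?thesis
    unfolding standard_point_def sp_move_def extpt.select_convs kernel lattice ..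
qed

lemma sp_move_in_Sp:
  assumes g: "g \<in> SpPlus_full" and a: "a \<in> Sp \<Lambda> B"
  shows "sp_move g a \<in> Sp \<Lambda> B"
proof -
  have "sp_move g a = sp_move g (standard_point (Zof a) (frame a))"
    using Sp_eq_standard_point[OF a] by simp
  then show ?thesis
    unfolding sp_move_standard_point[OF g Sp_framed[OF a]]
    using standard_point_in_Sp[OF framed_move[OF g Sp_framed[OF a]]] by simp
qed

end

section \<open>Transitivity of \<open>Sp\<^sup>+(H')\<close> on \<open>Sp(X,\<Theta>)\<close>\<close>

text \<open>Take \<open>X = p' - p\<close>, the difference of the projections to \<open>Z'\<close> and \<open>Z\<close> along \<open>H'\<^sub>+\<close>. It vanishes on \<open>H'\<^sub>+\<close> and has
  values in \<open>H'\<^sub>+\<close>, so \<open>X\<^sup>2 = 0\<close>. It is skew because \<open>Z\<close>, \<open>Z'\<close> and \<open>H'\<^sub>+\<close> are isotropic. On \<open>Z\<close> the map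
  \<open>1 + X\<close> is \<open>p'\<close>.\<close>

lemma move_complement:
  assumes Z: "lagrangian_complement Z" and Z': "lagrangian_complement Z'"
  shows "\<exists>g\<in>SpPlus. g ` Z = Z'"
proof -
  let ?p = "proj_along_Hplus Z" and ?p' = "proj_along_Hplus Z'"
  let ?X = "\<lambda>x. ?p' x - ?p x"
  interpret p: Vector_Spaces.linear hscale hscale ?p by (rule proj_linear[OF Z])
  interpret p': Vector_Spaces.linear hscale hscale ?p' by (rule proj_linear[OF Z'])
  have XH: "?X x \<in> Hplus" for x
  proof -
    have "?X x = (x - ?p x) - (x - ?p' x)" by simp
    then show ?thesis using hp.subspace_diff[OF Hplus_subspace proj_diff[OF Z, of x] proj_diff[OF Z', of x]] by simp
  qed
  have X0: "?X h = 0" if "h \<in> Hplus" for h using that by (simp add: proj_Hplus Z Z')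
  have lin: "Vector_Spaces.linear hscale hscale ?X"
    by unfold_locales (simp_all add: p.add p'.add p.scale p'.scale hp.scale_right_diff_distrib)
  have skew: "hform (?X x) y = - hform x (?X y)" for x y
  proof -
    have "hform (?X x) (y - ?p y) = 0" by (rule hform_Hplus[OF XH proj_diff[OF Z]])
    then have 1: "hform (?X x) y = hform (?X x) (?p y)" by (simp add: hform_diff_right)
    have "hform (x - ?p x) (?X y) = 0" by (rule hform_Hplus[OF proj_diff[OF Z] XH])
    then have 2: "hform x (?X y) = hform (?p x) (?X y)" by (simp add: hform_diff_left)
    have "hform (?X x) (?X y) = 0" by (rule hform_Hplus[OF XH XH])
    moreover have "hform (?p x) (?p y) = 0" "hform (?p' x) (?p' y) = 0"
      by (intro lagrangian_complement_isotropic[OF Z] lagrangian_complement_isotropic[OF Z'] proj_mem[OF Z] proj_mem[OF Z'])+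
    ultimately show ?thesis unfolding 1 2 by (simp add: hform_diff_left hform_diff_right)
  qed
  have inv: "inv (\<lambda>x. x + ?X x) = (\<lambda>x. x - ?X x)" and mem: "(\<lambda>x. x + ?X x) \<in> SpPlus"
    using unipotent_in_SpPlus[OF lin skew X0[OF XH] XH] by blast+
  have "(\<lambda>x. x + ?X x) ` Z = Z'"
  proof (intro equalityI subsetI)
    fix y assume "y \<in> (\<lambda>x. x + ?X x) ` Z"
    then obtain z where "z \<in> Z" "y = z + ?X z" by blast
    then have "y = ?p' z" by (simp add: proj_on[OF Z])
    then show "y \<in> Z'" using proj_mem[OF Z', of z] by simp
  next
    fix y assume y: "y \<in> Z'"
    have "y = ?p y + ?X (?p y)"
    proof -
      have "?p' (?p y) = y"
        by (rule proj_unique[OF Z' y]) (rule proj_diff'[OF Z])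
      then show ?thesis by (simp add: proj_on[OF Z proj_mem[OF Z]])
    qed
    then show "y \<in> (\<lambda>x. x + ?X x) ` Z" using proj_mem[OF Z, of y] by (rule image_eqI)
  qed
  then show ?thesis using mem by blast
qed

text \<open>Let \<open>h\<^sub>j \<in> H'\<^sub>+\<close> represent the \<open>j\<close>-th component of \<open>\<phi> - \<psi>\<close> on \<open>Z\<close>, and let \<open>X\<close> be the quadratic element
  \<open>\<Sum>\<^sub>j h\<^sub>j \<sigma>\<^sub>j\<close> of the Lie algebra. On \<open>Z\<close> it is \<open>z \<mapsto> \<Sum>\<^sub>j \<langle>h\<^sub>j, z\<rangle> \<sigma>\<^sub>j\<close>, so it preserves \<open>Z\<close> and
  \<open>\<phi> \<circ> X = \<phi> - \<psi>\<close> there. It squares to zero because both frames agree on the \<open>\<sigma>\<^sub>j\<close>, so that the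
  \<open>h\<^sub>j\<close> and \<open>\<sigma>\<^sub>j\<close> are pairwise orthogonal.\<close>

lemma move_frame_common_section:
  fixes \<phi> \<psi> :: "hprime \<Rightarrow> complex^'g::finite"
  assumes \<phi>: "framed Z \<phi>" and \<psi>: "framed Z \<psi>"
    and \<sigma>: "\<And>j. \<sigma> j \<in> Z" "\<And>j. \<phi> (\<sigma> j) = axis j 1" "\<And>j. \<psi> (\<sigma> j) = axis j 1"
  shows "\<exists>g\<in>SpPlus. g ` Z = Z \<and> (\<forall>x. \<phi> (inv g x) = \<psi> x)"
proof -
  note Z = framed_complement[OF \<phi>] and sub = framed_subspace[OF \<phi>]
  have "\<exists>h. h \<in> Hplus \<and> (\<forall>z\<in>Z. hform h z = (\<phi> z - \<psi> z) $ j)" for j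
  proof (rule functional_represented[OF Z, where f = "\<lambda>z. (\<phi> z - \<psi> z) $ j"])
    show "(\<phi> (x + y) - \<psi> (x + y)) $ j = (\<phi> x - \<psi> x) $ j + (\<phi> y - \<psi> y) $ j" if "x \<in> Z" "y \<in> Z" for x y
      unfolding framed_add[OF \<phi> that] framed_add[OF \<psi> that] by simp
    show "(\<phi> (hscale c x) - \<psi> (hscale c x)) $ j = c * (\<phi> x - \<psi> x) $ j" if "x \<in> Z" for c x
      unfolding framed_scale[OF \<phi> that] framed_scale[OF \<psi> that] by (simp add: right_diff_distrib)
  qed blast
  then have "\<exists>h. \<forall>j. h j \<in> Hplus \<and> (\<forall>z\<in>Z. hform (h j) z = (\<phi> z - \<psi> z) $ j)" by (intro choice allI)
  then obtain h where "\<forall>j. h j \<in> Hplus \<and> (\<forall>z\<in>Z. hform (h j) z = (\<phi> z - \<psi> z) $ j)" by (rule exE)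
  then have hH: "h j \<in> Hplus" and h: "z \<in> Z \<Longrightarrow> hform (h j) z = (\<phi> z - \<psi> z) $ j" for j z by blast+
  let ?X = "\<lambda>x. \<Sum>j\<in>UNIV. hscale (hform (h j) x) (\<sigma> j) + hscale (hform (\<sigma> j) x) (h j)"
  have h\<sigma>: "hform (h i) (\<sigma> j) = 0" for i j unfolding h[OF \<sigma>(1)] \<sigma>(2,3) by simp
  have \<sigma>h: "hform (\<sigma> j) (h i) = 0" for i j using hform_antisym[of "\<sigma> j" "h i"] h\<sigma> by simp
  have \<sigma>\<sigma>: "hform (\<sigma> i) (\<sigma> j) = 0" for i j by (rule lagrangian_complement_isotropic[OF Z \<sigma>(1) \<sigma>(1)])
  have hh: "hform (h i) (h j) = 0" for i j by (rule hform_Hplus[OF hH hH])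
  have lin: "Vector_Spaces.linear hscale hscale ?X"
  proof unfold_locales
    show "?X (x + y) = ?X x + ?X y" for x y
      unfolding sum.distrib[symmetric]
      by (intro sum.cong refl) (simp add: hform_add_right hp.scale_left_distrib algebra_simps)
    show "?X (hscale c x) = hscale c (?X x)" for c x
      unfolding hp.scale_sum_right
      by (intro sum.cong refl) (simp add: hform_scale_right hp.scale_right_distrib)
  qed
  have skew: "hform (?X x) y = - hform x (?X y)" for x y
  proof -
    have "hform (?X x) y = (\<Sum>j\<in>UNIV. hform (h j) x * hform (\<sigma> j) y + hform (\<sigma> j) x * hform (h j) y)"
      by (simp add: hform_sum_left hform_add_left hform_scale_left)
    also have "\<dots> = (\<Sum>j\<in>UNIV. - (hform (h j) y * hform x (\<sigma> j) + hform (\<sigma> j) y * hform x (h j)))"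
    proof (intro sum.cong refl)
      fix j show "hform (h j) x * hform (\<sigma> j) y + hform (\<sigma> j) x * hform (h j) y
          = - (hform (h j) y * hform x (\<sigma> j) + hform (\<sigma> j) y * hform x (h j))"
        unfolding hform_antisym[of x "\<sigma> j"] hform_antisym[of x "h j"] by (simp add: algebra_simps)
    qed
    also have "\<dots> = - hform x (?X y)"
      unfolding sum_negf by (simp only: hform_sum_right hform_add_right hform_scale_right)
    finally show ?thesis .
  qed
  have "hform (h i) (?X x) = 0" "hform (\<sigma> i) (?X x) = 0" for i x
    by (simp_all add: hform_sum_right hform_add_right hform_scale_right h\<sigma> \<sigma>h \<sigma>\<sigma> hh)
  then have square: "?X (?X x) = 0" for x by simp
  have plus: "?X k \<in> Hplus" if "k \<in> Hplus" for k
    by (intro hp.subspace_sum[OF Hplus_subspace])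
       (simp add: hform_Hplus[OF hH that] hp.subspace_scale[OF Hplus_subspace hH])
  let ?g = "\<lambda>x. x + ?X x"
  have g: "?g \<in> SpPlus" and ig: "inv ?g = (\<lambda>x. x - ?X x)"
    using unipotent_in_SpPlus[OF lin skew square plus] by blast+
  note gf = SpPlus_subset_full[OF g]
  have XZ: "?X z = (\<Sum>j\<in>UNIV. hscale (hform (h j) z) (\<sigma> j))" if "z \<in> Z" for z
    by (intro sum.cong refl) (simp add: lagrangian_complement_isotropic[OF Z \<sigma>(1) that])
  have XZ': "?X z \<in> Z" if "z \<in> Z" for z
    unfolding XZ[OF that] by (intro hp.subspace_sum[OF sub] hp.subspace_scale[OF sub] \<sigma>(1))
  have iZ: "inv ?g z \<in> Z" if "z \<in> Z" for z
    unfolding ig by (rule hp.subspace_diff[OF sub that XZ'[OF that]])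
  have gZ: "?g z \<in> Z" if "z \<in> Z" for z by (rule hp.subspace_add[OF sub that XZ'[OF that]])
  have image: "?g ` Z = Z"
  proof (intro equalityI subsetI)
    fix x assume "x \<in> ?g ` Z"
    then show "x \<in> Z" using gZ by blast
  next
    fix x assume "x \<in> Z"
    then show "x \<in> ?g ` Z" using image_eqI[of x ?g "inv ?g x" Z, OF SpPlus_inv(1)[OF gf, symmetric] iZ] by blast
  qed
  have "\<phi> (inv ?g x) = \<psi> x" for x
  proof (cases "x \<in> Z")
    case True
    have "\<phi> (inv ?g x) = \<phi> x - \<phi> (?X x)" unfolding ig by (rule framed_diff[OF \<phi> True XZ'[OF True]])
    also have "\<phi> (?X x) = (\<Sum>j\<in>UNIV. hform (h j) x *s axis j 1)"
      unfolding XZ[OF True]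
      by (subst framed_sum[OF \<phi>]) (simp_all add: framed_scale[OF \<phi>] \<sigma> hp.subspace_scale[OF sub])
    also have "\<dots> = (\<Sum>j\<in>UNIV. (\<phi> x - \<psi> x) $ j *s axis j 1)" unfolding h[OF True] ..
    also have "\<dots> = \<phi> x - \<psi> x" by (rule basis_expansion)
    finally show ?thesis by simp
  next
    case False
    have "inv ?g x \<notin> Z"
    proof
      assume "inv ?g x \<in> Z"
      from gZ[OF this] show False using SpPlus_inv(1)[OF gf, of x] False by simp
    qed
    then show ?thesis using \<phi> \<psi> False unfolding framed_def by simp
  qed
  then show ?thesis using g image by blast
qed

text \<open>Two frames of \<open>Z\<close> need not have a common section. But the section of \<open>\<phi>\<close> can be corrected by
  elements of \<open>ker \<phi>\<close> with poles of high order, so as to become independent of the section of \<open>\<psi>\<close>;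
  then a third frame has a common section with each of them.\<close>

lemma intermediate_frame:
  fixes \<phi> \<psi> :: "hprime \<Rightarrow> complex^'g::finite"
  assumes \<phi>: "framed Z \<phi>" and \<psi>: "framed Z \<psi>"
  shows "\<exists>\<rho> \<sigma> \<tau>. framed Z \<rho> \<and> (\<forall>j. \<sigma> j \<in> Z \<and> \<psi> (\<sigma> j) = axis j 1 \<and> \<rho> (\<sigma> j) = axis j 1) \<and>
    (\<forall>j. \<tau> j \<in> Z \<and> \<phi> (\<tau> j) = axis j 1 \<and> \<rho> (\<tau> j) = axis j 1)"
proof -
  note Z = framed_complement[OF \<phi>] and sub = framed_subspace[OF \<phi>]
  obtain s' where s': "\<forall>v. s' v \<in> Z \<and> \<phi> (s' v) = v" using framed_section[OF \<phi>] by (rule exE)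
  obtain t' where t': "\<forall>v. t' v \<in> Z \<and> \<psi> (t' v) = v" using framed_section[OF \<psi>] by (rule exE)
  define s where "s j = s' (axis j 1)" for j
  define \<sigma> where "\<sigma> j = t' (axis j 1)" for j
  have s: "s j \<in> Z" "\<phi> (s j) = axis j 1" for j using s' by (simp_all add: s_def)
  have \<sigma>: "\<sigma> j \<in> Z" "\<psi> (\<sigma> j) = axis j 1" for j using t' by (simp_all add: \<sigma>_def)
  let ?K = "(\<Union>j. {k::nat. hcoeff (s j) (- int k - 1) \<noteq> 0}) \<union> (\<Union>j. {k::nat. hcoeff (\<sigma> j) (- int k - 1) \<noteq> 0})"
  have "finite ?K" by (intro finite_UnI finite_UN_I finite_polar_support) simp_all
  then obtain N where N: "?K \<subseteq> {..<N}" using finite_nat_bounded[of ?K] by blast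
  have sN: "hcoeff (s j) (- int k - 1) = 0" if "k \<ge> N" for j k
  proof (rule ccontr)
    assume "hcoeff (s j) (- int k - 1) \<noteq> 0"
    then have "k \<in> ?K" by blast
    then show False using N that by fastforce
  qed
  have \<sigma>N: "hcoeff (\<sigma> j) (- int k - 1) = 0" if "k \<ge> N" for j k
  proof (rule ccontr)
    assume "hcoeff (\<sigma> j) (- int k - 1) \<noteq> 0"
    then have "k \<in> ?K" by blast
    then show False using N that by fastforce
  qed
  obtain e :: "'g \<Rightarrow> nat" where e: "inj e" using finite_imp_inj_to_nat_seg[of "UNIV :: 'g set"] by auto
  \<comment> \<open>Coefficients of pole order so high that they vanish on all \<open>s\<^sub>j\<close> and \<open>\<sigma>\<^sub>j\<close>.\<close>
  define c where "c j x = hcoeff x (- int (N + e j) - 1)" for j :: 'g and x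
  define z where "z j = proj_along_Hplus Z (hb (- int (N + e j) - 1))" for j :: 'g
  have zZ: "z j \<in> Z" for j unfolding z_def by (rule proj_mem[OF Z])
  have cz: "c i (z j) = (if i = j then 1 else 0)" for i j
  proof -
    have "hcoeff (z j - hb (- int (N + e j) - 1)) (- int (N + e i) - 1) = 0"
      using proj_diff'[OF Z, of "hb (- int (N + e j) - 1)"] unfolding z_def Hplus_iff_nat by blast
    then have "c i (z j) = hcoeff (hb (- int (N + e j) - 1)) (- int (N + e i) - 1)"
      unfolding c_def by simp
    then show ?thesis by (simp add: inj_eq[OF e])
  qed
  have cs: "c i (s j) = 0" "c i (\<sigma> j) = 0" for i j unfolding c_def by (rule sN, simp, rule \<sigma>N, simp)
  define \<tau> where "\<tau> j = z j - (\<Sum>i\<in>UNIV. hscale (\<phi> (z j) $ i) (s i)) + s j" for j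
  have sumZ: "(\<Sum>i\<in>UNIV. hscale (v $ i) (s i)) \<in> Z" for v :: "complex^'g"
    by (intro hp.subspace_sum[OF sub] hp.subspace_scale[OF sub] s)
  have \<phi>sum: "\<phi> (\<Sum>i\<in>UNIV. hscale (v $ i) (s i)) = v" for v :: "complex^'g"
  proof -
    have "\<phi> (\<Sum>i\<in>UNIV. hscale (v $ i) (s i)) = (\<Sum>i\<in>UNIV. v $ i *s axis i 1)"
      by (subst framed_sum[OF \<phi>]) (simp_all add: framed_scale[OF \<phi>] s hp.subspace_scale[OF sub])
    then show ?thesis by (simp only: basis_expansion)
  qed
  have dZ: "z j - (\<Sum>i\<in>UNIV. hscale (\<phi> (z j) $ i) (s i)) \<in> Z" for j
    by (rule hp.subspace_diff[OF sub zZ sumZ])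
  have \<tau>Z: "\<tau> j \<in> Z" for j unfolding \<tau>_def by (rule hp.subspace_add[OF sub dZ s(1)])
  have \<tau>\<phi>: "\<phi> (\<tau> j) = axis j 1" for j
    unfolding \<tau>_def framed_add[OF \<phi> dZ s(1)] framed_diff[OF \<phi> zZ sumZ] \<phi>sum s(2) by simp
  have c\<tau>: "c i (\<tau> j) = (if i = j then 1 else 0)" for i j
  proof -
    have "c i (\<tau> j) = c i (z j) - (\<Sum>l\<in>UNIV. \<phi> (z j) $ l * c i (s l)) + c i (s j)"
      unfolding \<tau>_def c_def by simp
    then show ?thesis by (simp add: cs cz)
  qed
  \<comment> \<open>Correcting \<open>\<psi>\<close> by these coefficients changes the values on the \<open>\<tau>\<^sub>j\<close> to the unit vectors, but not those on
    the \<open>\<sigma>\<^sub>j\<close>.\<close>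
  define \<rho> where "\<rho> x = (if x \<in> Z then \<psi> x + (\<Sum>j\<in>UNIV. c j x *s (axis j 1 - \<psi> (\<tau> j))) else 0)" for x
  have \<rho>\<sigma>: "\<rho> (\<sigma> j) = axis j 1" for j
    unfolding \<rho>_def by (simp add: \<sigma> cs)
  have \<rho>\<tau>: "\<rho> (\<tau> j) = axis j 1" for j
  proof -
    have "(\<Sum>i\<in>UNIV. c i (\<tau> j) *s (axis i 1 - \<psi> (\<tau> i))) = (\<Sum>i\<in>UNIV. if i = j then axis i 1 - \<psi> (\<tau> i) else 0)"
      by (intro sum.cong refl) (simp add: c\<tau>)
    then show ?thesis unfolding \<rho>_def by (simp add: \<tau>Z)
  qed
  have cadd: "c j (x + y) = c j x + c j y" and cscale: "c j (hscale b x) = b * c j x" for j x y b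
    by (simp_all add: c_def)
  have \<rho>add: "\<rho> (x + y) = \<rho> x + \<rho> y" if "x \<in> Z" "y \<in> Z" for x y
    using that hp.subspace_add[OF sub that]
    by (simp add: \<rho>_def framed_add[OF \<psi> that] cadd vec_eq_iff algebra_simps sum.distrib sum_subtractf)
  have \<rho>scale: "\<rho> (hscale b x) = b *s \<rho> x" if "x \<in> Z" for b x
    using that hp.subspace_scale[OF sub that]
    by (simp add: \<rho>_def framed_scale[OF \<psi> that] cscale vec_eq_iff sum_distrib_left algebra_simps)
  have "framed Z \<rho>"
    unfolding framed_def
  proof (intro conjI ballI allI Z \<rho>add \<rho>scale)
    show "x \<notin> Z \<longrightarrow> \<rho> x = 0" for x by (simp add: \<rho>_def)
    show "\<rho> ` Z = UNIV"
    proof (intro equalityI subset_UNIV subsetI)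
      fix v :: "complex^'g"
      have sum: "\<rho> (\<Sum>i\<in>I. hscale (v $ i) (\<sigma> i)) = (\<Sum>i\<in>I. v $ i *s axis i 1) \<and> (\<Sum>i\<in>I. hscale (v $ i) (\<sigma> i)) \<in> Z" for I
      proof (induction I rule: infinite_finite_induct)
        case (insert i I)
        have "hscale (v $ i) (\<sigma> i) \<in> Z" by (rule hp.subspace_scale[OF sub \<sigma>(1)])
        then show ?case using insert
          by (simp add: \<rho>add \<rho>scale \<sigma>(1) \<rho>\<sigma> hp.subspace_add[OF sub])
      qed (simp_all add: hp.subspace_0[OF sub] \<rho>_def framed_0[OF \<psi>] c_def)
      have "\<rho> (\<Sum>i\<in>UNIV. hscale (v $ i) (\<sigma> i)) = v"
        using conjunct1[OF sum[of UNIV]] unfolding basis_expansion .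
      then show "v \<in> \<rho> ` Z"
        using conjunct2[OF sum[of UNIV]] by (intro image_eqI[of v \<rho> "\<Sum>i\<in>UNIV. hscale (v $ i) (\<sigma> i)" Z]) simp_all
    qed
  qed
  then show ?thesis using \<sigma> \<rho>\<sigma> \<tau>Z \<tau>\<phi> \<rho>\<tau> by blast
qed

context polarized_torus
begin

text \<open>Transitivity of the group, in the form in which it is used: first \<open>Z\<close> is moved to the right place, then the
  frame is changed in two steps, through a frame that has a common section with the old and with the new one.\<close>

lemma SpPlus_invariant_constant:
  assumes inv: "\<And>g a. g \<in> SpPlus \<Longrightarrow> a \<in> Sp \<Lambda> B \<Longrightarrow> c (sp_move g a) = c a"
    and a: "a \<in> Sp \<Lambda> B" and b: "b \<in> Sp \<Lambda> B"
  shows "c a = c b"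
proof -
  obtain g where g: "g \<in> SpPlus" "g ` Zof a = Zof b"
    using move_complement[OF framed_complement[OF Sp_framed[OF a]] framed_complement[OF Sp_framed[OF b]]] by blast
  define a' where "a' = sp_move g a"
  have a': "a' \<in> Sp \<Lambda> B" "Zof a' = Zof b" "c a' = c a"
    unfolding a'_def by (simp_all add: sp_move_in_Sp[OF SpPlus_subset_full[OF g(1)] a] g inv a)
  have step: "c x = c y"
    if x: "x \<in> Sp \<Lambda> B" and y: "y \<in> Sp \<Lambda> B" "Zof x = Zof y"
      and \<sigma>: "\<forall>j. \<sigma> j \<in> Zof x \<and> frame x (\<sigma> j) = axis j 1 \<and> frame y (\<sigma> j) = axis j 1" for x y \<sigma>
  proof -
    have "framed (Zof x) (frame y)" using Sp_framed[OF y(1)] y(2) by simp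
    then obtain k where k: "k \<in> SpPlus" "k ` Zof x = Zof x" "\<forall>v. frame x (inv k v) = frame y v"
      using move_frame_common_section[OF Sp_framed[OF x], of "frame y" \<sigma>] \<sigma> by blast
    have "sp_move k x = y"
      by (rule Sp_eqI[OF sp_move_in_Sp[OF SpPlus_subset_full[OF k(1)] x] y(1)])
         (use k(2,3) y(2) in \<open>simp_all add: fun_eq_iff\<close>)
    then show ?thesis using inv[OF k(1) x] by simp
  qed
  have frb: "framed (Zof b) (frame b)" by (rule Sp_framed[OF b])
  have fra: "framed (Zof b) (frame a')" using Sp_framed[OF a'(1)] a'(2) by simp
  obtain \<rho> \<sigma> \<tau> where \<rho>: "framed (Zof b) \<rho>"
    and \<sigma>: "\<forall>j. \<sigma> j \<in> Zof b \<and> frame b (\<sigma> j) = axis j 1 \<and> \<rho> (\<sigma> j) = axis j 1"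
    and \<tau>: "\<forall>j. \<tau> j \<in> Zof b \<and> frame a' (\<tau> j) = axis j 1 \<and> \<rho> (\<tau> j) = axis j 1"
    using intermediate_frame[OF fra frb] by blast
  let ?m = "standard_point (Zof b) \<rho>"
  have m: "?m \<in> Sp \<Lambda> B" by (rule standard_point_in_Sp[OF \<rho>])
  have mZ: "Zof ?m = Zof b" "frame ?m = \<rho>" by (simp_all add: standard_point_def)
  have "c a' = c ?m" by (rule step[OF a'(1) m, of \<tau>]) (use \<tau> a'(2) mZ in simp_all)
  moreover have "c b = c ?m" by (rule step[OF b m, of \<sigma>]) (use \<sigma> mZ in simp_all)
  ultimately show ?thesis using a'(3) by simp
qed

end

section \<open>Coordinates and holomorphic functions on \<open>Sp(X,\<Theta>)\<close>\<close>

lemma topspace_sp_topology [simp]: "topspace (sp_topology M) = M"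
  by (simp add: sp_topology_def topspace_pullback_topology)

lemma openin_sp_subset: "openin (sp_topology M) U \<Longrightarrow> U \<subseteq> M"
  using openin_subset[of "sp_topology M" U] by simp

lemma openin_whole: "openin (sp_topology M) M"
  using openin_topspace[of "sp_topology M"] by simp

text \<open>The complex lines along which holomorphic functions are tested.\<close>

definition line_in :: "('g::finite) extpt set \<Rightarrow> real \<Rightarrow> (complex \<Rightarrow> 'g extpt) \<Rightarrow> bool" where
  "line_in U r \<gamma> \<longleftrightarrow> r > 0 \<and> (\<exists>a y. \<forall>z\<in>ball 0 r. \<gamma> z \<in> U \<and>
     coords (\<gamma> z) = ((\<lambda>i. fst a i + z * fst y i), (\<lambda>k. snd a k + z *s snd y k)))"

lemma hol_iff:
  "hol M U f \<longleftrightarrow> openin (sp_topology M) U \<and> continuous_map (subtopology (sp_topology M) U) euclidean f \<and>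
     (\<forall>\<gamma> r. line_in U r \<gamma> \<longrightarrow> (\<lambda>z. f (\<gamma> z)) holomorphic_on ball 0 r)"
  unfolding hol_def line_in_def by blast

lemma line_in_mono: "line_in U r \<gamma> \<Longrightarrow> U \<subseteq> V \<Longrightarrow> line_in V r \<gamma>"
  unfolding line_in_def by blast

lemma line_in_mem: "line_in U r \<gamma> \<Longrightarrow> z \<in> ball 0 r \<Longrightarrow> \<gamma> z \<in> U"
  unfolding line_in_def by blast

lemma hol_openin: "hol M U f \<Longrightarrow> openin (sp_topology M) U"
  by (simp add: hol_iff)

lemma hol_const: "openin (sp_topology M) U \<Longrightarrow> hol M U (\<lambda>_. c)"
  by (simp add: hol_iff)

lemma hol_add: "hol M U f \<Longrightarrow> hol M U g \<Longrightarrow> hol M U (\<lambda>x. f x + g x)"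
  unfolding hol_iff by (auto simp: continuous_map_atin intro!: tendsto_add holomorphic_intros)

lemma hol_mult: "hol M U f \<Longrightarrow> hol M U g \<Longrightarrow> hol M U (\<lambda>x. f x * g x)"
  unfolding hol_iff by (auto simp: continuous_map_atin intro!: tendsto_mult holomorphic_intros)

lemma hol_divide:
  assumes f: "hol M U f" and g: "hol M U g" and nz: "\<And>x. x \<in> U \<Longrightarrow> g x \<noteq> 0"
  shows "hol M U (\<lambda>x. f x / g x)"
  unfolding hol_iff
proof (intro conjI allI impI)
  show "openin (sp_topology M) U" by (rule hol_openin[OF f])
  show "continuous_map (subtopology (sp_topology M) U) euclidean (\<lambda>x. f x / g x)"
    using f g nz unfolding hol_iff by (auto simp: continuous_map_atin intro!: tendsto_divide)
  fix \<gamma> r assume l: "line_in U r \<gamma>"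
  have "g (\<gamma> z) \<noteq> 0" if "z \<in> ball 0 r" for z by (rule nz[OF line_in_mem[OF l that]])
  moreover have "(\<lambda>z. f (\<gamma> z)) holomorphic_on ball 0 r" "(\<lambda>z. g (\<gamma> z)) holomorphic_on ball 0 r"
    using f g l unfolding hol_iff by blast+
  ultimately show "(\<lambda>z. f (\<gamma> z) / g (\<gamma> z)) holomorphic_on ball 0 r"
    by (intro holomorphic_on_divide)
qed

lemma hol_sum:
  "openin (sp_topology M) U \<Longrightarrow> (\<And>i. i \<in> I \<Longrightarrow> hol M U (f i)) \<Longrightarrow> hol M U (\<lambda>x. \<Sum>i\<in>I. f i x)"
  by (induction I rule: infinite_finite_induct) (auto intro: hol_const hol_add)

lemma hol_prod:
  "openin (sp_topology M) U \<Longrightarrow> (\<And>i. i \<in> I \<Longrightarrow> hol M U (f i)) \<Longrightarrow> hol M U (\<lambda>x. \<Prod>i\<in>I. f i x)"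
  by (induction I rule: infinite_finite_induct) (auto intro: hol_const hol_mult)

lemma hol_uminus: "hol M U f \<Longrightarrow> hol M U (\<lambda>x. - f x)"
  using hol_mult[OF hol_const[OF hol_openin], of M U f f "- 1"] by simp

lemma hol_diff: "hol M U f \<Longrightarrow> hol M U g \<Longrightarrow> hol M U (\<lambda>x. f x - g x)"
  using hol_add[OF _ hol_uminus, of M U f g] by simp

lemma hol_mono:
  assumes "hol M U f" "openin (sp_topology M) V" "V \<subseteq> U"
  shows "hol M V f"
  unfolding hol_iff
proof (intro conjI allI impI assms(2))
  have "continuous_map (subtopology (sp_topology M) U) euclidean f"
    using assms(1) unfolding hol_iff by (elim conjE)
  then have "continuous_map (subtopology (subtopology (sp_topology M) U) V) euclidean f"
    by (rule continuous_map_from_subtopology)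
  moreover have "U \<inter> V = V" using assms(3) by blast
  ultimately show "continuous_map (subtopology (sp_topology M) V) euclidean f"
    unfolding subtopology_subtopology by simp
  fix \<gamma> r assume "line_in V r \<gamma>"
  then have "line_in U r \<gamma>" using assms(3) by (rule line_in_mono)
  then show "(\<lambda>z. f (\<gamma> z)) holomorphic_on ball 0 r" using assms(1) unfolding hol_iff by blast
qed

lemma hol_nonzero_open:
  assumes "hol M U f"
  shows "openin (sp_topology M) {x \<in> U. f x \<noteq> 0}"
proof -
  have U: "openin (sp_topology M) U" and c: "continuous_map (subtopology (sp_topology M) U) euclidean f"
    using assms unfolding hol_iff by blast+
  have "openin (subtopology (sp_topology M) U) {x \<in> topspace (subtopology (sp_topology M) U). f x \<in> - {0}}"
    by (rule openin_continuous_map_preimage[OF c]) (simp add: open_Compl)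
  moreover have "{x \<in> topspace (subtopology (sp_topology M) U). f x \<in> - {0}} = {x \<in> U. f x \<noteq> 0}"
    using openin_sp_subset[OF U] by auto
  ultimately have "openin (subtopology (sp_topology M) U) {x \<in> U. f x \<noteq> 0}" by simp
  then show ?thesis using U by (rule openin_trans_full)
qed

text \<open>Continuous functions that are affine along lines, such as the coordinates. They are singled out because a map
  with affine coordinates sends lines to lines, so that holomorphic functions can be pulled back along it.\<close>

definition affine_fun :: "('g::finite) extpt set \<Rightarrow> ('g extpt \<Rightarrow> complex) \<Rightarrow> bool" where
  "affine_fun M f \<longleftrightarrow> continuous_map (sp_topology M) euclidean f \<and>
     (\<forall>\<gamma> r. line_in M r \<gamma> \<longrightarrow> (\<exists>\<alpha> \<beta>. \<forall>z\<in>ball 0 r. f (\<gamma> z) = \<alpha> + z * \<beta>))"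

lemma affine_fun_const: "affine_fun M (\<lambda>_. c)"
  unfolding affine_fun_def
proof (intro conjI allI impI)
  show "\<exists>\<alpha> \<beta>. \<forall>z\<in>ball 0 r. c = \<alpha> + z * \<beta>" for r :: real
    by (rule exI[of _ c], rule exI[of _ 0]) simp
qed simp

lemma affine_fun_add:
  assumes "affine_fun M f" "affine_fun M g"
  shows "affine_fun M (\<lambda>x. f x + g x)"
  unfolding affine_fun_def
proof (intro conjI allI impI)
  show "continuous_map (sp_topology M) euclidean (\<lambda>x. f x + g x)"
    using assms unfolding affine_fun_def by (auto simp: continuous_map_atin intro!: tendsto_add)
  fix \<gamma> r assume l: "line_in M r \<gamma>"
  obtain \<alpha> \<beta> where 1: "\<forall>z\<in>ball 0 r. f (\<gamma> z) = \<alpha> + z * \<beta>" using assms(1) l unfolding affine_fun_def by blast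
  obtain \<alpha>' \<beta>' where 2: "\<forall>z\<in>ball 0 r. g (\<gamma> z) = \<alpha>' + z * \<beta>'" using assms(2) l unfolding affine_fun_def by blast
  show "\<exists>\<alpha> \<beta>. \<forall>z\<in>ball 0 r. f (\<gamma> z) + g (\<gamma> z) = \<alpha> + z * \<beta>"
    by (rule exI[of _ "\<alpha> + \<alpha>'"], rule exI[of _ "\<beta> + \<beta>'"]) (use 1 2 in \<open>simp add: algebra_simps\<close>)
qed

lemma affine_fun_scale:
  assumes "affine_fun M f"
  shows "affine_fun M (\<lambda>x. c * f x)"
  unfolding affine_fun_def
proof (intro conjI allI impI)
  show "continuous_map (sp_topology M) euclidean (\<lambda>x. c * f x)"
    using assms unfolding affine_fun_def by (auto simp: continuous_map_atin intro!: tendsto_mult)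
  fix \<gamma> r assume l: "line_in M r \<gamma>"
  obtain \<alpha> \<beta> where 1: "\<forall>z\<in>ball 0 r. f (\<gamma> z) = \<alpha> + z * \<beta>" using assms(1) l unfolding affine_fun_def by blast
  show "\<exists>\<alpha> \<beta>. \<forall>z\<in>ball 0 r. c * f (\<gamma> z) = \<alpha> + z * \<beta>"
    by (rule exI[of _ "c * \<alpha>"], rule exI[of _ "c * \<beta>"]) (use 1 in \<open>simp add: algebra_simps\<close>)
qed

lemma affine_fun_sum: "(\<And>i. i \<in> I \<Longrightarrow> affine_fun M (f i)) \<Longrightarrow> affine_fun M (\<lambda>x. \<Sum>i\<in>I. f i x)"
  by (induction I rule: infinite_finite_induct) (auto intro: affine_fun_const affine_fun_add)

lemma affine_fun_cong:
  assumes f: "affine_fun M f" and eq: "\<And>x. x \<in> M \<Longrightarrow> g x = f x"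
  shows "affine_fun M g"
  unfolding affine_fun_def
proof (intro conjI allI impI)
  have "continuous_map (sp_topology M) euclidean f" using f unfolding affine_fun_def by blast
  then show "continuous_map (sp_topology M) euclidean g"
    by (rule continuous_map_eq) (simp add: eq)
  fix \<gamma> r assume l: "line_in M r \<gamma>"
  then obtain \<alpha> \<beta> where "\<forall>z\<in>ball 0 r. f (\<gamma> z) = \<alpha> + z * \<beta>" using f unfolding affine_fun_def by blast
  then have "\<forall>z\<in>ball 0 r. g (\<gamma> z) = \<alpha> + z * \<beta>" using eq[OF line_in_mem[OF l]] by simp
  then show "\<exists>\<alpha> \<beta>. \<forall>z\<in>ball 0 r. g (\<gamma> z) = \<alpha> + z * \<beta>" by blast
qed

lemma affine_fun_hol:
  assumes "affine_fun M f" "openin (sp_topology M) U"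
  shows "hol M U f"
  unfolding hol_iff
proof (intro conjI allI impI assms(2))
  have "continuous_map (sp_topology M) euclidean f" using assms(1) unfolding affine_fun_def by (elim conjE)
  then show "continuous_map (subtopology (sp_topology M) U) euclidean f"
    by (rule continuous_map_from_subtopology)
  fix \<gamma> r assume "line_in U r \<gamma>"
  then have "line_in M r \<gamma>" using openin_sp_subset[OF assms(2)] by (rule line_in_mono)
  then obtain \<alpha> \<beta> where 1: "\<forall>z\<in>ball 0 r. f (\<gamma> z) = \<alpha> + z * \<beta>" using assms(1) unfolding affine_fun_def by blast
  have "(\<lambda>z. \<alpha> + z * \<beta>) holomorphic_on ball 0 r" by (intro holomorphic_intros)
  then show "(\<lambda>z. f (\<gamma> z)) holomorphic_on ball 0 r"
    by (rule holomorphic_transform) (use 1 in simp)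
qed

lemma continuous_map_coords: "continuous_map (sp_topology M) euclidean coords"
proof -
  have "continuous_map (pullback_topology M coords euclidean) euclidean (id \<circ> coords)"
    by (rule continuous_map_pullback) (rule continuous_map_id)
  then show ?thesis unfolding sp_topology_def id_comp .
qed

lemma affine_fun_coord:
  fixes M :: "('g::finite) extpt set"
  shows "affine_fun M (\<lambda>a. hcoeff (zel a k) (int m + 1))"
  unfolding affine_fun_def
proof (intro conjI allI impI)
  have "continuous_on UNIV (\<lambda>c::(nat \<times> nat \<Rightarrow> complex) \<times> (nat \<Rightarrow> complex^'g). fst c (k, m))"
    by (rule continuous_on_product_then_coordinatewise[OF continuous_on_fst[OF continuous_on_id]])
  then have "continuous_map (sp_topology M) euclidean
      ((\<lambda>c::(nat \<times> nat \<Rightarrow> complex) \<times> (nat \<Rightarrow> complex^'g). fst c (k, m)) \<circ> coords)"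
    by (intro continuous_map_compose[OF continuous_map_coords]) simp
  then show "continuous_map (sp_topology M) euclidean (\<lambda>a::'g extpt. hcoeff (zel a k) (int m + 1))"
    by (simp add: o_def coords_def)
  fix \<gamma> :: "complex \<Rightarrow> 'g extpt" and r assume "line_in M r \<gamma>"
  then obtain a y where l: "\<forall>z\<in>ball 0 r. coords (\<gamma> z) = ((\<lambda>i. fst a i + z * fst y i), (\<lambda>k. snd a k + z *s snd y k))"
    unfolding line_in_def by blast
  have "hcoeff (zel (\<gamma> z) k) (int m + 1) = fst a (k, m) + z * fst y (k, m)" if "z \<in> ball 0 r" for z
    using arg_cong[OF bspec[OF l that], of "\<lambda>c. fst c (k, m)"] by (simp add: coords_def)
  then show "\<exists>\<alpha> \<beta>. \<forall>z\<in>ball 0 r. hcoeff (zel (\<gamma> z) k) (int m + 1) = \<alpha> + z * \<beta>" by blast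
qed

lemma affine_fun_frame_coord:
  fixes M :: "('g::finite) extpt set" and j :: 'g
  shows "affine_fun M (\<lambda>a. frame a (zel a k) $ j)"
  unfolding affine_fun_def
proof (intro conjI allI impI)
  have "continuous_on UNIV (\<lambda>c::(nat \<times> nat \<Rightarrow> complex) \<times> (nat \<Rightarrow> complex^'g). snd c k $ j)"
    by (rule continuous_on_component[OF continuous_on_product_then_coordinatewise[OF continuous_on_snd[OF continuous_on_id]]])
  then have "continuous_map (sp_topology M) euclidean
      ((\<lambda>c::(nat \<times> nat \<Rightarrow> complex) \<times> (nat \<Rightarrow> complex^'g). snd c k $ j) \<circ> coords)"
    by (intro continuous_map_compose[OF continuous_map_coords]) simp
  then show "continuous_map (sp_topology M) euclidean (\<lambda>a::'g extpt. frame a (zel a k) $ j)"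
    by (simp add: o_def coords_def)
  fix \<gamma> :: "complex \<Rightarrow> 'g extpt" and r assume "line_in M r \<gamma>"
  then obtain a y where l: "\<forall>z\<in>ball 0 r. coords (\<gamma> z) = ((\<lambda>i. fst a i + z * fst y i), (\<lambda>k. snd a k + z *s snd y k))"
    unfolding line_in_def by blast
  have "frame (\<gamma> z) (zel (\<gamma> z) k) $ j = snd a k $ j + z * snd y k $ j" if "z \<in> ball 0 r" for z
    using arg_cong[OF bspec[OF l that], of "\<lambda>c. snd c k $ j"] by (simp add: coords_def)
  then show "\<exists>\<alpha> \<beta>. \<forall>z\<in>ball 0 r. frame (\<gamma> z) (zel (\<gamma> z) k) $ j = \<alpha> + z * \<beta>" by blast
qed

text \<open>A self-map of \<open>M\<close> with affine coordinates is continuous and maps lines to lines.\<close>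

lemma hol_pullback:
  fixes T :: "('g::finite) extpt \<Rightarrow> 'g extpt"
  assumes T: "\<And>b. b \<in> M \<Longrightarrow> T b \<in> M"
    and c1: "\<And>k m. affine_fun M (\<lambda>b. hcoeff (zel (T b) k) (int m + 1))"
    and c2: "\<And>k j. affine_fun M (\<lambda>b. frame (T b) (zel (T b) k) $ j)"
  shows "openin (sp_topology M) W \<Longrightarrow> openin (sp_topology M) {b \<in> M. T b \<in> W}"
    and "hol M W f \<Longrightarrow> hol M {b \<in> M. T b \<in> W} (\<lambda>b. f (T b))"
proof -
  have cont: "continuous_map (sp_topology M) (sp_topology M) T"
    unfolding sp_topology_def[of M]
  proof (rule continuous_map_pullback')
    have "continuous_map (sp_topology M) euclidean (\<lambda>b. fst (coords (T b)))"
      unfolding euclidean_product_topology[symmetric] continuous_map_componentwise_UNIV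
    proof
      fix p :: "nat \<times> nat"
      have "continuous_map (sp_topology M) euclidean (\<lambda>b. hcoeff (zel (T b) (fst p)) (int (snd p) + 1))"
        using c1 unfolding affine_fun_def by blast
      then show "continuous_map (sp_topology M) euclidean (\<lambda>b. fst (coords (T b)) p)"
        by (simp add: coords_def case_prod_beta)
    qed
    moreover have "continuous_map (sp_topology M) euclidean (\<lambda>b. snd (coords (T b)))"
      unfolding euclidean_product_topology[symmetric] continuous_map_componentwise_UNIV
    proof
      fix k :: nat
      have "continuous_map (sp_topology M) euclidean (\<lambda>b. frame (T b) (zel (T b) k))"
        using c2 unfolding affine_fun_def
        by (auto simp: continuous_map_atin intro!: vec_tendstoI)
      then show "continuous_map (sp_topology M) euclidean (\<lambda>b. snd (coords (T b)) k)"
        by (simp add: coords_def)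
    qed
    ultimately have "continuous_map (sp_topology M) (prod_topology euclidean euclidean)
        (\<lambda>b. (fst (coords (T b)), snd (coords (T b))))"
      by (rule continuous_map_pairedI)
    then show "continuous_map (pullback_topology M coords euclidean) euclidean (coords \<circ> T)"
      by (simp add: o_def sp_topology_def)
    show "topspace (pullback_topology M coords euclidean) \<subseteq> T -` M"
      using T by (auto simp: topspace_pullback_topology)
  qed
  show op: "openin (sp_topology M) {b \<in> M. T b \<in> W}" if "openin (sp_topology M) W" for W
    using openin_continuous_map_preimage[OF cont that] by simp
  assume f: "hol M W f"
  show "hol M {b \<in> M. T b \<in> W} (\<lambda>b. f (T b))"
    unfolding hol_iff
  proof (intro conjI allI impI op[OF hol_openin[OF f]])
    have "continuous_map (subtopology (sp_topology M) {b \<in> M. T b \<in> W}) (subtopology (sp_topology M) W) T"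
      using continuous_map_from_subtopology[OF cont] by (auto simp: continuous_map_in_subtopology)
    then have "continuous_map (subtopology (sp_topology M) {b \<in> M. T b \<in> W}) euclidean (f \<circ> T)"
      using f unfolding hol_iff by (blast intro: continuous_map_compose)
    then show "continuous_map (subtopology (sp_topology M) {b \<in> M. T b \<in> W}) euclidean (\<lambda>b. f (T b))"
      by (simp add: o_def)
    fix \<gamma> r assume l: "line_in {b \<in> M. T b \<in> W} r \<gamma>"
    then have lM: "line_in M r \<gamma>" by (rule line_in_mono) blast
    have "\<exists>\<alpha> \<beta>. \<forall>z\<in>ball 0 r. hcoeff (zel (T (\<gamma> z)) (fst p)) (int (snd p) + 1) = \<alpha> + z * \<beta>" for p :: "nat \<times> nat"
      using c1[of "fst p" "snd p"] lM unfolding affine_fun_def by blast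
    then have "\<exists>\<alpha>. \<forall>p. \<exists>\<beta>. \<forall>z\<in>ball 0 r. hcoeff (zel (T (\<gamma> z)) (fst p)) (int (snd p) + 1) = \<alpha> p + z * \<beta>"
      by (intro choice allI)
    then obtain \<alpha> where "\<forall>p. \<exists>\<beta>. \<forall>z\<in>ball 0 r. hcoeff (zel (T (\<gamma> z)) (fst p)) (int (snd p) + 1) = \<alpha> p + z * \<beta>"
      by (rule exE)
    then have "\<exists>\<beta>. \<forall>p. \<forall>z\<in>ball 0 r. hcoeff (zel (T (\<gamma> z)) (fst p)) (int (snd p) + 1) = \<alpha> p + z * \<beta> p"
      by (rule choice)
    then obtain \<beta> where \<alpha>\<beta>: "\<forall>p. \<forall>z\<in>ball 0 r. hcoeff (zel (T (\<gamma> z)) (fst p)) (int (snd p) + 1) = \<alpha> p + z * \<beta> p"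
      by (rule exE)
    have "\<exists>\<alpha> \<beta>. \<forall>z\<in>ball 0 r. frame (T (\<gamma> z)) (zel (T (\<gamma> z)) (fst p)) $ (snd p) = \<alpha> + z * \<beta>" for p :: "nat \<times> 'g"
      using c2[of "fst p" "snd p"] lM unfolding affine_fun_def by blast
    then have "\<exists>\<alpha>. \<forall>p. \<exists>\<beta>. \<forall>z\<in>ball 0 r. frame (T (\<gamma> z)) (zel (T (\<gamma> z)) (fst p)) $ (snd p) = \<alpha> p + z * \<beta>"
      by (intro choice allI)
    then obtain \<alpha>' where "\<forall>p. \<exists>\<beta>. \<forall>z\<in>ball 0 r. frame (T (\<gamma> z)) (zel (T (\<gamma> z)) (fst p)) $ (snd p) = \<alpha>' p + z * \<beta>"
      by (rule exE)
    then have "\<exists>\<beta>. \<forall>p. \<forall>z\<in>ball 0 r. frame (T (\<gamma> z)) (zel (T (\<gamma> z)) (fst p)) $ (snd p) = \<alpha>' p + z * \<beta> p"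
      by (rule choice)
    then obtain \<beta>' where \<alpha>\<beta>': "\<forall>p. \<forall>z\<in>ball 0 r. frame (T (\<gamma> z)) (zel (T (\<gamma> z)) (fst p)) $ (snd p) = \<alpha>' p + z * \<beta>' p"
      by (rule exE)
    let ?a = "(\<alpha>, \<lambda>k. \<chi> j. \<alpha>' (k, j))" and ?y = "(\<beta>, \<lambda>k. \<chi> j. \<beta>' (k, j))"
    have "coords (T (\<gamma> z)) = ((\<lambda>i. fst ?a i + z * fst ?y i), (\<lambda>k. snd ?a k + z *s snd ?y k))" if z: "z \<in> ball 0 r" for z
    proof (rule prod_eqI; rule ext)
      fix p :: "nat \<times> nat"
      show "fst (coords (T (\<gamma> z))) p = fst ((\<lambda>i. fst ?a i + z * fst ?y i), (\<lambda>k. snd ?a k + z *s snd ?y k)) p"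
        using bspec[OF spec[OF \<alpha>\<beta>, of p] z] by (simp add: coords_def case_prod_beta)
    next
      fix k :: nat
      have "frame (T (\<gamma> z)) (zel (T (\<gamma> z)) k) $ j = \<alpha>' (k, j) + z * \<beta>' (k, j)" for j
        using bspec[OF spec[OF \<alpha>\<beta>', of "(k, j)"] z] by simp
      then show "snd (coords (T (\<gamma> z))) k = snd ((\<lambda>i. fst ?a i + z * fst ?y i), (\<lambda>k. snd ?a k + z *s snd ?y k)) k"
        by (simp add: coords_def vec_eq_iff)
    qed
    then have "line_in W r (\<lambda>z. T (\<gamma> z))"
      using l unfolding line_in_def by blast
    then show "(\<lambda>z. f (T (\<gamma> z))) holomorphic_on ball 0 r"
      using f unfolding hol_iff by blast
  qed
qed

context polarized_torus
begin

abbreviation (input) "M \<equiv> Sp \<Lambda> B"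

lemma M_complement: "a \<in> M \<Longrightarrow> lagrangian_complement (Zof a)"
  by (rule framed_complement[OF Sp_framed])

lemma zel_proj: "a \<in> M \<Longrightarrow> zel a k = proj_along_Hplus (Zof a) (hb (- int k - 1))"
  by (rule zel_eq_proj[OF M_complement])

lemma zel_mem: "a \<in> M \<Longrightarrow> zel a k \<in> Zof a"
  unfolding zel_proj by (rule proj_mem[OF M_complement])

lemma zel_polar: "a \<in> M \<Longrightarrow> hcoeff (zel a k) (- int j - 1) = (if j = k then 1 else 0)"
proof -
  assume a: "a \<in> M"
  have "hcoeff (zel a k - hb (- int k - 1)) (- int j - 1) = 0"
    using proj_diff'[OF M_complement[OF a], of "hb (- int k - 1)"] unfolding zel_proj[OF a] Hplus_iff_nat by blast
  then show ?thesis by simp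
qed

lemma zel_expansion:
  assumes "a \<in> M" "finite K" "{k::nat. hcoeff x (- int k - 1) \<noteq> 0} \<subseteq> K"
  shows "proj_along_Hplus (Zof a) x = (\<Sum>k\<in>K. hscale (hcoeff x (- int k - 1)) (zel a k))"
  unfolding zel_proj[OF assms(1)] by (rule proj_basis_expansion[OF M_complement[OF assms(1)] assms(2,3)])

text \<open>The polar coefficients of \<open>zel\<close> are constant, and the others are coordinates.\<close>

lemma affine_zel_coeff: "affine_fun M (\<lambda>a. hcoeff (zel a k) n)"
proof (cases n "0::int" rule: linorder_cases)
  case less
  then have "n = - int (nat (- n - 1)) - 1" by simp
  then have "hcoeff (zel a k) n = (if nat (- n - 1) = k then 1 else 0)" if "a \<in> M" for a
    using zel_polar[OF that, of k "nat (- n - 1)"] by simp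
  then show ?thesis by (rule affine_fun_cong[OF affine_fun_const])
next
  case equal
  then show ?thesis using affine_fun_const by simp
next
  case greater
  then have "n = int (nat (n - 1)) + 1" by simp
  then show ?thesis using affine_fun_coord[of M k "nat (n - 1)"] by simp
qed

lemma proj_move:
  assumes g: "g \<in> SpPlus_full" and a: "a \<in> M"
  shows "proj_along_Hplus (Zof (sp_move g a)) (g x) = g (proj_along_Hplus (Zof a) x)"
proof (rule proj_unique[OF M_complement[OF sp_move_in_Sp[OF g a]]])
  show "g (proj_along_Hplus (Zof a) x) \<in> Zof (sp_move g a)"
    using proj_mem[OF M_complement[OF a]] by simp
  interpret g: Vector_Spaces.linear hscale hscale g by (rule SpPlus_linear[OF g])
  have "g (x - proj_along_Hplus (Zof a) x) \<in> Hplus"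
    unfolding SpPlus_Hplus[OF g] by (rule proj_diff[OF M_complement[OF a]])
  then show "g x - g (proj_along_Hplus (Zof a) x) \<in> Hplus" by (simp only: g.diff)
qed

text \<open>The polar part of \<open>g\<^sup>-\<^sup>1 t^{-k-1}\<close> is finite, so the new basis vector of \<open>Z\<close> is a finite combination of moved ones.\<close>

lemma zel_move:
  assumes g: "g \<in> SpPlus_full" and a: "a \<in> M"
  shows "zel (sp_move g a) k = g (\<Sum>j | hcoeff (inv g (hb (- int k - 1))) (- int j - 1) \<noteq> 0.
      hscale (hcoeff (inv g (hb (- int k - 1))) (- int j - 1)) (zel a j))"
proof -
  have "zel (sp_move g a) k = proj_along_Hplus (Zof (sp_move g a)) (g (inv g (hb (- int k - 1))))"
    unfolding zel_proj[OF sp_move_in_Sp[OF g a]] SpPlus_inv(1)[OF g] ..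
  also have "\<dots> = g (proj_along_Hplus (Zof a) (inv g (hb (- int k - 1))))" by (rule proj_move[OF g a])
  finally show ?thesis unfolding zel_expansion[OF a finite_polar_support order_refl] .
qed

text \<open>A coefficient of \<open>g z\<close> is, by adjunction, a pairing of \<open>z\<close> with a fixed element \<open>w\<close>. Such a pairing involves
  finitely many of the coordinates of \<open>z\<close>, and its contribution from the part of \<open>w\<close> in \<open>H'\<^sub>+\<close> is constant.\<close>

lemma affine_hform_zel: "affine_fun M (\<lambda>a. hform (zel a k) w)"
proof -
  let ?K = "{j::nat. hcoeff w (- int j - 1) \<noteq> 0}"
  let ?p = "w - (\<Sum>j\<in>?K. hscale (hcoeff w (- int j - 1)) (hb (- int j - 1)))"
  have p: "?p \<in> Hplus" by (rule polar_decomposition[OF finite_polar_support order_refl])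
  have "hform (zel a k) w = (\<Sum>j\<in>?K. (hcoeff w (- int j - 1) * of_nat (j + 1)) * hcoeff (zel a k) (int j + 1))
      + - (of_nat (k + 1) * hcoeff ?p (int k + 1))" if a: "a \<in> M" for a
  proof -
    have "hform ?p (zel a k) = (\<Sum>j\<in>{k}. of_nat (j + 1) * hcoeff ?p (int j + 1) * hcoeff (zel a k) (- int j - 1))"
      by (rule hform_Hplus_left[OF p]) (auto simp: zel_polar[OF a])
    then have 1: "hform ?p (zel a k) = of_nat (k + 1) * hcoeff ?p (int k + 1)"
      using zel_polar[OF a, of k k] by simp
    have "hform (zel a k) w = (\<Sum>j\<in>?K. hcoeff w (- int j - 1) * hform (zel a k) (hb (- int j - 1))) + hform (zel a k) ?p"
      unfolding hform_diff_right hform_sum_right hform_scale_right by simp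
    also have "hform (zel a k) ?p = - (of_nat (k + 1) * hcoeff ?p (int k + 1))"
      unfolding hform_antisym[of "zel a k" ?p] 1 ..
    also have "(\<Sum>j\<in>?K. hcoeff w (- int j - 1) * hform (zel a k) (hb (- int j - 1)))
        = (\<Sum>j\<in>?K. (hcoeff w (- int j - 1) * of_nat (j + 1)) * hcoeff (zel a k) (int j + 1))"
      by (intro sum.cong refl) (simp add: hform_hb_right add.commute)
    finally show ?thesis .
  qed
  then show ?thesis
    by (rule affine_fun_cong[rotated]) (assumption, intro affine_fun_add affine_fun_sum affine_fun_scale affine_fun_const affine_fun_coord)
qed

lemma sp_move_affine:
  assumes g: "g \<in> SpPlus_full"
  shows "affine_fun M (\<lambda>a. hcoeff (zel (sp_move g a) k) (int m + 1))"
    and "affine_fun M (\<lambda>a. frame (sp_move g a) (zel (sp_move g a) k) $ j)"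
proof -
  interpret g: Vector_Spaces.linear hscale hscale g by (rule SpPlus_linear[OF g])
  let ?c = "\<lambda>i. hcoeff (inv g (hb (- int k - 1))) (- int i - 1)"
  let ?K = "{i::nat. ?c i \<noteq> 0}"
  let ?w = "inv g (hb (- int m - 1))"
  have "hcoeff (zel (sp_move g a) k) (int m + 1) = (\<Sum>i\<in>?K. ?c i * (1 / of_nat (m + 1) * hform (zel a i) ?w))"
    if a: "a \<in> M" for a
  proof -
    have coeff: "hcoeff (g x) (int m + 1) = 1 / of_nat (m + 1) * hform x ?w" for x
    proof -
      have "hform x ?w = hform (g x) (hb (- int m - 1))" unfolding SpPlus_adjoint[OF g] ..
      also have "\<dots> = of_nat (m + 1) * hcoeff (g x) (int m + 1)" by (simp add: hform_hb_right add.commute)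
      finally show ?thesis by (simp del: of_nat_Suc of_nat_add)
    qed
    show ?thesis
      unfolding zel_move[OF g a] g.sum g.scale hcoeff_sum hcoeff_scale coeff ..
  qed
  then show "affine_fun M (\<lambda>a. hcoeff (zel (sp_move g a) k) (int m + 1))"
    by (rule affine_fun_cong[rotated]) (assumption, intro affine_fun_sum affine_fun_scale affine_hform_zel)
  have "frame (sp_move g a) (zel (sp_move g a) k) $ j = (\<Sum>i\<in>?K. ?c i * frame a (zel a i) $ j)" if a: "a \<in> M" for a
  proof -
    note fr = Sp_framed[OF a]
    have "frame (sp_move g a) (zel (sp_move g a) k) = frame a (\<Sum>i\<in>?K. hscale (?c i) (zel a i))"
      unfolding zel_move[OF g a] by (simp add: SpPlus_inv(2)[OF g])
    also have "\<dots> = (\<Sum>i\<in>?K. ?c i *s frame a (zel a i))"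
      by (subst framed_sum[OF fr]) (simp_all add: framed_scale[OF fr] zel_mem[OF a] hp.subspace_scale[OF framed_subspace[OF fr]])
    finally show ?thesis by (simp add: sum_component)
  qed
  then show "affine_fun M (\<lambda>a. frame (sp_move g a) (zel (sp_move g a) k) $ j)"
    by (rule affine_fun_cong[rotated]) (assumption, intro affine_fun_sum affine_fun_scale affine_fun_frame_coord)
qed

lemma openin_move:
  assumes g: "g \<in> SpPlus_full" and W: "openin (sp_topology M) W"
  shows "openin (sp_topology M) {b \<in> M. sp_move g b \<in> W}"
  by (rule hol_pullback(1)[OF sp_move_in_Sp[OF g] sp_move_affine[OF g] W])

lemma hol_move:
  assumes g: "g \<in> SpPlus_full" and f: "hol M W f"
  shows "hol M {b \<in> M. sp_move g b \<in> W} (\<lambda>b. f (sp_move g b))"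
  by (rule hol_pullback(2)[OF sp_move_in_Sp[OF g] sp_move_affine[OF g] f])

end

section \<open>The Heisenberg action and values in \<open>Sym(\<hh>\<^sub>\<Gamma> \<otimes> \<complex>\<^sup>g)\<close>\<close>

lemma heis_superset:
  fixes A :: "complex^'d::finite"
  assumes "finite K" "{k::nat. hcoeff f (- int k - 1) \<noteq> 0} \<subseteq> K"
  shows "heis A f = (\<Sum>i\<in>UNIV. PConst (A $ i) * (\<Sum>k\<in>K. PConst (hcoeff f (- int k - 1)) * PVar (i, k)))"
proof -
  have "(\<Sum>k | hcoeff f (- int k - 1) \<noteq> 0. PConst (A $ i * hcoeff f (- int k - 1)) * PVar (i, k))
      = PConst (A $ i) * (\<Sum>k\<in>K. PConst (hcoeff f (- int k - 1)) * PVar (i, k))" for i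
    unfolding sum_distrib_left mult.assoc[symmetric] PConst_mult[symmetric]
    using assms by (intro sum.mono_neutral_left) auto
  then show ?thesis unfolding heis_def by simp
qed

lemma heis_add:
  fixes A :: "complex^'d::finite"
  shows "heis A (f + g) = heis A f + heis A g"
proof -
  let ?K = "{k::nat. hcoeff f (- int k - 1) \<noteq> 0} \<union> {k::nat. hcoeff g (- int k - 1) \<noteq> 0}"
  have K: "finite ?K" by (intro finite_UnI finite_polar_support)
  have "{k::nat. hcoeff (f + g) (- int k - 1) \<noteq> 0} \<subseteq> ?K" by auto
  then show ?thesis
    by (simp add: heis_superset[OF K] PConst_add distrib_right distrib_left sum.distrib)
qed

lemma heis_scale:
  fixes A :: "complex^'d::finite"
  shows "heis A (hscale c f) = PConst c * heis A f"
proof -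
  have "{k::nat. hcoeff (hscale c f) (- int k - 1) \<noteq> 0} \<subseteq> {k::nat. hcoeff f (- int k - 1) \<noteq> 0}" by auto
  from heis_superset[OF finite_polar_support this, of A] heis_superset[OF finite_polar_support order_refl, of A f]
  show ?thesis by (simp add: PConst_mult sum_distrib_left mult_ac)
qed

lemma heis_0: "heis A 0 = 0" for A :: "complex^'d::finite"
  using heis_scale[of A 0 0] by simp

lemma heis_sum: "heis A (sum f I) = (\<Sum>i\<in>I. heis A (f i))" for A :: "complex^'d::finite"
  by (induction I rule: infinite_finite_induct) (simp_all add: heis_0 heis_add)

lemma heis_diff: "heis A (f - g) = heis A f - heis A g" for A :: "complex^'d::finite"
  using heis_add[of A "f - g" g] by simp

lemma heis_Hplus: "h \<in> Hplus \<Longrightarrow> heis A h = 0" for A :: "complex^'d::finite"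
  using heis_superset[of "{}" h A] by (simp add: Hplus_iff_nat)

lemma heis_eq_mod_Hplus: "f - g \<in> Hplus \<Longrightarrow> heis A f = heis A g" for A :: "complex^'d::finite"
  using heis_Hplus[of "f - g" A] by (simp add: heis_diff)

lemma heis_axis_expand: "heis A f = (\<Sum>i\<in>UNIV. PConst (A $ i) * heis (axis i 1) f)" for A :: "complex^'d::finite"
proof -
  let ?s = "\<lambda>i. \<Sum>k | hcoeff f (- int k - 1) \<noteq> 0. PConst (hcoeff f (- int k - 1)) * PVar (i, k)"
  have "heis (axis i 1) f = ?s i" for i :: 'd
  proof -
    have "heis (axis i 1) f = (\<Sum>j\<in>UNIV. PConst (axis i 1 $ j) * ?s j)"
      by (rule heis_superset[OF finite_polar_support order_refl])
    also have "\<dots> = (\<Sum>j\<in>UNIV. if j = i then ?s j else 0)"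
      by (intro sum.cong refl) (auto simp: axis_def)
    finally show ?thesis by simp
  qed
  then show ?thesis using heis_superset[OF finite_polar_support order_refl, of A f] by simp
qed

lemma heis_axis_hb: "heis (axis i 1) (hb (- int k - 1)) = PVar (i, k)" for i :: "'d::finite"
proof -
  have "heis (axis i 1) (hb (- int k - 1)) = (\<Sum>j\<in>UNIV. PConst (axis i 1 $ j) *
      (\<Sum>l\<in>{k}. PConst (hcoeff (hb (- int k - 1)) (- int l - 1)) * PVar (j, l)))"
    by (rule heis_superset) auto
  also have "\<dots> = (\<Sum>j\<in>UNIV. if j = i then PVar (j, k) else 0)"
    by (intro sum.cong refl) (auto simp: axis_def)
  finally show ?thesis by simp
qed

lemma sp_act_PVar: "sp_act g (PVar (i, k)) = heis (axis i 1) (g (hb (- int k - 1)))" for i :: "'d::finite"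
  by (simp add: sp_act_def psubst_PVar)

lemma sp_act_hom:
  "sp_act g (P + Q) = sp_act g P + sp_act g Q" "sp_act g (P * Q) = sp_act g P * sp_act g Q"
  "sp_act g (sum F I) = (\<Sum>x\<in>I. sp_act g (F x))" "sp_act g (PConst c) = PConst c"
  by (simp_all add: sp_act_def psubst_simps)

lemma sp_act_heis:
  fixes A :: "complex^'d::finite"
  assumes g: "g \<in> SpPlus_full"
  shows "sp_act g (heis A f) = heis A (g f)"
proof -
  interpret g: Vector_Spaces.linear hscale hscale g by (rule SpPlus_linear[OF g])
  let ?K = "{k::nat. hcoeff f (- int k - 1) \<noteq> 0}"
  let ?p = "\<Sum>k\<in>?K. hscale (hcoeff f (- int k - 1)) (hb (- int k - 1))"
  have "g (f - ?p) \<in> Hplus"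
    unfolding SpPlus_Hplus[OF g] by (rule polar_decomposition[OF finite_polar_support order_refl])
  then have "heis A (g f) = heis A (g ?p)" for A :: "complex^'d"
    by (intro heis_eq_mod_Hplus) (simp only: g.diff)
  then have gf: "heis A (g f) = (\<Sum>k\<in>?K. PConst (hcoeff f (- int k - 1)) * heis A (g (hb (- int k - 1))))" for A :: "complex^'d"
    by (simp only: g.sum g.scale heis_sum heis_scale)
  show ?thesis
    unfolding heis_superset[OF finite_polar_support order_refl, of A f] heis_axis_expand[of A "g f"]
    by (simp only: sp_act_hom sp_act_PVar gf)
qed

lemma sp_act_inv:
  assumes g: "g \<in> SpPlus_full"
  shows "sp_act g (sp_act (inv g) P) = P" "sp_act (inv g) (sp_act g P) = P"
proof -
  have "sp_act h (sp_act (inv h) P) = P" if h: "h \<in> SpPlus_full" for h and P :: "('d::finite) fock"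
  proof (induction P rule: cpoly_induct)
    case (var x)
    obtain i k where "x = (i, k)" by fastforce
    then show ?case by (simp add: sp_act_PVar sp_act_heis h heis_axis_hb)
  qed (simp_all add: sp_act_hom)
  from this[OF g] this[OF SpPlus_full_inv[OF g]] show "sp_act g (sp_act (inv g) P) = P" "sp_act (inv g) (sp_act g P) = P"
    by (simp_all add: inv_inv_SpPlus[OF g])
qed

text \<open>The homomorphism from \<open>V = Sym(\<hh>\<^sub>\<Gamma> \<otimes> Z)\<close> to \<open>Sym(\<hh>\<^sub>\<Gamma> \<otimes> \<complex>\<^sup>g)\<close> that is induced by the frame at \<open>a\<close>; the
  variable \<open>PVar (i, j)\<close> of the target stands for \<open>e\<^sub>i \<otimes> e\<^sub>j\<close>.\<close>

definition fibre_value :: "('g::finite) extpt \<Rightarrow> ('d::finite) fock \<Rightarrow> ('d \<times> 'g) cpoly" where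
  "fibre_value a = psubst PConst (\<lambda>(i, k). \<Sum>j\<in>UNIV. PConst (frame a (zel a k) $ j) * PVar (i, j))"

lemma fibre_value_hom:
  "fibre_value a (P + Q) = fibre_value a P + fibre_value a Q" "fibre_value a (P * Q) = fibre_value a P * fibre_value a Q" "fibre_value a (P - Q) = fibre_value a P - fibre_value a Q"
  "fibre_value a (sum F I) = (\<Sum>x\<in>I. fibre_value a (F x))" "fibre_value a (PConst c) = PConst c"
  "fibre_value a (PVar (i, k)) = (\<Sum>j\<in>UNIV. PConst (frame a (zel a k) $ j) * PVar (i, j))"
  by (simp_all add: fibre_value_def psubst_simps)

lemma fibre_value_0 [simp]: "fibre_value a 0 = 0"
  by (simp add: fibre_value_def)

context polarized_torus
begin

lemma heis_axis_zel: "a \<in> M \<Longrightarrow> heis (axis i 1) (zel a k) = PVar (i, k)" for i :: "'d::finite"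
  using heis_eq_mod_Hplus[of "zel a k" "hb (- int k - 1)" "axis i 1"] proj_diff'[OF M_complement]
  by (simp add: zel_proj heis_axis_hb)

text \<open>The action of \<open>A \<otimes> f\<close> depends on \<open>f\<close> modulo \<open>H'\<^sub>+\<close> only, hence on its component in \<open>Z\<close>.\<close>

lemma fibre_value_heis_axis:
  fixes i :: "'d::finite"
  assumes a: "a \<in> M"
  shows "fibre_value a (heis (axis i 1) f) = (\<Sum>j\<in>UNIV. PConst (frame a (proj_along_Hplus (Zof a) f) $ j) * PVar (i, j))"
proof -
  note fr = Sp_framed[OF a]
  let ?K = "{k::nat. hcoeff f (- int k - 1) \<noteq> 0}" and ?c = "\<lambda>k::nat. hcoeff f (- int k - 1)"
  have pf: "proj_along_Hplus (Zof a) f = (\<Sum>k\<in>?K. hscale (?c k) (zel a k))"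
    by (rule zel_expansion[OF a finite_polar_support order_refl])
  have "frame a (proj_along_Hplus (Zof a) f) = (\<Sum>k\<in>?K. ?c k *s frame a (zel a k))"
    unfolding pf
    by (subst framed_sum[OF fr]) (simp_all add: framed_scale[OF fr] zel_mem[OF a] hp.subspace_scale[OF framed_subspace[OF fr]])
  then have fj: "frame a (proj_along_Hplus (Zof a) f) $ j = (\<Sum>k\<in>?K. ?c k * frame a (zel a k) $ j)" for j
    by (simp add: sum_component)
  have "heis (axis i 1) f = heis (axis i 1) (proj_along_Hplus (Zof a) f)"
    by (rule heis_eq_mod_Hplus[OF proj_diff[OF M_complement[OF a]]])
  also have "\<dots> = (\<Sum>k\<in>?K. PConst (?c k) * PVar (i, k))"
    unfolding pf by (simp add: heis_sum heis_scale heis_axis_zel[OF a])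
  finally have "fibre_value a (heis (axis i 1) f)
      = (\<Sum>k\<in>?K. PConst (?c k) * (\<Sum>j\<in>UNIV. PConst (frame a (zel a k) $ j) * PVar (i, j)))"
    by (simp only: fibre_value_hom)
  also have "\<dots> = (\<Sum>j\<in>UNIV. \<Sum>k\<in>?K. PConst (?c k * frame a (zel a k) $ j) * PVar (i, j))"
    unfolding sum_distrib_left by (subst sum.swap) (simp add: PConst_mult mult.assoc)
  also have "\<dots> = (\<Sum>j\<in>UNIV. PConst (frame a (proj_along_Hplus (Zof a) f) $ j) * PVar (i, j))"
    unfolding fj PConst_sum sum_distrib_right ..
  finally show ?thesis .
qed

lemma fibre_value_heis_kernel:
  fixes A :: "complex^'d::finite"
  assumes a: "a \<in> M" and f: "f \<in> Fof a"
  shows "fibre_value a (heis A f) = 0"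
proof -
  have "proj_along_Hplus (Zof a) f = f" by (rule proj_on[OF M_complement[OF a] Sp_F_subset[OF a f]])
  moreover have "frame a f = 0" using f unfolding Sp_kernel[OF a] frame_kernel_def by blast
  ultimately have "fibre_value a (heis (axis i 1) f) = 0" for i :: 'd
    unfolding fibre_value_heis_axis[OF a] by simp
  then show ?thesis unfolding heis_axis_expand[of A f] by (simp add: fibre_value_hom)
qed

text \<open>Equivariance: the projection to \<open>Z\<close> along \<open>H'\<^sub>+\<close> and the frame are both transported by \<open>g\<close>, so that on generators
  \<open>g\<close> cancels against its inverse.\<close>

lemma fibre_value_move:
  fixes P :: "('d::finite) fock"
  assumes g: "g \<in> SpPlus_full" and a: "a \<in> M"
  shows "fibre_value (sp_move g a) (sp_act g P) = fibre_value a P"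
proof (induction P rule: cpoly_induct)
  case (var x)
  obtain i k where x: "x = (i, k)" by fastforce
  have "frame (sp_move g a) (proj_along_Hplus (Zof (sp_move g a)) (g (hb (- int k - 1)))) = frame a (zel a k)"
    unfolding proj_move[OF g a] zel_proj[OF a] by (simp add: SpPlus_inv(2)[OF g])
  then show ?case
    unfolding x sp_act_PVar fibre_value_heis_axis[OF sp_move_in_Sp[OF g a]] fibre_value_hom by simp
qed (simp_all add: sp_act_hom fibre_value_hom)

end

section \<open>Sections of \<open>V \<otimes> \<O>\<close> and the image of \<open>\<hh>\<^sup>o\<^sup>u\<^sup>t\<close>\<close>

text \<open>Sections of \<open>V \<otimes> \<O>\<close> that are given on all of \<open>W\<close> by one finite sum with holomorphic coefficients. A section of
  the sheaf is a function that is locally of this kind.\<close>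

definition expandable :: "('g::finite) extpt set \<Rightarrow> 'g extpt set \<Rightarrow> ('g extpt \<Rightarrow> ('d::finite) fock) \<Rightarrow> bool" where
  "expandable M W v \<longleftrightarrow> openin (sp_topology M) W \<and> (\<exists>(n::nat) \<phi> P. (\<forall>k<n. hol M W (\<phi> k)) \<and>
     (\<forall>b\<in>W. v b = (\<Sum>k<n. PConst (\<phi> k b) * P k)))"

lemma expandableI:
  assumes W: "openin (sp_topology M) W" and I: "finite I" and \<phi>: "\<And>i. i \<in> I \<Longrightarrow> hol M W (\<phi> i)"
    and v: "\<And>b. b \<in> W \<Longrightarrow> v b = (\<Sum>i\<in>I. PConst (\<phi> i b) * P i)"
  shows "expandable M W v"
proof -
  obtain e where e: "bij_betw e {..<card I} I" using ex_bij_betw_nat_finite[OF I] by (auto simp: atLeast0LessThan)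
  have "\<forall>k<card I. hol M W (\<phi> (e k))" using bij_betwE[OF e] \<phi> by blast
  moreover have "v b = (\<Sum>k<card I. PConst (\<phi> (e k) b) * P (e k))" if "b \<in> W" for b
    unfolding v[OF that] by (rule sum.reindex_bij_betw[OF e, symmetric])
  ultimately show ?thesis unfolding expandable_def using W
    by (intro conjI exI[of _ "card I"] exI[of _ "\<lambda>k. \<phi> (e k)"] exI[of _ "\<lambda>k. P (e k)"]) blast+
qed

lemma expandable_openin: "expandable M W v \<Longrightarrow> openin (sp_topology M) W"
  by (simp add: expandable_def)

lemma expandableE:
  assumes "expandable M W v"
  obtains n :: nat and \<phi> P where "\<forall>k<n. hol M W (\<phi> k)" "\<forall>b\<in>W. v b = (\<Sum>k<n. PConst (\<phi> k b) * P k)"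
  using assms unfolding expandable_def by blast

lemma expandable_hol: "hol M W \<phi> \<Longrightarrow> expandable M W (\<lambda>b. PConst (\<phi> b) * P)"
  by (rule expandableI[of M W "{()}" "\<lambda>_. \<phi>" _ "\<lambda>_. P"]) (auto dest: hol_openin)

lemma expandable_const: "openin (sp_topology M) W \<Longrightarrow> expandable M W (\<lambda>_. P)"
  using expandable_hol[OF hol_const, of M W 1 P] by simp

lemma expandable_add:
  assumes "expandable M W v" "expandable M W w"
  shows "expandable M W (\<lambda>b. v b + w b)"
proof -
  obtain n :: nat and \<phi> P where 1: "\<forall>k<n. hol M W (\<phi> k)" "\<forall>b\<in>W. v b = (\<Sum>k<n. PConst (\<phi> k b) * P k)"
    using assms(1) by (rule expandableE)
  obtain m :: nat and \<psi> Q where 2: "\<forall>k<m. hol M W (\<psi> k)" "\<forall>b\<in>W. w b = (\<Sum>k<m. PConst (\<psi> k b) * Q k)"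
    using assms(2) by (rule expandableE)
  show ?thesis
  proof (rule expandableI[where I = "{..<n} <+> {..<m}" and \<phi> = "case_sum \<phi> \<psi>" and P = "case_sum P Q"])
    show "v b + w b = (\<Sum>i\<in>{..<n} <+> {..<m}. PConst (case_sum \<phi> \<psi> i b) * case_sum P Q i)" if "b \<in> W" for b
      using 1(2) 2(2) that by (simp add: sum.Plus)
  qed (use 1(1) 2(1) expandable_openin[OF assms(1)] in auto)
qed

lemma expandable_mult:
  assumes "expandable M W v" "expandable M W w"
  shows "expandable M W (\<lambda>b. v b * w b)"
proof -
  obtain n :: nat and \<phi> P where 1: "\<forall>k<n. hol M W (\<phi> k)" "\<forall>b\<in>W. v b = (\<Sum>k<n. PConst (\<phi> k b) * P k)"
    using assms(1) by (rule expandableE)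
  obtain m :: nat and \<psi> Q where 2: "\<forall>k<m. hol M W (\<psi> k)" "\<forall>b\<in>W. w b = (\<Sum>k<m. PConst (\<psi> k b) * Q k)"
    using assms(2) by (rule expandableE)
  show ?thesis
  proof (rule expandableI[where I = "{..<n} \<times> {..<m}" and \<phi> = "\<lambda>p b. \<phi> (fst p) b * \<psi> (snd p) b" and P = "\<lambda>p. P (fst p) * Q (snd p)"])
    show "v b * w b = (\<Sum>p\<in>{..<n} \<times> {..<m}. PConst (\<phi> (fst p) b * \<psi> (snd p) b) * (P (fst p) * Q (snd p)))"
      if "b \<in> W" for b
      unfolding bspec[OF 1(2) that] bspec[OF 2(2) that] sum_product sum.cartesian_product
      by (intro sum.cong refl) (auto simp: PConst_mult mult_ac)
  qed (use 1(1) 2(1) expandable_openin[OF assms(1)] in \<open>auto intro: hol_mult\<close>)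
qed

lemma expandable_sum:
  "openin (sp_topology M) W \<Longrightarrow> (\<And>i. i \<in> I \<Longrightarrow> expandable M W (v i)) \<Longrightarrow> expandable M W (\<lambda>b. \<Sum>i\<in>I. v i b)"
  by (induction I rule: infinite_finite_induct) (auto intro: expandable_const expandable_add)

lemma expandable_mono:
  assumes "expandable M W v" "openin (sp_topology M) W'" "W' \<subseteq> W"
  shows "expandable M W' v"
proof -
  obtain n :: nat and \<phi> P where 1: "\<forall>k<n. hol M W (\<phi> k)" "\<forall>b\<in>W. v b = (\<Sum>k<n. PConst (\<phi> k b) * P k)"
    using assms(1) by (rule expandableE)
  show ?thesis
    by (rule expandableI[where I = "{..<n}" and \<phi> = \<phi> and P = P])
       (use 1 assms(2,3) in \<open>auto intro: hol_mono\<close>)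
qed

lemma expandable_cong:
  "expandable M W v \<Longrightarrow> (\<And>b. b \<in> W \<Longrightarrow> w b = v b) \<Longrightarrow> expandable M W w"
  unfolding expandable_def by simp

lemma V_section_iff:
  "V_section M U v \<longleftrightarrow> openin (sp_topology M) U \<and> (\<forall>a\<in>U. \<exists>W\<subseteq>U. a \<in> W \<and> expandable M W v)"
  unfolding V_section_def expandable_def by blast

lemma V_section_openin: "V_section M U v \<Longrightarrow> openin (sp_topology M) U"
  by (simp add: V_section_iff)

lemma V_section_local:
  assumes "V_section M U v" "a \<in> U"
  obtains W where "W \<subseteq> U" "a \<in> W" "expandable M W v"
  using assms unfolding V_section_iff by blast

lemma expandable_V_section: "expandable M U v \<Longrightarrow> V_section M U v"
  unfolding V_section_iff using expandable_openin by blast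

lemma V_section_mono:
  assumes "V_section M U v" "openin (sp_topology M) U'" "U' \<subseteq> U"
  shows "V_section M U' v"
  unfolding V_section_iff
proof (intro conjI ballI assms(2))
  fix a assume a: "a \<in> U'"
  then have "a \<in> U" using assms(3) by blast
  with assms(1) obtain W where W: "W \<subseteq> U" "a \<in> W" "expandable M W v" by (rule V_section_local)
  have "expandable M (W \<inter> U') v"
    by (rule expandable_mono[OF W(3) openin_Int[OF expandable_openin[OF W(3)] assms(2)]]) blast
  then show "\<exists>W\<subseteq>U'. a \<in> W \<and> expandable M W v" using W(2) a by (intro exI[of _ "W \<inter> U'"]) blast
qed

lemma V_section_binop:
  assumes v: "V_section M U v" and w: "V_section M U w"
    and op: "\<And>W. expandable M W v \<Longrightarrow> expandable M W w \<Longrightarrow> expandable M W u"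
  shows "V_section M U u"
  unfolding V_section_iff
proof (intro conjI ballI V_section_openin[OF v])
  fix a assume a: "a \<in> U"
  obtain W where W: "W \<subseteq> U" "a \<in> W" "expandable M W v" using v a by (rule V_section_local)
  obtain W' where W': "W' \<subseteq> U" "a \<in> W'" "expandable M W' w" using w a by (rule V_section_local)
  have o: "openin (sp_topology M) (W \<inter> W')"
    by (rule openin_Int[OF expandable_openin[OF W(3)] expandable_openin[OF W'(3)]])
  have "expandable M (W \<inter> W') u"
    by (rule op[OF expandable_mono[OF W(3) o] expandable_mono[OF W'(3) o]]) blast+
  then show "\<exists>W\<subseteq>U. a \<in> W \<and> expandable M W u" using W W' by (intro exI[of _ "W \<inter> W'"]) blast
qed

lemma V_section_add: "V_section M U v \<Longrightarrow> V_section M U w \<Longrightarrow> V_section M U (\<lambda>b. v b + w b)"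
  by (erule V_section_binop, assumption, rule expandable_add)

lemma V_section_mult: "V_section M U v \<Longrightarrow> V_section M U w \<Longrightarrow> V_section M U (\<lambda>b. v b * w b)"
  by (erule V_section_binop, assumption, rule expandable_mult)

lemma V_section_const: "openin (sp_topology M) U \<Longrightarrow> V_section M U (\<lambda>_. P)"
  by (rule expandable_V_section[OF expandable_const])

lemma V_section_sum:
  "openin (sp_topology M) U \<Longrightarrow> (\<And>i. i \<in> I \<Longrightarrow> V_section M U (v i)) \<Longrightarrow> V_section M U (\<lambda>b. \<Sum>i\<in>I. v i b)"
  by (induction I rule: infinite_finite_induct) (auto intro: V_section_const V_section_add)

lemma V_section_scale: "V_section M U v \<Longrightarrow> V_section M U (\<lambda>b. PConst c * v b)"
  by (rule V_section_mult[OF V_section_const[OF V_section_openin]])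

lemma V_section_cong:
  assumes v: "V_section M U v" and eq: "\<And>b. b \<in> U \<Longrightarrow> w b = v b"
  shows "V_section M U w"
  unfolding V_section_iff
proof (intro conjI ballI V_section_openin[OF v])
  fix a assume "a \<in> U"
  with v obtain W where W: "W \<subseteq> U" "a \<in> W" "expandable M W v" by (rule V_section_local)
  have "expandable M W w"
    by (rule expandable_cong[OF W(3)]) (use eq W(1) in blast)
  then show "\<exists>W\<subseteq>U. a \<in> W \<and> expandable M W w" using W by blast
qed

lemma F_section_mono:
  assumes f: "F_section M U f" and U': "openin (sp_topology M) U'" "U' \<subseteq> U"
  shows "F_section M U' f"
  unfolding F_section_def
proof (intro conjI ballI allI U'(1))
  show "f b \<in> Fof b" if "b \<in> U'" for b using f U'(2) that unfolding F_section_def by blast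
  show "hol M U' (\<lambda>b. hcoeff (f b) n)" for n
    using f unfolding F_section_def by (intro hol_mono[OF _ U']) blast
  fix a assume "a \<in> U'"
  then have "a \<in> U" using U'(2) by blast
  then obtain W N where W: "W \<subseteq> U" "a \<in> W" "openin (sp_topology M) W" "\<forall>b\<in>W. \<forall>n<N. hcoeff (f b) n = 0"
    using f unfolding F_section_def by blast
  show "\<exists>W\<subseteq>U'. a \<in> W \<and> openin (sp_topology M) W \<and> (\<exists>N. \<forall>b\<in>W. \<forall>n<N. hcoeff (f b) n = 0)"
    using W \<open>a \<in> U'\<close> openin_Int[OF W(3) U'(1)] by (intro exI[of _ "W \<inter> U'"]) blast
qed

text \<open>The local bound on the pole order of \<open>f\<close> makes the sum over exponents finite, uniformly near a point.\<close>

lemma V_section_heis: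
  fixes A :: "complex^'d::finite"
  assumes f: "F_section M U f"
  shows "V_section M U (\<lambda>b. heis A (f b))"
  unfolding V_section_iff
proof (intro conjI ballI)
  show "openin (sp_topology M) U" using f unfolding F_section_def by blast
  fix a assume a: "a \<in> U"
  obtain W N where W: "W \<subseteq> U" "a \<in> W" "openin (sp_topology M) W" and N: "\<forall>b\<in>W. \<forall>n<N. hcoeff (f b) n = 0"
    using f a unfolding F_section_def by blast
  let ?K = "{..nat (- N)}"
  have eq: "heis A (f b) = (\<Sum>i\<in>UNIV. PConst (A $ i) * (\<Sum>k\<in>?K. PConst (hcoeff (f b) (- int k - 1)) * PVar (i, k)))"
    if "b \<in> W" for b
  proof (rule heis_superset)
    show "{k. hcoeff (f b) (- int k - 1) \<noteq> 0} \<subseteq> ?K"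
    proof
      fix k assume "k \<in> {k. hcoeff (f b) (- int k - 1) \<noteq> 0}"
      then have "\<not> - int k - 1 < N" using N that by blast
      then show "k \<in> ?K" by simp
    qed
  qed simp
  have "hol M W (\<lambda>b. hcoeff (f b) n)" for n
    using f unfolding F_section_def by (intro hol_mono[OF _ W(3,1)]) blast
  then have "expandable M W (\<lambda>b. \<Sum>i\<in>UNIV. PConst (A $ i) * (\<Sum>k\<in>?K. PConst (hcoeff (f b) (- int k - 1)) * PVar (i, k)))"
    by (intro expandable_sum expandable_mult expandable_hol expandable_const W(3))
  then have "expandable M W (\<lambda>b. heis A (f b))" by (rule expandable_cong) (rule eq)
  then show "\<exists>W\<subseteq>U. a \<in> W \<and> expandable M W (\<lambda>b. heis A (f b))" using W by blast
qed

text \<open>Sections over \<open>U\<close> of the image of \<open>\<hh>\<^sup>o\<^sup>u\<^sup>t\<close>, given by one finite sum over all of \<open>U\<close>.\<close>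

definition out_section :: "('g::finite) extpt set \<Rightarrow> 'g extpt set \<Rightarrow> ('g extpt \<Rightarrow> ('d::finite) fock) \<Rightarrow> bool" where
  "out_section M U w \<longleftrightarrow> openin (sp_topology M) U \<and>
     (\<exists>(n::nat) A f v. (\<forall>k<n. F_section M U (f k) \<and> V_section M U (v k)) \<and>
        (\<forall>b\<in>U. w b = (\<Sum>k<n. heis (A k) (f k b) * v k b)))"

lemma out_stalk_iff: "w \<in> out_stalk M a \<longleftrightarrow> (\<exists>U. a \<in> U \<and> out_section M U w)"
  unfolding out_stalk_def out_section_def by blast

lemma out_section_openin: "out_section M U w \<Longrightarrow> openin (sp_topology M) U"
  by (simp add: out_section_def)

lemma out_sectionE:
  assumes "out_section M U w"
  obtains n :: nat and A f v where "\<forall>k<n. F_section M U (f k) \<and> V_section M U (v k)"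
    "\<forall>b\<in>U. w b = (\<Sum>k<n. heis (A k) (f k b) * v k b)"
  using assms unfolding out_section_def by blast

lemma out_sectionI:
  "openin (sp_topology M) U \<Longrightarrow> \<forall>k<n::nat. F_section M U (f k) \<and> V_section M U (v k) \<Longrightarrow>
    \<forall>b\<in>U. w b = (\<Sum>k<n. heis (A k) (f k b) * v k b) \<Longrightarrow> out_section M U w"
  unfolding out_section_def by blast

lemma out_section_0: "openin (sp_topology M) U \<Longrightarrow> out_section M U (\<lambda>_. 0)"
  by (rule out_sectionI[where n = 0]) simp_all

lemma out_section_single:
  fixes A :: "complex^'d::finite"
  assumes "F_section M U f"
  shows "out_section M U (\<lambda>b. heis A (f b))"
proof -
  have o: "openin (sp_topology M) U" using assms unfolding F_section_def by blast
  show ?thesis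
    by (rule out_sectionI[where n = 1 and f = "\<lambda>_. f" and v = "\<lambda>_ _. 1" and A = "\<lambda>_. A", OF o])
       (simp_all add: assms V_section_const[OF o])
qed

lemma out_section_add:
  fixes w w' :: "('g::finite) extpt \<Rightarrow> ('d::finite) fock"
  assumes "out_section M U w" "out_section M U w'"
  shows "out_section M U (\<lambda>b. w b + w' b)"
proof -
  obtain n :: nat and A f v where 1: "\<forall>k<n. F_section M U (f k) \<and> V_section M U (v k)"
    "\<forall>b\<in>U. w b = (\<Sum>k<n. heis (A k) (f k b) * v k b)" using assms(1) by (rule out_sectionE)
  obtain m :: nat and A' f' v' where 2: "\<forall>k<m. F_section M U (f' k) \<and> V_section M U (v' k)"
    "\<forall>b\<in>U. w' b = (\<Sum>k<m. heis (A' k) (f' k b) * v' k b)" using assms(2) by (rule out_sectionE)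
  have split: "(\<Sum>k<n + m. F k) = (\<Sum>k<n. F k) + (\<Sum>k<m. F (n + k))" for F :: "nat \<Rightarrow> 'd fock"
    by (induction m) (simp_all add: add.assoc)
  show ?thesis
    by (rule out_sectionI[where n = "n + m" and f = "\<lambda>k. if k < n then f k else f' (k - n)"
          and v = "\<lambda>k. if k < n then v k else v' (k - n)" and A = "\<lambda>k. if k < n then A k else A' (k - n)",
          OF out_section_openin[OF assms(1)]])
       (use 1 2 in \<open>auto simp: split\<close>)
qed

lemma out_section_mult:
  assumes "out_section M U w" "V_section M U u"
  shows "out_section M U (\<lambda>b. u b * w b)"
proof -
  obtain n :: nat and A f v where 1: "\<forall>k<n. F_section M U (f k) \<and> V_section M U (v k)"
    "\<forall>b\<in>U. w b = (\<Sum>k<n. heis (A k) (f k b) * v k b)" using assms(1) by (rule out_sectionE)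
  show ?thesis
    by (rule out_sectionI[where n = n and f = f and v = "\<lambda>k b. u b * v k b" and A = A, OF out_section_openin[OF assms(1)]])
       (use 1 assms(2) in \<open>auto intro: V_section_mult simp: sum_distrib_left mult_ac\<close>)
qed

lemma out_section_sum:
  "openin (sp_topology M) U \<Longrightarrow> (\<And>i. i \<in> I \<Longrightarrow> out_section M U (w i)) \<Longrightarrow> out_section M U (\<lambda>b. \<Sum>i\<in>I. w i b)"
  by (induction I rule: infinite_finite_induct) (auto intro: out_section_0 out_section_add)

lemma out_section_mono:
  assumes "out_section M U w" "openin (sp_topology M) U'" "U' \<subseteq> U"
  shows "out_section M U' w"
proof -
  obtain n :: nat and A f v where 1: "\<forall>k<n. F_section M U (f k) \<and> V_section M U (v k)"
    "\<forall>b\<in>U. w b = (\<Sum>k<n. heis (A k) (f k b) * v k b)" using assms(1) by (rule out_sectionE)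
  show ?thesis
    by (rule out_sectionI[where n = n and f = f and v = v and A = A, OF assms(2)])
       (use 1 assms(2,3) in \<open>auto intro: V_section_mono F_section_mono\<close>)
qed

lemma out_section_cong: "out_section M U w \<Longrightarrow> (\<And>b. b \<in> U \<Longrightarrow> w' b = w b) \<Longrightarrow> out_section M U w'"
  unfolding out_section_def by simp

lemma out_section_V_section:
  assumes "out_section M U w"
  shows "V_section M U w"
proof -
  obtain n :: nat and A f v where 1: "\<forall>k<n. F_section M U (f k) \<and> V_section M U (v k)"
    "\<forall>b\<in>U. w b = (\<Sum>k<n. heis (A k) (f k b) * v k b)" using assms by (rule out_sectionE)
  have "V_section M U (\<lambda>b. \<Sum>k<n. heis (A k) (f k b) * v k b)"
    using 1(1) by (intro V_section_sum[OF out_section_openin[OF assms]] V_section_mult V_section_heis) auto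
  then show ?thesis by (rule V_section_cong) (use 1(2) in blast)
qed

section \<open>Local trivializations and the coinvariants\<close>

lemma hol_det:
  fixes A :: "('g::finite) extpt \<Rightarrow> complex^'n^'n::finite"
  assumes U: "openin (sp_topology M) U" and A: "\<And>i j. hol M U (\<lambda>b. A b $ i $ j)"
  shows "hol M U (\<lambda>b. det (A b))"
  unfolding det_def by (intro hol_sum U hol_mult hol_const hol_prod A)

text \<open>The homomorphism that lifts \<open>e\<^sub>i \<otimes> e\<^sub>j\<close> to a combination of the generators \<open>e\<^sub>i \<otimes> t^{-\<kappa> l-1}\<close>, with the coefficients
  \<open>c l j\<close> depending on the point \<open>b\<close>.\<close>

definition fibre_lift :: "('g \<Rightarrow> nat) \<Rightarrow> ('g \<Rightarrow> 'g \<Rightarrow> 'a \<Rightarrow> complex) \<Rightarrow> 'a \<Rightarrow> ('d \<times> 'g::finite) cpoly \<Rightarrow> 'd fock" where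
  "fibre_lift \<kappa> c b = psubst PConst (\<lambda>(i, j). \<Sum>l\<in>UNIV. PConst (c l j b) * PVar (i, \<kappa> l))"

lemma fibre_lift_hom:
  "fibre_lift \<kappa> c b (P + Q) = fibre_lift \<kappa> c b P + fibre_lift \<kappa> c b Q"
  "fibre_lift \<kappa> c b (P * Q) = fibre_lift \<kappa> c b P * fibre_lift \<kappa> c b Q"
  "fibre_lift \<kappa> c b (sum F I) = (\<Sum>x\<in>I. fibre_lift \<kappa> c b (F x))"
  "fibre_lift \<kappa> c b (PConst r) = PConst r"
  "fibre_lift \<kappa> c b (PVar (i, j)) = (\<Sum>l\<in>UNIV. PConst (c l j b) * PVar (i, \<kappa> l))"
  by (simp_all add: fibre_lift_def psubst_simps)

context polarized_torus
begin

text \<open>Over \<open>U\<close>, the images in \<open>\<complex>\<^sup>g\<close> of the basis vectors of \<open>Z\<close> over \<open>t^{-\<kappa> l-1}\<close> form a basis, and \<open>c\<close> is the inverse of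
  the matrix with these columns.\<close>

definition trivialization :: "'g extpt set \<Rightarrow> ('g \<Rightarrow> nat) \<Rightarrow> ('g \<Rightarrow> 'g \<Rightarrow> 'g extpt \<Rightarrow> complex) \<Rightarrow> bool" where
  "trivialization U \<kappa> c \<longleftrightarrow> openin (sp_topology M) U \<and> (\<forall>l j. hol M U (c l j)) \<and>
     (\<forall>b\<in>U. \<forall>i j. (\<Sum>l\<in>UNIV. frame b (zel b (\<kappa> l)) $ i * c l j b) = (if i = j then 1 else 0))"

lemma frame_zel_span:
  assumes a: "a \<in> M"
  shows "vec.span (range (\<lambda>k. frame a (zel a k))) = UNIV"
proof -
  note fr = Sp_framed[OF a]
  have "v \<in> vec.span (range (\<lambda>k. frame a (zel a k)))" for v
  proof -
    obtain z where z: "z \<in> Zof a" "frame a z = v" using framed_onto[OF fr, of v] by blast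
    let ?K = "{k::nat. hcoeff z (- int k - 1) \<noteq> 0}" and ?c = "\<lambda>k::nat. hcoeff z (- int k - 1)"
    have "z = (\<Sum>k\<in>?K. hscale (?c k) (zel a k))"
      using zel_expansion[OF a finite_polar_support order_refl, of z] unfolding proj_on[OF M_complement[OF a] z(1)] .
    then have "v = frame a (\<Sum>k\<in>?K. hscale (?c k) (zel a k))" using z(2) by simp
    also have "\<dots> = (\<Sum>k\<in>?K. ?c k *s frame a (zel a k))"
      by (subst framed_sum[OF fr]) (simp_all add: framed_scale[OF fr] zel_mem[OF a] hp.subspace_scale[OF framed_subspace[OF fr]])
    also have "\<dots> \<in> vec.span (range (\<lambda>k. frame a (zel a k)))"
      by (intro vec.span_sum vec.span_scale vec.span_base rangeI)
    finally show ?thesis .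
  qed
  then show ?thesis by blast
qed

text \<open>Some \<open>g\<close> of the images form a basis at \<open>a\<close>, as the frame is onto. They stay a basis where the determinant of the
  matrix is not zero, and Cramer's rule gives the inverse matrix as a quotient of holomorphic functions.\<close>

lemma exists_trivialization:
  assumes a: "a \<in> M"
  shows "\<exists>U \<kappa> c. a \<in> U \<and> trivialization U \<kappa> c"
proof -
  let ?S = "range (\<lambda>k. frame a (zel a k))"
  obtain S where S: "S \<subseteq> ?S" "vec.independent S" "?S \<subseteq> vec.span S" "card S = vec.dim ?S"
    using vec.basis_exists[of ?S] by blast
  have "vec.dim ?S = CARD('g)"
    using vec.dim_span[of ?S] unfolding frame_zel_span[OF a] by (simp add: card_cart_basis)
  moreover have "finite S" using vec.finiteI_independent[OF S(2)] .
  ultimately obtain s where s: "bij_betw s (UNIV :: 'g set) S"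
    using finite_same_card_bij[of "UNIV :: 'g set" S] S(4) by auto
  have "vec.span S = UNIV"
    using vec.span_mono[OF S(3)] unfolding frame_zel_span[OF a] vec.span_span by blast
  have "\<exists>k. s l = frame a (zel a k)" for l using bij_betwE[OF s] S(1) by blast
  then have "\<exists>\<kappa>. \<forall>l. s l = frame a (zel a (\<kappa> l))" by (intro choice allI)
  then obtain \<kappa> where \<kappa>: "\<forall>l. s l = frame a (zel a (\<kappa> l))" by (rule exE)
  define N :: "'g extpt \<Rightarrow> complex^'g^'g" where "N b = (\<chi> j l. frame b (zel b (\<kappa> l)) $ j)" for b
  have "columns (N a) = S"
  proof -
    have "column l (N a) = s l" for l by (simp add: column_def N_def \<kappa> vec_eq_iff)
    then have "columns (N a) = range s" unfolding columns_def by auto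
    then show ?thesis using bij_betw_imp_surj_on[OF s] by simp
  qed
  then have "\<exists>N'. N a ** N' = mat 1"
    using matrix_right_invertible_span_columns[of "N a"] \<open>vec.span S = UNIV\<close> by simp
  then have "invertible (N a)" using matrix_left_right_inverse unfolding invertible_def by blast
  then have det_a: "det (N a) \<noteq> 0" by (simp add: invertible_det_nz)
  have N_hol: "hol M W (\<lambda>b. N b $ i $ l)" if "openin (sp_topology M) W" for i l W
    unfolding N_def vec_lambda_beta by (rule affine_fun_hol[OF affine_fun_frame_coord that])
  define U where "U = {b \<in> M. det (N b) \<noteq> 0}"
  have U: "openin (sp_topology M) U"
    unfolding U_def by (rule hol_nonzero_open[OF hol_det[OF openin_whole N_hol[OF openin_whole]]])
  define c where "c l j b = det (\<chi> i m. if m = l then axis j 1 $ i else N b $ i $ m) / det (N b)" for l j b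
  have "hol M U (c l j)" for l j
    unfolding c_def
  proof (intro hol_divide hol_det U)
    show "hol M U (\<lambda>b. (\<chi> i m. if m = l then axis j 1 $ i else N b $ i $ m) $ i $ m)" for i m
      by (cases "m = l") (simp_all add: hol_const[OF U] N_hol[OF U])
    show "hol M U (\<lambda>b. N b $ i $ m)" for i m by (rule N_hol[OF U])
    show "det (N b) \<noteq> 0" if "b \<in> U" for b using that by (simp add: U_def)
  qed
  moreover have "(\<Sum>l\<in>UNIV. frame b (zel b (\<kappa> l)) $ i * c l j b) = (if i = j then 1 else 0)" if b: "b \<in> U" for b i j
  proof -
    have "det (N b) \<noteq> 0" using b by (simp add: U_def)
    from cramer[OF this] have "N b *v (\<chi> l. c l j b) = axis j 1"
      unfolding c_def by blast
    from arg_cong[OF this, of "\<lambda>v. v $ i"] show ?thesis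
      by (simp add: matrix_vector_mult_def N_def axis_def)
  qed
  ultimately have "trivialization U \<kappa> c" unfolding trivialization_def using U by blast
  moreover have "a \<in> U" using a det_a by (simp add: U_def)
  ultimately show ?thesis by blast
qed

context
  fixes U \<kappa> c assumes triv: "trivialization U \<kappa> c"
begin

lemma triv_open: "openin (sp_topology M) U"
  and triv_hol: "hol M U (c l j)"
  and triv_inverse: "b \<in> U \<Longrightarrow> (\<Sum>l\<in>UNIV. frame b (zel b (\<kappa> l)) $ i * c l j b) = (if i = j then 1 else 0)"
  using triv unfolding trivialization_def by blast+

lemma triv_mem: "b \<in> U \<Longrightarrow> b \<in> M"
  using openin_sp_subset[OF triv_open] by blast

lemma fibre_value_fibre_lift:
  fixes Q :: "('d::finite \<times> 'g) cpoly"
  assumes b: "b \<in> U"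
  shows "fibre_value b (fibre_lift \<kappa> c b Q) = Q"
proof (induction Q rule: cpoly_induct)
  case (var x)
  obtain i j where x: "x = (i, j)" by fastforce
  have "fibre_value b (fibre_lift \<kappa> c b (PVar (i, j)))
      = (\<Sum>l\<in>UNIV. PConst (c l j b) * (\<Sum>j'\<in>UNIV. PConst (frame b (zel b (\<kappa> l)) $ j') * PVar (i, j')))"
    by (simp add: fibre_lift_hom fibre_value_hom)
  also have "\<dots> = (\<Sum>j'\<in>UNIV. PConst (\<Sum>l\<in>UNIV. frame b (zel b (\<kappa> l)) $ j' * c l j b) * PVar (i, j'))"
    unfolding sum_distrib_left PConst_sum sum_distrib_right
    by (subst sum.swap) (simp add: PConst_mult mult_ac)
  also have "\<dots> = (\<Sum>j'\<in>UNIV. if j' = j then PVar (i, j') else 0)"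
    unfolding triv_inverse[OF b] by (intro sum.cong) auto
  finally show ?case unfolding x by simp
qed (simp_all add: fibre_lift_hom fibre_value_hom)

lemma expandable_fibre_lift:
  fixes Q :: "('d::finite \<times> 'g) cpoly"
  shows "expandable M U (\<lambda>b. fibre_lift \<kappa> c b Q)"
proof (induction Q rule: cpoly_induct)
  case (var x)
  obtain i j where x: "x = (i, j)" by fastforce
  show ?case unfolding x fibre_lift_hom by (intro expandable_sum triv_open expandable_hol triv_hol)
qed (simp_all add: fibre_lift_hom expandable_const[OF triv_open] expandable_add expandable_mult)

lemma expandable_fibre_lift_fibre_value:
  fixes P :: "('d::finite) fock"
  shows "expandable M U (\<lambda>b. fibre_lift \<kappa> c b (fibre_value b P))"
proof (induction P rule: cpoly_induct)
  case (var x)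
  obtain i k where x: "x = (i, k)" by fastforce
  show ?case unfolding x fibre_value_hom fibre_lift_hom
    by (intro expandable_sum expandable_mult triv_open expandable_hol triv_hol
        affine_fun_hol[OF affine_fun_frame_coord triv_open, THEN expandable_hol[where P = 1, simplified]])
qed (simp_all add: fibre_value_hom fibre_lift_hom expandable_const[OF triv_open] expandable_add expandable_mult)

text \<open>The generator \<open>t^{-k-1}\<close>, minus the combination of the chosen generators with the same image in \<open>Z / F\<close>. It shows
  that modulo \<open>\<hh>\<^sub>\<Gamma> \<otimes> F\<close> the chosen generators suffice.\<close>

definition kernel_section :: "nat \<Rightarrow> 'g extpt \<Rightarrow> hprime" where
  "kernel_section k b = zel b k -
     (\<Sum>l\<in>UNIV. hscale (\<Sum>j\<in>UNIV. c l j b * frame b (zel b k) $ j) (zel b (\<kappa> l)))"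

lemma F_section_kernel_section: "F_section M U (kernel_section k)"
  unfolding F_section_def
proof (intro conjI ballI allI triv_open)
  fix b assume b: "b \<in> U"
  note bM = triv_mem[OF b] and fr = Sp_framed[OF triv_mem[OF b]]
  note sub = framed_subspace[OF fr]
  let ?d = "\<lambda>l. \<Sum>j\<in>UNIV. c l j b * frame b (zel b k) $ j"
  have sZ: "(\<Sum>l\<in>UNIV. hscale (?d l) (zel b (\<kappa> l))) \<in> Zof b"
    by (intro hp.subspace_sum[OF sub] hp.subspace_scale[OF sub] zel_mem[OF bM])
  have "frame b (\<Sum>l\<in>UNIV. hscale (?d l) (zel b (\<kappa> l))) = (\<Sum>l\<in>UNIV. ?d l *s frame b (zel b (\<kappa> l)))"
    by (subst framed_sum[OF fr]) (simp_all add: framed_scale[OF fr] zel_mem[OF bM] hp.subspace_scale[OF sub])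
  also have "\<dots> = frame b (zel b k)"
  proof (rule vec_eq_iff[THEN iffD2], rule allI)
    fix i
    have "(\<Sum>l\<in>UNIV. ?d l *s frame b (zel b (\<kappa> l))) $ i
        = (\<Sum>l\<in>UNIV. \<Sum>j\<in>UNIV. frame b (zel b k) $ j * (frame b (zel b (\<kappa> l)) $ i * c l j b))"
      by (simp add: sum_component sum_distrib_right sum_distrib_left mult_ac)
    also have "\<dots> = (\<Sum>j\<in>UNIV. frame b (zel b k) $ j * (\<Sum>l\<in>UNIV. frame b (zel b (\<kappa> l)) $ i * c l j b))"
      unfolding sum_distrib_left by (rule sum.swap)
    also have "\<dots> = (\<Sum>j\<in>UNIV. if i = j then frame b (zel b k) $ j else 0)"
      unfolding triv_inverse[OF b] by (intro sum.cong) auto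
    finally show "(\<Sum>l\<in>UNIV. ?d l *s frame b (zel b (\<kappa> l))) $ i = frame b (zel b k) $ i" by simp
  qed
  finally have "frame b (kernel_section k b) = 0"
    unfolding kernel_section_def framed_diff[OF fr zel_mem[OF bM] sZ] by simp
  moreover have "kernel_section k b \<in> Zof b"
    unfolding kernel_section_def by (rule hp.subspace_diff[OF sub zel_mem[OF bM] sZ])
  ultimately show "kernel_section k b \<in> Fof b" unfolding Sp_kernel[OF bM] frame_kernel_def by blast
next
  fix n
  show "hol M U (\<lambda>b. hcoeff (kernel_section k b) n)"
    unfolding kernel_section_def hcoeff_diff hcoeff_sum hcoeff_scale
    by (intro hol_diff hol_sum hol_mult triv_open triv_hol
        affine_fun_hol[OF affine_zel_coeff triv_open] affine_fun_hol[OF affine_fun_frame_coord triv_open])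
next
  fix a assume a: "a \<in> U"
  define m where "m = k + (\<Sum>l\<in>UNIV. \<kappa> l)"
  have km: "k \<le> m" "\<kappa> l \<le> m" for l unfolding m_def using member_le_sum[of l UNIV \<kappa>] by simp_all
  have "hcoeff (kernel_section k b) n = 0" if b: "b \<in> U" and n: "n < - int m - 1" for b n
  proof -
    have nn: "n = - int (nat (- n - 1)) - 1" "nat (- n - 1) > m" using n by simp_all
    have z: "hcoeff (zel b j) n = 0" if "j \<le> m" for j
      using zel_polar[OF triv_mem[OF b], of j "nat (- n - 1)"] nn that by simp
    show ?thesis
      unfolding kernel_section_def hcoeff_diff hcoeff_sum hcoeff_scale using z[OF km(1)] z[OF km(2)] by simp
  qed
  then show "\<exists>W\<subseteq>U. a \<in> W \<and> openin (sp_topology M) W \<and> (\<exists>N. \<forall>b\<in>W. \<forall>n<N. hcoeff (kernel_section k b) n = 0)"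
    using a triv_open by (intro exI[of _ U]) blast
qed

text \<open>Both \<open>P\<close> and its lifted value are multiplicative in \<open>P\<close>, so it suffices to compare them on generators, where the
  difference is the action of a section of the tautological sheaf.\<close>

lemma fibre_lift_fibre_value_congruent:
  fixes P :: "('d::finite) fock"
  shows "out_section M U (\<lambda>b. P - fibre_lift \<kappa> c b (fibre_value b P))"
proof (induction P rule: cpoly_induct)
  case (const r)
  show ?case using out_section_0[OF triv_open] by (simp add: fibre_value_hom fibre_lift_hom)
next
  case (var x)
  obtain i k where x: "x = (i, k)" by fastforce
  have "out_section M U (\<lambda>b. heis (axis i 1) (kernel_section k b))"
    by (rule out_section_single[OF F_section_kernel_section])
  then show ?case
  proof (rule out_section_cong)
    fix b assume b: "b \<in> U"
    have "fibre_lift \<kappa> c b (fibre_value b (PVar (i, k)))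
        = (\<Sum>j\<in>UNIV. \<Sum>l\<in>UNIV. PConst (c l j b * frame b (zel b k) $ j) * PVar (i, \<kappa> l))"
      by (simp add: fibre_value_hom fibre_lift_hom sum_distrib_left PConst_mult mult_ac)
    also have "\<dots> = (\<Sum>l\<in>UNIV. PConst (\<Sum>j\<in>UNIV. c l j b * frame b (zel b k) $ j) * PVar (i, \<kappa> l))"
      unfolding PConst_sum sum_distrib_right by (rule sum.swap)
    finally show "PVar x - fibre_lift \<kappa> c b (fibre_value b (PVar x)) = heis (axis i 1) (kernel_section k b)"
      unfolding x kernel_section_def heis_diff heis_sum heis_scale heis_axis_zel[OF triv_mem[OF b]] by simp
  qed
next
  case (add P Q)
  show ?case
    by (rule out_section_cong[OF out_section_add[OF add]]) (simp add: fibre_value_hom fibre_lift_hom algebra_simps)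
next
  case (mult P Q)
  have "out_section M U (\<lambda>b. Q * (P - fibre_lift \<kappa> c b (fibre_value b P)))"
    by (rule out_section_mult[OF mult(1) V_section_const[OF triv_open]])
  moreover have "out_section M U (\<lambda>b. fibre_lift \<kappa> c b (fibre_value b P) * (Q - fibre_lift \<kappa> c b (fibre_value b Q)))"
    by (rule out_section_mult[OF mult(2) expandable_V_section[OF expandable_fibre_lift_fibre_value]])
  ultimately show ?case
    by (rule out_section_cong[OF out_section_add]) (simp add: fibre_value_hom fibre_lift_hom algebra_simps)
qed

end

text \<open>Write the section as a finite sum of vectors \<open>P\<^sub>k\<close> with holomorphic coefficients and replace every \<open>P\<^sub>k\<close> by the lift
  of its value, which changes the section by a section of the image of \<open>\<hh>\<^sup>o\<^sup>u\<^sup>t\<close>. What remains is the lift of the value of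
  the section, which is \<open>0\<close>.\<close>

lemma fibre_value_zero_imp_out_stalk:
  fixes w :: "'g extpt \<Rightarrow> ('d::finite) fock"
  assumes w: "V_section M U w" and a: "a \<in> U" and zero: "\<And>b. b \<in> U \<Longrightarrow> fibre_value b (w b) = 0"
  shows "w \<in> out_stalk M a"
proof -
  have aM: "a \<in> M" using a openin_sp_subset[OF V_section_openin[OF w]] by blast
  obtain U' \<kappa> c where U': "a \<in> U'" "trivialization U' \<kappa> c" using exists_trivialization[OF aM] by blast
  obtain W where W: "W \<subseteq> U" "a \<in> W" "expandable M W w" using w a by (rule V_section_local)
  let ?W = "W \<inter> U'"
  have o: "openin (sp_topology M) ?W" by (rule openin_Int[OF expandable_openin[OF W(3)] triv_open[OF U'(2)]])
  have "expandable M ?W w" by (rule expandable_mono[OF W(3) o]) blast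
  then obtain n :: nat and \<phi> P where 1: "\<forall>k<n. hol M ?W (\<phi> k)" "\<forall>b\<in>?W. w b = (\<Sum>k<n. PConst (\<phi> k b) * P k)"
    by (rule expandableE)
  have "out_section M ?W (\<lambda>b. P k - fibre_lift \<kappa> c b (fibre_value b (P k)))" for k
    by (rule out_section_mono[OF fibre_lift_fibre_value_congruent[OF U'(2)] o]) blast
  moreover have "V_section M ?W (\<lambda>b. PConst (\<phi> k b))" if "k < n" for k
    using expandable_V_section[OF expandable_hol[of M ?W "\<phi> k" 1]] 1(1) that by simp
  ultimately have "out_section M ?W (\<lambda>b. \<Sum>k<n. PConst (\<phi> k b) * (P k - fibre_lift \<kappa> c b (fibre_value b (P k))))"
    by (intro out_section_sum[OF o] out_section_mult) auto
  then have "out_section M ?W w"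
  proof (rule out_section_cong)
    fix b assume b: "b \<in> ?W"
    have "(\<Sum>k<n. PConst (\<phi> k b) * (P k - fibre_lift \<kappa> c b (fibre_value b (P k)))) = w b - fibre_lift \<kappa> c b (fibre_value b (w b))"
      unfolding bspec[OF 1(2) b] by (simp add: fibre_value_hom fibre_lift_hom right_diff_distrib sum_subtractf)
    moreover have "fibre_value b (w b) = 0" using zero b W(1) by blast
    moreover have "fibre_lift \<kappa> c b 0 = (0 :: 'd fock)" by (simp add: fibre_lift_def)
    ultimately show "w b = (\<Sum>k<n. PConst (\<phi> k b) * (P k - fibre_lift \<kappa> c b (fibre_value b (P k))))" by simp
  qed
  then show ?thesis unfolding out_stalk_iff using W(2) U'(1) by blast
qed

lemma out_stalk_fibre_value_zero:
  fixes w :: "'g extpt \<Rightarrow> ('d::finite) fock"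
  assumes "w \<in> out_stalk M a"
  obtains U where "a \<in> U" "V_section M U w" "\<forall>b\<in>U. fibre_value b (w b) = 0"
proof -
  obtain U where U: "a \<in> U" "out_section M U w" using assms unfolding out_stalk_iff by blast
  obtain n :: nat and A f v where 1: "\<forall>k<n. F_section M U (f k) \<and> V_section M U (v k)"
    "\<forall>b\<in>U. w b = (\<Sum>k<n. heis (A k) (f k b) * v k b)" using U(2) by (rule out_sectionE)
  have "fibre_value b (w b) = 0" if b: "b \<in> U" for b
  proof -
    have bM: "b \<in> M" using b openin_sp_subset[OF out_section_openin[OF U(2)]] by blast
    have "fibre_value b (heis (A k) (f k b)) = 0" if "k < n" for k
      using 1(1) that b unfolding F_section_def by (intro fibre_value_heis_kernel[OF bM]) blast
    then show ?thesis unfolding bspec[OF 1(2) b] by (simp add: fibre_value_hom)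
  qed
  then show ?thesis using that[OF U(1) out_section_V_section[OF U(2)]] by blast
qed

end

section \<open>Coinvariants are families of constant value\<close>

lemma sp_act_scalar_sum:
  "sp_act g (\<Sum>k<n. PConst (r k) * P k) = (\<Sum>k<n::nat. PConst (r k) * sp_act g (P k))"
  by (simp add: sp_act_hom)

lemma sec_move_inverse:
  assumes g: "g \<in> SpPlus_full"
  shows "sec_move g (sec_move (inv g) v) = v"
  by (simp add: sec_move_def fun_eq_iff inv_inv_SpPlus[OF g] sp_move_inv[OF g] sp_act_inv[OF g])

context polarized_torus
begin

text \<open>The family of germs of sections with constant value \<open>Q\<close>: at each point it is one coset of the stalk of the image of
  \<open>\<hh>\<^sup>o\<^sup>u\<^sup>t\<close>. It is empty outside of \<open>Sp(X,\<Theta>)\<close>, as is required of families of stalk elements.\<close>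

definition coinv_of :: "('d::finite \<times> 'g) cpoly \<Rightarrow> 'g extpt \<Rightarrow> ('g extpt \<Rightarrow> 'd fock) set" where
  "coinv_of Q b = (if b \<in> M then {w. \<exists>U. b \<in> U \<and> V_section M U w \<and> (\<forall>c\<in>U. fibre_value c (w c) = Q)} else {})"

lemma coinv_ofI: "b \<in> U \<Longrightarrow> V_section M U w \<Longrightarrow> (\<And>c. c \<in> U \<Longrightarrow> fibre_value c (w c) = Q) \<Longrightarrow> w \<in> coinv_of Q b"
  using openin_sp_subset[OF V_section_openin, of M U w] unfolding coinv_of_def by auto

lemma coinv_ofE:
  assumes "w \<in> coinv_of Q b"
  obtains U where "b \<in> U" "V_section M U w" "\<forall>c\<in>U. fibre_value c (w c) = Q" "b \<in> M"
  using assms unfolding coinv_of_def by (auto split: if_splits)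

lemma coinv_of_fibre_value: "w \<in> coinv_of Q b \<Longrightarrow> fibre_value b (w b) = Q"
  by (erule coinv_ofE) blast

text \<open>The lift of \<open>Q\<close> over a trivializing set has constant value \<open>Q\<close>.\<close>

lemma coinv_of_local_section:
  fixes Q :: "('d::finite \<times> 'g) cpoly"
  assumes "a \<in> M"
  shows "\<exists>U v. a \<in> U \<and> V_section M U v \<and> (\<forall>b\<in>U. v \<in> coinv_of Q b)"
proof -
  obtain U \<kappa> c where U: "a \<in> U" "trivialization U \<kappa> c" using exists_trivialization[OF assms] by blast
  let ?v = "\<lambda>b. fibre_lift \<kappa> c b Q"
  have v: "V_section M U ?v" by (rule expandable_V_section[OF expandable_fibre_lift[OF U(2)]])
  have "?v \<in> coinv_of Q b" if "b \<in> U" for b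
    by (rule coinv_ofI[OF that v]) (rule fibre_value_fibre_lift[OF U(2)])
  then show ?thesis using U(1) v by blast
qed

lemma coinv_of_add_mem:
  assumes v: "v \<in> coinv_of Q b" and w: "w \<in> coinv_of R b"
  shows "v + w \<in> coinv_of (Q + R) b"
proof -
  obtain U where U: "b \<in> U" "V_section M U v" "\<forall>c\<in>U. fibre_value c (v c) = Q" "b \<in> M" using v by (rule coinv_ofE)
  obtain U' where U': "b \<in> U'" "V_section M U' w" "\<forall>c\<in>U'. fibre_value c (w c) = R" "b \<in> M" using w by (rule coinv_ofE)
  have o: "openin (sp_topology M) (U \<inter> U')" by (rule openin_Int[OF V_section_openin[OF U(2)] V_section_openin[OF U'(2)]])
  have "V_section M (U \<inter> U') (\<lambda>c. v c + w c)"
    by (intro V_section_add V_section_mono[OF U(2) o] V_section_mono[OF U'(2) o]) blast+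
  then have "V_section M (U \<inter> U') (v + w)" by (rule V_section_cong) simp
  then show ?thesis
    by (rule coinv_ofI[rotated]) (use U U' in \<open>auto simp: fibre_value_hom\<close>)
qed

lemma coinv_of_scale_mem:
  assumes "v \<in> coinv_of Q b"
  shows "(\<lambda>c. PConst r * v c) \<in> coinv_of (PConst r * Q) b"
proof -
  obtain U where U: "b \<in> U" "V_section M U v" "\<forall>c\<in>U. fibre_value c (v c) = Q" "b \<in> M" using assms by (rule coinv_ofE)
  show ?thesis
    by (rule coinv_ofI[OF U(1) V_section_scale[OF U(2)]]) (simp add: fibre_value_hom U(3))
qed

lemma coinv_of_diff_mem:
  assumes v: "v \<in> coinv_of Q b" and w: "w \<in> coinv_of R b"
  shows "v - w \<in> coinv_of (Q - R) b"
proof -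
  have "v + (\<lambda>c. PConst (- 1) * w c) \<in> coinv_of (Q + PConst (- 1) * R) b"
    by (rule coinv_of_add_mem[OF v coinv_of_scale_mem[OF w]])
  moreover have "v + (\<lambda>c. PConst (- 1) * w c) = v - w" by (simp add: fun_eq_iff PConst_uminus)
  moreover have "Q + PConst (- 1) * R = Q - R" by (simp add: PConst_uminus)
  ultimately show ?thesis by simp
qed

lemma coinv_of_0: "b \<in> M \<Longrightarrow> coinv_of 0 b = out_stalk M b"
proof (intro equalityI subsetI)
  fix w :: "'g extpt \<Rightarrow> ('d::finite) fock" assume "w \<in> coinv_of 0 b"
  then obtain U where "b \<in> U" "V_section M U w" "\<forall>c\<in>U. fibre_value c (w c) = 0" "b \<in> M" by (rule coinv_ofE)
  then show "w \<in> out_stalk M b" by (intro fibre_value_zero_imp_out_stalk[of U]) blast+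
next
  fix w :: "'g extpt \<Rightarrow> ('d::finite) fock" assume "w \<in> out_stalk M b"
  then obtain U where "b \<in> U" "V_section M U w" "\<forall>c\<in>U. fibre_value c (w c) = 0" by (rule out_stalk_fibre_value_zero)
  then show "w \<in> coinv_of 0 b" by (intro coinv_ofI[of b U]) blast+
qed

lemma coinv_of_coset:
  assumes v: "v \<in> coinv_of Q b"
  shows "coinv_of Q b = v +o out_stalk M b"
proof -
  have bM: "b \<in> M" using v by (rule coinv_ofE)
  show ?thesis
    unfolding coinv_of_0[OF bM, symmetric]
  proof (intro equalityI subsetI)
    fix w assume "w \<in> coinv_of Q b"
    from coinv_of_diff_mem[OF this v] have "w - v \<in> coinv_of 0 b" by simp
    then have "v + (w - v) \<in> v +o coinv_of 0 b" by (rule set_plus_intro2)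
    then show "w \<in> v +o coinv_of 0 b" by simp
  next
    fix w assume "w \<in> v +o coinv_of 0 b"
    then obtain u where "w = v + u" "u \<in> coinv_of 0 b" unfolding elt_set_plus_def by blast
    then show "w \<in> coinv_of Q b" using coinv_of_add_mem[OF v, of u 0] by simp
  qed
qed

lemma coinv_of_nonempty: "b \<in> M \<Longrightarrow> \<exists>v. v \<in> coinv_of Q b"
  using coinv_of_local_section[of b Q] by blast

lemma coinv_of_add:
  "coinv_of Q + coinv_of R = (coinv_of (Q + R) :: 'g extpt \<Rightarrow> ('g extpt \<Rightarrow> ('d::finite) fock) set)"
proof (rule ext)
  fix b
  show "(coinv_of Q + coinv_of R) b = (coinv_of (Q + R) :: 'g extpt \<Rightarrow> ('g extpt \<Rightarrow> ('d::finite) fock) set) b"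
  proof (cases "b \<in> M")
    case True
    show ?thesis
      unfolding plus_fun_apply
    proof (intro equalityI subsetI)
      fix x :: "'g extpt \<Rightarrow> 'd fock" assume "x \<in> coinv_of Q b + coinv_of R b"
      then obtain v w where "x = v + w" "v \<in> coinv_of Q b" "w \<in> coinv_of R b" by (rule set_plus_elim)
      then show "x \<in> coinv_of (Q + R) b" using coinv_of_add_mem by blast
    next
      fix x :: "'g extpt \<Rightarrow> 'd fock" assume x: "x \<in> coinv_of (Q + R) b"
      obtain v :: "'g extpt \<Rightarrow> 'd fock" where v: "v \<in> coinv_of Q b" using coinv_of_nonempty[OF True] by blast
      have "x - v \<in> coinv_of R b" using coinv_of_diff_mem[OF x v] by simp
      with v have "v + (x - v) \<in> coinv_of Q b + coinv_of R b" by (rule set_plus_intro)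
      then show "x \<in> coinv_of Q b + coinv_of R b" by simp
    qed
  next
    case False
    then show ?thesis by (simp add: coinv_of_def set_plus_def)
  qed
qed

lemma coinv_of_scale:
  "coinv_scale M r (coinv_of Q) = (coinv_of (PConst r * Q) :: 'g extpt \<Rightarrow> ('g extpt \<Rightarrow> ('d::finite) fock) set)"
proof (rule ext)
  fix b
  show "coinv_scale M r (coinv_of Q) b = (coinv_of (PConst r * Q) :: 'g extpt \<Rightarrow> ('g extpt \<Rightarrow> ('d::finite) fock) set) b"
  proof (cases "b \<in> M")
    case True
    show ?thesis
      unfolding coinv_scale_def coinv_of_0[OF True, symmetric]
    proof (intro equalityI subsetI)
      fix x :: "'g extpt \<Rightarrow> 'd fock" assume "x \<in> (\<lambda>v b. PConst r * v b) ` coinv_of Q b + coinv_of 0 b"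
      then obtain v w where "x = (\<lambda>c. PConst r * v c) + w" "v \<in> coinv_of Q b" "w \<in> coinv_of 0 b"
        by (elim set_plus_elim imageE) blast
      then show "x \<in> coinv_of (PConst r * Q) b"
        using coinv_of_add_mem[OF coinv_of_scale_mem, of v Q b w 0 r] by simp
    next
      fix x :: "'g extpt \<Rightarrow> 'd fock" assume x: "x \<in> coinv_of (PConst r * Q) b"
      obtain v :: "'g extpt \<Rightarrow> 'd fock" where v: "v \<in> coinv_of Q b" using coinv_of_nonempty[OF True] by blast
      have "x - (\<lambda>c. PConst r * v c) \<in> coinv_of 0 b"
        using coinv_of_diff_mem[OF x coinv_of_scale_mem[OF v, of r]] by simp
      with imageI[OF v, of "\<lambda>v b. PConst r * v b"]
      have "(\<lambda>c. PConst r * v c) + (x - (\<lambda>c. PConst r * v c)) \<in> (\<lambda>v b. PConst r * v b) ` coinv_of Q b + coinv_of 0 b"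
        by (rule set_plus_intro)
      then show "x \<in> (\<lambda>v b. PConst r * v b) ` coinv_of Q b + coinv_of 0 b" by simp
    qed
  next
    case False
    then show ?thesis by (simp add: coinv_of_def coinv_scale_def set_plus_def)
  qed
qed

text \<open>Moving a section by \<open>g\<close> pulls the coefficients back along a map with affine coordinates, and preserves values.\<close>

lemma sec_move_coinv_of:
  assumes g: "g \<in> SpPlus_full" and w: "w \<in> coinv_of Q a"
  shows "sec_move g w \<in> coinv_of Q (sp_move g a)"
proof -
  obtain U where U: "a \<in> U" "V_section M U w" "\<forall>c\<in>U. fibre_value c (w c) = Q" "a \<in> M" using w by (rule coinv_ofE)
  let ?T = "sp_move (inv g)"
  note ig = SpPlus_full_inv[OF g]
  let ?U = "{b \<in> M. ?T b \<in> U}"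
  have "V_section M ?U (sec_move g w)"
    unfolding V_section_iff
  proof (intro conjI ballI openin_move[OF ig V_section_openin[OF U(2)]])
    fix b assume b: "b \<in> ?U"
    then have "?T b \<in> U" by simp
    with U(2) obtain W where W: "W \<subseteq> U" "?T b \<in> W" "expandable M W w" by (rule V_section_local)
    obtain n :: nat and \<phi> P where 1: "\<forall>k<n. hol M W (\<phi> k)" "\<forall>b\<in>W. w b = (\<Sum>k<n. PConst (\<phi> k b) * P k)"
      using W(3) by (rule expandableE)
    have "expandable M {b \<in> M. ?T b \<in> W} (sec_move g w)"
    proof (rule expandableI[where I = "{..<n}" and \<phi> = "\<lambda>k b. \<phi> k (?T b)" and P = "\<lambda>k. sp_act g (P k)"])
      show "openin (sp_topology M) {b \<in> M. ?T b \<in> W}" by (rule openin_move[OF ig expandable_openin[OF W(3)]])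
      show "hol M {b \<in> M. ?T b \<in> W} (\<lambda>b. \<phi> k (?T b))" if "k \<in> {..<n}" for k
        using 1(1) that by (intro hol_move[OF ig]) simp
      show "sec_move g w b = (\<Sum>k<n. PConst (\<phi> k (?T b)) * sp_act g (P k))" if "b \<in> {b \<in> M. ?T b \<in> W}" for b
      proof -
        have "?T b \<in> W" using that by simp
        have "w (?T b) = (\<Sum>k<n. PConst (\<phi> k (?T b)) * P k)" by (rule bspec[OF 1(2) \<open>?T b \<in> W\<close>])
        then show ?thesis unfolding sec_move_def by (simp only: sp_act_scalar_sum)
      qed
    qed simp
    moreover have "{b \<in> M. ?T b \<in> W} \<subseteq> ?U" using W(1) by blast
    ultimately show "\<exists>W\<subseteq>?U. b \<in> W \<and> expandable M W (sec_move g w)"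
      using W(2) b by (intro exI[of _ "{b \<in> M. ?T b \<in> W}"]) blast
  qed
  moreover have "sp_move g a \<in> ?U"
    using U(1,4) by (simp add: sp_move_inv[OF g] sp_move_in_Sp[OF g])
  moreover have "fibre_value c (sec_move g w c) = Q" if c: "c \<in> ?U" for c
  proof -
    have cM: "?T c \<in> M" using c sp_move_in_Sp[OF ig] by blast
    have "fibre_value c (sec_move g w c) = fibre_value (sp_move g (?T c)) (sp_act g (w (?T c)))"
      unfolding sec_move_def sp_move_inv(1)[OF g] ..
    also have "\<dots> = fibre_value (?T c) (w (?T c))" by (rule fibre_value_move[OF g cM])
    also have "\<dots> = Q" using U(3) c by blast
    finally show ?thesis .
  qed
  ultimately show ?thesis by (intro coinv_ofI[of "sp_move g a" ?U])
qed

lemma sec_move_coinv_of_image: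
  assumes g: "g \<in> SpPlus_full" and a: "a \<in> M"
  shows "sec_move g ` coinv_of Q a = coinv_of Q (sp_move g a)"
proof (intro equalityI subsetI)
  fix x assume "x \<in> sec_move g ` coinv_of Q a"
  then show "x \<in> coinv_of Q (sp_move g a)" using sec_move_coinv_of[OF g] by blast
next
  fix x assume "x \<in> coinv_of Q (sp_move g a)"
  from sec_move_coinv_of[OF SpPlus_full_inv[OF g] this]
  have "sec_move (inv g) x \<in> coinv_of Q a" unfolding sp_move_inv(2)[OF g] .
  then have "sec_move g (sec_move (inv g) x) \<in> sec_move g ` coinv_of Q a" by (rule imageI)
  then show "x \<in> sec_move g ` coinv_of Q a" unfolding sec_move_inverse[OF g] .
qed

lemma zero_in_out_stalk: "a \<in> M \<Longrightarrow> (0 :: 'g extpt \<Rightarrow> ('d::finite) fock) \<in> out_stalk M a"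
  unfolding out_stalk_iff zero_fun_def using out_section_0[OF openin_whole] by blast

text \<open>Any two elements of the stalk coset of a coinvariant at \<open>a\<close> have the same value at \<open>a\<close>. This value is invariant under the
  group, hence the same at all points. A local section that represents the coinvariant thus has constant value \<open>Q\<close>, and
  so the coset is the one of \<open>Q\<close>.\<close>

lemma coinvariants_eq_range:
  "(coinvariants \<Lambda> B :: ('g extpt \<Rightarrow> ('g extpt \<Rightarrow> ('d::finite) fock) set) set) = range coinv_of"
proof (intro equalityI subsetI)
  fix s :: "'g extpt \<Rightarrow> ('g extpt \<Rightarrow> 'd fock) set" assume "s \<in> range coinv_of"
  then obtain Q where s: "s = coinv_of Q" by blast
  have loc: "\<exists>U v. a \<in> U \<and> V_section M U v \<and> (\<forall>b\<in>U. s b = v +o out_stalk M b)" if a: "a \<in> M" for a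
  proof -
    obtain U v where v: "a \<in> U" "V_section M U v" "\<forall>b\<in>U. v \<in> coinv_of Q b"
      using coinv_of_local_section[OF a, of Q] by blast
    have "\<forall>b\<in>U. s b = v +o out_stalk M b"
      unfolding s using v(3) by (intro ballI coinv_of_coset) (rule bspec)
    then show ?thesis using v(1,2) by blast
  qed
  have off: "s a = {}" if "a \<notin> M" for a using that by (simp add: s coinv_of_def)
  have equi: "sec_move g ` s a = s (sp_move g a)" if "g \<in> SpPlus" "a \<in> M" for g a
    unfolding s by (rule sec_move_coinv_of_image[OF SpPlus_subset_full[OF that(1)] that(2)])
  show "s \<in> coinvariants \<Lambda> B"
    unfolding coinvariants_def coinv_sections_def
    by (intro CollectI conjI ballI allI impI loc off equi)
next
  fix s :: "'g extpt \<Rightarrow> ('g extpt \<Rightarrow> 'd fock) set" assume s: "s \<in> coinvariants \<Lambda> B"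
  have "\<forall>a\<in>M. \<exists>U v. a \<in> U \<and> V_section M U v \<and> (\<forall>b\<in>U. s b = v +o out_stalk M b)"
    and "\<forall>a. a \<notin> M \<longrightarrow> s a = {}" and "\<forall>g\<in>SpPlus. \<forall>a\<in>M. sec_move g ` s a = s (sp_move g a)"
    by (insert s, unfold coinvariants_def coinv_sections_def mem_Collect_eq, (elim conjE, assumption)+)
  then have loc: "a \<in> M \<Longrightarrow> \<exists>U v. a \<in> U \<and> V_section M U v \<and> (\<forall>b\<in>U. s b = v +o out_stalk M b)"
    and off: "a \<notin> M \<Longrightarrow> s a = {}"
    and equi: "g \<in> SpPlus \<Longrightarrow> a \<in> M \<Longrightarrow> sec_move g ` s a = s (sp_move g a)" for a g by simp_all
  have uniq: "fibre_value a (v a) = fibre_value a (w a)" if a: "a \<in> M" and v: "v \<in> s a" and w: "w \<in> s a" for a v w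
  proof -
    obtain U u where u: "a \<in> U" "s a = u +o out_stalk M a" using loc[OF a] by blast
    have "fibre_value a (x a) = fibre_value a (u a)" if x: "x \<in> s a" for x
    proof -
      obtain y where y: "x = u + y" "y \<in> out_stalk M a" using x u(2) unfolding elt_set_plus_def by blast
      obtain U' where "a \<in> U'" "V_section M U' y" "\<forall>b\<in>U'. fibre_value b (y b) = 0" using y(2) by (rule out_stalk_fibre_value_zero)
      then have "fibre_value a (y a) = 0" by blast
      then show ?thesis unfolding y(1) plus_fun_apply fibre_value_hom by simp
    qed
    then show ?thesis using v w by simp
  qed
  have ex: "\<exists>v. v \<in> s a" if a: "a \<in> M" for a
  proof -
    obtain U u where u: "a \<in> U" "s a = u +o out_stalk M a" using loc[OF a] by blast
    then show ?thesis using set_plus_intro2[OF zero_in_out_stalk[OF a], of u] by blast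
  qed
  define c where "c a = fibre_value a ((SOME v. v \<in> s a) a)" for a
  have c: "fibre_value a (v a) = c a" if "a \<in> M" "v \<in> s a" for a v
    unfolding c_def by (rule uniq[OF that]) (rule someI[of "\<lambda>v. v \<in> s a", OF that(2)])
  have inv: "c (sp_move g a) = c a" if g: "g \<in> SpPlus" and a: "a \<in> M" for g a
  proof -
    note gf = SpPlus_subset_full[OF g]
    obtain v where v: "v \<in> s a" using ex[OF a] by blast
    then have "sec_move g v \<in> s (sp_move g a)" using equi[OF g a] by blast
    from c[OF sp_move_in_Sp[OF gf a] this]
    have "c (sp_move g a) = fibre_value (sp_move g a) (sec_move g v (sp_move g a))" ..
    also have "\<dots> = fibre_value (sp_move g a) (sp_act g (v a))" unfolding sec_move_def sp_move_inv(2)[OF gf] ..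
    also have "\<dots> = fibre_value a (v a)" by (rule fibre_value_move[OF gf a])
    also have "\<dots> = c a" by (rule c[OF a v])
    finally show ?thesis .
  qed
  obtain a0 where a0: "a0 \<in> M" using Sp_nonempty by blast
  have const: "c a = c a0" if "a \<in> M" for a by (rule SpPlus_invariant_constant[OF inv that a0])
  have "s = coinv_of (c a0)"
  proof (rule ext)
    fix a
    show "s a = coinv_of (c a0) a"
    proof (cases "a \<in> M")
      case True
      obtain U v where U: "a \<in> U" "V_section M U v" "\<forall>b\<in>U. s b = v +o out_stalk M b" using loc[OF True] by blast
      have UM: "b \<in> M" if "b \<in> U" for b using openin_sp_subset[OF V_section_openin[OF U(2)]] that by blast
      have "v \<in> s b" if "b \<in> U" for b
        using set_plus_intro2[OF zero_in_out_stalk[OF UM[OF that]], of v] U(3) that by simp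
      then have "fibre_value b (v b) = c a0" if "b \<in> U" for b using c[OF UM[OF that]] const[OF UM[OF that]] that by simp
      then have "v \<in> coinv_of (c a0) a" by (rule coinv_ofI[OF U(1,2)])
      from coinv_of_coset[OF this] show ?thesis using U(1,3) by simp
    next
      case False
      then show ?thesis by (simp add: off coinv_of_def)
    qed
  qed
  then show "s \<in> range coinv_of" by blast
qed

lemma inj_coinv_of: "inj (coinv_of :: ('d::finite \<times> 'g) cpoly \<Rightarrow> _)"
proof (rule injI)
  fix Q R :: "('d \<times> 'g) cpoly" assume eq: "coinv_of Q = coinv_of R"
  obtain a where a: "a \<in> M" using Sp_nonempty by blast
  obtain v :: "'g extpt \<Rightarrow> 'd fock" where v: "v \<in> coinv_of Q a" using coinv_of_nonempty[OF a] by blast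
  have "fibre_value a (v a) = Q" by (rule coinv_of_fibre_value[OF v])
  moreover have "fibre_value a (v a) = R" by (rule coinv_of_fibre_value) (use v eq in simp)
  ultimately show "Q = R" by simp
qed

end

section \<open>Holomorphic 1-forms on a complex torus\<close>

definition coord_form :: "'g \<Rightarrow> complex^'g \<Rightarrow> complex^'g \<Rightarrow> complex" where
  "coord_form j = (\<lambda>x v. v $ j)"

lemma coord_form_in_H0: "coord_form j \<in> H0_Omega \<Lambda>"
  unfolding H0_Omega_def coord_form_def by (auto intro!: exI[of _ "\<lambda>_. 0"])

lemma H0_Omega_add: "\<omega> \<in> H0_Omega \<Lambda> \<Longrightarrow> \<eta> \<in> H0_Omega \<Lambda> \<Longrightarrow> \<omega> + \<eta> \<in> H0_Omega \<Lambda>"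
proof -
  assume w: "\<omega> \<in> H0_Omega \<Lambda>" and e: "\<eta> \<in> H0_Omega \<Lambda>"
  have "\<exists>D. ((\<lambda>y. (\<omega> + \<eta>) y v) has_derivative D) (at x) \<and> (\<forall>c u. D (c *s u) = c * D u)" for v x
  proof -
    obtain D where D: "((\<lambda>y. \<omega> y v) has_derivative D) (at x)" "\<forall>c u. D (c *s u) = c * D u"
      using w unfolding H0_Omega_def by blast
    obtain D' where D': "((\<lambda>y. \<eta> y v) has_derivative D') (at x)" "\<forall>c u. D' (c *s u) = c * D' u"
      using e unfolding H0_Omega_def by blast
    have "((\<lambda>y. \<omega> y v + \<eta> y v) has_derivative (\<lambda>u. D u + D' u)) (at x)"
      by (rule has_derivative_add[OF D(1) D'(1)])
    then show ?thesis using D(2) D'(2)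
      by (intro exI[of _ "\<lambda>u. D u + D' u"]) (simp add: distrib_left)
  qed
  then show ?thesis using w e unfolding H0_Omega_def by (simp add: algebra_simps fun_eq_iff)
qed

lemma H0_Omega_scale: "\<omega> \<in> H0_Omega \<Lambda> \<Longrightarrow> (\<lambda>x v. c * \<omega> x v) \<in> H0_Omega \<Lambda>"
proof -
  assume w: "\<omega> \<in> H0_Omega \<Lambda>"
  have "\<exists>D. ((\<lambda>y. c * \<omega> y v) has_derivative D) (at x) \<and> (\<forall>c u. D (c *s u) = c * D u)" for v x
  proof -
    obtain D where D: "((\<lambda>y. \<omega> y v) has_derivative D) (at x)" "\<forall>c u. D (c *s u) = c * D u"
      using w unfolding H0_Omega_def by blast
    have "((\<lambda>y. c * \<omega> y v) has_derivative (\<lambda>u. c * D u)) (at x)"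
      by (rule has_derivative_mult_right[OF D(1)])
    then show ?thesis using D(2) by (intro exI[of _ "\<lambda>u. c * D u"]) simp
  qed
  then show ?thesis using w unfolding H0_Omega_def by (simp add: algebra_simps fun_eq_iff)
qed

lemma H0_Omega_0: "(\<lambda>x v. 0) \<in> H0_Omega \<Lambda>"
  using H0_Omega_scale[OF coord_form_in_H0, of 0] by simp

text \<open>The sum runs over a set \<open>I\<close> of coordinates, for the sake of inductions; all 1-forms arise for \<open>I = UNIV\<close>.\<close>

definition constant_form :: "('g \<Rightarrow> complex) \<Rightarrow> 'g set \<Rightarrow> complex^'g \<Rightarrow> complex^'g \<Rightarrow> complex" where
  "constant_form a I = (\<lambda>x v. \<Sum>j\<in>I. a j * coord_form j x v)"

lemma constant_form_in_H0: "constant_form a I \<in> H0_Omega \<Lambda>"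
proof (induction I rule: infinite_finite_induct)
  case (insert j I)
  have "constant_form a (insert j I) = (\<lambda>x v. a j * coord_form j x v) + constant_form a I"
    using insert.hyps by (simp add: constant_form_def fun_eq_iff)
  then show ?case using H0_Omega_add[OF H0_Omega_scale[OF coord_form_in_H0] insert.IH] by metis
qed (simp_all add: constant_form_def H0_Omega_0)

lemma H0_Omega_linear:
  assumes "\<omega> \<in> H0_Omega \<Lambda>"
  shows "\<omega> x (u + v) = \<omega> x u + \<omega> x v" "\<omega> x (c *s v) = c * \<omega> x v"
    and "\<omega> x v = (\<Sum>j\<in>UNIV. v $ j * \<omega> x (axis j 1))"
proof -
  show add: "\<omega> x (u + v) = \<omega> x u + \<omega> x v" and sc: "\<omega> x (c *s v) = c * \<omega> x v" for u v c
    using assms unfolding H0_Omega_def by blast+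
  have w0: "\<omega> x 0 = 0" using sc[of 0 0] by simp
  have "\<omega> x (\<Sum>j\<in>I. v $ j *s axis j 1) = (\<Sum>j\<in>I. v $ j * \<omega> x (axis j 1))" for I
    by (induction I rule: infinite_finite_induct) (simp_all add: w0 add sc)
  from this[of UNIV] show "\<omega> x v = (\<Sum>j\<in>UNIV. v $ j * \<omega> x (axis j 1))" by (simp only: basis_expansion)
qed

context polarized_torus
begin

text \<open>The coefficients of a 1-form are periodic, hence take all their values on a compact set and are bounded. By Liouville's
  theorem they are constant on the complex line through \<open>0\<close> and \<open>x\<close>.\<close>

lemma H0_Omega_constant:
  assumes w: "\<omega> \<in> H0_Omega \<Lambda>"
  shows "\<omega> x v = \<omega> 0 v"
proof -
  let ?f = "\<lambda>y. \<omega> y v"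
  have der: "\<exists>D. (?f has_derivative D) (at y) \<and> (\<forall>c u. D (c *s u) = c * D u)" for y
    using w unfolding H0_Omega_def by blast
  have per: "?f (y + l) = ?f y" if "l \<in> \<Lambda>" for y l
    using w that unfolding H0_Omega_def by simp
  have "continuous_on UNIV ?f"
    unfolding continuous_on_eq_continuous_at[OF open_UNIV] using der has_derivative_continuous by blast
  obtain S where S: "finite S" "card S = 2 * CARD('g)" "independent S" "span S = UNIV"
    "\<Lambda> = {\<Sum>s\<in>S. of_int (m s) *\<^sub>R s |m :: complex^'g \<Rightarrow> int. True}"
    using lattice_basis by blast
  let ?R = "\<Sum>s\<in>S. norm s"
  have "?f y \<in> ?f ` cball 0 ?R" for y
  proof -
    have "y \<in> span S" using S(4) by simp
    then have "\<exists>c. y = (\<Sum>s\<in>S. c s *\<^sub>R s)" unfolding span_finite[OF S(1)] by blast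
    then obtain c where c: "y = (\<Sum>s\<in>S. c s *\<^sub>R s)" by (rule exE)
    let ?l = "\<Sum>s\<in>S. of_int \<lfloor>c s\<rfloor> *\<^sub>R s" and ?y = "\<Sum>s\<in>S. frac (c s) *\<^sub>R s"
    have yl: "y = ?y + ?l"
      unfolding c sum.distrib[symmetric] scaleR_left_distrib[symmetric] by (simp add: frac_def)
    have "?l \<in> \<Lambda>" unfolding S(5) by (intro CollectI exI[of _ "\<lambda>s. \<lfloor>c s\<rfloor>"]) simp
    then have "?f y = ?f ?y" using per[of ?l ?y] yl by simp
    moreover have "norm ?y \<le> ?R"
    proof (rule order_trans[OF norm_sum sum_mono])
      fix s show "norm (frac (c s) *\<^sub>R s) \<le> norm s"
        using frac_ge_0[of "c s"] frac_lt_1[of "c s"] by (simp add: mult_left_le_one_le)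
    qed
    ultimately show ?thesis by (intro image_eqI[of _ _ ?y]) simp_all
  qed
  then have "range ?f \<subseteq> ?f ` cball 0 ?R" by blast
  moreover have "bounded (?f ` cball 0 ?R)"
    by (intro compact_imp_bounded compact_continuous_image compact_cball
        continuous_on_subset[OF \<open>continuous_on UNIV ?f\<close>]) simp
  ultimately have bounded: "bounded (range ?f)" by (rule bounded_subset[rotated])
  have hol: "(\<lambda>z. ?f (z *s x)) holomorphic_on UNIV"
    unfolding holomorphic_on_open[OF open_UNIV]
  proof (intro ballI)
    fix z
    obtain D where D: "(?f has_derivative D) (at (z *s x))" "\<forall>c u. D (c *s u) = c * D u"
      using der[of "z *s x"] by blast
    have "bounded_linear (\<lambda>z :: complex. z *s x)"
    proof (rule linear_conv_bounded_linear[THEN iffD1], rule linearI)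
      show "(a + b) *s x = a *s x + b *s x" for a b by (rule vector_sadd_rdistrib)
      show "(r *\<^sub>R b) *s x = r *\<^sub>R (b *s x)" for r b
        unfolding vec_eq_iff vector_scaleR_component vector_smult_component by simp
    qed
    then have "((\<lambda>z. z *s x) has_derivative (\<lambda>z. z *s x)) (at z)"
      by (rule bounded_linear_imp_has_derivative)
    from has_derivative_compose[OF this D(1)]
    have "((\<lambda>z. ?f (z *s x)) has_derivative (\<lambda>u. D (u *s x))) (at z)" .
    then have "((\<lambda>z. ?f (z *s x)) has_field_derivative D x) (at z)"
      unfolding has_field_derivative_def by (rule has_derivative_eq_rhs) (simp add: fun_eq_iff D(2) mult.commute)
    then show "\<exists>f'. ((\<lambda>z. ?f (z *s x)) has_field_derivative f') (at z)" by blast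
  qed
  have "bounded (range (\<lambda>z. ?f (z *s x)))" by (rule bounded_subset[OF bounded]) blast
  from Liouville_theorem[OF hol this] obtain r where "\<And>z. ?f (z *s x) = r"
    unfolding constant_on_def by blast
  from this[of 1] this[of 0] show ?thesis by simp
qed

lemma H0_Omega_eq_constant_form:
  assumes "\<omega> \<in> H0_Omega \<Lambda>"
  shows "\<omega> = constant_form (\<lambda>j. \<omega> 0 (axis j 1)) UNIV"
proof (intro ext)
  fix x v
  have "\<omega> x v = \<omega> 0 v" by (rule H0_Omega_constant[OF assms])
  also have "\<dots> = (\<Sum>j\<in>UNIV. v $ j * \<omega> 0 (axis j 1))" by (rule H0_Omega_linear(3)[OF assms])
  finally show "\<omega> x v = constant_form (\<lambda>j. \<omega> 0 (axis j 1)) UNIV x v"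
    by (simp add: constant_form_def coord_form_def mult.commute)
qed

lemma tangent_functional_in_dual: "tangent_functional \<Lambda> v \<in> H0_dual \<Lambda>"
  unfolding dual_space_def tangent_functional_def by (simp add: H0_Omega_add H0_Omega_scale)

lemma tangent_functional_coord_form [simp]: "tangent_functional \<Lambda> v (coord_form j) = v $ j"
  unfolding tangent_functional_def if_P[OF coord_form_in_H0] by (simp add: coord_form_def)

lemma dual_constant_form:
  assumes "l \<in> H0_dual \<Lambda>"
  shows "l (constant_form a I) = (\<Sum>j\<in>I. a j * l (coord_form j))"
proof -
  have add: "l (\<omega> + \<eta>) = l \<omega> + l \<eta>" if "\<omega> \<in> H0_Omega \<Lambda>" "\<eta> \<in> H0_Omega \<Lambda>" for \<omega> \<eta>
    using assms that unfolding dual_space_def by blast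
  have scale: "l (\<lambda>x v. c * \<omega> x v) = c * l \<omega>" if "\<omega> \<in> H0_Omega \<Lambda>" for \<omega> c
    using assms that unfolding dual_space_def by blast
  have l0: "l (\<lambda>x v. 0) = 0" using scale[OF H0_Omega_0, of 0] by simp
  show ?thesis
  proof (induction I rule: infinite_finite_induct)
    case (insert j I)
    have "constant_form a (insert j I) = (\<lambda>x v. a j * coord_form j x v) + constant_form a I"
      using insert.hyps by (simp add: constant_form_def fun_eq_iff)
    then have "l (constant_form a (insert j I)) = a j * l (coord_form j) + l (constant_form a I)"
      by (simp only: add[OF H0_Omega_scale[OF coord_form_in_H0] constant_form_in_H0] scale[OF coord_form_in_H0])
    then show ?case using insert by simp
  qed (simp_all add: constant_form_def l0)
qed

text \<open>A functional is determined by its values on the coordinate forms, which span all 1-forms.\<close>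

lemma dual_eq_tangent_functional:
  assumes l: "l \<in> H0_dual \<Lambda>"
  shows "l = tangent_functional \<Lambda> (\<chi> j. l (coord_form j))"
proof (rule ext)
  fix \<omega>
  show "l \<omega> = tangent_functional \<Lambda> (\<chi> j. l (coord_form j)) \<omega>"
  proof (cases "\<omega> \<in> H0_Omega \<Lambda>")
    case True
    have "l \<omega> = l (constant_form (\<lambda>j. \<omega> 0 (axis j 1)) UNIV)" using H0_Omega_eq_constant_form[OF True] by simp
    also have "\<dots> = (\<Sum>j\<in>UNIV. \<omega> 0 (axis j 1) * l (coord_form j))" by (rule dual_constant_form[OF l])
    also have "\<dots> = \<omega> 0 (\<chi> j. l (coord_form j))"
      by (subst H0_Omega_linear(3)[OF True, of 0 "\<chi> j. l (coord_form j)"]) (simp add: mult.commute)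
    finally show ?thesis using True by (simp add: tangent_functional_def)
  next
    case False
    then show ?thesis using l by (simp add: dual_space_def tangent_functional_def)
  qed
qed

end

section \<open>The symmetric algebra\<close>

lemma module_times: "module ((*) :: 'r::comm_ring_1 \<Rightarrow> 'r \<Rightarrow> 'r)"
  by unfold_locales (simp_all add: algebra_simps)

lemma sym_ideal_0: "0 \<in> sym_ideal sc W"
  and sym_ideal_add: "P \<in> sym_ideal sc W \<Longrightarrow> Q \<in> sym_ideal sc W \<Longrightarrow> P + Q \<in> sym_ideal sc W"
  and sym_ideal_mult: "P \<in> sym_ideal sc W \<Longrightarrow> R * P \<in> sym_ideal sc W"
  and sym_ideal_base: "P \<in> bilin_relations sc W \<Longrightarrow> P \<in> sym_ideal sc W"
  unfolding sym_ideal_def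
  by (rule module.span_zero[OF module_times], erule (1) module.span_add[OF module_times],
      erule module.span_scale[OF module_times], erule module.span_base[OF module_times])

lemma sym_ideal_uminus: "P \<in> sym_ideal sc W \<Longrightarrow> - P \<in> sym_ideal sc W"
  using sym_ideal_mult[of P sc W "- 1"] by simp

lemma sym_coset_eq:
  assumes "P - Q \<in> sym_ideal sc W"
  shows "P +o sym_ideal sc W = Q +o sym_ideal sc W"
proof -
  have sub: "P +o sym_ideal sc W \<subseteq> Q +o sym_ideal sc W" if "P - Q \<in> sym_ideal sc W" for P Q
  proof
    fix x assume "x \<in> P +o sym_ideal sc W"
    then obtain j where j: "x = P + j" "j \<in> sym_ideal sc W" unfolding elt_set_plus_def by blast
    have "Q + ((P - Q) + j) \<in> Q +o sym_ideal sc W" by (intro set_plus_intro2 sym_ideal_add that j(2))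
    then show "x \<in> Q +o sym_ideal sc W" using j(1) by simp
  qed
  have "Q - P \<in> sym_ideal sc W" using sym_ideal_uminus[OF assms] by simp
  then show ?thesis using sub[OF assms] sub by blast
qed

lemma sym_coset_eq_imp:
  assumes "P +o sym_ideal sc W = Q +o sym_ideal sc W"
  shows "P - Q \<in> sym_ideal sc W"
proof -
  have "P + 0 \<in> Q +o sym_ideal sc W" unfolding assms[symmetric] by (intro set_plus_intro2 sym_ideal_0)
  then obtain j where "P + 0 = Q + j" "j \<in> sym_ideal sc W" unfolding elt_set_plus_def by blast
  then have "P - Q = j" by simp
  then show ?thesis using \<open>j \<in> sym_ideal sc W\<close> by simp
qed

lemma sym_coset_add:
  fixes P Q :: "((complex^'d) \<times> 'w::plus) cpoly"
  shows "(P +o sym_ideal sc W) + (Q +o sym_ideal sc W) = (P + Q) +o sym_ideal sc W"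
proof -
  have "sym_ideal sc W + sym_ideal sc W = (sym_ideal sc W :: ((complex^'d) \<times> 'w) cpoly set)"
  proof (intro equalityI subsetI)
    fix x :: "((complex^'d) \<times> 'w) cpoly" assume "x \<in> sym_ideal sc W + sym_ideal sc W"
    then show "x \<in> sym_ideal sc W" by (elim set_plus_elim) (simp add: sym_ideal_add)
  next
    fix x :: "((complex^'d) \<times> 'w) cpoly" assume "x \<in> sym_ideal sc W"
    then have "0 + x \<in> sym_ideal sc W + sym_ideal sc W" by (intro set_plus_intro sym_ideal_0)
    then show "x \<in> sym_ideal sc W + sym_ideal sc W" by simp
  qed
  then show ?thesis by (simp add: set_plus_rearrange)
qed

lemma sym_coset_scale:
  "sym_scale (sym_ideal sc W) c (P +o sym_ideal sc W) = (PConst c * P) +o sym_ideal sc W"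
  unfolding sym_scale_def
proof (intro equalityI subsetI)
  fix x assume "x \<in> (\<lambda>P. PConst c * P) ` (P +o sym_ideal sc W) + sym_ideal sc W"
  then obtain j j' where j: "x = PConst c * (P + j) + j'" "j \<in> sym_ideal sc W" "j' \<in> sym_ideal sc W"
    unfolding set_plus_def elt_set_plus_def by blast
  have "PConst c * P + (PConst c * j + j') \<in> (PConst c * P) +o sym_ideal sc W"
    by (intro set_plus_intro2 sym_ideal_add sym_ideal_mult j)
  then show "x \<in> (PConst c * P) +o sym_ideal sc W" using j(1) by (simp add: algebra_simps)
next
  fix x assume "x \<in> (PConst c * P) +o sym_ideal sc W"
  then obtain j where j: "x = PConst c * P + j" "j \<in> sym_ideal sc W" unfolding elt_set_plus_def by blast
  have "P + 0 \<in> P +o sym_ideal sc W" by (intro set_plus_intro2 sym_ideal_0)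
  then have "PConst c * (P + 0) \<in> (\<lambda>P. PConst c * P) ` (P +o sym_ideal sc W)" by (rule imageI)
  then have "PConst c * (P + 0) + j \<in> (\<lambda>P. PConst c * P) ` (P +o sym_ideal sc W) + sym_ideal sc W"
    using j(2) by (rule set_plus_intro)
  then show "x \<in> (\<lambda>P. PConst c * P) ` (P +o sym_ideal sc W) + sym_ideal sc W" using j(1) by simp
qed

text \<open>A map that is additive and homogeneous modulo the ideal takes linear combinations to linear combinations modulo the
  ideal. This serves for the two tensor factors in turn; \<open>D\<close> is the vector space on which additivity is known.\<close>

lemma linear_mod_ideal_sum:
  fixes f :: "'z::comm_monoid_add \<Rightarrow> ((complex^'d) \<times> 'w::plus) cpoly"
  assumes D: "\<And>x y. x \<in> D \<Longrightarrow> y \<in> D \<Longrightarrow> x + y \<in> D" "0 \<in> D" and z: "\<And>i. i \<in> I \<Longrightarrow> s (c i) (z i) \<in> D"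
    and add: "\<And>x y. x \<in> D \<Longrightarrow> y \<in> D \<Longrightarrow> f (x + y) - f x - f y \<in> sym_ideal sc W"
    and zero: "f 0 \<in> sym_ideal sc W"
    and scale: "\<And>i. i \<in> I \<Longrightarrow> f (s (c i) (z i)) - PConst (c i) * f (z i) \<in> sym_ideal sc W"
  shows "f (\<Sum>i\<in>I. s (c i) (z i)) - (\<Sum>i\<in>I. PConst (c i) * f (z i)) \<in> sym_ideal sc W
    \<and> (\<Sum>i\<in>I. s (c i) (z i)) \<in> D"
  using z scale
proof (induction I rule: infinite_finite_induct)
  case (insert i I)
  let ?x = "s (c i) (z i)" and ?S = "\<Sum>i\<in>I. s (c i) (z i)"
  have S: "f ?S - (\<Sum>i\<in>I. PConst (c i) * f (z i)) \<in> sym_ideal sc W" "?S \<in> D" using insert by simp_all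
  have x: "?x \<in> D" "f ?x - PConst (c i) * f (z i) \<in> sym_ideal sc W" using insert.prems by simp_all
  have "(f (?x + ?S) - f ?x - f ?S) + (f ?x - PConst (c i) * f (z i)) + (f ?S - (\<Sum>i\<in>I. PConst (c i) * f (z i))) \<in> sym_ideal sc W"
    by (intro sym_ideal_add add x S)
  moreover have "(f (?x + ?S) - f ?x - f ?S) + (f ?x - PConst (c i) * f (z i)) + (f ?S - (\<Sum>i\<in>I. PConst (c i) * f (z i)))
      = f (?x + ?S) - (PConst (c i) * f (z i) + (\<Sum>i\<in>I. PConst (c i) * f (z i)))"
    by (simp add: algebra_simps)
  ultimately have "f (?x + ?S) - (PConst (c i) * f (z i) + (\<Sum>i\<in>I. PConst (c i) * f (z i))) \<in> sym_ideal sc W"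
    by (simp only:)
  then show ?case using insert.hyps D(1)[OF x(1) S(2)] by simp
qed (simp_all add: D(2) zero)

lemma fun_sum_apply: "(\<Sum>j\<in>I. f j) x = (\<Sum>j\<in>I. f j x)"
  by (induction I rule: infinite_finite_induct) simp_all

context polarized_torus
begin

abbreviation (input) "sym_J \<equiv> sym_ideal dual_scale (H0_dual \<Lambda>)"

text \<open>In the bases \<open>e\<^sub>i\<close> and \<open>\<partial>\<^sub>j\<close> of the two factors, \<open>A \<otimes> w\<close> has the coordinates \<open>A\<^sub>i w(dz\<^sub>j)\<close>.\<close>

definition sym_coord :: "((complex^'d::finite) \<times> ((complex^'g \<Rightarrow> complex^'g \<Rightarrow> complex) \<Rightarrow> complex)) cpoly \<Rightarrow> ('d \<times> 'g) cpoly" where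
  "sym_coord = psubst PConst (\<lambda>(A, w). \<Sum>i\<in>UNIV. \<Sum>j\<in>UNIV. PConst (A $ i * w (coord_form j)) * PVar (i, j))"

text \<open>A representative modulo the ideal for a polynomial in the coordinates \<open>e\<^sub>i \<otimes> \<partial>\<^sub>j\<close>.\<close>

definition sym_rep :: "('d::finite \<times> 'g) cpoly \<Rightarrow> ((complex^'d) \<times> ((complex^'g \<Rightarrow> complex^'g \<Rightarrow> complex) \<Rightarrow> complex)) cpoly" where
  "sym_rep = psubst PConst (\<lambda>(i, j). PVar (axis i 1, tangent_functional \<Lambda> (axis j 1)))"

lemma sym_coord_hom:
  "sym_coord (P + Q) = sym_coord P + sym_coord Q" "sym_coord (P * Q) = sym_coord P * sym_coord Q"
  "sym_coord (P - Q) = sym_coord P - sym_coord Q" "sym_coord (PConst c) = PConst c"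
  "sym_coord (PVar (A, w)) = (\<Sum>i\<in>UNIV. \<Sum>j\<in>UNIV. PConst (A $ i * w (coord_form j)) * PVar (i, j))"
  by (simp_all add: sym_coord_def psubst_simps)

lemma sym_rep_hom:
  "sym_rep (P + Q) = sym_rep P + sym_rep Q" "sym_rep (P * Q) = sym_rep P * sym_rep Q"
  "sym_rep (sum F I) = (\<Sum>x\<in>I. sym_rep (F x))" "sym_rep (PConst c) = PConst c"
  "sym_rep (PVar (i, j)) = PVar (axis i 1, tangent_functional \<Lambda> (axis j 1))"
  by (simp_all add: sym_rep_def psubst_simps)

lemma axis_unit_sum: "(\<Sum>i\<in>UNIV. \<Sum>j\<in>UNIV. PConst (axis k 1 $ i * v $ j) * PVar (i, j)) = (\<Sum>j\<in>UNIV. PConst (v $ j) * PVar (k, j))"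
  for k :: "'d::finite" and v :: "complex^'g"
proof -
  have "(\<Sum>i\<in>UNIV. \<Sum>j\<in>UNIV. PConst (axis k 1 $ i * v $ j) * PVar (i, j))
      = (\<Sum>i\<in>UNIV. if i = k then \<Sum>j\<in>UNIV. PConst (v $ j) * PVar (i, j) else 0)"
    by (intro sum.cong) (auto simp: axis_def)
  then show ?thesis by simp
qed

lemma sym_coord_rep: "sym_coord (sym_rep Q) = Q"
proof (induction Q rule: cpoly_induct)
  case (var x)
  obtain i j where x: "x = (i, j)" by fastforce
  have "sym_coord (sym_rep (PVar (i, j))) = (\<Sum>l\<in>UNIV. PConst (axis j 1 $ l) * PVar (i, l))"
    by (simp only: sym_rep_hom sym_coord_hom tangent_functional_coord_form axis_unit_sum)
  also have "\<dots> = (\<Sum>l\<in>UNIV. if l = j then PVar (i, l) else 0)"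
    by (intro sum.cong) (auto simp: axis_def)
  finally show ?case unfolding x by simp
qed (simp_all add: sym_rep_hom sym_coord_hom)

lemma sym_coord_kills_ideal:
  assumes "P \<in> sym_J"
  shows "sym_coord P = 0"
proof -
  have "module.subspace (*) {P. sym_coord P = 0}"
    unfolding module.subspace_def[OF module_times]
    using sym_coord_hom(4)[of 0] by (simp add: sym_coord_hom)
  moreover have "bilin_relations dual_scale (H0_dual \<Lambda>) \<subseteq> {P. sym_coord P = 0}"
    unfolding bilin_relations_def
    by (intro Un_least subsetI; clarify; simp add: sym_coord_hom sum_distrib_left PConst_add PConst_mult algebra_simps sum.distrib)
  ultimately have "sym_J \<subseteq> {P. sym_coord P = 0}"
    unfolding sym_ideal_def by (intro module.span_minimal[OF module_times])
  then show ?thesis using assms by blast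
qed

lemma H0_dual_add: "l \<in> H0_dual \<Lambda> \<Longrightarrow> l' \<in> H0_dual \<Lambda> \<Longrightarrow> l + l' \<in> H0_dual \<Lambda>"
  unfolding dual_space_def by (simp add: algebra_simps)

lemma H0_dual_scale: "l \<in> H0_dual \<Lambda> \<Longrightarrow> (\<lambda>u. c * l u) \<in> H0_dual \<Lambda>"
  unfolding dual_space_def by (simp add: algebra_simps)

lemma H0_dual_0: "0 \<in> H0_dual \<Lambda>"
  unfolding dual_space_def by simp

text \<open>Bilinearity of \<open>A \<otimes> w\<close> modulo the ideal, applied to the expansions of \<open>A\<close> and of \<open>w\<close> in the two bases.\<close>

lemma generator_expansion:
  fixes A :: "complex^'d::finite"
  assumes w: "w \<in> H0_dual \<Lambda>"
  shows "PVar (A, w) - sym_rep (sym_coord (PVar (A, w))) \<in> sym_J"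
proof -
  let ?\<tau> = "\<lambda>j. tangent_functional \<Lambda> (axis j 1)"
  let ?c = "\<lambda>j. w (coord_form j)"
  have wsum: "w = (\<Sum>j\<in>UNIV. dual_scale (?c j) (?\<tau> j))"
  proof (rule ext)
    fix \<omega>
    have "w \<omega> = tangent_functional \<Lambda> (\<chi> j. ?c j) \<omega>" using dual_eq_tangent_functional[OF w] by simp
    also have "\<dots> = (\<Sum>j\<in>UNIV. ?c j * ?\<tau> j \<omega>)"
    proof (cases "\<omega> \<in> H0_Omega \<Lambda>")
      case True
      then show ?thesis unfolding tangent_functional_def
        by (subst H0_Omega_linear(3)[OF True, of 0 "\<chi> j. ?c j"]) simp
    qed (simp add: tangent_functional_def)
    also have "\<dots> = (\<Sum>j\<in>UNIV. dual_scale (?c j) (?\<tau> j)) \<omega>"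
      by (rule fun_sum_apply[symmetric])
    finally show "w \<omega> = (\<Sum>j\<in>UNIV. dual_scale (?c j) (?\<tau> j)) \<omega>" .
  qed
  have rel: "P \<in> bilin_relations dual_scale (H0_dual \<Lambda>) \<Longrightarrow> P \<in> sym_J"
    for P :: "((complex^'d) \<times> ((complex^'g \<Rightarrow> complex^'g \<Rightarrow> complex) \<Rightarrow> complex)) cpoly" by (rule sym_ideal_base)
  have second: "PVar (E, w) - (\<Sum>j\<in>UNIV. PConst (?c j) * PVar (E, ?\<tau> j)) \<in> sym_J" for E :: "complex^'d"
  proof -
    have "PVar (E, \<Sum>j\<in>UNIV. dual_scale (?c j) (?\<tau> j)) - (\<Sum>j\<in>UNIV. PConst (?c j) * PVar (E, ?\<tau> j)) \<in> sym_J
      \<and> (\<Sum>j\<in>UNIV. dual_scale (?c j) (?\<tau> j)) \<in> H0_dual \<Lambda>"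
    proof (rule linear_mod_ideal_sum[where f = "\<lambda>x. PVar (E, x)" and s = dual_scale])
      show "PVar (E, x + y) - PVar (E, x) - PVar (E, y) \<in> sym_J" if "x \<in> H0_dual \<Lambda>" "y \<in> H0_dual \<Lambda>" for x y
        using that unfolding bilin_relations_def by (intro rel[unfolded bilin_relations_def]) blast
      have "PVar (E, dual_scale 0 w) - PConst 0 * PVar (E, w) \<in> sym_J"
        using w by (intro rel[unfolded bilin_relations_def]) blast
      then show "PVar (E, 0) \<in> sym_J" by (simp add: zero_fun_def)
      show "PVar (E, dual_scale (?c j) (?\<tau> j)) - PConst (?c j) * PVar (E, ?\<tau> j) \<in> sym_J" for j
        using tangent_functional_in_dual by (intro rel[unfolded bilin_relations_def]) blast
    qed (auto intro: H0_dual_add H0_dual_scale H0_dual_0 tangent_functional_in_dual)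
    then show ?thesis using wsum by simp
  qed
  have first: "PVar (A, w) - (\<Sum>i\<in>UNIV. PConst (A $ i) * PVar (axis i 1, w)) \<in> sym_J"
  proof -
    have "PVar (\<Sum>i\<in>UNIV. A $ i *s axis i 1, w) - (\<Sum>i\<in>UNIV. PConst (A $ i) * PVar (axis i 1, w)) \<in> sym_J
      \<and> (\<Sum>i\<in>UNIV. A $ i *s axis i 1) \<in> (UNIV :: (complex^'d) set)"
    proof (rule linear_mod_ideal_sum[where f = "\<lambda>x. PVar (x, w)" and s = "(*s)"])
      show "PVar (x + y, w) - PVar (x, w) - PVar (y, w) \<in> sym_J" for x y :: "complex^'d"
        using w by (intro rel[unfolded bilin_relations_def]) blast
      have "PVar (0 *s A, w) - PConst 0 * PVar (A, w) \<in> sym_J"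
        using w by (intro rel[unfolded bilin_relations_def]) blast
      then show "PVar (0 :: complex^'d, w) \<in> sym_J" by simp
      show "PVar (A $ i *s axis i 1, w) - PConst (A $ i) * PVar (axis i 1, w) \<in> sym_J" for i
        using w by (intro rel[unfolded bilin_relations_def]) blast
    qed simp_all
    then show ?thesis by (simp only: basis_expansion)
  qed
  have "(\<Sum>i\<in>I. PConst (A $ i) * (PVar (axis i 1, w) - (\<Sum>j\<in>UNIV. PConst (?c j) * PVar (axis i 1, ?\<tau> j)))) \<in> sym_J" for I
    by (induction I rule: infinite_finite_induct) (auto intro: sym_ideal_0 sym_ideal_add sym_ideal_mult second)
  from sym_ideal_add[OF first this[of UNIV]]
  have "PVar (A, w) - (\<Sum>i\<in>UNIV. PConst (A $ i) * (\<Sum>j\<in>UNIV. PConst (?c j) * PVar (axis i 1, ?\<tau> j))) \<in> sym_J"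
    by (simp add: right_diff_distrib sum_subtractf)
  then show ?thesis
    by (simp add: sym_coord_hom sym_rep_hom sum_distrib_left PConst_mult mult.assoc)
qed

lemma sym_rep_coord:
  assumes "vars_in (UNIV \<times> H0_dual \<Lambda>) P"
  shows "P - sym_rep (sym_coord P) \<in> sym_J"
  using assms
proof (induction P rule: cpoly_induct_vars)
  case (const c)
  then show ?case by (simp add: sym_coord_hom sym_rep_hom sym_ideal_0)
next
  case (var x)
  then obtain A w where "x = (A, w)" "w \<in> H0_dual \<Lambda>" by auto
  then show ?case using generator_expansion by blast
next
  case (add P Q)
  from sym_ideal_add[OF add] show ?case by (simp add: sym_coord_hom sym_rep_hom algebra_simps)
next
  case (mult P Q)
  from sym_ideal_add[OF sym_ideal_mult[OF mult(1), of Q] sym_ideal_mult[OF mult(2), of "sym_rep (sym_coord P)"]]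
  show ?case by (simp add: sym_coord_hom sym_rep_hom algebra_simps)
qed

lemma vars_in_sym_rep: "vars_in (UNIV \<times> H0_dual \<Lambda>) (sym_rep Q)"
proof (induction Q rule: cpoly_induct)
  case (var x)
  obtain i j where x: "x = (i, j)" by fastforce
  show ?case unfolding x sym_rep_hom by (rule vars_in_PVar) (simp add: tangent_functional_in_dual)
qed (simp_all add: sym_rep_hom vars_in_add vars_in_mult)

lemma Sym_tensor_eq:
  "Sym_tensor dual_scale (H0_dual \<Lambda>) = range (\<lambda>Q :: ('d::finite \<times> 'g) cpoly. sym_rep Q +o sym_J)"
proof (intro equalityI subsetI)
  fix X :: "((complex^'d) \<times> ((complex^'g \<Rightarrow> complex^'g \<Rightarrow> complex) \<Rightarrow> complex)) cpoly set"
  assume "X \<in> Sym_tensor dual_scale (H0_dual \<Lambda>)"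
  then obtain P where "X = P +o sym_J" "vars_in (UNIV \<times> H0_dual \<Lambda>) P"
    unfolding Sym_tensor_def vars_in_def by blast
  then have "X = sym_rep (sym_coord P) +o sym_J" using sym_coset_eq[OF sym_rep_coord] by blast
  then show "X \<in> range (\<lambda>Q :: ('d \<times> 'g) cpoly. sym_rep Q +o sym_J)" by blast
next
  fix X :: "((complex^'d) \<times> ((complex^'g \<Rightarrow> complex^'g \<Rightarrow> complex) \<Rightarrow> complex)) cpoly set"
  assume "X \<in> range (\<lambda>Q :: ('d \<times> 'g) cpoly. sym_rep Q +o sym_J)"
  then show "X \<in> Sym_tensor dual_scale (H0_dual \<Lambda>)"
    unfolding Sym_tensor_def using vars_in_sym_rep unfolding vars_in_def by blast
qed

text \<open>Modulo the ideal, \<open>e\<^sub>i \<otimes> \<tau>\<close> is linear in the tangent vector \<open>\<tau>\<close>, so its value may be computed from the coordinates of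
  \<open>\<tau>\<close> in \<open>\<complex>\<^sup>g\<close>.\<close>

lemma sym_value_congruent:
  fixes P :: "('d::finite) fock"
  shows "sym_value \<Lambda> a P - sym_rep (fibre_value a P) \<in> sym_J"
proof -
  have hom: "sym_value \<Lambda> a (P + Q) = sym_value \<Lambda> a P + sym_value \<Lambda> a Q"
    "sym_value \<Lambda> a (P * Q) = sym_value \<Lambda> a P * sym_value \<Lambda> a Q" "sym_value \<Lambda> a (PConst c) = PConst c"
    "sym_value \<Lambda> a (PVar (i, k) :: 'd fock) = PVar (axis i 1, tangent_functional \<Lambda> (frame a (zel a k)))"
    for P Q :: "'d fock" and c i k
    by (simp_all add: sym_value_def psubst_simps)
  have "sym_coord (sym_value \<Lambda> a P) = fibre_value a P"
  proof (induction P rule: cpoly_induct)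
    case (var x)
    obtain i k where x: "x = (i, k)" by fastforce
    show ?case unfolding x hom sym_coord_hom tangent_functional_coord_form axis_unit_sum fibre_value_hom ..
  qed (simp_all add: hom sym_coord_hom fibre_value_hom)
  moreover have "vars_in (UNIV \<times> H0_dual \<Lambda>) (sym_value \<Lambda> a P)"
  proof (induction P rule: cpoly_induct)
    case (var x)
    obtain i k where x: "x = (i, k)" by fastforce
    show ?case unfolding x hom by (rule vars_in_PVar) (simp add: tangent_functional_in_dual)
  qed (simp_all add: hom vars_in_add vars_in_mult)
  ultimately show ?thesis using sym_rep_coord by metis
qed

end

section \<open>The lattice form and polynomial functions\<close>

lemma additive_int:
  fixes f :: "int \<Rightarrow> int"
  assumes "\<And>a b. f (a + b) = f a + f b"
  shows "f c = c * f 1"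
proof -
  have f0: "f 0 = 0" using assms[of 0 0] by simp
  have nat: "f (int n) = int n * f 1" for n
    by (induction n) (simp_all add: f0 assms algebra_simps)
  show ?thesis
  proof (cases "c \<ge> 0")
    case True
    then show ?thesis using nat[of "nat c"] by simp
  next
    case False
    have "f c + f (- c) = 0" using assms[of c "- c"] f0 by simp
    then show ?thesis using nat[of "nat (- c)"] False by simp
  qed
qed

lemma even_pd_lattice_expand:
  fixes \<beta> :: "int^'d \<Rightarrow> int^'d \<Rightarrow> int"
  assumes "even_pd_lattice \<beta>"
  shows "\<beta> x y = (\<Sum>i\<in>UNIV. \<Sum>j\<in>UNIV. x $ i * (y $ j * \<beta> (axis i 1) (axis j 1)))"
proof -
  have add: "\<beta> (x + y) z = \<beta> x z + \<beta> y z" and sym: "\<beta> x y = \<beta> y x" for x y z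
    using assms unfolding even_pd_lattice_def by blast+
  have left: "\<beta> x z = (\<Sum>i\<in>UNIV. x $ i * \<beta> (axis i 1) z)" for x z
  proof -
    have smult: "\<beta> (c *s y) z = c * \<beta> y z" for c y
      using additive_int[of "\<lambda>c. \<beta> (c *s y) z" c] by (simp add: vector_sadd_rdistrib add)
    have "\<beta> 0 z = 0" using smult[of 0 0] by simp
    then have "\<beta> (\<Sum>i\<in>I. x $ i *s axis i 1) z = (\<Sum>i\<in>I. x $ i * \<beta> (axis i 1) z)" for I
      by (induction I rule: infinite_finite_induct) (simp_all add: add smult)
    from this[of UNIV] show ?thesis by (simp only: basis_expansion)
  qed
  have "\<beta> x y = (\<Sum>i\<in>UNIV. x $ i * \<beta> (axis i 1) y)" by (rule left)
  also have "\<dots> = (\<Sum>i\<in>UNIV. x $ i * (\<Sum>j\<in>UNIV. y $ j * \<beta> (axis i 1) (axis j 1)))"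
    by (intro sum.cong refl arg_cong2[of _ _ _ _ "(*)"]) (subst sym, subst left, subst sym, rule refl)
  finally show ?thesis by (simp add: sum_distrib_left)
qed

lemma common_denominator:
  fixes x :: "rat^'d"
  shows "\<exists>N m. N > 0 \<and> (\<forall>j. of_int N * x $ j = of_int (m $ j))"
proof -
  let ?d = "\<lambda>j. snd (quotient_of (x $ j))" and ?n = "\<lambda>j. fst (quotient_of (x $ j))"
  let ?N = "\<Prod>j\<in>UNIV. ?d j"
  have pos: "?d j > 0" for j by (rule quotient_of_denom_pos')
  have "of_int ?N * x $ j = of_int ((\<chi> j. ?n j * (\<Prod>i\<in>UNIV - {j}. ?d i)) $ j)" for j
  proof -
    have "x $ j = of_int (?n j) / of_int (?d j)" by (rule quotient_of_div) simp
    moreover have "(of_int (?d j) :: rat) \<noteq> 0" using pos[of j] by simp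
    ultimately have "x $ j * of_int (?d j) = of_int (?n j)" using nonzero_eq_divide_eq by blast
    then have "of_int (?d j) * x $ j = of_int (?n j)" by (subst mult.commute)
    moreover have "?N = ?d j * (\<Prod>i\<in>UNIV - {j}. ?d i)" by (rule prod.remove) simp_all
    ultimately show ?thesis by (simp add: mult_ac)
  qed
  moreover have "?N > 0" using pos by (intro prod_pos) simp
  ultimately show ?thesis by blast
qed

text \<open>A rational vector in the kernel of the Gram matrix can be scaled to an integral one, on which the form would vanish.
  So the matrix is invertible over \<open>\<rat>\<close>, and hence over \<open>\<complex>\<close>.\<close>

lemma gram_matrix_inverse:
  fixes \<beta> :: "int^'d \<Rightarrow> int^'d \<Rightarrow> int"
  assumes \<beta>: "even_pd_lattice \<beta>"
  shows "\<exists>\<gamma> :: 'd \<Rightarrow> 'd \<Rightarrow> complex. \<forall>i k.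
    (\<Sum>j\<in>UNIV. of_int (\<beta> (axis i 1) (axis j 1)) * \<gamma> j k) = (if i = k then 1 else 0) \<and>
    (\<Sum>j\<in>UNIV. \<gamma> i j * of_int (\<beta> (axis j 1) (axis k 1))) = (if i = k then 1 else 0)"
proof -
  let ?b = "\<lambda>i j. \<beta> (axis i 1) (axis j 1)"
  let ?A = "(\<chi> i j. of_int (?b i j)) :: rat^'d^'d"
  have ker: "x = 0" if x: "?A *v x = 0" for x
  proof -
    obtain N m where Nm: "N > 0" "\<forall>j. of_int N * x $ j = of_int (m $ j)"
      using common_denominator[of x] by blast
    have row: "(\<Sum>j\<in>UNIV. m $ j * ?b i j) = 0" for i
    proof -
      have "(\<Sum>j\<in>UNIV. of_int (?b i j) * x $ j) = 0"
        using arg_cong[OF x, of "\<lambda>v. v $ i"] by (simp add: matrix_vector_mult_def)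
      then have "0 = of_int N * (\<Sum>j\<in>UNIV. of_int (?b i j) * x $ j)" by simp
      also have "\<dots> = (\<Sum>j\<in>UNIV. of_int (?b i j) * (of_int N * x $ j))"
        by (simp add: sum_distrib_left mult_ac)
      also have "\<dots> = of_int (\<Sum>j\<in>UNIV. m $ j * ?b i j)" using Nm(2) by (simp add: mult_ac)
      finally have "of_int (\<Sum>j\<in>UNIV. m $ j * ?b i j) = (0::rat)" ..
      then show ?thesis by (simp only: of_int_eq_0_iff)
    qed
    have "\<beta> m m = (\<Sum>i\<in>UNIV. m $ i * (\<Sum>j\<in>UNIV. m $ j * ?b i j))"
      unfolding even_pd_lattice_expand[OF \<beta>, of m m] sum_distrib_left ..
    then have "\<beta> m m = 0" unfolding row by simp
    moreover have "\<beta> m m > 0" if "m \<noteq> 0" using \<beta> that unfolding even_pd_lattice_def by simp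
    ultimately have "m = 0" by force
    then have "x $ j = 0" for j using spec[OF Nm(2), of j] Nm(1) by simp
    then show "x = 0" by (simp add: vec_eq_iff)
  qed
  have "\<exists>C. C ** ?A = mat 1"
  proof (rule matrix_left_invertible_ker[THEN iffD2], rule allI, rule impI)
    fix x assume "?A *v x = 0"
    then show "x = 0" by (rule ker)
  qed
  then obtain C where C: "C ** ?A = mat 1" by (rule exE)
  have C': "?A ** C = mat 1" using C unfolding matrix_left_right_inverse .
  let ?\<gamma> = "\<lambda>i j. of_rat (C $ i $ j) :: complex"
  have "(\<Sum>j\<in>UNIV. of_int (?b i j) * ?\<gamma> j k) = (if i = k then 1 else 0)" for i k
  proof -
    have "(\<Sum>j\<in>UNIV. of_int (?b i j) * C $ j $ k) = (if i = k then 1 else 0)"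
      using arg_cong[OF C', of "\<lambda>A. A $ i $ k"] by (simp add: matrix_matrix_mult_def mat_def)
    from arg_cong[OF this, of "of_rat :: rat \<Rightarrow> complex"] show ?thesis
      by (simp add: of_rat_sum of_rat_mult split: if_splits)
  qed
  moreover have "(\<Sum>j\<in>UNIV. ?\<gamma> i j * of_int (?b j k)) = (if i = k then 1 else 0)" for i k
  proof -
    have "(\<Sum>j\<in>UNIV. C $ i $ j * of_int (?b j k)) = (if i = k then 1 else 0)"
      using arg_cong[OF C, of "\<lambda>A. A $ i $ k"] by (simp add: matrix_matrix_mult_def mat_def)
    from arg_cong[OF this, of "of_rat :: rat \<Rightarrow> complex"] show ?thesis
      by (simp add: of_rat_sum of_rat_mult split: if_splits)
  qed
  ultimately show ?thesis by (intro exI[of _ ?\<gamma>] allI conjI)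
qed

context polarized_torus
begin

text \<open>The value of the linear function \<open>e\<^sub>i \<otimes> \<partial>\<^sub>l\<close> at \<open>u\<close>, where \<open>e\<^sub>i\<close> acts through the form of \<open>\<Gamma>\<close>. As 1-forms are constant, it
  suffices to evaluate them at the origin.\<close>

definition form_coord :: "(int^'d \<Rightarrow> int^'d \<Rightarrow> int) \<Rightarrow> ('d \<Rightarrow> complex^'g \<Rightarrow> complex^'g \<Rightarrow> complex) \<Rightarrow> 'd \<times> 'g \<Rightarrow> complex" where
  "form_coord \<beta> u = (\<lambda>(i, l). \<Sum>j\<in>UNIV. of_int (\<beta> (axis i 1) (axis j 1)) * u j 0 (axis l 1))"

text \<open>The polynomial function on \<open>\<hh>\<^sub>\<Gamma> \<otimes> H\<^sup>0(X, \<Omega>\<^sup>1)\<close> given by a polynomial in the functions \<open>e\<^sub>i \<otimes> \<partial>\<^sub>l\<close>.\<close>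

definition poly_fun :: "(int^'d \<Rightarrow> int^'d \<Rightarrow> int) \<Rightarrow> ('d::finite \<times> 'g) cpoly \<Rightarrow> ('d \<Rightarrow> complex^'g \<Rightarrow> complex^'g \<Rightarrow> complex) \<Rightarrow> complex" where
  "poly_fun \<beta> Q u = (if u \<in> h_tensor_H0 \<Lambda> then psubst (\<lambda>c. c) (form_coord \<beta> u) Q else 0)"

lemma poly_fun_hom:
  "poly_fun \<beta> (P + Q) = poly_fun \<beta> P + poly_fun \<beta> Q"
  "poly_fun \<beta> (P * Q) = poly_fun \<beta> P * poly_fun \<beta> Q"
  "poly_fun \<beta> (P - Q) = poly_fun \<beta> P - poly_fun \<beta> Q"
  "poly_fun \<beta> (PConst c * Q) = dual_scale c (poly_fun \<beta> Q)"
  by (auto simp: fun_eq_iff poly_fun_def psubst_simps)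

text \<open>The image of a vector of \<open>V\<close> in the ring of functions factors through its value in the fibre, since both are
  homomorphisms that agree on generators.\<close>

lemma fun_value_eq_poly_fun:
  fixes P :: "('d::finite) fock"
  shows "fun_value \<beta> \<Lambda> a P = poly_fun \<beta> (fibre_value a P)"
proof (rule ext)
  fix u
  show "fun_value \<beta> \<Lambda> a P u = poly_fun \<beta> (fibre_value a P) u"
  proof (cases "u \<in> h_tensor_H0 \<Lambda>")
    case True
    then have u: "u j \<in> H0_Omega \<Lambda>" for j by (simp add: h_tensor_H0_def)
    have "(\<Sum>j\<in>UNIV. of_int (\<beta> (axis i 1) (axis j 1)) * tangent_functional \<Lambda> v (u j))
        = (\<Sum>l\<in>UNIV. v $ l * form_coord \<beta> u (i, l))" for i v
    proof -
      have "(\<Sum>j\<in>UNIV. of_int (\<beta> (axis i 1) (axis j 1)) * tangent_functional \<Lambda> v (u j))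
          = (\<Sum>j\<in>UNIV. \<Sum>l\<in>UNIV. v $ l * (of_int (\<beta> (axis i 1) (axis j 1)) * u j 0 (axis l 1)))"
        unfolding tangent_functional_def
        by (intro sum.cong refl) (simp add: u H0_Omega_linear(3)[OF u, of _ 0 v] sum_distrib_left mult.left_commute)
      also have "\<dots> = (\<Sum>l\<in>UNIV. v $ l * form_coord \<beta> u (i, l))"
        unfolding form_coord_def by (subst sum.swap) (simp add: sum_distrib_left)
      finally show ?thesis .
    qed
    then have eq: "(\<lambda>(i, k). \<Sum>j\<in>UNIV. of_int (\<beta> (axis i 1) (axis j 1)) * tangent_functional \<Lambda> (frame a (zel a k)) (u j))
        = (\<lambda>x. psubst (\<lambda>c. c) (form_coord \<beta> u)
            (case x of (i, k) \<Rightarrow> \<Sum>j\<in>UNIV. PConst (frame a (zel a k) $ j) * PVar (i, j)))"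
      by (auto simp: fun_eq_iff psubst_simps)
    show ?thesis
      unfolding fun_value_def poly_fun_def fibre_value_def psubst_psubst[OF scalar_hom_id] eq ..
  qed (simp add: fun_value_def poly_fun_def)
qed

context
  fixes \<beta> :: "int^'d::finite \<Rightarrow> int^'d \<Rightarrow> int" and \<gamma> :: "'d \<Rightarrow> 'd \<Rightarrow> complex"
  assumes \<gamma>1: "\<And>i k. (\<Sum>j\<in>UNIV. of_int (\<beta> (axis i 1) (axis j 1)) * \<gamma> j k) = (if i = k then 1 else 0)"
    and \<gamma>2: "\<And>i k. (\<Sum>j\<in>UNIV. \<gamma> i j * of_int (\<beta> (axis j 1) (axis k 1))) = (if i = k then 1 else 0)"
begin

text \<open>The inverse Gram matrix gives a point with prescribed coordinates.\<close>

lemma form_coord_surj: "\<exists>u\<in>h_tensor_H0 \<Lambda>. form_coord \<beta> u = \<theta>"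
proof
  let ?u = "\<lambda>j. constant_form (\<lambda>l. \<Sum>k\<in>UNIV. \<gamma> j k * \<theta> (k, l)) UNIV"
  show "?u \<in> h_tensor_H0 \<Lambda>" by (simp add: h_tensor_H0_def constant_form_in_H0)
  have u: "?u j 0 (axis l 1) = (\<Sum>k\<in>UNIV. \<gamma> j k * \<theta> (k, l))" for j l
  proof -
    have "?u j 0 (axis l 1) = (\<Sum>l'\<in>UNIV. if l' = l then \<Sum>k\<in>UNIV. \<gamma> j k * \<theta> (k, l') else 0)"
      unfolding constant_form_def coord_form_def by (intro sum.cong) (auto simp: axis_def)
    then show ?thesis by simp
  qed
  show "form_coord \<beta> ?u = \<theta>"
  proof (rule ext)
    fix p :: "'d \<times> 'g"
    obtain i l where p: "p = (i, l)" by fastforce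
    have "form_coord \<beta> ?u (i, l) = (\<Sum>j\<in>UNIV. of_int (\<beta> (axis i 1) (axis j 1)) * (\<Sum>k\<in>UNIV. \<gamma> j k * \<theta> (k, l)))"
      unfolding form_coord_def prod.case u ..
    also have "\<dots> = (\<Sum>k\<in>UNIV. (\<Sum>j\<in>UNIV. of_int (\<beta> (axis i 1) (axis j 1)) * \<gamma> j k) * \<theta> (k, l))"
      unfolding sum_distrib_left sum_distrib_right by (subst sum.swap) (simp add: mult.assoc)
    also have "\<dots> = (\<Sum>k\<in>UNIV. if k = i then \<theta> (k, l) else 0)"
      unfolding \<gamma>1 by (intro sum.cong) auto
    finally show "form_coord \<beta> ?u p = \<theta> p" unfolding p by simp
  qed
qed

text \<open>The coordinates take arbitrary values, and a polynomial that vanishes at all of them is zero.\<close>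

lemma inj_poly_fun: "inj (poly_fun \<beta>)"
proof (rule injI)
  fix P Q :: "('d \<times> 'g) cpoly" assume eq: "poly_fun \<beta> P = poly_fun \<beta> Q"
  have "psubst (\<lambda>c. c) \<theta> (P - Q) = 0" for \<theta>
  proof -
    obtain u where u: "u \<in> h_tensor_H0 \<Lambda>" "form_coord \<beta> u = \<theta>" using form_coord_surj[of \<theta>] by blast
    have "poly_fun \<beta> (P - Q) u = 0" using eq by (simp add: poly_fun_hom)
    then show ?thesis using u by (simp add: poly_fun_def)
  qed
  then have "P - Q = 0" by (rule psubst_all_zero_imp_zero)
  then show "P = Q" by simp
qed

lemma poly_fun_polynomial:
  "poly_fun \<beta> Q \<in> polynomial_functions h_tensor_scale (h_tensor_H0 \<Lambda>)"
proof (induction Q rule: cpoly_induct)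
  case (const c)
  have "poly_fun \<beta> (PConst c) = (\<lambda>u. if u \<in> h_tensor_H0 \<Lambda> then c else 0)"
    by (simp add: fun_eq_iff poly_fun_def psubst_simps)
  then show ?case by (simp add: polynomial_functions.const)
next
  case (var x)
  obtain i l where x: "x = (i, l)" by fastforce
  have H_add: "u + v \<in> h_tensor_H0 \<Lambda>" if "u \<in> h_tensor_H0 \<Lambda>" "v \<in> h_tensor_H0 \<Lambda>" for u v :: "'d \<Rightarrow> complex^'g \<Rightarrow> complex^'g \<Rightarrow> complex"
    using that by (simp add: h_tensor_H0_def H0_Omega_add)
  have H_scale: "h_tensor_scale c u \<in> h_tensor_H0 \<Lambda>" if "u \<in> h_tensor_H0 \<Lambda>" for c and u :: "'d \<Rightarrow> complex^'g \<Rightarrow> complex^'g \<Rightarrow> complex"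
    using that by (simp add: h_tensor_H0_def H0_Omega_scale)
  have "poly_fun \<beta> (PVar (i, l)) \<in> dual_space h_tensor_scale (h_tensor_H0 \<Lambda>)"
    unfolding dual_space_def
    by (auto simp: poly_fun_def psubst_simps H_add H_scale form_coord_def algebra_simps sum.distrib sum_distrib_left)
  then show ?case unfolding x by (rule polynomial_functions.linear)
next
  case (add P Q)
  then show ?case unfolding poly_fun_hom by (rule polynomial_functions.add)
next
  case (mult P Q)
  then show ?case unfolding poly_fun_hom by (rule polynomial_functions.mult)
qed

text \<open>The inverse Gram matrix expresses the coordinates of \<open>u\<close> through the functions \<open>e\<^sub>i \<otimes> \<partial>\<^sub>l\<close>.\<close>

lemma coordinate_in_range:
  "(\<lambda>u. if u \<in> h_tensor_H0 \<Lambda> then u j 0 (axis l 1) else 0) = poly_fun \<beta> (\<Sum>i\<in>UNIV. PConst (\<gamma> j i) * PVar (i, l))"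
proof (rule ext)
  fix u :: "'d \<Rightarrow> complex^'g \<Rightarrow> complex^'g \<Rightarrow> complex"
  have "(\<Sum>i\<in>UNIV. \<gamma> j i * form_coord \<beta> u (i, l)) = (\<Sum>k\<in>UNIV. (\<Sum>i\<in>UNIV. \<gamma> j i * of_int (\<beta> (axis i 1) (axis k 1))) * u k 0 (axis l 1))"
    unfolding form_coord_def prod.case sum_distrib_left sum_distrib_right by (subst sum.swap) (simp add: mult.assoc)
  also have "\<dots> = (\<Sum>k\<in>UNIV. if k = j then u k 0 (axis l 1) else 0)"
    unfolding \<gamma>2 by (intro sum.cong) auto
  finally show "(if u \<in> h_tensor_H0 \<Lambda> then u j 0 (axis l 1) else 0) = poly_fun \<beta> (\<Sum>i\<in>UNIV. PConst (\<gamma> j i) * PVar (i, l)) u"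
    by (simp add: poly_fun_def psubst_simps)
qed

text \<open>A linear function is a combination of the coordinates of \<open>u\<close> with respect to the basis \<open>E\<close>.\<close>

lemma linear_in_range:
  fixes f :: "('d \<Rightarrow> complex^'g \<Rightarrow> complex^'g \<Rightarrow> complex) \<Rightarrow> complex"
  assumes f: "f \<in> dual_space h_tensor_scale (h_tensor_H0 \<Lambda>)"
  shows "f \<in> range (poly_fun \<beta>)"
proof -
  have add: "f (u + v) = f u + f v" if "u \<in> h_tensor_H0 \<Lambda>" "v \<in> h_tensor_H0 \<Lambda>" for u v
    using f that unfolding dual_space_def by blast
  have scale: "f (h_tensor_scale c u) = c * f u" if "u \<in> h_tensor_H0 \<Lambda>" for c u
    using f that unfolding dual_space_def by blast
  have off: "f u = 0" if "u \<notin> h_tensor_H0 \<Lambda>" for u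
    using f that unfolding dual_space_def by blast
  define E :: "'d \<times> 'g \<Rightarrow> 'd \<Rightarrow> complex^'g \<Rightarrow> complex^'g \<Rightarrow> complex"
    where "E p = (\<lambda>j x v. if j = fst p then coord_form (snd p) x v else 0)" for p
  have E_H: "E p \<in> h_tensor_H0 \<Lambda>" for p
  proof -
    have "E p j \<in> H0_Omega \<Lambda>" for j
      unfolding E_def using coord_form_in_H0[of "snd p" \<Lambda>] H0_Omega_0[of \<Lambda>] by (cases "j = fst p") simp_all
    then show ?thesis by (simp add: h_tensor_H0_def)
  qed
  have H_scale: "h_tensor_scale c u \<in> h_tensor_H0 \<Lambda>" if "u \<in> h_tensor_H0 \<Lambda>" for c and u :: "'d \<Rightarrow> complex^'g \<Rightarrow> complex^'g \<Rightarrow> complex"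
    using that by (simp add: h_tensor_H0_def H0_Omega_scale)
  have H_add: "u + v \<in> h_tensor_H0 \<Lambda>" if "u \<in> h_tensor_H0 \<Lambda>" "v \<in> h_tensor_H0 \<Lambda>" for u v :: "'d \<Rightarrow> complex^'g \<Rightarrow> complex^'g \<Rightarrow> complex"
    using that by (simp add: h_tensor_H0_def H0_Omega_add)
  have f0: "f 0 = 0" and H0: "(0 :: 'd \<Rightarrow> complex^'g \<Rightarrow> complex^'g \<Rightarrow> complex) \<in> h_tensor_H0 \<Lambda>"
  proof -
    have z: "h_tensor_scale 0 (E undefined) = 0" by (simp add: fun_eq_iff)
    show "f 0 = 0" using scale[OF E_H, of 0 undefined] unfolding z by simp
    show "(0 :: 'd \<Rightarrow> complex^'g \<Rightarrow> complex^'g \<Rightarrow> complex) \<in> h_tensor_H0 \<Lambda>" using H_scale[OF E_H, of 0 undefined] unfolding z .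
  qed
  have fsum: "f (\<Sum>p\<in>I. h_tensor_scale (c p) (E p)) = (\<Sum>p\<in>I. c p * f (E p)) \<and> (\<Sum>p\<in>I. h_tensor_scale (c p) (E p)) \<in> h_tensor_H0 \<Lambda>"
    for c :: "'d \<times> 'g \<Rightarrow> complex" and I
  proof (induction I rule: infinite_finite_induct)
    case (insert p I)
    show ?case
      unfolding sum.insert[OF insert.hyps] add[OF H_scale[OF E_H] conjunct2[OF insert.IH], of "c p" p]
        scale[OF E_H, of "c p" p] conjunct1[OF insert.IH]
      by (intro conjI refl H_add[OF H_scale[OF E_H] conjunct2[OF insert.IH], of "c p" p])
  qed (simp_all only: sum.infinite sum.empty f0 H0 simp_thms)
  have expand: "u = (\<Sum>p\<in>UNIV. h_tensor_scale (u (fst p) 0 (axis (snd p) 1)) (E p))" if u: "u \<in> h_tensor_H0 \<Lambda>" for u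
  proof (intro ext)
    fix j x v
    have uj: "u j \<in> H0_Omega \<Lambda>" using u by (simp add: h_tensor_H0_def)
    have "u j x v = constant_form (\<lambda>l. u j 0 (axis l 1)) UNIV x v"
      by (subst H0_Omega_eq_constant_form[OF uj]) (rule refl)
    also have "\<dots> = (\<Sum>l\<in>UNIV. u j 0 (axis l 1) * coord_form l x v)" unfolding constant_form_def ..
    also have "\<dots> = (\<Sum>i\<in>UNIV. if i = j then \<Sum>l\<in>UNIV. u i 0 (axis l 1) * coord_form l x v else 0)" by simp
    also have "\<dots> = (\<Sum>i\<in>UNIV. \<Sum>l\<in>UNIV. u i 0 (axis l 1) * E (i, l) j x v)"
      by (intro sum.cong refl) (simp add: E_def)
    also have "\<dots> = (\<Sum>p\<in>UNIV. u (fst p) 0 (axis (snd p) 1) * E p j x v)"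
      by (simp add: sum.cartesian_product case_prod_beta)
    also have "\<dots> = (\<Sum>p\<in>UNIV. h_tensor_scale (u (fst p) 0 (axis (snd p) 1)) (E p)) j x v"
      by (simp only: fun_sum_apply)
    finally show "u j x v = (\<Sum>p\<in>UNIV. h_tensor_scale (u (fst p) 0 (axis (snd p) 1)) (E p)) j x v" .
  qed
  let ?q = "\<lambda>p. \<Sum>i\<in>UNIV. PConst (\<gamma> (fst p) i) * PVar (i, snd p)"
  let ?Q = "\<Sum>p\<in>UNIV. PConst (f (E p)) * ?q p"
  have ev: "poly_fun \<beta> (?q p) u = u (fst p) 0 (axis (snd p) 1)" if "u \<in> h_tensor_H0 \<Lambda>" for p u
    using fun_cong[OF coordinate_in_range[of "fst p" "snd p"], of u] that by simp
  have "poly_fun \<beta> ?Q u = f u" for u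
  proof (cases "u \<in> h_tensor_H0 \<Lambda>")
    case True
    have "poly_fun \<beta> ?Q u = (\<Sum>p\<in>UNIV. f (E p) * poly_fun \<beta> (?q p) u)"
      using True by (simp add: poly_fun_def psubst_simps)
    also have "\<dots> = (\<Sum>p\<in>UNIV. u (fst p) 0 (axis (snd p) 1) * f (E p))" unfolding ev[OF True] by (simp add: mult.commute)
    also have "\<dots> = f (\<Sum>p\<in>UNIV. h_tensor_scale (u (fst p) 0 (axis (snd p) 1)) (E p))"
      using fsum[of "\<lambda>p. u (fst p) 0 (axis (snd p) 1)" UNIV] by simp
    also have "\<dots> = f u" using expand[OF True] by simp
    finally show ?thesis .
  next
    case False
    then show ?thesis by (simp add: poly_fun_def off)
  qed
  then have "f = poly_fun \<beta> ?Q" by (intro ext) simp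
  then show ?thesis by blast
qed

lemma polynomial_functions_eq: "polynomial_functions h_tensor_scale (h_tensor_H0 \<Lambda>) = range (poly_fun \<beta>)"
proof (intro equalityI subsetI)
  fix p assume "p \<in> polynomial_functions h_tensor_scale (h_tensor_H0 \<Lambda> :: ('d \<Rightarrow> complex^'g \<Rightarrow> complex^'g \<Rightarrow> complex) set)"
  then show "p \<in> range (poly_fun \<beta>)"
  proof (induction rule: polynomial_functions.induct)
    case (const c)
    have "(\<lambda>u. if u \<in> h_tensor_H0 \<Lambda> then c else 0) = poly_fun \<beta> (PConst c)"
      by (simp add: fun_eq_iff poly_fun_def psubst_simps)
    then show ?case by blast
  next
    case (linear l)
    then show ?case by (rule linear_in_range)
  next
    case (add p q)
    then obtain P Q where "p = poly_fun \<beta> P" "q = poly_fun \<beta> Q" by blast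
    then have "p + q = poly_fun \<beta> (P + Q)" by (simp add: poly_fun_hom)
    then show ?case by blast
  next
    case (mult p q)
    then obtain P Q where "p = poly_fun \<beta> P" "q = poly_fun \<beta> Q" by blast
    then have "p * q = poly_fun \<beta> (P * Q)" by (simp add: poly_fun_hom)
    then show ?case by blast
  qed
qed (use poly_fun_polynomial in blast)

end

text \<open>Coinvariants are parametrized by polynomials \<open>Q\<close>. So any other space with a linear parametrization by the \<open>Q\<close> is
  isomorphic to them. Its scalar multiplication \<open>sc\<close> is an arbitrary function, to cover both cosets and functions.\<close>

lemma linear_iso_from_range:
  fixes T :: "('d::finite \<times> 'g) cpoly \<Rightarrow> 'b::plus"
  assumes inj: "inj T" and add: "\<And>P Q. T P + T Q = T (P + Q)" and scale: "\<And>c Q. sc c (T Q) = T (PConst c * Q)"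
  shows "linear_iso (coinv_scale M) (coinvariants \<Lambda> B) sc (range T) (\<lambda>s. T (inv coinv_of s))"
proof -
  have inv: "inv coinv_of (coinv_of Q) = Q" for Q :: "('d \<times> 'g) cpoly" by (rule inv_f_f[OF inj_coinv_of])
  have "bij_betw (\<lambda>s. T (inv coinv_of s)) (coinvariants \<Lambda> B) (range T)"
    unfolding bij_betw_def coinvariants_eq_range
  proof
    show "inj_on (\<lambda>s. T (inv coinv_of s)) (range coinv_of)"
    proof (rule inj_onI)
      fix x y :: "'g extpt \<Rightarrow> ('g extpt \<Rightarrow> 'd fock) set"
      assume "x \<in> range coinv_of" "y \<in> range coinv_of" and eq: "T (inv coinv_of x) = T (inv coinv_of y)"
      then obtain P Q where PQ: "x = coinv_of P" "y = coinv_of Q" by blast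
      have "T P = T Q" using eq unfolding PQ inv .
      then show "x = y" unfolding PQ using injD[OF inj, of P Q] by simp
    qed
    show "(\<lambda>s. T (inv coinv_of s)) ` range coinv_of = range T" by (simp add: image_image inv)
  qed
  then show ?thesis
    unfolding linear_iso_def coinvariants_eq_range
    by (auto simp: coinv_of_add coinv_of_scale inv add scale)
qed

lemma coinv_of_inv_fibre_value:
  assumes s: "s \<in> coinvariants \<Lambda> B" and v: "v \<in> s a"
  shows "fibre_value a (v a) = inv coinv_of s"
proof -
  obtain Q where Q: "s = coinv_of Q" using s unfolding coinvariants_eq_range by blast
  show ?thesis unfolding Q inv_f_f[OF inj_coinv_of] by (rule coinv_of_fibre_value) (use v Q in simp)
qed

end

theorem theorem5p4:
  fixes \<beta> :: "int^'d \<Rightarrow> int^'d \<Rightarrow> int"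
    and \<Lambda> :: "(complex^'g) set"
    and B :: "complex^'g \<Rightarrow> complex^'g \<Rightarrow> complex"
  assumes "even_pd_lattice \<beta>" and "ppav \<Lambda> B"
  shows
    "(\<exists>\<Phi> :: ('g extpt \<Rightarrow> ('g extpt \<Rightarrow> 'd fock) set) \<Rightarrow>
            ((complex^'d) \<times> ((complex^'g \<Rightarrow> complex^'g \<Rightarrow> complex) \<Rightarrow> complex)) cpoly set.
        linear_iso (coinv_scale (Sp \<Lambda> B)) (coinvariants \<Lambda> B)
          (sym_scale (sym_ideal dual_scale (H0_dual \<Lambda>))) (Sym_tensor dual_scale (H0_dual \<Lambda>)) \<Phi> \<and>
        (\<forall>s\<in>coinvariants \<Lambda> B. \<forall>a\<in>Sp \<Lambda> B. \<forall>v\<in>s a.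
           \<Phi> s = sym_value \<Lambda> a (v a) +o sym_ideal dual_scale (H0_dual \<Lambda>))) \<and>
     (\<exists>\<Psi> :: ('g extpt \<Rightarrow> ('g extpt \<Rightarrow> 'd fock) set) \<Rightarrow>
            ('d \<Rightarrow> complex^'g \<Rightarrow> complex^'g \<Rightarrow> complex) \<Rightarrow> complex.
        linear_iso (coinv_scale (Sp \<Lambda> B)) (coinvariants \<Lambda> B)
          dual_scale (polynomial_functions h_tensor_scale (h_tensor_H0 \<Lambda>)) \<Psi> \<and>
        (\<forall>s\<in>coinvariants \<Lambda> B. \<forall>a\<in>Sp \<Lambda> B. \<forall>v\<in>s a. \<Psi> s = fun_value \<beta> \<Lambda> a (v a)))"
proof -
  interpret polarized_torus \<Lambda> B by unfold_locales (rule assms(2))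
  let ?T = "\<lambda>Q :: ('d \<times> 'g) cpoly. sym_rep Q +o sym_J"
  have "inj ?T"
  proof (rule injI)
    fix P Q :: "('d \<times> 'g) cpoly" assume "?T P = ?T Q"
    then have "sym_rep P - sym_rep Q \<in> sym_J" by (rule sym_coset_eq_imp)
    then have "sym_coord (sym_rep P - sym_rep Q) = 0" by (rule sym_coord_kills_ideal)
    then show "P = Q" by (simp add: sym_coord_hom sym_coord_rep)
  qed
  then have iso1: "linear_iso (coinv_scale M) (coinvariants \<Lambda> B) (sym_scale sym_J) (range ?T) (\<lambda>s. ?T (inv coinv_of s))"
    by (rule linear_iso_from_range) (simp_all add: sym_coset_add sym_coset_scale sym_rep_hom)
  have val1: "?T (inv coinv_of s) = sym_value \<Lambda> a (v a) +o sym_J"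
    if "s \<in> coinvariants \<Lambda> B" "v \<in> s a" for s a and v :: "'g extpt \<Rightarrow> 'd fock"
    unfolding coinv_of_inv_fibre_value[OF that, symmetric] by (rule sym_coset_eq[OF sym_value_congruent, symmetric])
  obtain \<gamma> :: "'d \<Rightarrow> 'd \<Rightarrow> complex" where \<gamma>: "\<forall>i k.
    (\<Sum>j\<in>UNIV. of_int (\<beta> (axis i 1) (axis j 1)) * \<gamma> j k) = (if i = k then 1 else 0) \<and>
    (\<Sum>j\<in>UNIV. \<gamma> i j * of_int (\<beta> (axis j 1) (axis k 1))) = (if i = k then 1 else 0)"
    using gram_matrix_inverse[OF assms(1)] by (rule exE)
  then have \<gamma>1: "(\<Sum>j\<in>UNIV. of_int (\<beta> (axis i 1) (axis j 1)) * \<gamma> j k) = (if i = k then 1 else 0)"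
    and \<gamma>2: "(\<Sum>j\<in>UNIV. \<gamma> i j * of_int (\<beta> (axis j 1) (axis k 1))) = (if i = k then 1 else 0)" for i k
    by blast+
  have iso2: "linear_iso (coinv_scale M) (coinvariants \<Lambda> B) dual_scale (range (poly_fun \<beta>)) (\<lambda>s. poly_fun \<beta> (inv coinv_of s))"
    by (rule linear_iso_from_range[OF inj_poly_fun[OF \<gamma>1 \<gamma>2]]) (rule poly_fun_hom(1)[symmetric], rule poly_fun_hom(4)[symmetric])
  have val2: "poly_fun \<beta> (inv coinv_of s) = fun_value \<beta> \<Lambda> a (v a)"
    if "s \<in> coinvariants \<Lambda> B" "v \<in> s a" for s a and v :: "'g extpt \<Rightarrow> 'd fock"
    unfolding fun_value_eq_poly_fun coinv_of_inv_fibre_value[OF that] ..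
  show ?thesis
    unfolding Sym_tensor_eq polynomial_functions_eq[OF \<gamma>1 \<gamma>2]
  proof (intro conjI)
    show "\<exists>\<Phi>. linear_iso (coinv_scale M) (coinvariants \<Lambda> B) (sym_scale sym_J) (range ?T) \<Phi> \<and>
        (\<forall>s\<in>coinvariants \<Lambda> B. \<forall>a\<in>M. \<forall>v\<in>s a. \<Phi> s = sym_value \<Lambda> a (v a) +o sym_J)"
      by (rule exI[of _ "\<lambda>s. ?T (inv coinv_of s)"]) (intro conjI iso1 ballI val1)
    show "\<exists>\<Psi>. linear_iso (coinv_scale M) (coinvariants \<Lambda> B) dual_scale (range (poly_fun \<beta>)) \<Psi> \<and>
        (\<forall>s\<in>coinvariants \<Lambda> B. \<forall>a\<in>M. \<forall>v\<in>s a. \<Psi> s = fun_value \<beta> \<Lambda> a (v a))"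
      by (rule exI[of _ "\<lambda>s. poly_fun \<beta> (inv coinv_of s)"]) (intro conjI iso2 ballI val2)
  qed
qed

end
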